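(* Let $u\colon R\to U$ be an associative ring epimorphism such that $U$ is a flat left $R$-module, and let $\mathbb G$ be the related perfect right Gabriel topology on $R$. Assume that $\mathbb G$ has a countable base. Let $M$ be a $u$-torsion-free left $R$-module. Then $\beta_{u,M}\colon\Delta_u(M)\to\Lambda_{\mathbb G}(M)$ and $\theta_{\mathbb G,M}\colon\Lambda_{\mathbb G}(M)\to\Delta_u(M)$ are mutually inverse isomorphisms of left $R$-modules.
   Context: Rings are associative and unital. The perfect Gabriel topology related to $u$ is $\mathbb G=\{I\subset R\text{ a right ideal}: R/I\otimes_RU=0\}$. A base of $\mathbb G$ is a subset $\mathbb B\subset\mathbb G$ such that every element of $\mathbb G$ contains an element of $\mathbb B$. A left $R$-module $M$ is $u$-torsion-free if the map $M\to U\otimes_RM$, $m\mapsto1\otimes m$, is injective. $\Delta_u$. $K^\bullet_{R,U}$ is the complex of $R$-$R$-bimodules $(R\xrightarrow{u}U)$ with $R$ in cohomological degree $-1$ and $U$ in degree $0$; $\Delta_u(M)=\operatorname{Ext}^1_R(K^\bullet_{R,U},M)=\operatorname{Hom}_{\mathsf D(R\text{-mod})}(K^\bullet_{R,U},M[1])$, a left $R$-module via the right action of $R$ on $K^\bullet_{R,U}$. The map $\delta_{u,M}\colon M\to\Delta_u(M)$ is induced by the natural morphism $K^\bullet_{R,U}\to R[1]$. A left $R$-module $C$ is a $u$-contramodule if $\operatorname{Hom}_R(U,C)=0=\operatorname{Ext}^1_R(U,C)$. In the situation of the claim the left $R$-module $U$ has projective dimension at most $1$, $\Delta_u(M)$ is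 a $u$-contramodule, and $\delta_{u,M}$ is the universal morphism from $M$ to a $u$-contramodule. $\Lambda_{\mathbb G}$. $\Lambda_{\mathbb G}(M)=\varprojlim_{I\in\mathbb G}M/IM$, where $IM\subset M$ is the subgroup spanned by the products. It is a left $R$-module: for $r\in R$, the $I$-component of $r\cdot(m_J)_{J\in\mathbb G}$ is the image of $m_{(I:r)}$ under the map $M/(I:r)M\to M/IM$ of left multiplication by $r$, where $(I:r)=\{t\in R: rt\in I\}\in\mathbb G$. The completion map is $\lambda_{\mathbb G,M}\colon M\to\Lambda_{\mathbb G}(M)$. The left $R$-module $\Lambda_{\mathbb G}(M)$ is a $u$-contramodule. $\beta_{u,M}$ is the unique left $R$-module morphism $\Delta_u(M)\to\Lambda_{\mathbb G}(M)$ with $\beta_{u,M}\circ\delta_{u,M}=\lambda_{\mathbb G,M}$. $\theta_{\mathbb G,M}$ (for $u$-torsion-free $M$). Put $U/R=\operatorname{coker}(u)$, an $R$-$R$-bimodule, and $V=U/R\otimes_RM$. Then $\theta_{\mathbb G,M}$ is the composition $$\Lambda_{\mathbb G}(M)\to\Lambda_{\mathbb G}(\operatorname{Hom}_R(U/R,V))\to\operatorname{Hom}_R(U/R,V)\to\operatorname{Ext}^1_R(U/R,M)\to\Delta_u(M),$$ where: the first map is $\Lambda_{\mathbb G}$ applied to $M\to\operatorname{Hom}_R(U/R,V)$, $m\mapsto(x\mapsto x\otimes m)$; the second is the map $\varprojlim_{I}\operatorname{Hom}_R(U/R,V)/I\operatorname{Hom}_R(U/R,V)\to\varprojlim_I\operatorname{Hom}_R((U/R)_I,V)=\operatorname{Hom}_R(U/R,V)$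 induced by restriction, with $(U/R)_I=\{x\in U/R: xI=0\}$ (one has $U/R=\bigcup_{I\in\mathbb G}(U/R)_I$); the third is the connecting homomorphism for the short exact sequence $0\to M\to U\otimes_RM\to V\to0$; the fourth is induced by the natural morphism $K^\bullet_{R,U}\to U/R$. (Sign conventions for connecting maps are the compatible ones, for which $\theta_{\mathbb G,M}\circ\lambda_{\mathbb G,M}=\delta_{u,M}$.) *)

theory Defs
  imports "HOL-Algebra.Algebra" "HOL-Library.Countable_Set"
begin

section \<open>Modules over noncommutative rings\<close>

text \<open>
  All modules are records whose \<open>mult\<close> and \<open>one\<close> fields, inherited from \<open>ring\<close>, are irrelevant.
  \<open>Module.module\<close> of HOL-Algebra assumes a commutative ring of scalars, so that only its record
  type is used here.
\<close>

locale left_module = R?: ring R + M?: abelian_group M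
    for R :: "('r, 'k) ring_scheme" (structure) and M :: "('r, 'a, 'x) module_scheme" (structure) +
  assumes smult_closed:
      "\<lbrakk>a \<in> carrier R; x \<in> carrier M\<rbrakk> \<Longrightarrow> a \<odot>\<^bsub>M\<^esub> x \<in> carrier M"
    and smult_l_distr:
      "\<lbrakk>a \<in> carrier R; b \<in> carrier R; x \<in> carrier M\<rbrakk>
        \<Longrightarrow> (a \<oplus>\<^bsub>R\<^esub> b) \<odot>\<^bsub>M\<^esub> x = a \<odot>\<^bsub>M\<^esub> x \<oplus>\<^bsub>M\<^esub> b \<odot>\<^bsub>M\<^esub> x"
    and smult_r_distr:
      "\<lbrakk>a \<in> carrier R; x \<in> carrier M; y \<in> carrier M\<rbrakk>
        \<Longrightarrow> a \<odot>\<^bsub>M\<^esub> (x \<oplus>\<^bsub>M\<^esub> y) = a \<odot>\<^bsub>M\<^esub> x \<oplus>\<^bsub>M\<^esub> a \<odot>\<^bsub>M\<^esub> y"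
    and smult_assoc1:
      "\<lbrakk>a \<in> carrier R; b \<in> carrier R; x \<in> carrier M\<rbrakk>
        \<Longrightarrow> (a \<otimes>\<^bsub>R\<^esub> b) \<odot>\<^bsub>M\<^esub> x = a \<odot>\<^bsub>M\<^esub> (b \<odot>\<^bsub>M\<^esub> x)"
    and smult_one:
      "x \<in> carrier M \<Longrightarrow> \<one>\<^bsub>R\<^esub> \<odot>\<^bsub>M\<^esub> x = x"

record ('r, 'a) rmodule = "'a ring" +
  rsmult :: "['a, 'r] \<Rightarrow> 'a"

locale right_module = R?: ring R + M?: abelian_group M
    for R :: "('r, 'k) ring_scheme" (structure) and M :: "('r, 'a, 'x) rmodule_scheme" (structure) +
  assumes rsmult_closed:
      "\<lbrakk>a \<in> carrier R; x \<in> carrier M\<rbrakk> \<Longrightarrow> rsmult M x a \<in> carrier M"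
    and rsmult_r_distr:
      "\<lbrakk>a \<in> carrier R; b \<in> carrier R; x \<in> carrier M\<rbrakk>
        \<Longrightarrow> rsmult M x (a \<oplus>\<^bsub>R\<^esub> b) = rsmult M x a \<oplus>\<^bsub>M\<^esub> rsmult M x b"
    and rsmult_l_distr:
      "\<lbrakk>a \<in> carrier R; x \<in> carrier M; y \<in> carrier M\<rbrakk>
        \<Longrightarrow> rsmult M (x \<oplus>\<^bsub>M\<^esub> y) a = rsmult M x a \<oplus>\<^bsub>M\<^esub> rsmult M y a"
    and rsmult_assoc:
      "\<lbrakk>a \<in> carrier R; b \<in> carrier R; x \<in> carrier M\<rbrakk>
        \<Longrightarrow> rsmult M x (a \<otimes>\<^bsub>R\<^esub> b) = rsmult M (rsmult M x a) b"
    and rsmult_one: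
      "x \<in> carrier M \<Longrightarrow> rsmult M x \<one>\<^bsub>R\<^esub> = x"

text \<open>A bimodule is a left module with an additional right action \<open>ract\<close>.\<close>

record ('r, 'a) bimodule = "('r, 'a) module" +
  ract :: "['a, 'r] \<Rightarrow> 'a"

definition right_of :: "('r, 'a) bimodule \<Rightarrow> ('r, 'a) rmodule" where
  "right_of B = \<lparr>carrier = carrier B,
     monoid.mult = monoid.mult B, monoid.one = monoid.one B, ring.zero = \<zero>\<^bsub>B\<^esub>, ring.add = ring.add B,
     rsmult = ract B\<rparr>"

definition mod_hom ::
    "'r ring \<Rightarrow> ('r, 'a, 'x) module_scheme \<Rightarrow> ('r, 'b, 'y) module_scheme \<Rightarrow> ('a \<Rightarrow> 'b) set" where
  "mod_hom R A B = {f \<in> carrier A \<rightarrow>\<^sub>E carrier B.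
     (\<forall>x\<in>carrier A. \<forall>y\<in>carrier A. f (x \<oplus>\<^bsub>A\<^esub> y) = f x \<oplus>\<^bsub>B\<^esub> f y) \<and>
     (\<forall>r\<in>carrier R. \<forall>x\<in>carrier A. f (r \<odot>\<^bsub>A\<^esub> x) = r \<odot>\<^bsub>B\<^esub> f x)}"

definition rmod_hom :: "'r ring \<Rightarrow> ('r, 'a) rmodule \<Rightarrow> ('r, 'b) rmodule \<Rightarrow> ('a \<Rightarrow> 'b) set" where
  "rmod_hom R A B = {f \<in> carrier A \<rightarrow>\<^sub>E carrier B.
     (\<forall>x\<in>carrier A. \<forall>y\<in>carrier A. f (x \<oplus>\<^bsub>A\<^esub> y) = f x \<oplus>\<^bsub>B\<^esub> f y) \<and>
     (\<forall>r\<in>carrier R. \<forall>x\<in>carrier A. f (rsmult A x r) = rsmult B (f x) r)}"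

definition inverse_module_isos ::
    "'r ring \<Rightarrow> ('r, 'a) module \<Rightarrow> ('r, 'b) module \<Rightarrow> ('a \<Rightarrow> 'b) \<Rightarrow> ('b \<Rightarrow> 'a) \<Rightarrow> bool" where
  "inverse_module_isos R A B f g \<longleftrightarrow>
     left_module R A \<and> left_module R B \<and> f \<in> mod_hom R A B \<and> g \<in> mod_hom R B A \<and>
     (\<forall>x\<in>carrier A. g (f x) = x) \<and> (\<forall>y\<in>carrier B. f (g y) = y)"

text \<open>
  The map on cosets induced by \<open>f\<close>, where \<open>N\<close> is a subgroup of the target \<open>B\<close>. When \<open>f\<close> does
  induce a map, all members of the union coincide.
\<close>

definition coset_map :: "('b, 'y) ring_scheme \<Rightarrow> 'b set \<Rightarrow> ('a \<Rightarrow> 'b) \<Rightarrow> 'a set \<Rightarrow> 'b set" where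
  "coset_map B N f C = (\<Union>x\<in>C. N +>\<^bsub>B\<^esub> f x)"

definition quot_mod :: "('r, 'a, 'x) module_scheme \<Rightarrow> 'a set \<Rightarrow> ('r, 'a set) module" where
  "quot_mod A N = \<lparr>carrier = a_rcosets\<^bsub>A\<^esub> N,
     monoid.mult = undefined, monoid.one = undefined, ring.zero = N,
     ring.add = set_add A, smult = (\<lambda>r. coset_map A N (\<lambda>x. r \<odot>\<^bsub>A\<^esub> x))\<rparr>"

definition quot_bimod :: "('r, 'a) bimodule \<Rightarrow> 'a set \<Rightarrow> ('r, 'a set) bimodule" where
  "quot_bimod A N = \<lparr>carrier = a_rcosets\<^bsub>A\<^esub> N,
     monoid.mult = undefined, monoid.one = undefined, ring.zero = N,
     ring.add = set_add A, smult = (\<lambda>r. coset_map A N (\<lambda>x. r \<odot>\<^bsub>A\<^esub> x)),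
     ract = (\<lambda>C r. coset_map A N (\<lambda>x. ract A x r) C)\<rparr>"

definition ring_rquot :: "'r ring \<Rightarrow> 'r set \<Rightarrow> ('r, 'r set) rmodule" where
  "ring_rquot R I = \<lparr>carrier = a_rcosets\<^bsub>R\<^esub> I,
     monoid.mult = undefined, monoid.one = undefined, ring.zero = I,
     ring.add = set_add R, rsmult = (\<lambda>C r. coset_map R I (\<lambda>x. x \<otimes>\<^bsub>R\<^esub> r) C)\<rparr>"

definition self_bimod :: "'r ring \<Rightarrow> ('r, 'r) bimodule" where
  "self_bimod R = \<lparr>carrier = carrier R,
     monoid.mult = undefined, monoid.one = undefined, ring.zero = \<zero>\<^bsub>R\<^esub>,
     ring.add = ring.add R, smult = monoid.mult R, ract = monoid.mult R\<rparr>"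

definition zero_bimod :: "('r, unit) bimodule" where
  "zero_bimod = \<lparr>carrier = {()},
     monoid.mult = undefined, monoid.one = undefined, ring.zero = (),
     ring.add = (\<lambda>_ _. ()), smult = (\<lambda>_ _. ()), ract = (\<lambda>_ _. ())\<rparr>"

text \<open>\<open>U\<close> as a bimodule via a ring homomorphism \<open>u\<close>.\<close>

definition restr_bimod :: "'u ring \<Rightarrow> ('r \<Rightarrow> 'u) \<Rightarrow> ('r, 'u) bimodule" where
  "restr_bimod U u = \<lparr>carrier = carrier U,
     monoid.mult = undefined, monoid.one = undefined, ring.zero = \<zero>\<^bsub>U\<^esub>,
     ring.add = ring.add U, smult = (\<lambda>r x. u r \<otimes>\<^bsub>U\<^esub> x), ract = (\<lambda>x r. x \<otimes>\<^bsub>U\<^esub> u r)\<rparr>"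

definition coker_bimod :: "'r ring \<Rightarrow> 'u ring \<Rightarrow> ('r \<Rightarrow> 'u) \<Rightarrow> ('r, 'u set) bimodule" where
  "coker_bimod R U u = quot_bimod (restr_bimod U u) (u ` carrier R)"

definition coker_proj :: "'r ring \<Rightarrow> 'u ring \<Rightarrow> ('r \<Rightarrow> 'u) \<Rightarrow> 'u \<Rightarrow> 'u set" where
  "coker_proj R U u x = (u ` carrier R) +>\<^bsub>U\<^esub> x"

text \<open>\<open>Hom\<^sub>R(B, N)\<close>, with left action coming from the right action on \<open>B\<close>.\<close>

definition hom_mod :: "'r ring \<Rightarrow> ('r, 'b) bimodule \<Rightarrow> ('r, 'n) module \<Rightarrow> ('r, 'b \<Rightarrow> 'n) module" where
  "hom_mod R B N = \<lparr>carrier = mod_hom R B N,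
     monoid.mult = undefined, monoid.one = undefined,
     ring.zero = (\<lambda>x\<in>carrier B. \<zero>\<^bsub>N\<^esub>), ring.add = (\<lambda>f g. \<lambda>x\<in>carrier B. f x \<oplus>\<^bsub>N\<^esub> g x),
     smult = (\<lambda>r f. \<lambda>x\<in>carrier B. f (ract B x r))\<rparr>"


section \<open>Tensor products\<close>

text \<open>
  The tensor product of a right module \<open>A\<close> and a left module \<open>B\<close> is the quotient of the free abelian
  group on \<open>carrier A \<times> carrier B\<close> by the subgroup \<open>tensor_rel\<close>.
\<close>

definition tensor_rel ::
    "'r ring \<Rightarrow> ('r, 'a) rmodule \<Rightarrow> ('r, 'b, 'x) module_scheme \<Rightarrow> ('a \<times> 'b \<Rightarrow>\<^sub>0 int) set" where
  "tensor_rel R A B = generate (free_Abelian_group (carrier A \<times> carrier B))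
     ({frag_of (a \<oplus>\<^bsub>A\<^esub> a', b) - frag_of (a, b) - frag_of (a', b) | a a' b.
         a \<in> carrier A \<and> a' \<in> carrier A \<and> b \<in> carrier B} \<union>
      {frag_of (a, b \<oplus>\<^bsub>B\<^esub> b') - frag_of (a, b) - frag_of (a, b') | a b b'.
         a \<in> carrier A \<and> b \<in> carrier B \<and> b' \<in> carrier B} \<union>
      {frag_of (rsmult A a r, b) - frag_of (a, r \<odot>\<^bsub>B\<^esub> b) | a r b.
         a \<in> carrier A \<and> r \<in> carrier R \<and> b \<in> carrier B})"

definition tensor_group ::
    "'r ring \<Rightarrow> ('r, 'a) rmodule \<Rightarrow> ('r, 'b, 'x) module_scheme \<Rightarrow> ('a \<times> 'b \<Rightarrow>\<^sub>0 int) set monoid" where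
  "tensor_group R A B = free_Abelian_group (carrier A \<times> carrier B) Mod tensor_rel R A B"

definition tens ::
    "'r ring \<Rightarrow> ('r, 'a) rmodule \<Rightarrow> ('r, 'b, 'x) module_scheme \<Rightarrow> 'a \<Rightarrow> 'b \<Rightarrow> ('a \<times> 'b \<Rightarrow>\<^sub>0 int) set" where
  "tens R A B a b = tensor_rel R A B #>\<^bsub>free_Abelian_group (carrier A \<times> carrier B)\<^esub> frag_of (a, b)"

text \<open>The map \<open>f \<otimes> g\<close> into \<open>A' \<otimes> B'\<close>; see \<^const>\<open>coset_map\<close> for the union.\<close>

definition tensor_map ::
    "'r ring \<Rightarrow> ('r, 'c) rmodule \<Rightarrow> ('r, 'd, 'x) module_scheme \<Rightarrow> ('a \<Rightarrow> 'c) \<Rightarrow> ('b \<Rightarrow> 'd)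
      \<Rightarrow> ('a \<times> 'b \<Rightarrow>\<^sub>0 int) set \<Rightarrow> ('c \<times> 'd \<Rightarrow>\<^sub>0 int) set" where
  "tensor_map R A' B' f g C =
     (\<Union>c\<in>C. tensor_rel R A' B' #>\<^bsub>free_Abelian_group (carrier A' \<times> carrier B')\<^esub>
               frag_extend (\<lambda>(a, b). frag_of (f a, g b)) c)"

definition tensor_mod ::
    "'r ring \<Rightarrow> ('r, 'a) bimodule \<Rightarrow> ('r, 'b) module \<Rightarrow> ('r, ('a \<times> 'b \<Rightarrow>\<^sub>0 int) set) module" where
  "tensor_mod R A B =
     \<lparr>carrier = carrier (tensor_group R (right_of A) B),
     monoid.mult = undefined, monoid.one = undefined,
      ring.zero = monoid.one (tensor_group R (right_of A) B), ring.add = monoid.mult (tensor_group R (right_of A) B),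
      smult = (\<lambda>r. tensor_map R (right_of A) B (\<lambda>a. r \<odot>\<^bsub>A\<^esub> a) (\<lambda>b. b))\<rparr>"


section \<open>Flat ring epimorphisms and the associated Gabriel topology\<close>

text \<open>
  Epimorphisms in the category of rings. Testing against rings \<open>S\<close> carried by \<open>'u list\<close> is no
  restriction: two homomorphisms \<open>v\<close>, \<open>w\<close> out of \<open>U\<close> may be corestricted to the subring generated by
  their images, whose cardinality does not exceed that of \<open>'u list\<close>.
\<close>

definition ring_epimorphism :: "'r ring \<Rightarrow> 'u ring \<Rightarrow> ('r \<Rightarrow> 'u) \<Rightarrow> bool" where
  "ring_epimorphism R U u \<longleftrightarrow> u \<in> ring_hom R U \<and>
     (\<forall>S :: 'u list ring. ring S \<longrightarrow>
       (\<forall>v\<in>ring_hom U S. \<forall>w\<in>ring_hom U S.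
          (\<forall>r\<in>carrier R. v (u r) = w (u r)) \<longrightarrow> (\<forall>x\<in>carrier U. v x = w x)))"

text \<open>
  Flatness: \<open>- \<otimes>\<^sub>R N\<close> preserves injectivity. Testing against modules carried by \<open>'r list\<close> is no
  restriction: an element of the kernel of \<open>A \<otimes> N \<rightarrow> B \<otimes> N\<close> already occurs for finitely generated
  submodules of \<open>A\<close> and \<open>B\<close>, whose cardinality does not exceed that of \<open>'r list\<close>.
\<close>

definition flat_left_module :: "'r ring \<Rightarrow> ('r, 'n, 'x) module_scheme \<Rightarrow> bool" where
  "flat_left_module R N \<longleftrightarrow> left_module R N \<and>
     (\<forall>(A :: ('r, 'r list) rmodule) (B :: ('r, 'r list) rmodule).
       right_module R A \<longrightarrow> right_module R B \<longrightarrow>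
       (\<forall>f\<in>rmod_hom R A B. inj_on f (carrier A) \<longrightarrow>
          inj_on (tensor_map R B N f (\<lambda>n. n)) (carrier (tensor_group R A N))))"

definition right_ideal :: "'r ring \<Rightarrow> 'r set \<Rightarrow> bool" where
  "right_ideal R I \<longleftrightarrow> additive_subgroup I R \<and> (\<forall>i\<in>I. \<forall>r\<in>carrier R. i \<otimes>\<^bsub>R\<^esub> r \<in> I)"

definition gabriel :: "'r ring \<Rightarrow> 'u ring \<Rightarrow> ('r \<Rightarrow> 'u) \<Rightarrow> 'r set set" where
  "gabriel R U u = {I. right_ideal R I \<and>
     carrier (tensor_group R (ring_rquot R I) (restr_bimod U u)) =
       {monoid.one (tensor_group R (ring_rquot R I) (restr_bimod U u))}}"

definition has_countable_base :: "'r set set \<Rightarrow> bool" where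
  "has_countable_base G \<longleftrightarrow> (\<exists>B\<subseteq>G. countable B \<and> (\<forall>I\<in>G. \<exists>J\<in>B. J \<subseteq> I))"

definition unit_tens ::
    "'r ring \<Rightarrow> 'u ring \<Rightarrow> ('r \<Rightarrow> 'u) \<Rightarrow> ('r, 'm) module \<Rightarrow> 'm \<Rightarrow> ('u \<times> 'm \<Rightarrow>\<^sub>0 int) set" where
  "unit_tens R U u M m = tens R (right_of (restr_bimod U u)) M \<one>\<^bsub>U\<^esub> m"

definition torsion_free :: "'r ring \<Rightarrow> 'u ring \<Rightarrow> ('r \<Rightarrow> 'u) \<Rightarrow> ('r, 'm) module \<Rightarrow> bool" where
  "torsion_free R U u M \<longleftrightarrow> inj_on (unit_tens R U u M) (carrier M)"


section \<open>The completion\<close>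

definition ideal_smult :: "'r set \<Rightarrow> ('r, 'm) module \<Rightarrow> 'm set" where
  "ideal_smult I M = generate (add_monoid M) {i \<odot>\<^bsub>M\<^esub> m | i m. i \<in> I \<and> m \<in> carrier M}"

definition ideal_colon :: "'r ring \<Rightarrow> 'r set \<Rightarrow> 'r \<Rightarrow> 'r set" where
  "ideal_colon R I r = {t \<in> carrier R. r \<otimes>\<^bsub>R\<^esub> t \<in> I}"

definition Lambda :: "'r ring \<Rightarrow> 'r set set \<Rightarrow> ('r, 'm) module \<Rightarrow> ('r, 'r set \<Rightarrow> 'm set) module" where
  "Lambda R G M =
     \<lparr>carrier = {x \<in> (\<Pi>\<^sub>E I\<in>G. a_rcosets\<^bsub>M\<^esub> (ideal_smult I M)).
        \<forall>I\<in>G. \<forall>J\<in>G. I \<subseteq> J \<longrightarrow> coset_map M (ideal_smult J M) (\<lambda>m. m) (x I) = x J},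
      monoid.mult = undefined, monoid.one = undefined,
      ring.zero = (\<lambda>I\<in>G. ideal_smult I M),
      ring.add = (\<lambda>x y. \<lambda>I\<in>G. x I <+>\<^bsub>M\<^esub> y I),
      smult = (\<lambda>r x. \<lambda>I\<in>G. coset_map M (ideal_smult I M) (\<lambda>m. r \<odot>\<^bsub>M\<^esub> m) (x (ideal_colon R I r)))\<rparr>"

definition completion_map :: "'r set set \<Rightarrow> ('r, 'm) module \<Rightarrow> 'm \<Rightarrow> 'r set \<Rightarrow> 'm set" where
  "completion_map G M m = (\<lambda>I\<in>G. ideal_smult I M +>\<^bsub>M\<^esub> m)"

text \<open>The functor \<open>Lambda\<close> on a homomorphism \<open>f\<close> into \<open>N\<close>.\<close>

definition Lambda_map ::
    "'r set set \<Rightarrow> ('r, 'n) module \<Rightarrow> ('m \<Rightarrow> 'n) \<Rightarrow> ('r set \<Rightarrow> 'm set) \<Rightarrow> 'r set \<Rightarrow> 'n set" where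
  "Lambda_map G N f x = (\<lambda>I\<in>G. coset_map N (ideal_smult I N) f (x I))"


section \<open>Standard free resolutions\<close>

definition free_mod :: "'r ring \<Rightarrow> 's set \<Rightarrow> ('r, 's \<Rightarrow> 'r) module" where
  "free_mod R S =
     \<lparr>carrier = {c. (\<forall>s. c s \<in> carrier R) \<and> (\<forall>s. s \<notin> S \<longrightarrow> c s = \<zero>\<^bsub>R\<^esub>) \<and> finite {s. c s \<noteq> \<zero>\<^bsub>R\<^esub>}},
      monoid.mult = undefined, monoid.one = undefined, ring.zero = (\<lambda>_. \<zero>\<^bsub>R\<^esub>),
      ring.add = (\<lambda>c d s. c s \<oplus>\<^bsub>R\<^esub> d s), smult = (\<lambda>r c s. r \<otimes>\<^bsub>R\<^esub> c s)\<rparr>"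

definition free_gen :: "'r ring \<Rightarrow> 's \<Rightarrow> 's \<Rightarrow> 'r" where
  "free_gen R s = (\<lambda>t. if t = s then \<one>\<^bsub>R\<^esub> else \<zero>\<^bsub>R\<^esub>)"

definition free_ext ::
    "'r ring \<Rightarrow> ('r, 'n, 'x) module_scheme \<Rightarrow> ('s \<Rightarrow> 'n) \<Rightarrow> ('s \<Rightarrow> 'r) \<Rightarrow> 'n" where
  "free_ext R N g c = finsum N (\<lambda>s. c s \<odot>\<^bsub>N\<^esub> g s) {s. c s \<noteq> \<zero>\<^bsub>R\<^esub>}"

text \<open>
  The standard free resolution \<open>\<dots> \<rightarrow> F\<^sub>2 E \<rightarrow> F\<^sub>1 E \<rightarrow> F\<^sub>0 E \<rightarrow> E\<close> of a left module \<open>E\<close>: \<open>F\<^sub>0 E\<close> is free on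
  the set \<open>E\<close>, and each further term is free on the kernel of the preceding map. It is functorial
  in \<open>E\<close>. The terms of degree at least 3 do not enter into \<open>Ext\<^sup>1\<close>.
\<close>

definition F0 :: "'r ring \<Rightarrow> ('r, 'a) bimodule \<Rightarrow> ('r, 'a \<Rightarrow> 'r) module" where
  "F0 R E = free_mod R (carrier E)"

definition aug :: "'r ring \<Rightarrow> ('r, 'a) bimodule \<Rightarrow> ('a \<Rightarrow> 'r) \<Rightarrow> 'a" where
  "aug R E = free_ext R E (\<lambda>x. x)"

definition F1 :: "'r ring \<Rightarrow> ('r, 'a) bimodule \<Rightarrow> ('r, ('a \<Rightarrow> 'r) \<Rightarrow> 'r) module" where
  "F1 R E = free_mod R {c \<in> carrier (F0 R E). aug R E c = \<zero>\<^bsub>E\<^esub>}"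

definition d1 :: "'r ring \<Rightarrow> ('r, 'a) bimodule \<Rightarrow> (('a \<Rightarrow> 'r) \<Rightarrow> 'r) \<Rightarrow> 'a \<Rightarrow> 'r" where
  "d1 R E = free_ext R (F0 R E) (\<lambda>c. c)"

definition F2 :: "'r ring \<Rightarrow> ('r, 'a) bimodule \<Rightarrow> ('r, (('a \<Rightarrow> 'r) \<Rightarrow> 'r) \<Rightarrow> 'r) module" where
  "F2 R E = free_mod R {c \<in> carrier (F1 R E). d1 R E c = \<zero>\<^bsub>F0 R E\<^esub>}"

definition d2 :: "'r ring \<Rightarrow> ('r, 'a) bimodule \<Rightarrow> ((('a \<Rightarrow> 'r) \<Rightarrow> 'r) \<Rightarrow> 'r) \<Rightarrow> ('a \<Rightarrow> 'r) \<Rightarrow> 'r" where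
  "d2 R E = free_ext R (F1 R E) (\<lambda>c. c)"

text \<open>The maps induced by a left module homomorphism \<open>f\<close> into \<open>Y\<close>.\<close>

definition F0_map :: "'r ring \<Rightarrow> ('r, 'b) bimodule \<Rightarrow> ('a \<Rightarrow> 'b) \<Rightarrow> ('a \<Rightarrow> 'r) \<Rightarrow> 'b \<Rightarrow> 'r" where
  "F0_map R Y f = free_ext R (F0 R Y) (\<lambda>x. free_gen R (f x))"

definition F1_map ::
    "'r ring \<Rightarrow> ('r, 'b) bimodule \<Rightarrow> ('a \<Rightarrow> 'b) \<Rightarrow> (('a \<Rightarrow> 'r) \<Rightarrow> 'r) \<Rightarrow> ('b \<Rightarrow> 'r) \<Rightarrow> 'r" where
  "F1_map R Y f = free_ext R (F1 R Y) (\<lambda>c. free_gen R (F0_map R Y f c))"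

definition prod_mod :: "('r, 'a) module \<Rightarrow> ('r, 'b) module \<Rightarrow> ('r, 'a \<times> 'b) module" where
  "prod_mod A B = \<lparr>carrier = carrier A \<times> carrier B,
     monoid.mult = undefined, monoid.one = undefined,
     ring.zero = (\<zero>\<^bsub>A\<^esub>, \<zero>\<^bsub>B\<^esub>), ring.add = (\<lambda>(a, b) (a', b'). (a \<oplus>\<^bsub>A\<^esub> a', b \<oplus>\<^bsub>B\<^esub> b')),
     smult = (\<lambda>r (a, b). (r \<odot>\<^bsub>A\<^esub> a, r \<odot>\<^bsub>B\<^esub> b))\<rparr>"

text \<open>A complex of bimodules \<open>lterm \<rightarrow> rterm\<close> placed in the cohomological degrees -1 and 0.\<close>

record ('r, 'a, 'b) twoterm =
  lterm :: "('r, 'a) bimodule"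
  rterm :: "('r, 'b) bimodule"
  tdiff :: "'a \<Rightarrow> 'b"

text \<open>
  The free resolution \<open>P\<close> of a two-term complex \<open>K\<close> of left modules is the mapping cone of
  \<open>F lterm \<rightarrow> F rterm\<close>; \<open>P0\<close>, \<open>P1\<close>, \<open>P2\<close> are its terms in the cohomological degrees 0, -1, -2. The
  quasi-isomorphism \<open>P \<rightarrow> K\<close> is \<open>aug\<close> of \<open>rterm\<close> on \<open>P0\<close> and \<open>aug\<close> of \<open>lterm\<close> on the first summand of
  \<open>P1\<close>.
\<close>

definition P0 :: "'r ring \<Rightarrow> ('r, 'a, 'b) twoterm \<Rightarrow> ('r, 'b \<Rightarrow> 'r) module" where
  "P0 R K = F0 R (rterm K)"

definition P1 ::
    "'r ring \<Rightarrow> ('r, 'a, 'b) twoterm \<Rightarrow> ('r, ('a \<Rightarrow> 'r) \<times> (('b \<Rightarrow> 'r) \<Rightarrow> 'r)) module" where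
  "P1 R K = prod_mod (F0 R (lterm K)) (F1 R (rterm K))"

definition P2 ::
    "'r ring \<Rightarrow> ('r, 'a, 'b) twoterm
      \<Rightarrow> ('r, (('a \<Rightarrow> 'r) \<Rightarrow> 'r) \<times> ((('b \<Rightarrow> 'r) \<Rightarrow> 'r) \<Rightarrow> 'r)) module" where
  "P2 R K = prod_mod (F1 R (lterm K)) (F2 R (rterm K))"

definition bd1 ::
    "'r ring \<Rightarrow> ('r, 'a, 'b) twoterm \<Rightarrow> ('a \<Rightarrow> 'r) \<times> (('b \<Rightarrow> 'r) \<Rightarrow> 'r) \<Rightarrow> 'b \<Rightarrow> 'r" where
  "bd1 R K = (\<lambda>(x, y). F0_map R (rterm K) (tdiff K) x \<oplus>\<^bsub>F0 R (rterm K)\<^esub> d1 R (rterm K) y)"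

definition bd2 ::
    "'r ring \<Rightarrow> ('r, 'a, 'b) twoterm \<Rightarrow> (('a \<Rightarrow> 'r) \<Rightarrow> 'r) \<times> ((('b \<Rightarrow> 'r) \<Rightarrow> 'r) \<Rightarrow> 'r)
      \<Rightarrow> ('a \<Rightarrow> 'r) \<times> (('b \<Rightarrow> 'r) \<Rightarrow> 'r)" where
  "bd2 R K = (\<lambda>(x, y). (\<ominus>\<^bsub>F0 R (lterm K)\<^esub> d1 R (lterm K) x,
      F1_map R (rterm K) (tdiff K) x \<oplus>\<^bsub>F1 R (rterm K)\<^esub> d2 R (rterm K) y))"

text \<open>The map on \<open>P1\<close> induced by a morphism of two-term complexes \<open>(f, g)\<close> into \<open>L\<close>.\<close>

definition P1_map ::
    "'r ring \<Rightarrow> ('r, 'c, 'd) twoterm \<Rightarrow> ('a \<Rightarrow> 'c) \<Rightarrow> ('b \<Rightarrow> 'd)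
      \<Rightarrow> ('a \<Rightarrow> 'r) \<times> (('b \<Rightarrow> 'r) \<Rightarrow> 'r) \<Rightarrow> ('c \<Rightarrow> 'r) \<times> (('d \<Rightarrow> 'r) \<Rightarrow> 'r)" where
  "P1_map R L f g = (\<lambda>(x, y). (F0_map R (lterm L) f x, F1_map R (rterm L) g y))"


section \<open>First extension modules of two-term complexes\<close>

text \<open>
  \<open>Ext\<^sup>1\<^sub>R(K, M) = Hom\<^sub>D(K, M[1])\<close>, for \<open>D\<close> the derived category of left \<open>R\<close>-modules, is the first
  cohomology of the complex \<open>Hom\<^sub>R(P, M)\<close>, that is, the group of homotopy classes of morphisms of
  complexes \<open>P \<rightarrow> M[1]\<close>. The element \<open>r\<close> of \<open>R\<close> acts through the endomorphism of \<open>P\<close> induced by the right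
  multiplication by \<open>r\<close> on \<open>K\<close>.
\<close>

definition ext1_cocycles ::
    "'r ring \<Rightarrow> ('r, 'a, 'b) twoterm \<Rightarrow> ('r, 'm) module
      \<Rightarrow> ('r, ('a \<Rightarrow> 'r) \<times> (('b \<Rightarrow> 'r) \<Rightarrow> 'r) \<Rightarrow> 'm) module" where
  "ext1_cocycles R K M =
     \<lparr>carrier = {\<phi> \<in> mod_hom R (P1 R K) M. \<forall>z\<in>carrier (P2 R K). \<phi> (bd2 R K z) = \<zero>\<^bsub>M\<^esub>},
      monoid.mult = undefined, monoid.one = undefined,
      ring.zero = (\<lambda>z\<in>carrier (P1 R K). \<zero>\<^bsub>M\<^esub>),
      ring.add = (\<lambda>\<phi> \<psi>. \<lambda>z\<in>carrier (P1 R K). \<phi> z \<oplus>\<^bsub>M\<^esub> \<psi> z),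
      smult = (\<lambda>r \<phi>. \<lambda>z\<in>carrier (P1 R K).
        \<phi> (P1_map R K (\<lambda>x. ract (lterm K) x r) (\<lambda>x. ract (rterm K) x r) z))\<rparr>"

definition ext1_coboundaries ::
    "'r ring \<Rightarrow> ('r, 'a, 'b) twoterm \<Rightarrow> ('r, 'm) module
      \<Rightarrow> (('a \<Rightarrow> 'r) \<times> (('b \<Rightarrow> 'r) \<Rightarrow> 'r) \<Rightarrow> 'm) set" where
  "ext1_coboundaries R K M =
     (\<lambda>c. \<lambda>z\<in>carrier (P1 R K). c (bd1 R K z)) ` mod_hom R (P0 R K) M"

definition Ext1 ::
    "'r ring \<Rightarrow> ('r, 'a, 'b) twoterm \<Rightarrow> ('r, 'm) module
      \<Rightarrow> ('r, (('a \<Rightarrow> 'r) \<times> (('b \<Rightarrow> 'r) \<Rightarrow> 'r) \<Rightarrow> 'm) set) module" where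
  "Ext1 R K M = quot_mod (ext1_cocycles R K M) (ext1_coboundaries R K M)"

text \<open>The map \<open>Ext\<^sup>1(L, M) \<rightarrow> Ext\<^sup>1(K, M)\<close> induced by a morphism \<open>(f, g)\<close> from \<open>K\<close> to \<open>L\<close>.\<close>

definition Ext1_map ::
    "'r ring \<Rightarrow> ('r, 'a, 'b) twoterm \<Rightarrow> ('r, 'c, 'd) twoterm \<Rightarrow> ('r, 'm) module
      \<Rightarrow> ('a \<Rightarrow> 'c) \<Rightarrow> ('b \<Rightarrow> 'd) \<Rightarrow> (('c \<Rightarrow> 'r) \<times> (('d \<Rightarrow> 'r) \<Rightarrow> 'r) \<Rightarrow> 'm) set
      \<Rightarrow> (('a \<Rightarrow> 'r) \<times> (('b \<Rightarrow> 'r) \<Rightarrow> 'r) \<Rightarrow> 'm) set" where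
  "Ext1_map R K L M f g =
     coset_map (ext1_cocycles R K M) (ext1_coboundaries R K M)
       (\<lambda>\<phi>. \<lambda>z\<in>carrier (P1 R K). \<phi> (P1_map R L f g z))"

text \<open>A bimodule regarded as a complex concentrated in degree 0.\<close>

definition stalk :: "('r, 'b) bimodule \<Rightarrow> ('r, unit, 'b) twoterm" where
  "stalk E = \<lparr>lterm = zero_bimod, rterm = E, tdiff = (\<lambda>_. \<zero>\<^bsub>E\<^esub>)\<rparr>"

text \<open>
  The connecting homomorphism \<open>Hom\<^sub>R(E, V) \<rightarrow> Ext\<^sup>1\<^sub>R(E, M)\<close> of a short exact sequence
  \<open>0 \<rightarrow> M \<rightarrow> N \<rightarrow> V \<rightarrow> 0\<close> with maps \<open>i\<close> and \<open>p\<close>, given by the snake lemma: lift \<open>g \<circ> aug\<close> to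
  \<open>h: P0 \<rightarrow> N\<close>, and pull \<open>h \<circ> bd1\<close> back along \<open>i\<close>. The set of all cocycles obtained from the various
  lifts \<open>h\<close> is a single cohomology class. With these signs the composition \<open>theta\<close> below satisfies
  \<open>theta (completion_map m) = delta m\<close>.
\<close>

definition connecting ::
    "'r ring \<Rightarrow> ('r, 'b) bimodule \<Rightarrow> ('r, 'm) module \<Rightarrow> ('r, 'n) module
      \<Rightarrow> ('m \<Rightarrow> 'n) \<Rightarrow> ('n \<Rightarrow> 'v) \<Rightarrow> ('b \<Rightarrow> 'v)
      \<Rightarrow> ((unit \<Rightarrow> 'r) \<times> (('b \<Rightarrow> 'r) \<Rightarrow> 'r) \<Rightarrow> 'm) set" where
  "connecting R E M N i p g =
     {\<phi> \<in> carrier (ext1_cocycles R (stalk E) M).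
        \<exists>h\<in>mod_hom R (P0 R (stalk E)) N.
          (\<forall>c\<in>carrier (P0 R (stalk E)). p (h c) = g (aug R E c)) \<and>
          (\<forall>z\<in>carrier (P1 R (stalk E)). i (\<phi> z) = h (bd1 R (stalk E) z))}"


section \<open>The modules and maps of the theorem\<close>

definition K_complex :: "'r ring \<Rightarrow> 'u ring \<Rightarrow> ('r \<Rightarrow> 'u) \<Rightarrow> ('r, 'r, 'u) twoterm" where
  "K_complex R U u = \<lparr>lterm = self_bimod R, rterm = restr_bimod U u, tdiff = u\<rparr>"

definition Delta ::
    "'r ring \<Rightarrow> 'u ring \<Rightarrow> ('r \<Rightarrow> 'u) \<Rightarrow> ('r, 'm) module
      \<Rightarrow> ('r, (('r \<Rightarrow> 'r) \<times> (('u \<Rightarrow> 'r) \<Rightarrow> 'r) \<Rightarrow> 'm) set) module" where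
  "Delta R U u M = Ext1 R (K_complex R U u) M"

text \<open>
  \<open>delta m\<close> is the class of the composition \<open>P \<rightarrow> K \<rightarrow> R[1] \<rightarrow> M[1]\<close>, whose last map is \<open>r \<mapsto> r m\<close>.
\<close>

definition delta ::
    "'r ring \<Rightarrow> 'u ring \<Rightarrow> ('r \<Rightarrow> 'u) \<Rightarrow> ('r, 'm) module
      \<Rightarrow> 'm \<Rightarrow> (('r \<Rightarrow> 'r) \<times> (('u \<Rightarrow> 'r) \<Rightarrow> 'r) \<Rightarrow> 'm) set" where
  "delta R U u M m =
     ext1_coboundaries R (K_complex R U u) M +>\<^bsub>ext1_cocycles R (K_complex R U u) M\<^esub>
       (\<lambda>z\<in>carrier (P1 R (K_complex R U u)). aug R (self_bimod R) (fst z) \<odot>\<^bsub>M\<^esub> m)"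

definition is_beta ::
    "'r ring \<Rightarrow> 'u ring \<Rightarrow> ('r \<Rightarrow> 'u) \<Rightarrow> ('r, 'm) module
      \<Rightarrow> ((('r \<Rightarrow> 'r) \<times> (('u \<Rightarrow> 'r) \<Rightarrow> 'r) \<Rightarrow> 'm) set \<Rightarrow> 'r set \<Rightarrow> 'm set) \<Rightarrow> bool" where
  "is_beta R U u M b \<longleftrightarrow>
     b \<in> mod_hom R (Delta R U u M) (Lambda R (gabriel R U u) M) \<and>
     (\<forall>m\<in>carrier M. b (delta R U u M m) = completion_map (gabriel R U u) M m)"

definition beta ::
    "'r ring \<Rightarrow> 'u ring \<Rightarrow> ('r \<Rightarrow> 'u) \<Rightarrow> ('r, 'm) module
      \<Rightarrow> (('r \<Rightarrow> 'r) \<times> (('u \<Rightarrow> 'r) \<Rightarrow> 'r) \<Rightarrow> 'm) set \<Rightarrow> 'r set \<Rightarrow> 'm set" where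
  "beta R U u M = (THE b. is_beta R U u M b)"

definition V_mod ::
    "'r ring \<Rightarrow> 'u ring \<Rightarrow> ('r \<Rightarrow> 'u) \<Rightarrow> ('r, 'm) module \<Rightarrow> ('r, ('u set \<times> 'm \<Rightarrow>\<^sub>0 int) set) module" where
  "V_mod R U u M = tensor_mod R (coker_bimod R U u) M"

definition annihilated :: "'r set \<Rightarrow> ('r, 'b) bimodule \<Rightarrow> 'b set" where
  "annihilated I B = {x \<in> carrier B. \<forall>i\<in>I. ract B x i = \<zero>\<^bsub>B\<^esub>}"

definition theta1 ::
    "'r ring \<Rightarrow> 'u ring \<Rightarrow> ('r \<Rightarrow> 'u) \<Rightarrow> ('r, 'm) module \<Rightarrow> ('r set \<Rightarrow> 'm set)
      \<Rightarrow> 'r set \<Rightarrow> ('u set \<Rightarrow> ('u set \<times> 'm \<Rightarrow>\<^sub>0 int) set) set" where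
  "theta1 R U u M =
     Lambda_map (gabriel R U u) (hom_mod R (coker_bimod R U u) (V_mod R U u M))
       (\<lambda>m. \<lambda>x\<in>carrier (coker_bimod R U u). tens R (right_of (coker_bimod R U u)) M x m)"

text \<open>
  A family of cosets \<open>y I = f + I Hom(B, V)\<close> is sent to the homomorphism whose restriction to the
  part of \<open>B\<close> annihilated by \<open>I\<close> agrees with that of \<open>f\<close>, for all \<open>I\<close>.
\<close>

definition glue ::
    "'r ring \<Rightarrow> 'r set set \<Rightarrow> ('r, 'b) bimodule \<Rightarrow> ('r, 'v) module
      \<Rightarrow> ('r set \<Rightarrow> ('b \<Rightarrow> 'v) set) \<Rightarrow> 'b \<Rightarrow> 'v" where
  "glue R G B V y = (THE h. h \<in> mod_hom R B V \<and>
     (\<forall>I\<in>G. \<forall>f\<in>y I. \<forall>x\<in>annihilated I B. h x = f x))"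

definition theta2 ::
    "'r ring \<Rightarrow> 'u ring \<Rightarrow> ('r \<Rightarrow> 'u) \<Rightarrow> ('r, 'm) module
      \<Rightarrow> ('r set \<Rightarrow> ('u set \<Rightarrow> ('u set \<times> 'm \<Rightarrow>\<^sub>0 int) set) set)
      \<Rightarrow> 'u set \<Rightarrow> ('u set \<times> 'm \<Rightarrow>\<^sub>0 int) set" where
  "theta2 R U u M = glue R (gabriel R U u) (coker_bimod R U u) (V_mod R U u M)"

definition theta3 ::
    "'r ring \<Rightarrow> 'u ring \<Rightarrow> ('r \<Rightarrow> 'u) \<Rightarrow> ('r, 'm) module
      \<Rightarrow> ('u set \<Rightarrow> ('u set \<times> 'm \<Rightarrow>\<^sub>0 int) set)
      \<Rightarrow> ((unit \<Rightarrow> 'r) \<times> (('u set \<Rightarrow> 'r) \<Rightarrow> 'r) \<Rightarrow> 'm) set" where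
  "theta3 R U u M =
     connecting R (coker_bimod R U u) M (tensor_mod R (restr_bimod U u) M)
       (unit_tens R U u M)
       (tensor_map R (right_of (coker_bimod R U u)) M (coker_proj R U u) (\<lambda>m. m))"

definition theta4 ::
    "'r ring \<Rightarrow> 'u ring \<Rightarrow> ('r \<Rightarrow> 'u) \<Rightarrow> ('r, 'm) module
      \<Rightarrow> ((unit \<Rightarrow> 'r) \<times> (('u set \<Rightarrow> 'r) \<Rightarrow> 'r) \<Rightarrow> 'm) set
      \<Rightarrow> (('r \<Rightarrow> 'r) \<times> (('u \<Rightarrow> 'r) \<Rightarrow> 'r) \<Rightarrow> 'm) set" where
  "theta4 R U u M =
     Ext1_map R (K_complex R U u) (stalk (coker_bimod R U u)) M (\<lambda>_. ()) (coker_proj R U u)"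

definition theta ::
    "'r ring \<Rightarrow> 'u ring \<Rightarrow> ('r \<Rightarrow> 'u) \<Rightarrow> ('r, 'm) module \<Rightarrow> ('r set \<Rightarrow> 'm set)
      \<Rightarrow> (('r \<Rightarrow> 'r) \<times> (('u \<Rightarrow> 'r) \<Rightarrow> 'r) \<Rightarrow> 'm) set" where
  "theta R U u M =
     restrict (theta4 R U u M \<circ> theta3 R U u M \<circ> theta2 R U u M \<circ> theta1 R U u M)
       (carrier (Lambda R (gabriel R U u) M))"

end

theory Submission
  imports Defs
begin

text \<open>
  Write \<open>N = U \<otimes>\<^sub>R M\<close>. As \<open>M\<close> is torsion-free, it embeds into \<open>N\<close>, with cokernel
  \<open>V = U/R \<otimes>\<^sub>R M\<close>. The theorem holds because both \<open>Delta M\<close> and the completion are isomorphic to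
  \<open>Hom\<^sub>R(U/R, V)\<close>, compatibly with the maps that \<open>M\<close> has to them.

  For \<open>Delta M\<close>, the reason is that \<open>U \<otimes>\<^sub>R K\<close> is acyclic, so that the derived category has no nonzero
  morphisms from \<open>K\<close> to a shift of the \<open>U\<close>-module \<open>N\<close>. Therefore the connecting map
  \<open>Hom(K, V) \<rightarrow> Hom(K, M[1])\<close> is bijective. In terms of resolutions, a homomorphism \<open>g\<close> from \<open>U/R\<close> to
  \<open>V\<close> is lifted to a homomorphism \<open>H\<close> from the free module on the set \<open>U\<close> to \<open>N\<close>, and the cocycle of
  \<open>g\<close> is \<open>H \<circ> bd1\<close>, whose values lie in \<open>M\<close>. Surjectivity (\<open>cocycle_from_lift\<close>) rests on
  \<open>extend_from_kernel\<close>, injectivity is \<open>hom_class_inj\<close>.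

  For the completion, a compatible family \<open>y\<close> of cosets of the \<open>I M\<close> is sent to the homomorphism whose
  value on the class of \<open>x\<close> is the class of \<open>x \<otimes> m\<close>, where \<open>m \<in> y I\<close> for some \<open>I\<close> with \<open>x I\<close> in the
  image of \<open>R\<close>. Conversely, let \<open>H\<close> lift a homomorphism \<open>g\<close> as above. An ideal \<open>I\<close> of the topology
  contains the coefficients \<open>\<beta> w\<close> of a combination \<open>\<Sum> u (\<beta> w) w = 1\<close>. Then \<open>H \<beta>\<close> belongs to \<open>M\<close>, and
  its coset is the component at \<open>I\<close> of the family that corresponds to \<open>g\<close> (\<open>represents_component\<close>,
  \<open>represents_surj\<close>).

  The composition of the two isomorphisms is \<open>theta\<close>, which sends \<open>completion_map m\<close> to \<open>delta m\<close>. Hence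
  its inverse is a candidate for \<open>beta\<close>. It is the only one: modulo \<open>I\<close>-multiples, which do not affect the
  component at \<open>I\<close>, every element of \<open>Hom\<^sub>R(U/R, V)\<close> comes from \<open>M\<close> (\<open>hom_decomposition\<close>).

  All computations in \<open>U\<close> rely on \<open>trivialize_relations\<close>: finitely many elements of \<open>U\<close> have common
  denominators whose numerators satisfy finitely many given \<open>R\<close>-linear relations that hold between these
  elements. It combines the equational criterion for flatness (\<open>flat_relations\<close>) with the equation
  \<open>x \<otimes> 1 = 1 \<otimes> x\<close>, which characterizes epimorphisms.
\<close>

section \<open>Linear maps and free modules\<close>

text \<open>
  In contrast to \<^const>\<open>mod_hom\<close> this does not restrict the function outside the module, so that
  compositions and pointwise sums are again linear.
\<close>

definition linear_on ::
    "'r ring \<Rightarrow> ('r, 'a, 'x) module_scheme \<Rightarrow> ('r, 'b, 'y) module_scheme \<Rightarrow> ('a \<Rightarrow> 'b) \<Rightarrow> bool" where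
  "linear_on R A B f \<longleftrightarrow> (\<forall>x\<in>carrier A. f x \<in> carrier B) \<and>
     (\<forall>x\<in>carrier A. \<forall>y\<in>carrier A. f (x \<oplus>\<^bsub>A\<^esub> y) = f x \<oplus>\<^bsub>B\<^esub> f y) \<and>
     (\<forall>r\<in>carrier R. \<forall>x\<in>carrier A. f (r \<odot>\<^bsub>A\<^esub> x) = r \<odot>\<^bsub>B\<^esub> f x)"

lemma linear_onI:
  assumes "\<And>x. x \<in> carrier A \<Longrightarrow> f x \<in> carrier B"
    and "\<And>x y. \<lbrakk>x \<in> carrier A; y \<in> carrier A\<rbrakk> \<Longrightarrow> f (x \<oplus>\<^bsub>A\<^esub> y) = f x \<oplus>\<^bsub>B\<^esub> f y"
    and "\<And>r x. \<lbrakk>r \<in> carrier R; x \<in> carrier A\<rbrakk> \<Longrightarrow> f (r \<odot>\<^bsub>A\<^esub> x) = r \<odot>\<^bsub>B\<^esub> f x"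
  shows "linear_on R A B f"
  using assms by (simp add: linear_on_def)

lemma linear_on_closed: "\<lbrakk>linear_on R A B f; x \<in> carrier A\<rbrakk> \<Longrightarrow> f x \<in> carrier B"
  and linear_on_add: "\<lbrakk>linear_on R A B f; x \<in> carrier A; y \<in> carrier A\<rbrakk> \<Longrightarrow> f (x \<oplus>\<^bsub>A\<^esub> y) = f x \<oplus>\<^bsub>B\<^esub> f y"
  and linear_on_smult: "\<lbrakk>linear_on R A B f; r \<in> carrier R; x \<in> carrier A\<rbrakk> \<Longrightarrow> f (r \<odot>\<^bsub>A\<^esub> x) = r \<odot>\<^bsub>B\<^esub> f x"
  by (simp_all add: linear_on_def)

lemma mod_hom_iff: "f \<in> mod_hom R A B \<longleftrightarrow> linear_on R A B f \<and> f \<in> extensional (carrier A)"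
  by (auto simp: mod_hom_def linear_on_def PiE_def)

lemma linear_on_comp: "\<lbrakk>linear_on R A B f; linear_on R B C g\<rbrakk> \<Longrightarrow> linear_on R A C (\<lambda>x. g (f x))"
  by (simp add: linear_on_def)

lemma linear_on_cong:
  assumes "linear_on R A B f" "\<And>x. x \<in> carrier A \<Longrightarrow> g x = f x" "left_module R A"
  shows "linear_on R A B g"
proof -
  interpret left_module R A by fact
  show ?thesis
    using assms(1) by (simp add: linear_on_def assms(2) smult_closed)
qed

lemma linear_on_restrict:
  assumes "left_module R A" "linear_on R A B f"
  shows "(\<lambda>x\<in>carrier A. f x) \<in> mod_hom R A B"
  using linear_on_cong[OF assms(2) _ assms(1), of "\<lambda>x\<in>carrier A. f x"] by (simp add: mod_hom_iff)

context left_module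
begin

lemma smult_zero_right: "a \<in> carrier R \<Longrightarrow> a \<odot>\<^bsub>M\<^esub> \<zero>\<^bsub>M\<^esub> = \<zero>\<^bsub>M\<^esub>"
  using smult_r_distr[of a "\<zero>\<^bsub>M\<^esub>" "\<zero>\<^bsub>M\<^esub>"] smult_closed[of a "\<zero>\<^bsub>M\<^esub>"]
  by (simp add: M.add.l_cancel_one')

lemma smult_zero_left: "x \<in> carrier M \<Longrightarrow> \<zero>\<^bsub>R\<^esub> \<odot>\<^bsub>M\<^esub> x = \<zero>\<^bsub>M\<^esub>"
  using smult_l_distr[of "\<zero>\<^bsub>R\<^esub>" "\<zero>\<^bsub>R\<^esub>" x] smult_closed[of "\<zero>\<^bsub>R\<^esub>" x]
  by (simp add: M.add.l_cancel_one')

lemma smult_minus_right: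
  assumes "a \<in> carrier R" "x \<in> carrier M"
  shows "a \<odot>\<^bsub>M\<^esub> (\<ominus>\<^bsub>M\<^esub> x) = \<ominus>\<^bsub>M\<^esub> (a \<odot>\<^bsub>M\<^esub> x)"
  using smult_r_distr[of a "\<ominus>\<^bsub>M\<^esub> x" x] assms
  by (intro M.minus_equality[symmetric]) (simp_all add: smult_closed M.l_neg smult_zero_right)

lemma smult_minus_left:
  assumes "a \<in> carrier R" "x \<in> carrier M"
  shows "(\<ominus>\<^bsub>R\<^esub> a) \<odot>\<^bsub>M\<^esub> x = \<ominus>\<^bsub>M\<^esub> (a \<odot>\<^bsub>M\<^esub> x)"
  using smult_l_distr[of "\<ominus>\<^bsub>R\<^esub> a" a x] assms
  by (intro M.minus_equality[symmetric]) (simp_all add: smult_closed R.l_neg smult_zero_left)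

lemma smult_finsum:
  assumes "a \<in> carrier R" "f \<in> A \<rightarrow> carrier M"
  shows "a \<odot>\<^bsub>M\<^esub> finsum M f A = finsum M (\<lambda>i. a \<odot>\<^bsub>M\<^esub> f i) A"
  using assms(2)
proof (induction A rule: infinite_finite_induct)
  case (infinite A)
  then show ?case using assms(1) by (simp add: M.finsum_infinite smult_zero_right)
next
  case empty
  then show ?case using assms(1) by (simp add: smult_zero_right)
next
  case (insert i A)
  then have "(\<lambda>i. a \<odot>\<^bsub>M\<^esub> f i) \<in> A \<rightarrow> carrier M" "a \<odot>\<^bsub>M\<^esub> f i \<in> carrier M"
    using assms(1) by (auto intro!: smult_closed)
  with insert assms(1) show ?case
    by (simp add: M.finsum_insert smult_r_distr M.finsum_closed Pi_iff)
qed

lemma finsum_smult: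
  assumes "f \<in> A \<rightarrow> carrier R" "x \<in> carrier M"
  shows "finsum R f A \<odot>\<^bsub>M\<^esub> x = finsum M (\<lambda>i. f i \<odot>\<^bsub>M\<^esub> x) A"
  using assms(1)
proof (induction A rule: infinite_finite_induct)
  case (infinite A)
  then show ?case using assms(2) by (simp add: M.finsum_infinite R.finsum_infinite smult_zero_left)
next
  case empty
  then show ?case using assms(2) by (simp add: smult_zero_left)
next
  case (insert i A)
  then have "(\<lambda>i. f i \<odot>\<^bsub>M\<^esub> x) \<in> A \<rightarrow> carrier M" "f i \<odot>\<^bsub>M\<^esub> x \<in> carrier M"
    using assms(2) by (auto intro!: smult_closed)
  with insert assms(2) show ?case
    by (simp add: M.finsum_insert R.finsum_insert smult_l_distr R.finsum_closed Pi_iff)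
qed

end

lemma linear_on_zero:
  assumes "left_module R A" "left_module R B" "linear_on R A B f"
  shows "f \<zero>\<^bsub>A\<^esub> = \<zero>\<^bsub>B\<^esub>"
proof -
  interpret A: left_module R A by fact
  interpret B: left_module R B by fact
  have "f \<zero>\<^bsub>A\<^esub> = f (\<zero>\<^bsub>R\<^esub> \<odot>\<^bsub>A\<^esub> \<zero>\<^bsub>A\<^esub>)" by (simp add: A.smult_zero_right)
  also have "\<dots> = \<zero>\<^bsub>B\<^esub>"
    using assms(3) by (simp add: linear_on_smult[OF assms(3)] linear_on_closed B.smult_zero_left)
  finally show ?thesis .
qed

lemma linear_on_minus:
  assumes "left_module R A" "left_module R B" "linear_on R A B f" "x \<in> carrier A"
  shows "f (\<ominus>\<^bsub>A\<^esub> x) = \<ominus>\<^bsub>B\<^esub> f x"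
proof -
  interpret A: left_module R A by fact
  interpret B: left_module R B by fact
  have "f (\<ominus>\<^bsub>A\<^esub> x) \<oplus>\<^bsub>B\<^esub> f x = \<zero>\<^bsub>B\<^esub>"
    using assms by (simp add: linear_on_add[OF assms(3), symmetric] A.M.l_neg linear_on_zero)
  then show ?thesis
    using B.M.minus_equality[of "f (\<ominus>\<^bsub>A\<^esub> x)" "f x"] assms by (simp add: linear_on_closed)
qed

lemma linear_on_diff:
  assumes "left_module R A" "left_module R B" "linear_on R A B f" "x \<in> carrier A" "y \<in> carrier A"
  shows "f (x \<ominus>\<^bsub>A\<^esub> y) = f x \<ominus>\<^bsub>B\<^esub> f y"
proof -
  interpret A: left_module R A by fact
  show ?thesis
    using assms by (simp add: a_minus_def linear_on_add[OF assms(3)] linear_on_minus)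
qed

lemma linear_on_finsum:
  assumes "left_module R A" "left_module R B" "linear_on R A B f" "g \<in> I \<rightarrow> carrier A"
  shows "f (finsum A g I) = finsum B (\<lambda>i. f (g i)) I"
proof -
  interpret A: left_module R A by fact
  interpret B: left_module R B by fact
  show ?thesis
    using assms(4)
  proof (induction I rule: infinite_finite_induct)
    case (insert i I)
    then have "(\<lambda>i. f (g i)) \<in> I \<rightarrow> carrier B" "f (g i) \<in> carrier B" "g \<in> I \<rightarrow> carrier A" "g i \<in> carrier A"
      using linear_on_closed[OF assms(3)] by (auto simp: Pi_iff)
    with insert show ?case
      by (simp add: A.M.finsum_insert B.M.finsum_insert linear_on_add[OF assms(3)] A.M.finsum_closed)
  qed (use assms in \<open>simp_all add: A.M.finsum_infinite B.M.finsum_infinite linear_on_zero\<close>)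
qed

lemma linear_on_sum:
  assumes "left_module R B" "linear_on R A B f" "linear_on R A B g"
  shows "linear_on R A B (\<lambda>x. f x \<oplus>\<^bsub>B\<^esub> g x)"
proof -
  interpret B: left_module R B by fact
  show ?thesis
    using assms(2,3) by (auto simp: linear_on_def B.smult_r_distr B.M.a_ac)
qed

lemma linear_on_uminus:
  assumes "left_module R B" "linear_on R A B f"
  shows "linear_on R A B (\<lambda>x. \<ominus>\<^bsub>B\<^esub> f x)"
proof -
  interpret B: left_module R B by fact
  show ?thesis
    using assms(2) by (auto simp: linear_on_def B.smult_minus_right B.M.minus_add)
qed

lemma linear_on_minus_fun:
  assumes "left_module R B" "linear_on R A B f" "linear_on R A B g"
  shows "linear_on R A B (\<lambda>x. f x \<ominus>\<^bsub>B\<^esub> g x)"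
  using linear_on_sum[OF assms(1,2) linear_on_uminus[OF assms(1,3)]] by (simp add: a_minus_def)

lemma linear_on_const_zero:
  assumes "left_module R B"
  shows "linear_on R A B (\<lambda>_. \<zero>\<^bsub>B\<^esub>)"
proof -
  interpret B: left_module R B by fact
  show ?thesis by (simp add: linear_on_def B.smult_zero_right)
qed

lemma free_mod_simps:
  "\<zero>\<^bsub>free_mod R S\<^esub> = (\<lambda>_. \<zero>\<^bsub>R\<^esub>)"
  "c \<oplus>\<^bsub>free_mod R S\<^esub> d = (\<lambda>s. c s \<oplus>\<^bsub>R\<^esub> d s)"
  "r \<odot>\<^bsub>free_mod R S\<^esub> c = (\<lambda>s. r \<otimes>\<^bsub>R\<^esub> c s)"
  by (simp_all add: free_mod_def)

lemma free_mod_carrier_iff: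
  "c \<in> carrier (free_mod R S) \<longleftrightarrow>
     (\<forall>s. c s \<in> carrier R) \<and> (\<forall>s. s \<notin> S \<longrightarrow> c s = \<zero>\<^bsub>R\<^esub>) \<and> finite {s. c s \<noteq> \<zero>\<^bsub>R\<^esub>}"
  by (simp add: free_mod_def)

lemma free_mod_left_module:
  assumes "ring R"
  shows "left_module R (free_mod R S)"
proof -
  interpret R: ring R by fact
  let ?F = "free_mod R S"
  have add: "c \<oplus>\<^bsub>?F\<^esub> d \<in> carrier ?F" if "c \<in> carrier ?F" "d \<in> carrier ?F" for c d
  proof -
    have "{s. c s \<oplus>\<^bsub>R\<^esub> d s \<noteq> \<zero>\<^bsub>R\<^esub>} \<subseteq> {s. c s \<noteq> \<zero>\<^bsub>R\<^esub>} \<union> {s. d s \<noteq> \<zero>\<^bsub>R\<^esub>}" by auto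
    with that show ?thesis
      by (auto simp: free_mod_carrier_iff free_mod_simps intro: finite_subset)
  qed
  have smult: "r \<odot>\<^bsub>?F\<^esub> c \<in> carrier ?F" if "r \<in> carrier R" "c \<in> carrier ?F" for r c
  proof -
    have "{s. r \<otimes>\<^bsub>R\<^esub> c s \<noteq> \<zero>\<^bsub>R\<^esub>} \<subseteq> {s. c s \<noteq> \<zero>\<^bsub>R\<^esub>}" using that(1) by auto
    with that show ?thesis
      by (auto simp: free_mod_carrier_iff free_mod_simps intro: finite_subset)
  qed
  have "abelian_group ?F"
  proof (rule abelian_groupI)
    fix c assume c: "c \<in> carrier ?F"
    show "\<exists>d\<in>carrier ?F. d \<oplus>\<^bsub>?F\<^esub> c = \<zero>\<^bsub>?F\<^esub>"
    proof (rule bexI)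
      show "(\<lambda>s. \<ominus>\<^bsub>R\<^esub> c s) \<oplus>\<^bsub>?F\<^esub> c = \<zero>\<^bsub>?F\<^esub>"
        using c by (auto simp: free_mod_carrier_iff free_mod_simps R.l_neg)
      have "{s. \<ominus>\<^bsub>R\<^esub> c s \<noteq> \<zero>\<^bsub>R\<^esub>} \<subseteq> {s. c s \<noteq> \<zero>\<^bsub>R\<^esub>}" by auto
      with c show "(\<lambda>s. \<ominus>\<^bsub>R\<^esub> c s) \<in> carrier ?F"
        by (auto simp: free_mod_carrier_iff intro: finite_subset)
    qed
  qed (use add in \<open>auto simp: free_mod_carrier_iff free_mod_simps R.a_ac\<close>)
  then show ?thesis
    by (intro left_module.intro left_module_axioms.intro assms smult)
      (auto simp: free_mod_carrier_iff free_mod_simps R.l_distr R.r_distr R.m_assoc)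
qed

lemma free_gen_closed:
  assumes "ring R" "s \<in> S"
  shows "free_gen R s \<in> carrier (free_mod R S)"
proof -
  interpret R: ring R by fact
  have "{t. free_gen R s t \<noteq> \<zero>\<^bsub>R\<^esub>} \<subseteq> {s}" by (auto simp: free_gen_def)
  with assms(2) show ?thesis
    by (auto simp: free_mod_carrier_iff intro: finite_subset) (auto simp: free_gen_def)
qed

lemma free_mod_induct [consumes 2, case_names zero add]:
  assumes "ring R" "c \<in> carrier (free_mod R S)"
    and zero: "P \<zero>\<^bsub>free_mod R S\<^esub>"
    and add: "\<And>c r s. \<lbrakk>c \<in> carrier (free_mod R S); P c; r \<in> carrier R; s \<in> S\<rbrakk>
        \<Longrightarrow> P (c \<oplus>\<^bsub>free_mod R S\<^esub> r \<odot>\<^bsub>free_mod R S\<^esub> free_gen R s)"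
  shows "P c"
proof -
  interpret R: ring R by fact
  have "\<forall>c\<in>carrier (free_mod R S). {s. c s \<noteq> \<zero>\<^bsub>R\<^esub>} \<subseteq> T \<longrightarrow> P c" if "finite T" for T
    using that
  proof (induction T)
    case empty
    have "c = \<zero>\<^bsub>free_mod R S\<^esub>" if "{s. c s \<noteq> \<zero>\<^bsub>R\<^esub>} \<subseteq> {}" for c
      using that by (auto simp: free_mod_simps)
    with zero show ?case by blast
  next
    case (insert s T)
    show ?case
    proof (intro ballI impI)
      fix c assume c: "c \<in> carrier (free_mod R S)" "{s. c s \<noteq> \<zero>\<^bsub>R\<^esub>} \<subseteq> insert s T"
      define c' where "c' = c(s := \<zero>\<^bsub>R\<^esub>)"
      have sub: "{s. c' s \<noteq> \<zero>\<^bsub>R\<^esub>} \<subseteq> {s. c s \<noteq> \<zero>\<^bsub>R\<^esub>}" "{s. c' s \<noteq> \<zero>\<^bsub>R\<^esub>} \<subseteq> T"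
        using c(2) by (auto simp: c'_def split: if_splits)
      have c': "c' \<in> carrier (free_mod R S)"
        using c(1) sub(1) by (auto simp: free_mod_carrier_iff intro: finite_subset) (auto simp: c'_def)
      then have P: "P c'" using insert.IH sub(2) by blast
      show "P c"
      proof (cases "s \<in> S")
        case True
        have "c = c' \<oplus>\<^bsub>free_mod R S\<^esub> c s \<odot>\<^bsub>free_mod R S\<^esub> free_gen R s"
          using c(1) by (auto simp: free_mod_simps c'_def free_gen_def free_mod_carrier_iff)
        then show ?thesis using add[OF c' P _ True, of "c s"] c(1) by (auto simp: free_mod_carrier_iff)
      next
        case False
        then have "c' = c" using c(1) by (auto simp: c'_def free_mod_carrier_iff)
        with P show ?thesis by simp
      qed
    qed
  qed
  then show ?thesis using assms(2) by (auto simp: free_mod_carrier_iff)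
qed

lemma linear_on_free_eq:
  assumes "ring R" "left_module R N" "linear_on R (free_mod R S) N f" "linear_on R (free_mod R S) N g"
    and "\<And>s. s \<in> S \<Longrightarrow> f (free_gen R s) = g (free_gen R s)"
    and "c \<in> carrier (free_mod R S)"
  shows "f c = g c"
proof -
  interpret F: left_module R "free_mod R S" by (rule free_mod_left_module) fact
  from assms(1,6) show ?thesis
  proof (induction c rule: free_mod_induct)
    case zero
    show ?case using linear_on_zero[OF F.left_module_axioms assms(2)] assms(3,4) by metis
  next
    case (add c r s)
    then show ?case
      using assms(3-5) free_gen_closed[OF assms(1) add(3)]
      by (simp add: linear_on_add linear_on_smult F.smult_closed)
  qed
qed

lemma free_ext_superset:
  assumes "left_module R M" and "c \<in> carrier (free_mod R S)" "g \<in> S \<rightarrow> carrier M" "finite T" "{s. c s \<noteq> \<zero>\<^bsub>R\<^esub>} \<subseteq> T" "T \<subseteq> S"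
  shows "free_ext R M g c = finsum M (\<lambda>s. c s \<odot>\<^bsub>M\<^esub> g s) T"
proof -
  interpret left_module R M by fact
  show ?thesis
  unfolding free_ext_def
proof (rule M.add.finprod_mono_neutral_cong_left)
  show "(\<lambda>s. c s \<odot>\<^bsub>M\<^esub> g s) \<in> T \<rightarrow> carrier M"
    using assms by (auto simp: free_mod_carrier_iff intro!: smult_closed)
qed (use assms smult_zero_left in auto)
qed

lemma free_ext_linear:
  assumes M: "left_module R M" and g: "g \<in> S \<rightarrow> carrier M"
  shows "linear_on R (free_mod R S) M (free_ext R M g)"
proof (rule linear_onI)
  interpret left_module R M by fact
  interpret F: left_module R "free_mod R S" by (rule free_mod_left_module[OF R.ring_axioms])
  have supp: "{s. c s \<noteq> \<zero>\<^bsub>R\<^esub>} \<subseteq> S" "finite {s. c s \<noteq> \<zero>\<^bsub>R\<^esub>}" if "c \<in> carrier (free_mod R S)" for c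
    using that by (auto simp: free_mod_carrier_iff)
  have cl: "(\<lambda>s. c s \<odot>\<^bsub>M\<^esub> g s) \<in> T \<rightarrow> carrier M" if "c \<in> carrier (free_mod R S)" "T \<subseteq> S" for c T
    using that g by (auto simp: free_mod_carrier_iff intro!: smult_closed)
  fix c assume c: "c \<in> carrier (free_mod R S)"
  show "free_ext R M g c \<in> carrier M"
    unfolding free_ext_def by (rule M.finsum_closed[OF cl[OF c supp(1)[OF c]]])
  { fix d assume d: "d \<in> carrier (free_mod R S)"
    let ?T = "{s. c s \<noteq> \<zero>\<^bsub>R\<^esub>} \<union> {s. d s \<noteq> \<zero>\<^bsub>R\<^esub>}"
    have T: "finite ?T" "?T \<subseteq> S" using supp c d by auto
    have cd: "c \<oplus>\<^bsub>free_mod R S\<^esub> d \<in> carrier (free_mod R S)" using c d by simp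
    have "free_ext R M g (c \<oplus>\<^bsub>free_mod R S\<^esub> d) = finsum M (\<lambda>s. (c \<oplus>\<^bsub>free_mod R S\<^esub> d) s \<odot>\<^bsub>M\<^esub> g s) ?T"
      by (rule free_ext_superset[OF left_module_axioms cd g T(1) _ T(2)]) (auto simp: free_mod_simps)
    also have "\<dots> = finsum M (\<lambda>s. c s \<odot>\<^bsub>M\<^esub> g s \<oplus>\<^bsub>M\<^esub> d s \<odot>\<^bsub>M\<^esub> g s) ?T"
    proof (rule M.finsum_cong')
      show "(\<lambda>s. c s \<odot>\<^bsub>M\<^esub> g s \<oplus>\<^bsub>M\<^esub> d s \<odot>\<^bsub>M\<^esub> g s) \<in> ?T \<rightarrow> carrier M"
        using cl[OF c T(2)] cl[OF d T(2)] by (auto simp: Pi_iff)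
      fix s assume "s \<in> ?T"
      then have "g s \<in> carrier M" using g T(2) by blast
      with c d show "(c \<oplus>\<^bsub>free_mod R S\<^esub> d) s \<odot>\<^bsub>M\<^esub> g s = c s \<odot>\<^bsub>M\<^esub> g s \<oplus>\<^bsub>M\<^esub> d s \<odot>\<^bsub>M\<^esub> g s"
        by (simp add: free_mod_simps free_mod_carrier_iff smult_l_distr)
    qed rule
    also have "\<dots> = finsum M (\<lambda>s. c s \<odot>\<^bsub>M\<^esub> g s) ?T \<oplus>\<^bsub>M\<^esub> finsum M (\<lambda>s. d s \<odot>\<^bsub>M\<^esub> g s) ?T"
      by (rule M.finsum_addf[OF cl[OF c T(2)] cl[OF d T(2)]])
    also have "\<dots> = free_ext R M g c \<oplus>\<^bsub>M\<^esub> free_ext R M g d"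
      by (simp only: free_ext_superset[OF left_module_axioms c g T(1) Un_upper1 T(2)]
          free_ext_superset[OF left_module_axioms d g T(1) Un_upper2 T(2)])
    finally show "free_ext R M g (c \<oplus>\<^bsub>free_mod R S\<^esub> d) = free_ext R M g c \<oplus>\<^bsub>M\<^esub> free_ext R M g d" . }
  { fix r assume r: "r \<in> carrier R"
    let ?T = "{s. c s \<noteq> \<zero>\<^bsub>R\<^esub>}"
    have T: "finite ?T" "?T \<subseteq> S" using supp c by auto
    have rc: "r \<odot>\<^bsub>free_mod R S\<^esub> c \<in> carrier (free_mod R S)" using c r by (rule F.smult_closed[rotated])
    have "free_ext R M g (r \<odot>\<^bsub>free_mod R S\<^esub> c) = finsum M (\<lambda>s. (r \<odot>\<^bsub>free_mod R S\<^esub> c) s \<odot>\<^bsub>M\<^esub> g s) ?T"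
      by (rule free_ext_superset[OF left_module_axioms rc g T(1) _ T(2)]) (use r in \<open>auto simp: free_mod_simps\<close>)
    also have "\<dots> = finsum M (\<lambda>s. r \<odot>\<^bsub>M\<^esub> (c s \<odot>\<^bsub>M\<^esub> g s)) ?T"
    proof (rule M.finsum_cong')
      show "(\<lambda>s. r \<odot>\<^bsub>M\<^esub> (c s \<odot>\<^bsub>M\<^esub> g s)) \<in> ?T \<rightarrow> carrier M"
        using cl[OF c T(2)] r by (auto simp: Pi_iff smult_closed)
      fix s assume "s \<in> ?T"
      then have "g s \<in> carrier M" using g T(2) by blast
      with c r show "(r \<odot>\<^bsub>free_mod R S\<^esub> c) s \<odot>\<^bsub>M\<^esub> g s = r \<odot>\<^bsub>M\<^esub> (c s \<odot>\<^bsub>M\<^esub> g s)"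
        by (simp add: free_mod_simps free_mod_carrier_iff smult_assoc1)
    qed rule
    also have "\<dots> = r \<odot>\<^bsub>M\<^esub> finsum M (\<lambda>s. c s \<odot>\<^bsub>M\<^esub> g s) ?T"
      by (rule smult_finsum[symmetric, OF r cl[OF c T(2)]])
    finally show "free_ext R M g (r \<odot>\<^bsub>free_mod R S\<^esub> c) = r \<odot>\<^bsub>M\<^esub> free_ext R M g c"
      by (simp add: free_ext_def) }
qed

lemma free_ext_gen:
  assumes M: "left_module R M" and "g \<in> S \<rightarrow> carrier M" "s \<in> S"
  shows "free_ext R M g (free_gen R s) = g s"
proof -
  interpret left_module R M by fact
  have "free_ext R M g (free_gen R s) = finsum M (\<lambda>t. free_gen R s t \<odot>\<^bsub>M\<^esub> g t) {s}"
    by (rule free_ext_superset[OF left_module_axioms free_gen_closed[OF R.ring_axioms assms(3)] assms(2)])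
      (use assms in \<open>auto simp: free_gen_def\<close>)
  also have "\<dots> = g s"
    using assms by (subst M.finsum_insert) (auto simp: free_gen_def smult_one Pi_iff)
  finally show ?thesis .
qed

lemma linear_on_eq_free_ext:
  assumes "left_module R M" "linear_on R (free_mod R S) M f" "c \<in> carrier (free_mod R S)"
  shows "f c = free_ext R M (\<lambda>s. f (free_gen R s)) c"
proof -
  interpret left_module R M by fact
  have *: "(\<lambda>s. f (free_gen R s)) \<in> S \<rightarrow> carrier M"
    using linear_on_closed[OF assms(2)] free_gen_closed[OF R.ring_axioms, where S=S] by (auto simp: Pi_iff)
  show ?thesis
    by (rule linear_on_free_eq[OF R.ring_axioms left_module_axioms assms(2) free_ext_linear[OF assms(1) *] _ assms(3)])
      (simp add: free_ext_gen[OF assms(1) *])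
qed

lemma free_mod_uminus:
  assumes "ring R" "c \<in> carrier (free_mod R S)"
  shows "(\<ominus>\<^bsub>free_mod R S\<^esub> c) s = \<ominus>\<^bsub>R\<^esub> c s"
proof -
  interpret R: ring R by fact
  interpret F: left_module R "free_mod R S" by (rule free_mod_left_module) fact
  have "(\<ominus>\<^bsub>free_mod R S\<^esub> c) s \<oplus>\<^bsub>R\<^esub> c s = (\<ominus>\<^bsub>free_mod R S\<^esub> c \<oplus>\<^bsub>free_mod R S\<^esub> c) s" by (simp add: free_mod_simps)
  also have "\<dots> = \<zero>\<^bsub>R\<^esub>" using assms(2) by (simp add: F.M.l_neg) (simp add: free_mod_simps)
  finally show ?thesis
    using R.minus_equality[of "(\<ominus>\<^bsub>free_mod R S\<^esub> c) s" "c s"] assms(2) F.M.a_inv_closed[OF assms(2)]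
    by (simp add: free_mod_carrier_iff)
qed

lemma free_mod_minus:
  assumes "ring R" "c \<in> carrier (free_mod R S)" "d \<in> carrier (free_mod R S)"
  shows "(c \<ominus>\<^bsub>free_mod R S\<^esub> d) s = c s \<ominus>\<^bsub>R\<^esub> d s"
  using free_mod_uminus[OF assms(1,3), of s] by (simp add: a_minus_def) (simp add: free_mod_simps)

lemma (in abelian_group) minus_eq_zero_iff:
  assumes "a \<in> carrier G" "b \<in> carrier G"
  shows "a \<ominus> b = \<zero> \<longleftrightarrow> a = b"
proof
  assume "a \<ominus> b = \<zero>"
  then have "(a \<ominus> b) \<oplus> b = b" using assms by simp
  then show "a = b" using assms by (simp add: a_minus_def a_assoc l_neg)
qed (use assms in \<open>simp add: a_minus_def r_neg\<close>)

lemma (in abelian_group) add_minus_minus: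
  assumes "a \<in> carrier G" "b \<in> carrier G"
  shows "a \<oplus> b \<ominus> a \<ominus> b = \<zero>"
  using assms a_comm[of a b] by (simp add: a_minus_def a_assoc r_neg)

section \<open>Functoriality of the standard resolutions\<close>

lemma prod_mod_simps:
  "carrier (prod_mod A B) = carrier A \<times> carrier B"
  "\<zero>\<^bsub>prod_mod A B\<^esub> = (\<zero>\<^bsub>A\<^esub>, \<zero>\<^bsub>B\<^esub>)"
  "(a, b) \<oplus>\<^bsub>prod_mod A B\<^esub> (a', b') = (a \<oplus>\<^bsub>A\<^esub> a', b \<oplus>\<^bsub>B\<^esub> b')"
  "r \<odot>\<^bsub>prod_mod A B\<^esub> (a, b) = (r \<odot>\<^bsub>A\<^esub> a, r \<odot>\<^bsub>B\<^esub> b)"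
  by (simp_all add: prod_mod_def)

lemma prod_mod_left_module:
  assumes "left_module R A" "left_module R B"
  shows "left_module R (prod_mod A B)"
proof -
  interpret A: left_module R A by fact
  interpret B: left_module R B by fact
  have "abelian_group (prod_mod A B)"
  proof (rule abelian_groupI)
    fix x assume "x \<in> carrier (prod_mod A B)"
    then obtain a b where x: "x = (a, b)" "a \<in> carrier A" "b \<in> carrier B" by (auto simp: prod_mod_simps)
    then have "(\<ominus>\<^bsub>A\<^esub> a, \<ominus>\<^bsub>B\<^esub> b) \<in> carrier (prod_mod A B)"
      "(\<ominus>\<^bsub>A\<^esub> a, \<ominus>\<^bsub>B\<^esub> b) \<oplus>\<^bsub>prod_mod A B\<^esub> x = \<zero>\<^bsub>prod_mod A B\<^esub>"
      by (simp_all add: prod_mod_simps A.M.l_neg B.M.l_neg)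
    then show "\<exists>y\<in>carrier (prod_mod A B). y \<oplus>\<^bsub>prod_mod A B\<^esub> x = \<zero>\<^bsub>prod_mod A B\<^esub>" by blast
  qed (auto simp: prod_mod_simps A.M.a_ac B.M.a_ac)
  then show ?thesis
    by (intro left_module.intro A.R.ring_axioms left_module_axioms.intro)
      (auto simp: prod_mod_simps A.smult_closed B.smult_closed A.smult_l_distr B.smult_l_distr
        A.smult_r_distr B.smult_r_distr A.smult_assoc1 B.smult_assoc1 A.smult_one B.smult_one)
qed

lemma linear_on_prod_sum:
  assumes "left_module R C" "linear_on R A C f" "linear_on R B C g"
  shows "linear_on R (prod_mod A B) C (\<lambda>(x, y). f x \<oplus>\<^bsub>C\<^esub> g y)"
proof -
  interpret C: left_module R C by fact
  show ?thesis
    using assms(2,3) by (auto simp: linear_on_def prod_mod_simps C.smult_r_distr C.M.a_ac)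
qed

lemma linear_on_prod_pair:
  assumes "linear_on R A C f" "linear_on R B D g"
  shows "linear_on R (prod_mod A B) (prod_mod C D) (\<lambda>(x, y). (f x, g y))"
  using assms by (auto simp: linear_on_def prod_mod_simps)

lemma self_bimod_simps:
  "carrier (self_bimod R) = carrier R" "\<zero>\<^bsub>self_bimod R\<^esub> = \<zero>\<^bsub>R\<^esub>"
  "x \<oplus>\<^bsub>self_bimod R\<^esub> y = x \<oplus>\<^bsub>R\<^esub> y" "x \<odot>\<^bsub>self_bimod R\<^esub> y = x \<otimes>\<^bsub>R\<^esub> y"
  "ract (self_bimod R) x y = x \<otimes>\<^bsub>R\<^esub> y"
  by (simp_all add: self_bimod_def)

lemma self_bimod_left_module:
  assumes "ring R"
  shows "left_module R (self_bimod R)"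
proof -
  interpret R: ring R by fact
  have "abelian_group (self_bimod R)"
    by (rule abelian_groupI)
      (auto simp: self_bimod_simps R.a_ac intro!: bexI[of _ "\<ominus>\<^bsub>R\<^esub> _"] R.l_neg)
  then show ?thesis
    by (intro left_module.intro R.ring_axioms left_module_axioms.intro)
      (auto simp: self_bimod_simps R.l_distr R.r_distr R.m_assoc)
qed

lemma self_bimod_minus:
  assumes "ring R" "y \<in> carrier R"
  shows "x \<ominus>\<^bsub>self_bimod R\<^esub> y = x \<ominus>\<^bsub>R\<^esub> y"
proof -
  interpret R: ring R by fact
  interpret B: left_module R "self_bimod R" by (rule self_bimod_left_module[OF assms(1)])
  have "\<ominus>\<^bsub>self_bimod R\<^esub> y = \<ominus>\<^bsub>R\<^esub> y"
    using B.M.minus_equality[of "\<ominus>\<^bsub>R\<^esub> y" y] assms(2) by (simp add: self_bimod_simps R.l_neg)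
  then show ?thesis by (simp add: a_minus_def self_bimod_simps)
qed

lemma F0_left_module: "ring R \<Longrightarrow> left_module R (F0 R E)"
  and F1_left_module: "ring R \<Longrightarrow> left_module R (F1 R E)"
  and F2_left_module: "ring R \<Longrightarrow> left_module R (F2 R E)"
  by (simp_all add: F0_def F1_def F2_def free_mod_left_module)

lemma left_module_ring: "left_module R E \<Longrightarrow> ring R"
  by (rule left_module.axioms(1))

lemma aug_linear: "left_module R E \<Longrightarrow> linear_on R (F0 R E) E (aug R E)"
  unfolding aug_def F0_def by (rule free_ext_linear) auto

lemma aug_gen: "\<lbrakk>left_module R E; x \<in> carrier E\<rbrakk> \<Longrightarrow> aug R E (free_gen R x) = x"
  unfolding aug_def by (rule free_ext_gen) auto

lemma F0_gen_closed: "\<lbrakk>ring R; x \<in> carrier E\<rbrakk> \<Longrightarrow> free_gen R x \<in> carrier (F0 R E)"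
  by (simp add: F0_def free_gen_closed)

lemma F1_gen_closed:
  "\<lbrakk>ring R; c \<in> carrier (F0 R E); aug R E c = \<zero>\<^bsub>E\<^esub>\<rbrakk> \<Longrightarrow> free_gen R c \<in> carrier (F1 R E)"
  by (simp add: F1_def free_gen_closed)

lemma d1_linear:
  assumes "ring R"
  shows "linear_on R (F1 R E) (F0 R E) (d1 R E)"
  unfolding d1_def F1_def by (rule free_ext_linear[OF F0_left_module[OF assms]]) auto

lemma d1_gen:
  assumes "ring R" "c \<in> carrier (F0 R E)" "aug R E c = \<zero>\<^bsub>E\<^esub>"
  shows "d1 R E (free_gen R c) = c"
  unfolding d1_def
  by (rule free_ext_gen[OF F0_left_module[OF assms(1)], where S = "{c \<in> carrier (F0 R E). aug R E c = \<zero>\<^bsub>E\<^esub>}"])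
    (use assms in auto)

lemma aug_d1:
  assumes "left_module R E" "x \<in> carrier (F1 R E)"
  shows "aug R E (d1 R E x) = \<zero>\<^bsub>E\<^esub>"
proof -
  note R = left_module_ring[OF assms(1)]
  show ?thesis
    by (rule linear_on_free_eq[OF R assms(1) linear_on_comp[OF d1_linear[OF R, unfolded F1_def] aug_linear[OF assms(1)]]
          linear_on_const_zero[OF assms(1)] _ assms(2)[unfolded F1_def]])
      (simp add: d1_gen[OF R])
qed

lemma d2_linear:
  assumes "ring R"
  shows "linear_on R (F2 R E) (F1 R E) (d2 R E)"
  unfolding d2_def F2_def by (rule free_ext_linear[OF F1_left_module[OF assms]]) auto

lemma d2_gen:
  assumes "ring R" "c \<in> carrier (F1 R E)" "d1 R E c = \<zero>\<^bsub>F0 R E\<^esub>"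
  shows "d2 R E (free_gen R c) = c"
  unfolding d2_def
  by (rule free_ext_gen[OF F1_left_module[OF assms(1)], where S = "{c \<in> carrier (F1 R E). d1 R E c = \<zero>\<^bsub>F0 R E\<^esub>}"])
    (use assms in auto)

lemma d1_d2:
  assumes R: "ring R" and "x \<in> carrier (F2 R E)"
  shows "d1 R E (d2 R E x) = \<zero>\<^bsub>F0 R E\<^esub>"
  by (rule linear_on_free_eq[OF R F0_left_module[OF R]
        linear_on_comp[OF d2_linear[OF R, unfolded F2_def] d1_linear[OF R]]
        linear_on_const_zero[OF F0_left_module[OF R]] _ assms(2)[unfolded F2_def]])
    (simp add: d2_gen[OF R])

lemma linear_on_Pi: "linear_on R A B f \<Longrightarrow> f \<in> carrier A \<rightarrow> carrier B"
  by (simp add: linear_on_def)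

lemma F0_map_linear:
  assumes "ring R" "f \<in> carrier A \<rightarrow> carrier B"
  shows "linear_on R (F0 R A) (F0 R B) (F0_map R B f)"
  unfolding F0_map_def F0_def[of R A]
  by (rule free_ext_linear[OF F0_left_module[OF assms(1)]]) (use assms in \<open>auto intro!: F0_gen_closed\<close>)

lemma F0_map_gen:
  assumes "ring R" "f \<in> carrier A \<rightarrow> carrier B" "x \<in> carrier A"
  shows "F0_map R B f (free_gen R x) = free_gen R (f x)"
  unfolding F0_map_def
  by (rule free_ext_gen[OF F0_left_module[OF assms(1)] _ assms(3)]) (use assms in \<open>auto intro!: F0_gen_closed\<close>)

lemma aug_F0_map:
  assumes "left_module R A" "left_module R B" "linear_on R A B f" "c \<in> carrier (F0 R A)"
  shows "aug R B (F0_map R B f c) = f (aug R A c)"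
proof -
  note R = left_module_ring[OF assms(1)]
  note f = linear_on_Pi[OF assms(3)]
  show ?thesis
    by (rule linear_on_free_eq[OF R assms(2) linear_on_comp[OF F0_map_linear[OF R f, unfolded F0_def[of R A]] aug_linear[OF assms(2)]]
          linear_on_comp[OF aug_linear[OF assms(1), unfolded F0_def] assms(3)] _ assms(4)[unfolded F0_def]])
      (simp_all add: F0_map_gen[OF R f] aug_gen assms(1,2) linear_on_closed[OF assms(3)])
qed

lemma F1_map_linear:
  assumes "left_module R A" "left_module R B" "linear_on R A B f"
  shows "linear_on R (F1 R A) (F1 R B) (F1_map R B f)"
proof -
  note R = left_module_ring[OF assms(1)]
  note f = linear_on_Pi[OF assms(3)]
  show ?thesis
    unfolding F1_map_def F1_def[of R A]
    by (rule free_ext_linear[OF F1_left_module[OF R]])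
      (auto intro!: F1_gen_closed R simp: aug_F0_map[OF assms] linear_on_zero[OF assms]
        linear_on_closed[OF F0_map_linear[OF R f]])
qed

lemma F1_map_gen:
  assumes "left_module R A" "left_module R B" "linear_on R A B f" "c \<in> carrier (F0 R A)" "aug R A c = \<zero>\<^bsub>A\<^esub>"
  shows "F1_map R B f (free_gen R c) = free_gen R (F0_map R B f c)"
proof -
  note R = left_module_ring[OF assms(1)]
  note f = linear_on_Pi[OF assms(3)]
  show ?thesis
    unfolding F1_map_def
    by (rule free_ext_gen[OF F1_left_module[OF R], where S = "{c \<in> carrier (F0 R A). aug R A c = \<zero>\<^bsub>A\<^esub>}"])
      (use assms(4,5) in \<open>auto intro!: F1_gen_closed R simp: aug_F0_map[OF assms(1-3)] linear_on_zero[OF assms(1-3)]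
        linear_on_closed[OF F0_map_linear[OF R f]]\<close>)
qed

lemma d1_F1_map:
  assumes "left_module R A" "left_module R B" "linear_on R A B f" "x \<in> carrier (F1 R A)"
  shows "d1 R B (F1_map R B f x) = F0_map R B f (d1 R A x)"
proof -
  note R = left_module_ring[OF assms(1)]
  note f = linear_on_Pi[OF assms(3)]
  note F0f = F0_map_linear[OF R f]
  show ?thesis
    by (rule linear_on_free_eq[OF R F0_left_module[OF R]
          linear_on_comp[OF F1_map_linear[OF assms(1-3), unfolded F1_def[of R A]] d1_linear[OF R]]
          linear_on_comp[OF d1_linear[OF R, unfolded F1_def] F0f] _ assms(4)[unfolded F1_def]])
      (auto simp: F1_map_gen[OF assms(1-3)] d1_gen[OF R] aug_F0_map[OF assms(1-3)] linear_on_zero[OF assms(1-3)]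
        linear_on_closed[OF F0f])
qed

lemma F0_map_comp:
  assumes "ring R" "f \<in> carrier A \<rightarrow> carrier B" "g \<in> carrier B \<rightarrow> carrier C"
    "c \<in> carrier (F0 R A)"
  shows "F0_map R C g (F0_map R B f c) = F0_map R C (\<lambda>x. g (f x)) c"
proof -
  note 1 = F0_map_linear[OF assms(1,2)]
  note 2 = F0_map_linear[OF assms(1,3)]
  have 4: "(\<lambda>x. g (f x)) \<in> carrier A \<rightarrow> carrier C" using assms(2,3) by auto
  note 3 = F0_map_linear[OF assms(1) 4]
  show ?thesis
    by (rule linear_on_free_eq[OF assms(1) F0_left_module[OF assms(1)] linear_on_comp[OF 1 2, unfolded F0_def[of R A]]
        3[unfolded F0_def[of R A]] _ assms(4)[unfolded F0_def]])
      (use assms(2,3) in \<open>auto simp: F0_map_gen[OF assms(1,2)] F0_map_gen[OF assms(1,3)] F0_map_gen[OF assms(1) 4] Pi_iff\<close>)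
qed

lemma F0_map_cong:
  assumes "ring R" "f \<in> carrier A \<rightarrow> carrier B" "\<And>x. x \<in> carrier A \<Longrightarrow> g x = f x"
    "c \<in> carrier (F0 R A)"
  shows "F0_map R B f c = F0_map R B g c"
proof -
  note 1 = F0_map_linear[OF assms(1,2)]
  have 3: "g \<in> carrier A \<rightarrow> carrier B" using assms(2,3) by auto
  note 2 = F0_map_linear[OF assms(1) 3]
  show ?thesis
    by (rule linear_on_free_eq[OF assms(1) F0_left_module[OF assms(1)] 1[unfolded F0_def[of R A]]
        2[unfolded F0_def[of R A]] _ assms(4)[unfolded F0_def]])
      (use assms(2,3) in \<open>auto simp: F0_map_gen[OF assms(1,2)] F0_map_gen[OF assms(1) 3]\<close>)
qed

definition linear_complex :: "'r ring \<Rightarrow> ('r, 'a, 'b) twoterm \<Rightarrow> bool" where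
  "linear_complex R K \<longleftrightarrow> left_module R (lterm K) \<and> left_module R (rterm K) \<and>
     linear_on R (lterm K) (rterm K) (tdiff K)"

lemma linear_complexD:
  assumes "linear_complex R K"
  shows "ring R" "left_module R (lterm K)" "left_module R (rterm K)" "linear_on R (lterm K) (rterm K) (tdiff K)"
  using assms left_module_ring by (auto simp: linear_complex_def)

lemma P0_left_module: "ring R \<Longrightarrow> left_module R (P0 R K)"
  by (simp add: P0_def F0_left_module)

lemma P1_left_module: "ring R \<Longrightarrow> left_module R (P1 R K)"
  by (simp add: P1_def F0_left_module F1_left_module prod_mod_left_module)

lemma bd1_linear:
  assumes "linear_complex R K"
  shows "linear_on R (P1 R K) (P0 R K) (bd1 R K)"
  unfolding bd1_def P1_def P0_def
  by (intro linear_on_prod_sum F0_left_module F0_map_linear d1_linear linear_complexD[OF assms]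
      linear_on_Pi[OF linear_complexD(4)[OF assms]])

lemma bd2_closed:
  assumes "linear_complex R K" "z \<in> carrier (P2 R K)"
  shows "bd2 R K z \<in> carrier (P1 R K)"
proof -
  note K = linear_complexD[OF assms(1)]
  interpret A: left_module R "F0 R (lterm K)" by (rule F0_left_module[OF K(1)])
  interpret B: left_module R "F1 R (rterm K)" by (rule F1_left_module[OF K(1)])
  show ?thesis
    using assms(2)
    by (auto simp: bd2_def P1_def P2_def prod_mod_simps linear_on_closed[OF d1_linear[OF K(1)]]
        linear_on_closed[OF d2_linear[OF K(1)]] linear_on_closed[OF F1_map_linear[OF K(2-4)]])
qed

lemma bd1_bd2:
  assumes "linear_complex R K" "z \<in> carrier (P2 R K)"
  shows "bd1 R K (bd2 R K z) = \<zero>\<^bsub>P0 R K\<^esub>"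
proof -
  note K = linear_complexD[OF assms(1)]
  interpret A: left_module R "F0 R (lterm K)" by (rule F0_left_module[OF K(1)])
  interpret A1: left_module R "F1 R (rterm K)" by (rule F1_left_module[OF K(1)])
  interpret B: left_module R "F0 R (rterm K)" by (rule F0_left_module[OF K(1)])
  obtain x y where z: "z = (x, y)" "x \<in> carrier (F1 R (lterm K))" "y \<in> carrier (F2 R (rterm K))"
    using assms(2) by (auto simp: P2_def prod_mod_simps)
  note F0t = F0_map_linear[OF K(1) linear_on_Pi[OF K(4)]]
  have x: "d1 R (lterm K) x \<in> carrier (F0 R (lterm K))"
    "F1_map R (rterm K) (tdiff K) x \<in> carrier (F1 R (rterm K))"
    "d2 R (rterm K) y \<in> carrier (F1 R (rterm K))"
    using z by (simp_all add: linear_on_closed[OF d1_linear[OF K(1)]] linear_on_closed[OF d2_linear[OF K(1)]]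
        linear_on_closed[OF F1_map_linear[OF K(2-4)]])
  show ?thesis
    using x z(2,3) linear_on_closed[OF F0t x(1)]
    by (simp add: z(1) bd1_def bd2_def P0_def linear_on_add[OF d1_linear[OF K(1)]] d1_F1_map[OF K(2-4)] d1_d2[OF K(1)]
        linear_on_minus[OF A.left_module_axioms B.left_module_axioms F0t] B.M.l_neg)
qed

lemma P1_map_linear:
  assumes "linear_complex R K" "linear_complex R L"
    "linear_on R (lterm K) (lterm L) f" "linear_on R (rterm K) (rterm L) g"
  shows "linear_on R (P1 R K) (P1 R L) (P1_map R L f g)"
  unfolding P1_map_def P1_def
  by (intro linear_on_prod_pair F0_map_linear F1_map_linear linear_complexD[OF assms(1)] linear_complexD[OF assms(2)]
      linear_on_Pi[OF assms(3)] assms(4))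

lemma bd1_P1_map:
  assumes K: "linear_complex R K" and L: "linear_complex R L"
    and f: "linear_on R (lterm K) (lterm L) f" and g: "linear_on R (rterm K) (rterm L) g"
    and comm: "\<And>x. x \<in> carrier (lterm K) \<Longrightarrow> g (tdiff K x) = tdiff L (f x)"
    and z: "z \<in> carrier (P1 R K)"
  shows "bd1 R L (P1_map R L f g z) = F0_map R (rterm L) g (bd1 R K z)"
proof -
  note Kd = linear_complexD[OF K] and Ld = linear_complexD[OF L]
  obtain x y where xy: "z = (x, y)" "x \<in> carrier (F0 R (lterm K))" "y \<in> carrier (F1 R (rterm K))"
    using z by (auto simp: P1_def prod_mod_simps)
  note tK = F0_map_linear[OF Kd(1) linear_on_Pi[OF Kd(4)]]
  note F0g = F0_map_linear[OF Kd(1) linear_on_Pi[OF g]]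
  have "F0_map R (rterm L) (tdiff L) (F0_map R (lterm L) f x) = F0_map R (rterm L) (\<lambda>x. tdiff L (f x)) x"
    by (rule F0_map_comp[OF Kd(1) linear_on_Pi[OF f] linear_on_Pi[OF Ld(4)] xy(2)])
  also have "\<dots> = F0_map R (rterm L) (\<lambda>x. g (tdiff K x)) x"
    by (rule F0_map_cong[OF Kd(1) _ comm xy(2)]) (simp_all add: Pi_iff linear_on_closed[OF f] linear_on_closed[OF Ld(4)])
  also have "\<dots> = F0_map R (rterm L) g (F0_map R (rterm K) (tdiff K) x)"
    by (rule F0_map_comp[symmetric, OF Kd(1) linear_on_Pi[OF Kd(4)] linear_on_Pi[OF g] xy(2)])
  finally show ?thesis
    using xy linear_on_closed[OF tK xy(2)] linear_on_closed[OF d1_linear[OF Kd(1)] xy(3)]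
    by (simp add: bd1_def P1_map_def d1_F1_map[OF Kd(3) Ld(3) g] linear_on_add[OF F0g])
qed

section \<open>Cosets and extension classes\<close>

lemma coset_eq_iff:
  assumes "abelian_group G" "additive_subgroup N G" "x \<in> carrier G" "y \<in> carrier G"
  shows "N +>\<^bsub>G\<^esub> x = N +>\<^bsub>G\<^esub> y \<longleftrightarrow> x \<ominus>\<^bsub>G\<^esub> y \<in> N"
proof -
  interpret abelian_subgroup N G using assms(1,2) by (rule abelian_subgroupI3[rotated])
  show ?thesis
    using assms(3,4) a_rcos_module[of y x] a_repr_independence[of x N y] a_rcos_self[of x] 
    by (metis a_minus_def a_subgroup)
qed

lemma mem_coset_iff:
  assumes "abelian_group G" "additive_subgroup N G" "x \<in> carrier G"
  shows "y \<in> N +>\<^bsub>G\<^esub> x \<longleftrightarrow> y \<in> carrier G \<and> y \<ominus>\<^bsub>G\<^esub> x \<in> N"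
proof -
  interpret abelian_subgroup N G using assms(1,2) by (rule abelian_subgroupI3[rotated])
  show ?thesis
    using assms(3) a_rcos_module[of x y] a_elemrcos_carrier[of x y] by (auto simp: a_minus_def)
qed

lemma coset_self:
  assumes "abelian_group G" "additive_subgroup N G" "x \<in> carrier G"
  shows "x \<in> N +>\<^bsub>G\<^esub> x"
proof -
  interpret abelian_subgroup N G using assms(1,2) by (rule abelian_subgroupI3[rotated])
  show ?thesis using assms(3) by (rule a_rcos_self)
qed

lemma coset_add:
  assumes "abelian_group G" "additive_subgroup N G" "x \<in> carrier G" "y \<in> carrier G"
  shows "(N +>\<^bsub>G\<^esub> x) <+>\<^bsub>G\<^esub> (N +>\<^bsub>G\<^esub> y) = N +>\<^bsub>G\<^esub> (x \<oplus>\<^bsub>G\<^esub> y)"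
proof -
  interpret abelian_subgroup N G using assms(1,2) by (rule abelian_subgroupI3[rotated])
  show ?thesis using assms(3,4) by (rule a_rcos_sum)
qed

lemma coset_zero:
  assumes "abelian_group G" "additive_subgroup N G"
  shows "N +>\<^bsub>G\<^esub> \<zero>\<^bsub>G\<^esub> = N"
proof -
  interpret abelian_subgroup N G using assms(1,2) by (rule abelian_subgroupI3[rotated])
  show ?thesis using a_subset by simp
qed

lemma rcosets_iff: "C \<in> a_rcosets\<^bsub>G\<^esub> N \<longleftrightarrow> (\<exists>x\<in>carrier G. C = N +>\<^bsub>G\<^esub> x)"
  by (auto simp: A_RCOSETS_def')

lemma coset_map_eq: "\<lbrakk>C \<noteq> {}; \<And>x. x \<in> C \<Longrightarrow> N +>\<^bsub>B\<^esub> f x = D\<rbrakk> \<Longrightarrow> coset_map B N f C = D"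
  by (auto simp: coset_map_def)

lemma coset_map_coset:
  assumes A: "abelian_group A" "additive_subgroup K A" and B: "abelian_group B" "additive_subgroup N B"
    and f: "f \<in> carrier A \<rightarrow> carrier B"
      "\<And>x y. \<lbrakk>x \<in> carrier A; y \<in> carrier A\<rbrakk> \<Longrightarrow> f (x \<oplus>\<^bsub>A\<^esub> y) = f x \<oplus>\<^bsub>B\<^esub> f y"
      "\<And>x. x \<in> K \<Longrightarrow> f x \<in> N"
    and x: "x \<in> carrier A"
  shows "coset_map B N f (K +>\<^bsub>A\<^esub> x) = N +>\<^bsub>B\<^esub> f x"
proof (rule coset_map_eq)
  interpret A: abelian_group A by fact
  interpret B: abelian_group B by fact
  interpret K: additive_subgroup K A by fact
  show "K +>\<^bsub>A\<^esub> x \<noteq> {}" using coset_self[OF A x] by blast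
  fix y assume "y \<in> K +>\<^bsub>A\<^esub> x"
  then have y: "y \<in> carrier A" "y \<ominus>\<^bsub>A\<^esub> x \<in> K" using mem_coset_iff[OF A x] by auto
  have "f y = f ((y \<ominus>\<^bsub>A\<^esub> x) \<oplus>\<^bsub>A\<^esub> x)"
    using x y by (simp add: a_minus_def A.a_assoc A.l_neg)
  also have "\<dots> = f (y \<ominus>\<^bsub>A\<^esub> x) \<oplus>\<^bsub>B\<^esub> f x" using x y by (simp add: f)
  finally have "f y \<ominus>\<^bsub>B\<^esub> f x = f (y \<ominus>\<^bsub>A\<^esub> x)"
    using x y funcset_mem[OF f(1) y(1)] funcset_mem[OF f(1) x] funcset_mem[OF f(1), of "y \<ominus>\<^bsub>A\<^esub> x"] by (simp add: a_minus_def[of B] B.a_assoc B.r_neg)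
  then show "N +>\<^bsub>B\<^esub> f y = N +>\<^bsub>B\<^esub> f x"
    using coset_eq_iff[OF B funcset_mem[OF f(1) y(1)] funcset_mem[OF f(1) x]] f(3)[OF y(2)] by simp
qed

lemma ext1_cocycles_iff:
  "\<phi> \<in> carrier (ext1_cocycles R K M) \<longleftrightarrow> linear_on R (P1 R K) M \<phi> \<and> \<phi> \<in> extensional (carrier (P1 R K)) \<and>
     (\<forall>z\<in>carrier (P2 R K). \<phi> (bd2 R K z) = \<zero>\<^bsub>M\<^esub>)"
  by (auto simp: ext1_cocycles_def mod_hom_iff)

lemma ext1_cocycles_simps:
  "\<zero>\<^bsub>ext1_cocycles R K M\<^esub> = (\<lambda>z\<in>carrier (P1 R K). \<zero>\<^bsub>M\<^esub>)"
  "\<phi> \<oplus>\<^bsub>ext1_cocycles R K M\<^esub> \<psi> = (\<lambda>z\<in>carrier (P1 R K). \<phi> z \<oplus>\<^bsub>M\<^esub> \<psi> z)"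
  by (simp_all add: ext1_cocycles_def)

lemma ext1_cocycles_restrict:
  assumes "linear_complex R K" "linear_on R (P1 R K) M \<phi>" "\<And>z. z \<in> carrier (P2 R K) \<Longrightarrow> \<phi> (bd2 R K z) = \<zero>\<^bsub>M\<^esub>"
  shows "(\<lambda>z\<in>carrier (P1 R K). \<phi> z) \<in> carrier (ext1_cocycles R K M)"
  using linear_on_restrict[OF P1_left_module[OF linear_complexD(1)[OF assms(1)]] assms(2)] bd2_closed[OF assms(1)] assms(3)
  by (auto simp: ext1_cocycles_iff mod_hom_iff)

lemma ext1_cocycles_group:
  assumes K: "linear_complex R K" and M: "left_module R M"
  shows "abelian_group (ext1_cocycles R K M)"
proof (rule abelian_groupI)
  interpret M: left_module R M by fact
  interpret P1: left_module R "P1 R K" by (rule P1_left_module[OF linear_complexD(1)[OF K]])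
  note cl = bd2_closed[OF K]
  show "\<zero>\<^bsub>ext1_cocycles R K M\<^esub> \<in> carrier (ext1_cocycles R K M)"
    unfolding ext1_cocycles_simps by (rule ext1_cocycles_restrict[OF K]) (simp_all add: linear_on_const_zero[OF M])
  fix \<phi> assume \<phi>: "\<phi> \<in> carrier (ext1_cocycles R K M)"
  then have \<phi>': "linear_on R (P1 R K) M \<phi>" "\<And>z. z \<in> carrier (P2 R K) \<Longrightarrow> \<phi> (bd2 R K z) = \<zero>\<^bsub>M\<^esub>"
    "\<phi> \<in> extensional (carrier (P1 R K))"
    by (auto simp: ext1_cocycles_iff)
  show "\<zero>\<^bsub>ext1_cocycles R K M\<^esub> \<oplus>\<^bsub>ext1_cocycles R K M\<^esub> \<phi> = \<phi>"
    using \<phi>' by (auto simp: ext1_cocycles_simps fun_eq_iff extensional_def linear_on_closed)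
  show "\<exists>\<psi>\<in>carrier (ext1_cocycles R K M). \<psi> \<oplus>\<^bsub>ext1_cocycles R K M\<^esub> \<phi> = \<zero>\<^bsub>ext1_cocycles R K M\<^esub>"
  proof
    show "(\<lambda>z\<in>carrier (P1 R K). \<ominus>\<^bsub>M\<^esub> \<phi> z) \<in> carrier (ext1_cocycles R K M)"
      by (rule ext1_cocycles_restrict[OF K linear_on_uminus[OF M \<phi>'(1)]]) (simp add: \<phi>'(2))
    show "(\<lambda>z\<in>carrier (P1 R K). \<ominus>\<^bsub>M\<^esub> \<phi> z) \<oplus>\<^bsub>ext1_cocycles R K M\<^esub> \<phi> = \<zero>\<^bsub>ext1_cocycles R K M\<^esub>"
      by (auto simp: ext1_cocycles_simps fun_eq_iff M.M.l_neg linear_on_closed[OF \<phi>'(1)])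
  qed
  fix \<psi> assume \<psi>: "\<psi> \<in> carrier (ext1_cocycles R K M)"
  then have \<psi>': "linear_on R (P1 R K) M \<psi>" "\<And>z. z \<in> carrier (P2 R K) \<Longrightarrow> \<psi> (bd2 R K z) = \<zero>\<^bsub>M\<^esub>"
    by (auto simp: ext1_cocycles_iff)
  show "\<phi> \<oplus>\<^bsub>ext1_cocycles R K M\<^esub> \<psi> \<in> carrier (ext1_cocycles R K M)"
    unfolding ext1_cocycles_simps
    by (rule ext1_cocycles_restrict[OF K linear_on_sum[OF M \<phi>'(1) \<psi>'(1)]]) (simp add: \<phi>'(2) \<psi>'(2))
  show "\<phi> \<oplus>\<^bsub>ext1_cocycles R K M\<^esub> \<psi> = \<psi> \<oplus>\<^bsub>ext1_cocycles R K M\<^esub> \<phi>"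
    by (auto simp: ext1_cocycles_simps fun_eq_iff M.M.a_comm linear_on_closed[OF \<phi>'(1)] linear_on_closed[OF \<psi>'(1)])
  fix \<chi> assume "\<chi> \<in> carrier (ext1_cocycles R K M)"
  then have \<chi>': "linear_on R (P1 R K) M \<chi>" by (auto simp: ext1_cocycles_iff)
  show "\<phi> \<oplus>\<^bsub>ext1_cocycles R K M\<^esub> \<psi> \<oplus>\<^bsub>ext1_cocycles R K M\<^esub> \<chi> = \<phi> \<oplus>\<^bsub>ext1_cocycles R K M\<^esub> (\<psi> \<oplus>\<^bsub>ext1_cocycles R K M\<^esub> \<chi>)"
    by (auto simp: ext1_cocycles_simps fun_eq_iff M.M.a_assoc linear_on_closed[OF \<phi>'(1)] linear_on_closed[OF \<psi>'(1)]
        linear_on_closed[OF \<chi>'])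
qed

lemma ext1_coboundaryI:
  assumes "linear_complex R K" "linear_on R (P0 R K) M c"
  shows "(\<lambda>z\<in>carrier (P1 R K). c (bd1 R K z)) \<in> ext1_coboundaries R K M"
proof -
  have "(\<lambda>z\<in>carrier (P1 R K). c (bd1 R K z)) = (\<lambda>z\<in>carrier (P1 R K). (\<lambda>z\<in>carrier (P0 R K). c z) (bd1 R K z))"
    by (auto simp: fun_eq_iff linear_on_closed[OF bd1_linear[OF assms(1)]])
  then show ?thesis
    unfolding ext1_coboundaries_def
    by (rule image_eqI[OF _ linear_on_restrict[OF P0_left_module[OF linear_complexD(1)[OF assms(1)]] assms(2)]])
qed

lemma ext1_coboundaryE:
  assumes "\<phi> \<in> ext1_coboundaries R K M"
  obtains c where "linear_on R (P0 R K) M c" "\<phi> = (\<lambda>z\<in>carrier (P1 R K). c (bd1 R K z))"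
  using assms by (auto simp: ext1_coboundaries_def mod_hom_iff)

lemma ext1_coboundaries_cocycles:
  assumes K: "linear_complex R K" and M: "left_module R M"
  shows "ext1_coboundaries R K M \<subseteq> carrier (ext1_cocycles R K M)"
proof
  fix \<phi> assume "\<phi> \<in> ext1_coboundaries R K M"
  then obtain c where c: "linear_on R (P0 R K) M c" "\<phi> = (\<lambda>z\<in>carrier (P1 R K). c (bd1 R K z))"
    by (rule ext1_coboundaryE)
  show "\<phi> \<in> carrier (ext1_cocycles R K M)"
    unfolding c(2)
    by (rule ext1_cocycles_restrict[OF K linear_on_comp[OF bd1_linear[OF K] c(1)]])
      (simp add: bd1_bd2[OF K] linear_on_zero[OF P0_left_module[OF linear_complexD(1)[OF K]] M c(1)])
qed

lemma ext1_coboundaries_subgroup: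
  assumes K: "linear_complex R K" and M: "left_module R M"
  shows "additive_subgroup (ext1_coboundaries R K M) (ext1_cocycles R K M)"
proof (rule additive_subgroupI)
  interpret M: left_module R M by fact
  interpret Z: abelian_group "ext1_cocycles R K M" by (rule ext1_cocycles_group[OF assms])
  show "subgroup (ext1_coboundaries R K M) (add_monoid (ext1_cocycles R K M))"
  proof (rule Z.add.subgroupI)
    show "ext1_coboundaries R K M \<subseteq> carrier (ext1_cocycles R K M)" by (rule ext1_coboundaries_cocycles[OF assms])
    show "ext1_coboundaries R K M \<noteq> {}" using ext1_coboundaryI[OF K linear_on_const_zero[OF M]] by blast
    fix \<phi> assume \<phi>: "\<phi> \<in> ext1_coboundaries R K M"
    then obtain c where c: "linear_on R (P0 R K) M c" "\<phi> = (\<lambda>z\<in>carrier (P1 R K). c (bd1 R K z))"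
      by (rule ext1_coboundaryE)
    let ?n = "\<lambda>z\<in>carrier (P1 R K). \<ominus>\<^bsub>M\<^esub> c (bd1 R K z)"
    have n: "?n \<in> ext1_coboundaries R K M" by (rule ext1_coboundaryI[OF K linear_on_uminus[OF M c(1)]])
    have "\<ominus>\<^bsub>ext1_cocycles R K M\<^esub> \<phi> = ?n"
    proof (rule Z.minus_equality)
      show "?n \<oplus>\<^bsub>ext1_cocycles R K M\<^esub> \<phi> = \<zero>\<^bsub>ext1_cocycles R K M\<^esub>"
        by (auto simp: ext1_cocycles_simps fun_eq_iff c(2) M.M.l_neg linear_on_closed[OF c(1)]
            linear_on_closed[OF bd1_linear[OF K]])
    qed (use \<phi> n ext1_coboundaries_cocycles[OF assms] in auto)
    with n show "\<ominus>\<^bsub>ext1_cocycles R K M\<^esub> \<phi> \<in> ext1_coboundaries R K M" by simp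
    fix \<psi> assume "\<psi> \<in> ext1_coboundaries R K M"
    then obtain d where d: "linear_on R (P0 R K) M d" "\<psi> = (\<lambda>z\<in>carrier (P1 R K). d (bd1 R K z))"
      by (rule ext1_coboundaryE)
    have "\<phi> \<oplus>\<^bsub>ext1_cocycles R K M\<^esub> \<psi> = (\<lambda>z\<in>carrier (P1 R K). c (bd1 R K z) \<oplus>\<^bsub>M\<^esub> d (bd1 R K z))"
      by (auto simp: ext1_cocycles_simps c(2) d(2))
    also have "\<dots> \<in> ext1_coboundaries R K M" by (rule ext1_coboundaryI[OF K linear_on_sum[OF M c(1) d(1)]])
    finally show "\<phi> \<oplus>\<^bsub>ext1_cocycles R K M\<^esub> \<psi> \<in> ext1_coboundaries R K M" .
  qed
qed

lemma ext1_class_eqI: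
  assumes K: "linear_complex R K" and M: "left_module R M"
    and "\<phi> \<in> carrier (ext1_cocycles R K M)" "\<psi> \<in> carrier (ext1_cocycles R K M)" "linear_on R (P0 R K) M c"
    and eq: "\<And>z. z \<in> carrier (P1 R K) \<Longrightarrow> \<phi> z = c (bd1 R K z) \<oplus>\<^bsub>M\<^esub> \<psi> z"
  shows "ext1_coboundaries R K M +>\<^bsub>ext1_cocycles R K M\<^esub> \<phi> = ext1_coboundaries R K M +>\<^bsub>ext1_cocycles R K M\<^esub> \<psi>"
proof -
  interpret Z: abelian_group "ext1_cocycles R K M" by (rule ext1_cocycles_group[OF K M])
  let ?c = "\<lambda>z\<in>carrier (P1 R K). c (bd1 R K z)"
  have c: "?c \<in> ext1_coboundaries R K M" by (rule ext1_coboundaryI[OF K assms(5)])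
  then have c': "?c \<in> carrier (ext1_cocycles R K M)" using ext1_coboundaries_cocycles[OF K M] by blast
  have "\<phi> = ?c \<oplus>\<^bsub>ext1_cocycles R K M\<^esub> \<psi>"
    using eq assms(3) by (auto simp: fun_eq_iff ext1_cocycles_simps ext1_cocycles_iff extensional_def)
  then have "\<phi> \<ominus>\<^bsub>ext1_cocycles R K M\<^esub> \<psi> = ?c"
    using c' assms(4) by (simp add: a_minus_def Z.a_assoc Z.r_neg)
  with c show ?thesis
    by (simp add: coset_eq_iff[OF Z.abelian_group_axioms ext1_coboundaries_subgroup[OF K M] assms(3,4)])
qed

lemma ext1_class_eqD:
  assumes K: "linear_complex R K" and M: "left_module R M"
    and "\<phi> \<in> carrier (ext1_cocycles R K M)" "\<psi> \<in> carrier (ext1_cocycles R K M)"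
    and eq: "ext1_coboundaries R K M +>\<^bsub>ext1_cocycles R K M\<^esub> \<phi> = ext1_coboundaries R K M +>\<^bsub>ext1_cocycles R K M\<^esub> \<psi>"
  obtains c where "linear_on R (P0 R K) M c"
    "\<And>z. z \<in> carrier (P1 R K) \<Longrightarrow> \<phi> z = c (bd1 R K z) \<oplus>\<^bsub>M\<^esub> \<psi> z"
proof -
  interpret Z: abelian_group "ext1_cocycles R K M" by (rule ext1_cocycles_group[OF K M])
  have "\<phi> \<ominus>\<^bsub>ext1_cocycles R K M\<^esub> \<psi> \<in> ext1_coboundaries R K M"
    using eq by (simp add: coset_eq_iff[OF Z.abelian_group_axioms ext1_coboundaries_subgroup[OF K M] assms(3,4)])
  then obtain c where c: "linear_on R (P0 R K) M c"
    "\<phi> \<ominus>\<^bsub>ext1_cocycles R K M\<^esub> \<psi> = (\<lambda>z\<in>carrier (P1 R K). c (bd1 R K z))"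
    by (rule ext1_coboundaryE)
  have "\<phi> = (\<phi> \<ominus>\<^bsub>ext1_cocycles R K M\<^esub> \<psi>) \<oplus>\<^bsub>ext1_cocycles R K M\<^esub> \<psi>"
    using assms(3,4) by (simp add: a_minus_def Z.a_assoc Z.l_neg)
  then have "\<phi> z = c (bd1 R K z) \<oplus>\<^bsub>M\<^esub> \<psi> z" if "z \<in> carrier (P1 R K)" for z
    using that c(2) by (metis (no_types, lifting) ext1_cocycles_simps(2) restrict_apply')
  with c(1) show ?thesis by (rule that)
qed

section \<open>Tensor products\<close>

lemma keys_diff_subset:
  fixes c d :: "'a \<Rightarrow>\<^sub>0 int"
  shows "\<lbrakk>Poly_Mapping.keys c \<subseteq> T; Poly_Mapping.keys d \<subseteq> T\<rbrakk> \<Longrightarrow> Poly_Mapping.keys (c - d) \<subseteq> T"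
  using keys_diff[of c d] by blast

lemma keys_add_subset:
  fixes c d :: "'a \<Rightarrow>\<^sub>0 int"
  shows "\<lbrakk>Poly_Mapping.keys c \<subseteq> T; Poly_Mapping.keys d \<subseteq> T\<rbrakk> \<Longrightarrow> Poly_Mapping.keys (c + d) \<subseteq> T"
  using keys_add[of c d] by blast

lemma (in abelian_group) add_add_swap:
  "\<lbrakk>a \<in> carrier G; b \<in> carrier G; c \<in> carrier G; d \<in> carrier G\<rbrakk>
    \<Longrightarrow> (a \<oplus> b) \<oplus> (c \<oplus> d) = (a \<oplus> c) \<oplus> (b \<oplus> d)"
  by (simp add: a_assoc a_lcomm)

definition rlinear_on :: "'r ring \<Rightarrow> ('r, 'a) rmodule \<Rightarrow> ('r, 'b) rmodule \<Rightarrow> ('a \<Rightarrow> 'b) \<Rightarrow> bool" where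
  "rlinear_on R A B f \<longleftrightarrow> (\<forall>x\<in>carrier A. f x \<in> carrier B) \<and>
     (\<forall>x\<in>carrier A. \<forall>y\<in>carrier A. f (x \<oplus>\<^bsub>A\<^esub> y) = f x \<oplus>\<^bsub>B\<^esub> f y) \<and>
     (\<forall>r\<in>carrier R. \<forall>x\<in>carrier A. f (rsmult A x r) = rsmult B (f x) r)"

lemma linear_on_id: "linear_on R A A (\<lambda>x. x)"
  by (simp add: linear_on_def)

lemma rlinear_on_id: "rlinear_on R A A (\<lambda>x. x)"
  by (simp add: rlinear_on_def)

text \<open>
  The homomorphism that extends \<open>f\<close> to the free abelian group. It is a constant, and not just obtained,
  because whole families of extensions are used simultaneously.
\<close>

definition frag_lift :: "('a, 'k) ring_scheme \<Rightarrow> 's set \<Rightarrow> ('s \<Rightarrow> 'a) \<Rightarrow> ('s \<Rightarrow>\<^sub>0 int) \<Rightarrow> 'a" where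
  "frag_lift G S f =
     (SOME h. h \<in> hom (free_Abelian_group S) (add_monoid G) \<and> (\<forall>x\<in>S. h (frag_of x) = f x))"

lemma
  assumes "abelian_group G" "f \<in> S \<rightarrow> carrier G"
  shows frag_lift_closed: "Poly_Mapping.keys c \<subseteq> S \<Longrightarrow> frag_lift G S f c \<in> carrier G"
    and frag_lift_add: "\<lbrakk>Poly_Mapping.keys c \<subseteq> S; Poly_Mapping.keys d \<subseteq> S\<rbrakk>
        \<Longrightarrow> frag_lift G S f (c + d) = frag_lift G S f c \<oplus>\<^bsub>G\<^esub> frag_lift G S f d"
    and frag_lift_neg: "Poly_Mapping.keys c \<subseteq> S \<Longrightarrow> frag_lift G S f (- c) = \<ominus>\<^bsub>G\<^esub> frag_lift G S f c"
    and frag_lift_diff: "\<lbrakk>Poly_Mapping.keys c \<subseteq> S; Poly_Mapping.keys d \<subseteq> S\<rbrakk>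
        \<Longrightarrow> frag_lift G S f (c - d) = frag_lift G S f c \<ominus>\<^bsub>G\<^esub> frag_lift G S f d"
    and frag_lift_zero: "frag_lift G S f 0 = \<zero>\<^bsub>G\<^esub>"
    and frag_lift_gen: "s \<in> S \<Longrightarrow> frag_lift G S f (frag_of s) = f s"
proof -
  interpret G: abelian_group G by fact
  let ?h = "frag_lift G S f"
  have "f ` S \<subseteq> carrier (add_monoid G)" using assms(2) by auto
  then have "\<exists>h. h \<in> hom (free_Abelian_group S) (add_monoid G) \<and> (\<forall>x\<in>S. h (frag_of x) = f x)"
    by (metis comm_group.free_Abelian_group_universal[OF G.a_comm_group])
  from someI_ex[OF this] have h: "?h \<in> hom (free_Abelian_group S) (add_monoid G)" "\<forall>x\<in>S. ?h (frag_of x) = f x"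
    unfolding frag_lift_def by auto
  interpret h: group_hom "free_Abelian_group S" "add_monoid G" ?h
    using h(1) by (intro group_hom.intro group_hom_axioms.intro) (simp_all add: G.add.is_group)
  show add: "?h (c + d) = ?h c \<oplus>\<^bsub>G\<^esub> ?h d" if "Poly_Mapping.keys c \<subseteq> S" "Poly_Mapping.keys d \<subseteq> S" for c d
    using h.hom_mult[of c d] that by simp
  show neg: "?h (- c) = \<ominus>\<^bsub>G\<^esub> ?h c" if "Poly_Mapping.keys c \<subseteq> S" for c
    using h.hom_inv[of c] that by (simp add: a_inv_def)
  show "?h c \<in> carrier G" if "Poly_Mapping.keys c \<subseteq> S" for c using h.hom_closed[of c] that by simp
  show "?h (c - d) = ?h c \<ominus>\<^bsub>G\<^esub> ?h d" if "Poly_Mapping.keys c \<subseteq> S" "Poly_Mapping.keys d \<subseteq> S" for c d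
    using add[of c "- d"] neg[of d] that by (simp add: a_minus_def)
  show "?h 0 = \<zero>\<^bsub>G\<^esub>" using h.hom_one by simp
  show "?h (frag_of s) = f s" if "s \<in> S" for s using h(2) that by blast
qed

locale tensor_pair = A: right_module R A + B: left_module R B
  for R :: "'r ring" and A :: "('r, 'a) rmodule" and B :: "('r, 'b, 'x) module_scheme"
begin

abbreviation "base \<equiv> carrier A \<times> carrier B"
abbreviation "rel \<equiv> tensor_rel R A B"
abbreviation "cls c \<equiv> rel #>\<^bsub>free_Abelian_group base\<^esub> c"

abbreviation "gens \<equiv> {frag_of (a \<oplus>\<^bsub>A\<^esub> a', b) - frag_of (a, b) - frag_of (a', b) | a a' b.
         a \<in> carrier A \<and> a' \<in> carrier A \<and> b \<in> carrier B} \<union>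
      {frag_of (a, b \<oplus>\<^bsub>B\<^esub> b') - frag_of (a, b) - frag_of (a, b') | a b b'.
         a \<in> carrier A \<and> b \<in> carrier B \<and> b' \<in> carrier B} \<union>
      {frag_of (rsmult A a r, b) - frag_of (a, r \<odot>\<^bsub>B\<^esub> b) | a r b.
         a \<in> carrier A \<and> r \<in> carrier R \<and> b \<in> carrier B}"


lemma gens_subset: "gens \<subseteq> carrier (free_Abelian_group base)"
  by (auto simp: A.rsmult_closed B.smult_closed intro!: keys_diff_subset
      simp del: Poly_Mapping.keys_minus dest!: subsetD[OF keys_diff])

lemma rel_subgroup: "subgroup rel (free_Abelian_group base)"
  unfolding tensor_rel_def using gens_subset by (rule group.generate_is_subgroup[OF group_free_Abelian_group])

lemma rel_gens: "gens \<subseteq> rel"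
  unfolding tensor_rel_def by (rule subsetI, rule generate.incl)

lemma rel_keys: "c \<in> rel \<Longrightarrow> Poly_Mapping.keys c \<subseteq> base"
  using subsetD[OF subgroup.subset[OF rel_subgroup], of c] by simp

lemma rel_zero: "0 \<in> rel"
  using subgroup.one_closed[OF rel_subgroup] by simp

lemma rel_add: "\<lbrakk>c \<in> rel; d \<in> rel\<rbrakk> \<Longrightarrow> c + d \<in> rel"
  using subgroup.m_closed[OF rel_subgroup] by simp

lemma rel_minus: "c \<in> rel \<Longrightarrow> - c \<in> rel"
  using subgroup.m_inv_closed[OF rel_subgroup] rel_keys by (metis inv_free_Abelian_group)

lemma rel_diff: "\<lbrakk>c \<in> rel; d \<in> rel\<rbrakk> \<Longrightarrow> c - d \<in> rel"
  using rel_add[OF _ rel_minus] by (metis add_uminus_conv_diff)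

lemma rel_sum: "(\<And>i. i \<in> I \<Longrightarrow> f i \<in> rel) \<Longrightarrow> sum f I \<in> rel"
  by (induction I rule: infinite_finite_induct) (auto simp: rel_zero rel_add)

lemma rel_addl: "\<lbrakk>a \<in> carrier A; a' \<in> carrier A; b \<in> carrier B\<rbrakk>
    \<Longrightarrow> frag_of (a \<oplus>\<^bsub>A\<^esub> a', b) - frag_of (a, b) - frag_of (a', b) \<in> rel"
  and rel_addr: "\<lbrakk>a \<in> carrier A; b \<in> carrier B; b' \<in> carrier B\<rbrakk>
    \<Longrightarrow> frag_of (a, b \<oplus>\<^bsub>B\<^esub> b') - frag_of (a, b) - frag_of (a, b') \<in> rel"
  and rel_bal: "\<lbrakk>a \<in> carrier A; r \<in> carrier R; b \<in> carrier B\<rbrakk>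
    \<Longrightarrow> frag_of (rsmult A a r, b) - frag_of (a, r \<odot>\<^bsub>B\<^esub> b) \<in> rel"
  by (rule subsetD[OF rel_gens], blast)+

lemma rel_zerol: "b \<in> carrier B \<Longrightarrow> frag_of (\<zero>\<^bsub>A\<^esub>, b) \<in> rel"
  using rel_minus[OF rel_addl[of "\<zero>\<^bsub>A\<^esub>" "\<zero>\<^bsub>A\<^esub>" b]] by simp

lemma rel_zeror: "a \<in> carrier A \<Longrightarrow> frag_of (a, \<zero>\<^bsub>B\<^esub>) \<in> rel"
  using rel_minus[OF rel_addr[of a "\<zero>\<^bsub>B\<^esub>" "\<zero>\<^bsub>B\<^esub>"]] by simp

text \<open>
  To see that a property holds for the relations of the tensor product, it suffices to check the
  three kinds of bilinearity relations, provided that the property is inherited by sums and negatives.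
\<close>

lemma rel_induct [consumes 1, case_names zero add minus addl addr bal]:
  assumes "c \<in> rel"
    and zero: "P 0"
    and add: "\<And>c d. \<lbrakk>Poly_Mapping.keys c \<subseteq> base; Poly_Mapping.keys d \<subseteq> base; P c; P d\<rbrakk> \<Longrightarrow> P (c + d)"
    and minus: "\<And>c. \<lbrakk>Poly_Mapping.keys c \<subseteq> base; P c\<rbrakk> \<Longrightarrow> P (- c)"
    and addl: "\<And>a a' b. \<lbrakk>a \<in> carrier A; a' \<in> carrier A; b \<in> carrier B\<rbrakk>
      \<Longrightarrow> P (frag_of (a \<oplus>\<^bsub>A\<^esub> a', b) - frag_of (a, b) - frag_of (a', b))"
    and addr: "\<And>a b b'. \<lbrakk>a \<in> carrier A; b \<in> carrier B; b' \<in> carrier B\<rbrakk>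
      \<Longrightarrow> P (frag_of (a, b \<oplus>\<^bsub>B\<^esub> b') - frag_of (a, b) - frag_of (a, b'))"
    and bal: "\<And>a r b. \<lbrakk>a \<in> carrier A; r \<in> carrier R; b \<in> carrier B\<rbrakk>
      \<Longrightarrow> P (frag_of (rsmult A a r, b) - frag_of (a, r \<odot>\<^bsub>B\<^esub> b))"
  shows "P c"
proof -
  let ?H = "{c. Poly_Mapping.keys c \<subseteq> base \<and> P c}"
  have "subgroup ?H (free_Abelian_group base)"
  proof (rule group.subgroupI[OF group_free_Abelian_group])
    show "?H \<subseteq> carrier (free_Abelian_group base)" by auto
    have "0 \<in> ?H" using zero by simp
    then show "?H \<noteq> {}" by blast
    fix c assume c: "c \<in> ?H"
    then show "inv\<^bsub>free_Abelian_group base\<^esub> c \<in> ?H" using minus by simp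
    fix d assume "d \<in> ?H"
    with c show "c \<otimes>\<^bsub>free_Abelian_group base\<^esub> d \<in> ?H" using add keys_add_subset[of c base d] by simp
  qed
  moreover have "gens \<subseteq> ?H"
  proof
    fix c assume c: "c \<in> gens"
    then have "P c" by (elim UnE CollectE exE conjE) (simp_all only: addl addr bal)
    moreover have "c \<in> carrier (free_Abelian_group base)" using c gens_subset by (rule rev_subsetD)
    ultimately show "c \<in> ?H" by simp
  qed
  ultimately have "rel \<subseteq> ?H"
    unfolding tensor_rel_def by (rule group.generate_subgroup_incl[OF group_free_Abelian_group, rotated])
  with assms(1) show ?thesis by blast
qed

lemma mem_cls: "x \<in> cls c \<longleftrightarrow> x - c \<in> rel"
proof
  assume "x - c \<in> rel"
  then have "\<exists>t\<in>rel. x = t + c" by (intro bexI[of _ "x - c"]) simp_all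
  then show "x \<in> cls c" by (simp add: r_coset_def)
qed (auto simp: r_coset_def)

lemma cls_eq_iff: "cls c = cls d \<longleftrightarrow> c - d \<in> rel"
proof
  assume "cls c = cls d"
  then have "c \<in> cls d" using mem_cls[of c c] rel_zero by simp
  then show "c - d \<in> rel" by (simp add: mem_cls)
next
  assume cd: "c - d \<in> rel"
  have "x - c \<in> rel \<longleftrightarrow> x - d \<in> rel" for x
    using rel_add[of "x - c" "c - d"] rel_diff[of "x - d" "c - d"] cd by (auto simp: algebra_simps)
  then show "cls c = cls d" by (auto simp: mem_cls)
qed

lemma carrier_tensor_group: "carrier (tensor_group R A B) = cls ` {c. Poly_Mapping.keys c \<subseteq> base}"
  by (auto simp: tensor_group_def FactGroup_def RCOSETS_def)

lemma one_tensor_group: "\<one>\<^bsub>tensor_group R A B\<^esub> = cls 0"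
  by (auto simp: tensor_group_def FactGroup_def mem_cls)

lemma rel_normal: "rel \<lhd> free_Abelian_group base"
  by (rule comm_group.subgroup_imp_normal[OF abelian_free_Abelian_group rel_subgroup])

lemma mult_tensor_group:
  "\<lbrakk>Poly_Mapping.keys c \<subseteq> base; Poly_Mapping.keys d \<subseteq> base\<rbrakk>
    \<Longrightarrow> cls c \<otimes>\<^bsub>tensor_group R A B\<^esub> cls d = cls (c + d)"
  using normal.rcos_sum[OF rel_normal, of c d] by (simp add: tensor_group_def FactGroup_def)

lemma comm_group_tensor_group: "comm_group (tensor_group R A B)"
  unfolding tensor_group_def
  by (rule comm_group.abelian_FactGroup[OF abelian_free_Abelian_group rel_subgroup])

lemma tens_eq_cls: "tens R A B a b = cls (frag_of (a, b))"
  by (simp add: tens_def)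

end

text \<open>
  A ring \<open>Q\<close> acting on the left factor by endomorphisms \<open>act q\<close> of right modules acts on the tensor
  product. The two instances are \<open>Q = R\<close>, which gives \<^const>\<open>tensor_mod\<close>, and the left action of
  \<open>U\<close> on \<open>U \<otimes> M\<close>.
\<close>

definition tensor_act_mod ::
    "'r ring \<Rightarrow> ('r, 'a) rmodule \<Rightarrow> ('r, 'b, 'x) module_scheme \<Rightarrow> ('q \<Rightarrow> 'a \<Rightarrow> 'a)
      \<Rightarrow> ('q, ('a \<times> 'b \<Rightarrow>\<^sub>0 int) set) module" where
  "tensor_act_mod R A B act =
     \<lparr>carrier = carrier (tensor_group R A B), monoid.mult = undefined, monoid.one = undefined,
      ring.zero = monoid.one (tensor_group R A B), ring.add = monoid.mult (tensor_group R A B),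
      smult = (\<lambda>q. tensor_map R A B (act q) (\<lambda>b. b))\<rparr>"

lemma tensor_mod_eq: "tensor_mod R E M = tensor_act_mod R (right_of E) M (\<lambda>r a. r \<odot>\<^bsub>E\<^esub> a)"
  by (simp add: tensor_mod_def tensor_act_mod_def)

context tensor_pair
begin

abbreviation "TA act \<equiv> tensor_act_mod R A B act"

lemma tensor_act_mod_simps:
  "carrier (TA act) = cls ` {c. Poly_Mapping.keys c \<subseteq> base}"
  "\<zero>\<^bsub>TA act\<^esub> = cls 0"
  "\<lbrakk>Poly_Mapping.keys c \<subseteq> base; Poly_Mapping.keys d \<subseteq> base\<rbrakk> \<Longrightarrow> cls c \<oplus>\<^bsub>TA act\<^esub> cls d = cls (c + d)"
  by (simp_all add: tensor_act_mod_def carrier_tensor_group one_tensor_group mult_tensor_group)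

lemma tensor_act_mod_abelian_group: "abelian_group (TA act)"
proof -
  interpret G: comm_group "tensor_group R A B" by (rule comm_group_tensor_group)
  show ?thesis
    by (rule abelian_groupI)
      (auto simp: tensor_act_mod_def G.m_ac intro!: bexI[of _ "inv\<^bsub>tensor_group R A B\<^esub> _"])
qed

lemma tens_closed: "\<lbrakk>a \<in> carrier A; b \<in> carrier B\<rbrakk> \<Longrightarrow> tens R A B a b \<in> carrier (TA act)"
  by (auto simp: tensor_act_mod_simps tens_eq_cls)

lemma tens_addl: "\<lbrakk>a \<in> carrier A; a' \<in> carrier A; b \<in> carrier B\<rbrakk>
    \<Longrightarrow> tens R A B (a \<oplus>\<^bsub>A\<^esub> a') b = tens R A B a b \<oplus>\<^bsub>TA act\<^esub> tens R A B a' b"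
  using rel_addl[of a a' b] by (simp add: tensor_act_mod_simps tens_eq_cls cls_eq_iff diff_diff_eq)

lemma tens_addr: "\<lbrakk>a \<in> carrier A; b \<in> carrier B; b' \<in> carrier B\<rbrakk>
    \<Longrightarrow> tens R A B a (b \<oplus>\<^bsub>B\<^esub> b') = tens R A B a b \<oplus>\<^bsub>TA act\<^esub> tens R A B a b'"
  using rel_addr[of a b b'] by (simp add: tensor_act_mod_simps tens_eq_cls cls_eq_iff diff_diff_eq)

lemma tens_bal: "\<lbrakk>a \<in> carrier A; r \<in> carrier R; b \<in> carrier B\<rbrakk>
    \<Longrightarrow> tens R A B (rsmult A a r) b = tens R A B a (r \<odot>\<^bsub>B\<^esub> b)"
  using rel_bal[of a r b] by (simp add: tens_eq_cls cls_eq_iff)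

lemma tens_zerol: "b \<in> carrier B \<Longrightarrow> tens R A B \<zero>\<^bsub>A\<^esub> b = \<zero>\<^bsub>TA act\<^esub>"
  using rel_zerol[of b] by (simp add: tens_eq_cls tensor_act_mod_simps cls_eq_iff)

lemma tens_zeror: "a \<in> carrier A \<Longrightarrow> tens R A B a \<zero>\<^bsub>B\<^esub> = \<zero>\<^bsub>TA act\<^esub>"
  using rel_zeror[of a] by (simp add: tens_eq_cls tensor_act_mod_simps cls_eq_iff)

lemma tens_negl:
  assumes "a \<in> carrier A" "b \<in> carrier B"
  shows "tens R A B (\<ominus>\<^bsub>A\<^esub> a) b = \<ominus>\<^bsub>TA act\<^esub> tens R A B a b"
proof -
  interpret T: abelian_group "TA act" by (rule tensor_act_mod_abelian_group)
  have "tens R A B (\<ominus>\<^bsub>A\<^esub> a) b \<oplus>\<^bsub>TA act\<^esub> tens R A B a b = tens R A B (\<ominus>\<^bsub>A\<^esub> a \<oplus>\<^bsub>A\<^esub> a) b"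
    using assms by (simp only: tens_addl[symmetric] A.M.a_inv_closed)
  also have "\<dots> = \<zero>\<^bsub>TA act\<^esub>" using assms by (simp add: A.M.l_neg tens_zerol)
  finally show ?thesis
    using T.minus_equality assms by (metis A.M.a_inv_closed tens_closed)
qed

lemma tensor_induct [consumes 1, case_names tens add]:
  assumes "t \<in> carrier (TA act)"
    and tens: "\<And>a b. \<lbrakk>a \<in> carrier A; b \<in> carrier B\<rbrakk> \<Longrightarrow> P (tens R A B a b)"
    and add: "\<And>s t. \<lbrakk>s \<in> carrier (TA act); t \<in> carrier (TA act); P s; P t\<rbrakk> \<Longrightarrow> P (s \<oplus>\<^bsub>TA act\<^esub> t)"
  shows "P t"
proof -
  interpret T: abelian_group "TA act" by (rule tensor_act_mod_abelian_group)
  obtain c where c: "t = cls c" "Poly_Mapping.keys c \<subseteq> base" using assms(1) by (auto simp: tensor_act_mod_simps)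
  have "Poly_Mapping.keys c \<subseteq> base \<and> P (cls c) \<and> P (cls (- c))"
    using c(2)
  proof (induction c rule: frag_induction)
    case zero
    have "cls 0 = tens R A B \<zero>\<^bsub>A\<^esub> \<zero>\<^bsub>B\<^esub>" using tens_zerol[of "\<zero>\<^bsub>B\<^esub>"] by (simp add: tensor_act_mod_simps)
    then show ?case using tens[of "\<zero>\<^bsub>A\<^esub>" "\<zero>\<^bsub>B\<^esub>"] by simp
  next
    case (one p)
    then obtain a b where p: "p = (a, b)" "a \<in> carrier A" "b \<in> carrier B" by auto
    have "cls (- frag_of p) \<oplus>\<^bsub>TA act\<^esub> tens R A B a b = \<zero>\<^bsub>TA act\<^esub>"
      using p by (simp add: tens_eq_cls tensor_act_mod_simps)
    then have "cls (- frag_of p) = \<ominus>\<^bsub>TA act\<^esub> tens R A B a b"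
      using p by (intro T.minus_equality[symmetric]) (use tens_closed[of a b, where act = act] in \<open>auto simp: tensor_act_mod_simps(1,2)\<close>)
    also have "\<dots> = tens R A B (\<ominus>\<^bsub>A\<^esub> a) b" using p by (simp add: tens_negl[where act = act])
    finally show ?case using p tens[of a b] tens[of "\<ominus>\<^bsub>A\<^esub> a" b] by (simp add: tens_eq_cls)
  next
    case (diff c d)
    then have k: "Poly_Mapping.keys c \<subseteq> base" "Poly_Mapping.keys d \<subseteq> base" by auto
    have "P (cls c \<oplus>\<^bsub>TA act\<^esub> cls (- d))" "P (cls d \<oplus>\<^bsub>TA act\<^esub> cls (- c))"
      using diff k by (auto intro!: add simp: tensor_act_mod_simps(1))
    with k show ?case by (simp add: tensor_act_mod_simps keys_diff_subset)
  qed
  with c(1) show ?thesis by blast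
qed

lemma tensor_hom_eq:
  assumes "t \<in> carrier (TA act)"
    and "\<And>s t. \<lbrakk>s \<in> carrier (TA act); t \<in> carrier (TA act)\<rbrakk> \<Longrightarrow> f (s \<oplus>\<^bsub>TA act\<^esub> t) = f s \<oplus>\<^bsub>G\<^esub> f t"
    and "\<And>s t. \<lbrakk>s \<in> carrier (TA act); t \<in> carrier (TA act)\<rbrakk> \<Longrightarrow> g (s \<oplus>\<^bsub>TA act\<^esub> t) = g s \<oplus>\<^bsub>G\<^esub> g t"
    and "\<And>a b. \<lbrakk>a \<in> carrier A; b \<in> carrier B\<rbrakk> \<Longrightarrow> f (tens R A B a b) = g (tens R A B a b)"
  shows "f t = g t"
  using assms(1) by (induction t rule: tensor_induct) (simp_all add: assms(2-4))

end

lemma tensor_map_cls: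
  assumes "tensor_pair R A B" "tensor_pair R A' B'" "rlinear_on R A A' f" "linear_on R B B' g"
    and "Poly_Mapping.keys c \<subseteq> carrier A \<times> carrier B"
  defines "\<phi> \<equiv> frag_extend (\<lambda>(a, b). frag_of (f a, g b))"
  shows "tensor_map R A' B' f g (tensor_rel R A B #>\<^bsub>free_Abelian_group (carrier A \<times> carrier B)\<^esub> c)
      = tensor_rel R A' B' #>\<^bsub>free_Abelian_group (carrier A' \<times> carrier B')\<^esub> \<phi> c"
    and "Poly_Mapping.keys (\<phi> c) \<subseteq> carrier A' \<times> carrier B'"
proof -
  interpret T: tensor_pair R A B by fact
  interpret T': tensor_pair R A' B' by fact
  note f = assms(3)[unfolded rlinear_on_def] and g = assms(4)[unfolded linear_on_def]
  show "Poly_Mapping.keys (\<phi> c) \<subseteq> carrier A' \<times> carrier B'"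
    unfolding \<phi>_def using keys_frag_extend[of "\<lambda>(a, b). frag_of (f a, g b)" c] assms(5) f g by fastforce
  have "\<phi> d \<in> T'.rel" if "d \<in> T.rel" for d
    using that
  proof (induction d rule: T.rel_induct)
    case (addl a a' b)
    then show ?case using T'.rel_addl[of "f a" "f a'" "g b"] f g by (simp add: \<phi>_def frag_extend_diff)
  next
    case (addr a b b')
    then show ?case using T'.rel_addr[of "f a" "g b" "g b'"] f g by (simp add: \<phi>_def frag_extend_diff)
  next
    case (bal a r b)
    then show ?case using T'.rel_bal[of "f a" r "g b"] f g by (simp add: \<phi>_def frag_extend_diff)
  qed (simp_all add: \<phi>_def T'.rel_zero frag_extend_add T'.rel_add frag_extend_minus T'.rel_minus)
  then have "T'.cls (\<phi> d) = T'.cls (\<phi> c)" if "d \<in> T.cls c" for d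
    using that by (simp add: T.mem_cls T'.cls_eq_iff \<phi>_def frag_extend_diff[symmetric])
  moreover have "c \<in> T.cls c" by (simp add: T.mem_cls T.rel_zero)
  ultimately show "tensor_map R A' B' f g (T.cls c) = T'.cls (\<phi> c)"
    unfolding tensor_map_def \<phi>_def[symmetric] by blast
qed

lemma tensor_map_tens:
  assumes "tensor_pair R A B" "tensor_pair R A' B'" "rlinear_on R A A' f" "linear_on R B B' g"
    and "a \<in> carrier A" "b \<in> carrier B"
  shows "tensor_map R A' B' f g (tens R A B a b) = tens R A' B' (f a) (g b)"
  using tensor_map_cls(1)[OF assms(1-4), of "frag_of (a, b)"] assms(5,6) by (simp add: tens_def)

lemma tensor_map_closed:
  assumes "tensor_pair R A B" "tensor_pair R A' B'" "rlinear_on R A A' f" "linear_on R B B' g"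
    and "t \<in> carrier (tensor_act_mod R A B act)"
  shows "tensor_map R A' B' f g t \<in> carrier (tensor_act_mod R A' B' act')"
proof -
  interpret T: tensor_pair R A B by fact
  interpret T': tensor_pair R A' B' by fact
  show ?thesis
    using assms(5) tensor_map_cls[OF assms(1-4)] by (auto simp: T.tensor_act_mod_simps T'.tensor_act_mod_simps)
qed

lemma tensor_map_add:
  assumes "tensor_pair R A B" "tensor_pair R A' B'" "rlinear_on R A A' f" "linear_on R B B' g"
    and "s \<in> carrier (tensor_act_mod R A B act)" "t \<in> carrier (tensor_act_mod R A B act)"
  shows "tensor_map R A' B' f g (s \<oplus>\<^bsub>tensor_act_mod R A B act\<^esub> t)
      = tensor_map R A' B' f g s \<oplus>\<^bsub>tensor_act_mod R A' B' act'\<^esub> tensor_map R A' B' f g t"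
proof -
  interpret T: tensor_pair R A B by fact
  interpret T': tensor_pair R A' B' by fact
  obtain c d where cd: "s = T.cls c" "Poly_Mapping.keys c \<subseteq> T.base" "t = T.cls d" "Poly_Mapping.keys d \<subseteq> T.base"
    using assms(5,6) by (auto simp: T.tensor_act_mod_simps)
  show ?thesis
    using cd(2,4) tensor_map_cls[OF assms(1-4) cd(2)] tensor_map_cls[OF assms(1-4) cd(4)]
      tensor_map_cls[OF assms(1-4), of "c + d"]
    by (simp add: cd(1,3) T.tensor_act_mod_simps T'.tensor_act_mod_simps keys_add_subset frag_extend_add)
qed

context tensor_pair
begin

lemma tensor_act_mod_left_module:
  assumes "ring Q"
    and rlin: "\<And>q. q \<in> carrier Q \<Longrightarrow> rlinear_on R A A (act q)"
    and add: "\<And>q q' a. \<lbrakk>q \<in> carrier Q; q' \<in> carrier Q; a \<in> carrier A\<rbrakk> \<Longrightarrow> act (q \<oplus>\<^bsub>Q\<^esub> q') a = act q a \<oplus>\<^bsub>A\<^esub> act q' a"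
    and mult: "\<And>q q' a. \<lbrakk>q \<in> carrier Q; q' \<in> carrier Q; a \<in> carrier A\<rbrakk> \<Longrightarrow> act (q \<otimes>\<^bsub>Q\<^esub> q') a = act q (act q' a)"
    and one: "\<And>a. a \<in> carrier A \<Longrightarrow> act \<one>\<^bsub>Q\<^esub> a = a"
  shows "left_module Q (TA act)"
proof -
  interpret Q: ring Q by fact
  interpret T: abelian_group "TA act" by (rule tensor_act_mod_abelian_group)
  note ax = tensor_pair_axioms
  have sm: "q \<odot>\<^bsub>TA act\<^esub> t = tensor_map R A B (act q) (\<lambda>b. b) t" for q t
    by (simp add: tensor_act_mod_def)
  have smt: "q \<odot>\<^bsub>TA act\<^esub> tens R A B a b = tens R A B (act q a) b"
    if "q \<in> carrier Q" "a \<in> carrier A" "b \<in> carrier B" for q a b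
    unfolding sm using tensor_map_tens[OF ax ax rlin[OF that(1)] linear_on_id that(2,3)] .
  have sma: "q \<odot>\<^bsub>TA act\<^esub> (s \<oplus>\<^bsub>TA act\<^esub> t) = q \<odot>\<^bsub>TA act\<^esub> s \<oplus>\<^bsub>TA act\<^esub> q \<odot>\<^bsub>TA act\<^esub> t"
    if "q \<in> carrier Q" "s \<in> carrier (TA act)" "t \<in> carrier (TA act)" for q s t
    unfolding sm by (rule tensor_map_add[OF ax ax rlin[OF that(1)] linear_on_id that(2,3)])
  have smc: "q \<odot>\<^bsub>TA act\<^esub> t \<in> carrier (TA act)" if "q \<in> carrier Q" "t \<in> carrier (TA act)" for q t
    unfolding sm by (rule tensor_map_closed[OF ax ax rlin[OF that(1)] linear_on_id that(2)])
  have cl: "act q a \<in> carrier A" if "q \<in> carrier Q" "a \<in> carrier A" for q a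
    using rlin[OF that(1)] that(2) by (simp add: rlinear_on_def)
  show ?thesis
  proof (intro left_module.intro left_module_axioms.intro Q.ring_axioms T.abelian_group_axioms smc sma)
    fix q q' t assume q: "q \<in> carrier Q" "q' \<in> carrier Q" and t: "t \<in> carrier (TA act)"
    show "(q \<oplus>\<^bsub>Q\<^esub> q') \<odot>\<^bsub>TA act\<^esub> t = q \<odot>\<^bsub>TA act\<^esub> t \<oplus>\<^bsub>TA act\<^esub> q' \<odot>\<^bsub>TA act\<^esub> t"
      by (rule tensor_hom_eq[OF t]) (use q in \<open>simp_all add: sma smc smt T.add_add_swap add cl tens_addl\<close>)
    show "(q \<otimes>\<^bsub>Q\<^esub> q') \<odot>\<^bsub>TA act\<^esub> t = q \<odot>\<^bsub>TA act\<^esub> (q' \<odot>\<^bsub>TA act\<^esub> t)"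
      by (rule tensor_hom_eq[OF t]) (use q in \<open>simp_all add: sma smc smt mult cl\<close>)
  next
    fix t assume t: "t \<in> carrier (TA act)"
    show "\<one>\<^bsub>Q\<^esub> \<odot>\<^bsub>TA act\<^esub> t = t"
      by (rule tensor_hom_eq[OF t]) (simp_all add: sma smt one)
  qed
qed

end

section \<open>The equational criterion for flatness\<close>

lemma (in tensor_pair) rel_finsum:
  assumes "finite I" "a \<in> carrier A" "g \<in> I \<rightarrow> carrier B"
  shows "frag_of (a, finsum B g I) - (\<Sum>i\<in>I. frag_of (a, g i)) \<in> rel"
  using assms(1,3)
proof (induction I rule: finite_induct)
  case empty
  then show ?case using rel_zeror[OF assms(2)] by simp
next
  case (insert i I)
  have cl: "g i \<in> carrier B" "g \<in> I \<rightarrow> carrier B" "finsum B g I \<in> carrier B" using insert.prems by auto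
  have "(frag_of (a, g i \<oplus>\<^bsub>B\<^esub> finsum B g I) - frag_of (a, g i) - frag_of (a, finsum B g I)) +
      (frag_of (a, finsum B g I) - (\<Sum>i\<in>I. frag_of (a, g i))) \<in> rel"
    using insert.IH[OF cl(2)] rel_addr[OF assms(2) cl(1,3)] by (rule rel_add[rotated])
  with insert cl show ?case by (simp add: B.M.finsum_insert algebra_simps)
qed

lemma (in ring) finsum_minus:
  assumes "f \<in> A \<rightarrow> carrier R" "g \<in> A \<rightarrow> carrier R"
  shows "(\<Oplus>i\<in>A. f i \<ominus> g i) = (\<Oplus>i\<in>A. f i) \<ominus> (\<Oplus>i\<in>A. g i)"
proof -
  have cl: "(\<lambda>i. f i \<ominus> g i) \<in> A \<rightarrow> carrier R" using assms by auto
  have "(\<Oplus>i\<in>A. f i) = (\<Oplus>i\<in>A. (f i \<ominus> g i) \<oplus> g i)"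
    using assms by (intro finsum_cong') (auto simp: a_minus_def a_assoc l_neg Pi_iff)
  also have "\<dots> = (\<Oplus>i\<in>A. f i \<ominus> g i) \<oplus> (\<Oplus>i\<in>A. g i)" by (rule finsum_addf[OF cl assms(2)])
  finally show ?thesis
    using finsum_closed[OF cl] finsum_closed[OF assms(2)]
    by (simp add: a_minus_def[where y = "finsum R g A"] a_assoc r_neg)
qed

text \<open>
  The columns of the matrix \<open>z\<close> generate a submodule \<open>W\<close> of \<open>R^m\<close>. The sum of the tensors
  \<open>col b \<otimes> b\<close> vanishes in \<open>R^m \<otimes> N\<close>, since the rows of \<open>z\<close> are relations between the elements of \<open>S\<close>.
  By flatness it already vanishes in \<open>W \<otimes> N\<close>, and the bilinearity relations that witness this yield
  the coefficients \<open>\<tau>\<close>. The elements of \<open>R^m\<close> are encoded as lists because flatness is tested against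
  modules carried by lists.
\<close>

lemma flat_relations:
  fixes R :: "'r ring" and N :: "('r, 'n, 'x) module_scheme" and m :: nat
  assumes flat: "flat_left_module R N" and S: "finite S" "S \<subseteq> carrier N"
    and z: "\<And>j b. \<lbrakk>j < m; b \<in> S\<rbrakk> \<Longrightarrow> z j b \<in> carrier R"
    and rel: "\<And>j. j < m \<Longrightarrow> (\<Oplus>\<^bsub>N\<^esub>b\<in>S. z j b \<odot>\<^bsub>N\<^esub> b) = \<zero>\<^bsub>N\<^esub>"
  obtains \<tau> where "\<And>b. b \<in> S \<Longrightarrow> \<tau> b \<in> carrier (free_mod R (carrier N))"
    and "\<And>b. b \<in> S \<Longrightarrow> free_ext R N (\<lambda>x. x) (\<tau> b) = b"
    and "\<And>j y. j < m \<Longrightarrow> (\<Oplus>\<^bsub>R\<^esub>b\<in>S. z j b \<otimes>\<^bsub>R\<^esub> \<tau> b y) = \<zero>\<^bsub>R\<^esub>"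
proof -
  have N: "left_module R N" using flat by (simp add: flat_left_module_def)
  interpret N: left_module R N by fact
  define F where "F = free_mod R (carrier N)"
  interpret F: left_module R F unfolding F_def by (rule free_mod_left_module[OF N.R.ring_axioms])
  define fe where "fe = free_ext R N (\<lambda>x. x)"
  have fe: "linear_on R F N fe" unfolding fe_def F_def by (rule free_ext_linear[OF N]) auto
  have fe_gen: "fe (free_gen R n) = n" if "n \<in> carrier N" for n
    unfolding fe_def by (rule free_ext_gen[OF N _ that]) auto
  define vec :: "(nat \<Rightarrow> 'r) \<Rightarrow> 'r list" where "vec f = map f [0..<m]" for f
  have vec_nth [simp]: "vec f ! j = f j" if "j < m" for f j using that by (simp add: vec_def)
  have vec_eq: "vec f = vec g \<longleftrightarrow> (\<forall>j<m. f j = g j)" for f g by (auto simp: vec_def)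
  define L :: "'r list set \<Rightarrow> ('r, 'r list) rmodule" where
    "L C = \<lparr>carrier = C, monoid.mult = undefined, monoid.one = undefined, ring.zero = vec (\<lambda>_. \<zero>\<^bsub>R\<^esub>),
        ring.add = (\<lambda>xs ys. vec (\<lambda>j. xs ! j \<oplus>\<^bsub>R\<^esub> ys ! j)), rsmult = (\<lambda>xs r. vec (\<lambda>j. xs ! j \<otimes>\<^bsub>R\<^esub> r))\<rparr>" for C
  define V where "V = {vec f | f. \<forall>j<m. f j \<in> carrier R}"
  have Vn: "xs ! j \<in> carrier R" if "xs \<in> V" "j < m" for xs j using that by (auto simp: V_def)
  have V_eqI: "xs = vec f" if "xs \<in> V" "\<And>j. j < m \<Longrightarrow> xs ! j = f j" for xs f
    using that by (auto simp: V_def vec_eq)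
  have L_right_module: "right_module R (L C)"
    if C: "C \<subseteq> V" "vec (\<lambda>_. \<zero>\<^bsub>R\<^esub>) \<in> C" "\<And>xs ys. \<lbrakk>xs \<in> C; ys \<in> C\<rbrakk> \<Longrightarrow> vec (\<lambda>j. xs ! j \<oplus>\<^bsub>R\<^esub> ys ! j) \<in> C"
      "\<And>xs r. \<lbrakk>xs \<in> C; r \<in> carrier R\<rbrakk> \<Longrightarrow> vec (\<lambda>j. xs ! j \<otimes>\<^bsub>R\<^esub> r) \<in> C" for C
  proof -
    have Cn: "xs ! j \<in> carrier R" if "xs \<in> C" "j < m" for xs j using Vn C(1) that by blast
    have Ceq: "xs = vec f" if "xs \<in> C" "\<And>j. j < m \<Longrightarrow> xs ! j = f j" for xs f
      using V_eqI[of xs f] C(1) that by blast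
    have "abelian_group (L C)"
    proof (rule abelian_groupI)
      fix xs assume "xs \<in> carrier (L C)"
      then have xs: "xs \<in> C" by (simp add: L_def)
      show "\<zero>\<^bsub>L C\<^esub> \<oplus>\<^bsub>L C\<^esub> xs = xs"
        using Ceq[OF xs] Cn[OF xs] by (simp add: L_def)
      show "\<exists>ys\<in>carrier (L C). ys \<oplus>\<^bsub>L C\<^esub> xs = \<zero>\<^bsub>L C\<^esub>"
      proof
        show "vec (\<lambda>j. xs ! j \<otimes>\<^bsub>R\<^esub> (\<ominus>\<^bsub>R\<^esub> \<one>\<^bsub>R\<^esub>)) \<in> carrier (L C)" using C(4)[OF xs] by (simp add: L_def)
        show "vec (\<lambda>j. xs ! j \<otimes>\<^bsub>R\<^esub> (\<ominus>\<^bsub>R\<^esub> \<one>\<^bsub>R\<^esub>)) \<oplus>\<^bsub>L C\<^esub> xs = \<zero>\<^bsub>L C\<^esub>"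
          using Cn[OF xs] by (simp add: L_def vec_eq N.R.r_minus N.R.l_neg)
      qed
    qed (use C Cn in \<open>simp_all add: L_def vec_eq N.R.a_ac\<close>)
    moreover have "rsmult (L C) xs \<one>\<^bsub>R\<^esub> = xs" if "xs \<in> C" for xs
    proof -
      have "vec (\<lambda>j. xs ! j \<otimes>\<^bsub>R\<^esub> \<one>\<^bsub>R\<^esub>) = xs"
        by (rule V_eqI[symmetric]) (use that C(1) Cn in auto)
      then show ?thesis by (simp add: L_def)
    qed
    ultimately show ?thesis
      by (intro right_module.intro N.R.ring_axioms right_module_axioms.intro)
        (use C Cn in \<open>simp_all add: L_def vec_eq N.R.l_distr N.R.r_distr N.R.m_assoc\<close>)
  qed
  \<comment> \<open>The \<open>j\<close>-th entry of the combination of the columns with the coefficients \<open>v\<close>.\<close>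
  define cmp where "cmp v j = (\<Oplus>\<^bsub>R\<^esub>b\<in>S. z j b \<otimes>\<^bsub>R\<^esub> v b)" for v j
  have zv: "(\<lambda>b. z j b \<otimes>\<^bsub>R\<^esub> v b) \<in> S \<rightarrow> carrier R" if "j < m" "\<forall>b. v b \<in> carrier R" for v j
    using that z by auto
  have cmp_cl: "cmp v j \<in> carrier R" if "j < m" "\<forall>b. v b \<in> carrier R" for v j
    unfolding cmp_def using zv[OF that] by (rule N.R.finsum_closed)
  have cmp_add: "cmp (\<lambda>b. v b \<oplus>\<^bsub>R\<^esub> w b) j = cmp v j \<oplus>\<^bsub>R\<^esub> cmp w j"
    if "j < m" "\<forall>b. v b \<in> carrier R" "\<forall>b. w b \<in> carrier R" for v w j
  proof -
    have "cmp (\<lambda>b. v b \<oplus>\<^bsub>R\<^esub> w b) j = (\<Oplus>\<^bsub>R\<^esub>b\<in>S. z j b \<otimes>\<^bsub>R\<^esub> v b \<oplus>\<^bsub>R\<^esub> z j b \<otimes>\<^bsub>R\<^esub> w b)"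
      unfolding cmp_def using that z by (intro N.R.finsum_cong') (auto simp: N.R.r_distr)
    then show ?thesis using N.R.finsum_addf[OF zv[OF that(1,2)] zv[OF that(1,3)]] by (simp add: cmp_def)
  qed
  have cmp_minus: "cmp (\<lambda>b. v b \<ominus>\<^bsub>R\<^esub> w b) j = cmp v j \<ominus>\<^bsub>R\<^esub> cmp w j"
    if "j < m" "\<forall>b. v b \<in> carrier R" "\<forall>b. w b \<in> carrier R" for v w j
  proof -
    have "cmp (\<lambda>b. v b \<ominus>\<^bsub>R\<^esub> w b) j = (\<Oplus>\<^bsub>R\<^esub>b\<in>S. z j b \<otimes>\<^bsub>R\<^esub> v b \<ominus>\<^bsub>R\<^esub> z j b \<otimes>\<^bsub>R\<^esub> w b)"
      unfolding cmp_def using that z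
      by (intro N.R.finsum_cong') (auto simp: a_minus_def N.R.r_distr N.R.r_minus)
    then show ?thesis using N.R.finsum_minus[OF zv[OF that(1,2)] zv[OF that(1,3)]] by (simp add: cmp_def)
  qed
  have cmp_smult: "cmp (\<lambda>b. v b \<otimes>\<^bsub>R\<^esub> r) j = cmp v j \<otimes>\<^bsub>R\<^esub> r"
    if "j < m" "\<forall>b. v b \<in> carrier R" "r \<in> carrier R" for v r j
  proof -
    have "cmp (\<lambda>b. v b \<otimes>\<^bsub>R\<^esub> r) j = (\<Oplus>\<^bsub>R\<^esub>b\<in>S. z j b \<otimes>\<^bsub>R\<^esub> v b \<otimes>\<^bsub>R\<^esub> r)"
      unfolding cmp_def using that z by (intro N.R.finsum_cong') (auto simp: N.R.m_assoc)
    then show ?thesis using N.R.finsum_ldistr[OF S(1) that(3) zv[OF that(1,2)]] by (simp add: cmp_def)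
  qed
  define W where "W = {vec (cmp v) | v. \<forall>b. v b \<in> carrier R}"
  have WV: "W \<subseteq> V" using cmp_cl by (auto simp: W_def V_def)
  have W_mem: "vec f \<in> W" if "\<forall>b. v b \<in> carrier R" "\<And>j. j < m \<Longrightarrow> f j = cmp v j" for f v
    using that by (auto simp: W_def vec_eq)
  \<comment> \<open>Coefficients of a combination of the columns that gives \<open>xs\<close>.\<close>
  define vv where "vv xs = (SOME v. (\<forall>b. v b \<in> carrier R) \<and> xs = vec (cmp v))" for xs
  have vv: "\<forall>b. vv xs b \<in> carrier R" "\<And>j. j < m \<Longrightarrow> cmp (vv xs) j = xs ! j" if "xs \<in> W" for xs
  proof -
    have "\<exists>v. (\<forall>b. v b \<in> carrier R) \<and> xs = vec (cmp v)" using that by (auto simp: W_def)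
    then have "(\<forall>b. vv xs b \<in> carrier R) \<and> xs = vec (cmp (vv xs))"
      unfolding vv_def by (rule someI_ex)
    then show "\<forall>b. vv xs b \<in> carrier R" "\<And>j. j < m \<Longrightarrow> cmp (vv xs) j = xs ! j"       by (auto, metis vec_nth)
  qed
  have RW: "right_module R (L W)"
  proof (rule L_right_module[OF WV])
    show "vec (\<lambda>_. \<zero>\<^bsub>R\<^esub>) \<in> W"
      by (rule W_mem[of "\<lambda>_. \<zero>\<^bsub>R\<^esub>"]) (use z in \<open>auto simp: cmp_def intro!: N.R.add.finprod_one_eqI[symmetric]\<close>)
    show "vec (\<lambda>j. xs ! j \<oplus>\<^bsub>R\<^esub> ys ! j) \<in> W" if "xs \<in> W" "ys \<in> W" for xs ys
      by (rule W_mem[of "\<lambda>b. vv xs b \<oplus>\<^bsub>R\<^esub> vv ys b"]) (use vv that in \<open>auto simp: cmp_add\<close>)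
    show "vec (\<lambda>j. xs ! j \<otimes>\<^bsub>R\<^esub> r) \<in> W" if "xs \<in> W" "r \<in> carrier R" for xs r
      by (rule W_mem[of "\<lambda>b. vv xs b \<otimes>\<^bsub>R\<^esub> r"]) (use vv that in \<open>auto simp: cmp_smult\<close>)
  qed
  have RV: "right_module R (L V)"
    by (rule L_right_module) (use Vn in \<open>auto simp: V_def\<close>)
  interpret TW: tensor_pair R "L W" N using RW N by (intro tensor_pair.intro)
  interpret TV: tensor_pair R "L V" N using RV N by (intro tensor_pair.intro)
  let ?f = "\<lambda>xs\<in>carrier (L W). xs"
  have f: "?f \<in> rmod_hom R (L W) (L V)" "inj_on ?f (carrier (L W))" "rlinear_on R (L W) (L V) ?f"
    using WV TW.A.M.a_closed TW.A.rsmult_closed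
    by (auto simp: rmod_hom_def L_def inj_on_def rlinear_on_def)
  have inj: "inj_on (tensor_map R (L V) N ?f (\<lambda>n. n)) (carrier (tensor_group R (L W) N))"
    using flat RW RV f(1,2) unfolding flat_left_module_def by blast
  define col where "col b = vec (\<lambda>j. z j b)" for b
  define \<delta> where "\<delta> b b' = (if b = b' then \<one>\<^bsub>R\<^esub> else \<zero>\<^bsub>R\<^esub>)" for b b' :: 'n
  have cmp_\<delta>: "cmp (\<delta> b) j = z j b" if "b \<in> S" "j < m" for b j
  proof -
    have "cmp (\<delta> b) j = (\<Oplus>\<^bsub>R\<^esub>b'\<in>S. if b = b' then z j b' else \<zero>\<^bsub>R\<^esub>)"
      unfolding cmp_def using that z by (intro N.R.finsum_cong') (auto simp: \<delta>_def)
    also have "\<dots> = z j b" using that z S by (intro N.R.add.finprod_singleton) auto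
    finally show ?thesis .
  qed
  have colW: "col b \<in> W" if "b \<in> S" for b
    unfolding col_def by (rule W_mem[of "\<delta> b"]) (use that cmp_\<delta> in \<open>auto simp: \<delta>_def\<close>)
  define c where "c = (\<Sum>b\<in>S. frag_of (col b, b))"
  have keys_c: "Poly_Mapping.keys c \<subseteq> TW.base"
    unfolding c_def using sum_closed_free_Abelian_group[of S "\<lambda>b. frag_of (col b, b)" TW.base] colW S(2)
    by (auto simp: L_def)

  \<comment> \<open>In the free module of columns the element \<open>c\<close> vanishes, because of the given relations.\<close>
  define e where "e j = vec (\<lambda>i. if i = j then \<one>\<^bsub>R\<^esub> else \<zero>\<^bsub>R\<^esub>)" for j
  have eV: "e j \<in> carrier (L V)" for j by (auto simp: e_def L_def V_def)
  have expand: "frag_of (vec (\<lambda>i. if i < k then f i else \<zero>\<^bsub>R\<^esub>), n) - (\<Sum>j<k. frag_of (e j, f j \<odot>\<^bsub>N\<^esub> n)) \<in> TV.rel"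
    if "k \<le> m" "\<forall>j<m. f j \<in> carrier R" "n \<in> carrier N" for k f n
    using that(1)
  proof (induction k)
    case 0
    then show ?case using TV.rel_zerol[OF that(3)] by (simp add: L_def)
  next
    case (Suc k)
    let ?t = "\<lambda>k. vec (\<lambda>i. if i < k then f i else \<zero>\<^bsub>R\<^esub>)"
    have t: "?t k \<in> carrier (L V)" using that(2) by (auto simp: L_def V_def)
    have fk: "f k \<in> carrier R" using Suc that by simp
    have "?t (Suc k) = ?t k \<oplus>\<^bsub>L V\<^esub> rsmult (L V) (e k) (f k)"
      using that(2) fk by (auto simp: L_def e_def vec_eq less_Suc_eq)
    then have "frag_of (?t (Suc k), n) - frag_of (?t k, n) - frag_of (rsmult (L V) (e k) (f k), n) \<in> TV.rel"
      using TV.rel_addl[OF t TV.A.rsmult_closed[OF fk eV] that(3)] by simp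
    from TV.rel_add[OF TV.rel_add[OF this TV.rel_bal[OF eV[of k] fk that(3)]] Suc.IH] Suc.prems
    show ?case by (simp add: algebra_simps)
  qed
  have expand_col: "frag_of (col b, b) - (\<Sum>j<m. frag_of (e j, z j b \<odot>\<^bsub>N\<^esub> b)) \<in> TV.rel" if "b \<in> S" for b
  proof -
    have "col b = vec (\<lambda>i. if i < m then z i b else \<zero>\<^bsub>R\<^esub>)" by (simp add: col_def vec_eq)
    then show ?thesis using expand[of m "\<lambda>j. z j b" b] that z S(2) by auto
  qed
  have zb: "(\<lambda>b. z j b \<odot>\<^bsub>N\<^esub> b) \<in> S \<rightarrow> carrier N" if "j < m" for j
    using that z S(2) by (auto intro!: N.smult_closed)
  have rows: "(\<Sum>b\<in>S. frag_of (e j, z j b \<odot>\<^bsub>N\<^esub> b)) \<in> TV.rel" if "j < m" for j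
    using TV.rel_diff[OF TV.rel_zeror[OF eV] TV.rel_finsum[OF S(1) eV zb[OF that]], of j j] rel[OF that] by simp
  have "(\<Sum>b\<in>S. frag_of (col b, b) - (\<Sum>j<m. frag_of (e j, z j b \<odot>\<^bsub>N\<^esub> b))) +
      (\<Sum>j<m. \<Sum>b\<in>S. frag_of (e j, z j b \<odot>\<^bsub>N\<^esub> b)) \<in> TV.rel"
    by (intro TV.rel_add TV.rel_sum expand_col rows) auto
  also have "(\<Sum>b\<in>S. frag_of (col b, b) - (\<Sum>j<m. frag_of (e j, z j b \<odot>\<^bsub>N\<^esub> b))) +
      (\<Sum>j<m. \<Sum>b\<in>S. frag_of (e j, z j b \<odot>\<^bsub>N\<^esub> b)) = c"
    unfolding c_def sum_subtractf by (subst sum.swap) simp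
  finally have cV: "c \<in> TV.rel" .
  have "frag_extend (\<lambda>(a, b). frag_of (?f a, b)) c = c"
    unfolding c_def using colW S(1) by (auto simp: frag_extend_sum L_def intro!: sum.cong)
  then have "tensor_map R (L V) N ?f (\<lambda>n. n) (TW.cls c) = TV.cls c"
    using tensor_map_cls(1)[OF TW.tensor_pair_axioms TV.tensor_pair_axioms f(3) linear_on_id keys_c] by simp
  moreover have "tensor_map R (L V) N ?f (\<lambda>n. n) (TW.cls 0) = TV.cls 0"
    using tensor_map_cls(1)[OF TW.tensor_pair_axioms TV.tensor_pair_axioms f(3) linear_on_id, of 0] by simp
  moreover have "TV.cls c = TV.cls 0" using cV by (simp add: TV.cls_eq_iff)
  ultimately have eq: "tensor_map R (L V) N ?f (\<lambda>n. n) (TW.cls c) = tensor_map R (L V) N ?f (\<lambda>n. n) (TW.cls 0)"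
    by simp
  have "TW.cls c = TW.cls 0"
  proof (rule inj_onD[OF inj eq])
    show "TW.cls c \<in> carrier (tensor_group R (L W) N)"
      unfolding TW.carrier_tensor_group using keys_c by blast
    show "TW.cls 0 \<in> carrier (tensor_group R (L W) N)"
      unfolding TW.carrier_tensor_group by (rule imageI) simp
  qed
  then have cW: "c \<in> TW.rel" by (simp add: TW.cls_eq_iff)

  \<comment> \<open>The element \<open>w \<otimes> n\<close> has the \<open>m\<close> coordinates \<open>w\<^sub>j [n]\<close> in the free module on \<open>N\<close>. For each bilinearity
    relation \<open>c\<close> in \<open>W \<otimes> N\<close> the coordinates \<open>\<theta> j c\<close> are combinations, with the coefficients \<open>z\<close>, of
    elements \<open>\<tau> b\<close> that vanish in \<open>N\<close>. For the sum \<open>c\<close> of the tensors \<open>col b \<otimes> b\<close> the coordinates are also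
    the combinations of the generators \<open>[b]\<close>, so the elements \<open>[b] - \<tau> b\<close> have the required properties.\<close>
  define \<theta> where "\<theta> j = frag_lift F TW.base (\<lambda>(xs, n). xs ! j \<odot>\<^bsub>F\<^esub> free_gen R n)" for j
  have gF: "free_gen R n \<in> carrier F" if "n \<in> carrier N" for n
    unfolding F_def by (rule free_gen_closed[OF N.R.ring_axioms that])
  have Fy: "\<tau> y \<in> carrier R" if "\<tau> \<in> carrier F" for \<tau> y using that by (simp add: F_def free_mod_carrier_iff)
  have W: "carrier (L W) = W" by (simp add: L_def)
  have Wn: "xs ! j \<in> carrier R" if "xs \<in> W" "j < m" for xs j using that WV Vn by blast
  have \<theta>cl: "(\<lambda>(xs, n). xs ! j \<odot>\<^bsub>F\<^esub> free_gen R n) \<in> TW.base \<rightarrow> carrier F" if "j < m" for j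
    using Wn[OF _ that] gF by (auto simp: W intro!: F.smult_closed)
  note \<theta>_add = frag_lift_add[OF F.M.abelian_group_axioms \<theta>cl, folded \<theta>_def]
    and \<theta>_neg = frag_lift_neg[OF F.M.abelian_group_axioms \<theta>cl, folded \<theta>_def]
    and \<theta>_diff = frag_lift_diff[OF F.M.abelian_group_axioms \<theta>cl, folded \<theta>_def]
    and \<theta>_zero = frag_lift_zero[OF F.M.abelian_group_axioms \<theta>cl, folded \<theta>_def]
    and \<theta>_closed = frag_lift_closed[OF F.M.abelian_group_axioms \<theta>cl, folded \<theta>_def]
  have \<theta>_gen: "\<theta> j (frag_of (xs, n)) = xs ! j \<odot>\<^bsub>F\<^esub> free_gen R n" if "j < m" "xs \<in> W" "n \<in> carrier N" for j xs n
    using frag_lift_gen[OF F.M.abelian_group_axioms \<theta>cl[OF that(1)], of "(xs, n)"] that by (simp add: \<theta>_def W)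
  define good where "good c \<tau> \<longleftrightarrow> (\<forall>b. \<tau> b \<in> carrier F \<and> fe (\<tau> b) = \<zero>\<^bsub>N\<^esub>) \<and>
      (\<forall>j<m. \<forall>y. cmp (\<lambda>b. \<tau> b y) j = \<theta> j c y)" for c \<tau>
  have good_e: "\<exists>\<tau>. good c \<tau>"
    if "xs \<in> W" "e \<in> carrier F" "fe e = \<zero>\<^bsub>N\<^esub>" "\<And>j. j < m \<Longrightarrow> \<theta> j c = xs ! j \<odot>\<^bsub>F\<^esub> e" for xs e c
  proof -
    have "good c (\<lambda>b. vv xs b \<odot>\<^bsub>F\<^esub> e)"
      using that vv[OF that(1)] cmp_smult[OF _ vv(1)[OF that(1)] Fy[OF that(2)]]
      by (auto simp: good_def F.smult_closed linear_on_smult[OF fe] N.smult_zero_right) (simp add: F_def free_mod_simps)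
    then show ?thesis by blast
  qed
  have W0: "\<zero>\<^bsub>L W\<^esub> \<in> W" using TW.A.M.zero_closed unfolding W .
  have fe0: "fe \<zero>\<^bsub>F\<^esub> = \<zero>\<^bsub>N\<^esub>" by (rule linear_on_zero[OF F.left_module_axioms N fe])
  have good_zero: "\<exists>\<tau>. good c \<tau>" if "\<And>j. j < m \<Longrightarrow> \<theta> j c = \<zero>\<^bsub>F\<^esub>" for c
    by (rule good_e[OF W0 F.M.zero_closed fe0]) (use that Wn[OF W0] in \<open>simp add: F.smult_zero_right\<close>)
  have "\<exists>\<tau>. good c \<tau>"
    using cW
  proof (induction c rule: TW.rel_induct)
    case zero
    show ?case by (rule good_zero) (rule \<theta>_zero)
  next
    case (add c d)
    then obtain \<tau> \<tau>' where t: "good c \<tau>" "good d \<tau>'" by blast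
    have "good (c + d) (\<lambda>b. \<tau> b \<oplus>\<^bsub>F\<^esub> \<tau>' b)"
      unfolding good_def
    proof (intro conjI allI impI)
      fix j y assume j: "j < m"
      have "(\<tau> b \<oplus>\<^bsub>F\<^esub> \<tau>' b) y = \<tau> b y \<oplus>\<^bsub>R\<^esub> \<tau>' b y" "(\<theta> j c \<oplus>\<^bsub>F\<^esub> \<theta> j d) y = \<theta> j c y \<oplus>\<^bsub>R\<^esub> \<theta> j d y" for b
        by (simp_all add: F_def free_mod_simps)
      then show "cmp (\<lambda>b. (\<tau> b \<oplus>\<^bsub>F\<^esub> \<tau>' b) y) j = \<theta> j (c + d) y"
        using t j cmp_add[OF j, of "\<lambda>b. \<tau> b y" "\<lambda>b. \<tau>' b y"] Fy \<theta>_add[OF j add(1,2)] by (simp add: good_def)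
    qed (use t in \<open>simp_all add: good_def linear_on_add[OF fe]\<close>)
    then show ?case by blast
  next
    case (minus c)
    then obtain \<tau> where t: "good c \<tau>" by blast
    have "good (- c) (\<lambda>b. \<ominus>\<^bsub>F\<^esub> \<tau> b)"
      unfolding good_def
    proof (intro conjI allI impI)
      fix j y assume j: "j < m"
      have "(\<ominus>\<^bsub>F\<^esub> \<tau> b) y = \<tau> b y \<otimes>\<^bsub>R\<^esub> \<ominus>\<^bsub>R\<^esub> \<one>\<^bsub>R\<^esub>" for b
        using t Fy[of "\<tau> b" y] free_mod_uminus[OF N.R.ring_axioms, of "\<tau> b"] by (simp add: good_def F_def N.R.r_minus)
      moreover have "(\<ominus>\<^bsub>F\<^esub> \<theta> j c) y = \<theta> j c y \<otimes>\<^bsub>R\<^esub> \<ominus>\<^bsub>R\<^esub> \<one>\<^bsub>R\<^esub>"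
        using Fy[OF \<theta>_closed[OF j minus(1)], of y] \<theta>_closed[OF j minus(1)] free_mod_uminus[OF N.R.ring_axioms, of "\<theta> j c"]
        by (simp add: F_def N.R.r_minus)
      ultimately show "cmp (\<lambda>b. (\<ominus>\<^bsub>F\<^esub> \<tau> b) y) j = \<theta> j (- c) y"
        using t j cmp_smult[OF j, of "\<lambda>b. \<tau> b y" "\<ominus>\<^bsub>R\<^esub> \<one>\<^bsub>R\<^esub>"] Fy \<theta>_neg[OF j minus(1)] by (simp add: good_def)
    qed (use t in \<open>simp_all add: good_def linear_on_minus[OF F.left_module_axioms N fe]\<close>)
    then show ?case by blast
  next
    case (addl xs ys n)
    let ?s = "xs \<oplus>\<^bsub>L W\<^esub> ys"
    have w: "xs \<in> W" "ys \<in> W" "?s \<in> W" "n \<in> carrier N" using addl TW.A.M.a_closed[of xs ys] by (auto simp: W)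
    show ?case
    proof (rule good_zero)
      fix j assume j: "j < m"
      let ?g = "free_gen R n"
      have "\<theta> j (frag_of (?s, n) - frag_of (xs, n) - frag_of (ys, n)) = ?s ! j \<odot>\<^bsub>F\<^esub> ?g \<ominus>\<^bsub>F\<^esub> xs ! j \<odot>\<^bsub>F\<^esub> ?g \<ominus>\<^bsub>F\<^esub> ys ! j \<odot>\<^bsub>F\<^esub> ?g"
        using w by (simp add: \<theta>_diff[OF j] \<theta>_gen[OF j] keys_diff_subset W)
      also have "?s ! j = xs ! j \<oplus>\<^bsub>R\<^esub> ys ! j" using j by (simp add: L_def)
      finally show "\<theta> j (frag_of (?s, n) - frag_of (xs, n) - frag_of (ys, n)) = \<zero>\<^bsub>F\<^esub>"
        using Wn[OF w(1) j] Wn[OF w(2) j] gF[OF w(4)] F.smult_closed[OF Wn[OF w(1) j] gF[OF w(4)]] F.smult_closed[OF Wn[OF w(2) j] gF[OF w(4)]]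
        by (simp add: F.smult_l_distr F.M.add_minus_minus)
    qed
  next
    case (addr xs n n')
    then have w: "xs \<in> W" by (simp add: W)
    let ?g = "free_gen R n" and ?g' = "free_gen R n'" and ?s = "free_gen R (n \<oplus>\<^bsub>N\<^esub> n')"
    have g: "?g \<in> carrier F" "?g' \<in> carrier F" "?s \<in> carrier F" using addr by (auto intro: gF)
    show ?case
    proof (rule good_e[OF w, of "?s \<ominus>\<^bsub>F\<^esub> ?g \<ominus>\<^bsub>F\<^esub> ?g'"])
      show "fe (?s \<ominus>\<^bsub>F\<^esub> ?g \<ominus>\<^bsub>F\<^esub> ?g') = \<zero>\<^bsub>N\<^esub>"
        using g addr by (simp add: linear_on_diff[OF F.left_module_axioms N fe] fe_gen N.M.add_minus_minus)
      show "\<theta> j (frag_of (xs, n \<oplus>\<^bsub>N\<^esub> n') - frag_of (xs, n) - frag_of (xs, n')) = xs ! j \<odot>\<^bsub>F\<^esub> (?s \<ominus>\<^bsub>F\<^esub> ?g \<ominus>\<^bsub>F\<^esub> ?g')"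
        if j: "j < m" for j
        using w addr g Wn[OF w j] F.smult_minus_right[OF Wn[OF w j]]
        by (simp add: \<theta>_diff[OF j] \<theta>_gen[OF j] keys_diff_subset W) (simp add: a_minus_def F.smult_r_distr)
    qed (use g in simp)
  next
    case (bal xs r n)
    let ?s = "rsmult (L W) xs r"
    have w: "xs \<in> W" "?s \<in> W" "n \<in> carrier N" "r \<in> carrier R" "r \<odot>\<^bsub>N\<^esub> n \<in> carrier N"
      using bal TW.A.rsmult_closed[of r xs] by (auto simp: W N.smult_closed)
    let ?e = "r \<odot>\<^bsub>F\<^esub> free_gen R n \<ominus>\<^bsub>F\<^esub> free_gen R (r \<odot>\<^bsub>N\<^esub> n)"
    have g: "free_gen R n \<in> carrier F" "r \<odot>\<^bsub>F\<^esub> free_gen R n \<in> carrier F" "free_gen R (r \<odot>\<^bsub>N\<^esub> n) \<in> carrier F"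
      using w by (auto intro!: gF F.smult_closed)
    show ?case
    proof (rule good_e[OF w(1), of ?e])
      show "fe ?e = \<zero>\<^bsub>N\<^esub>"
        using g w by (simp add: linear_on_diff[OF F.left_module_axioms N fe] linear_on_smult[OF fe] fe_gen)
          (simp add: a_minus_def N.M.r_neg)
      show "\<theta> j (frag_of (?s, n) - frag_of (xs, r \<odot>\<^bsub>N\<^esub> n)) = xs ! j \<odot>\<^bsub>F\<^esub> ?e" if j: "j < m" for j
      proof -
        have "?s ! j = xs ! j \<otimes>\<^bsub>R\<^esub> r" using j by (simp add: L_def)
        then show ?thesis
          using w g Wn[OF w(1) j] F.smult_minus_right[OF Wn[OF w(1) j]]
          by (simp add: \<theta>_diff[OF j] \<theta>_gen[OF j] W a_minus_def F.smult_r_distr F.smult_assoc1)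
      qed
    qed (use g in simp)
  qed
  then obtain \<tau> where \<tau>: "\<And>b. \<tau> b \<in> carrier F" "\<And>b. fe (\<tau> b) = \<zero>\<^bsub>N\<^esub>" "\<And>j y. j < m \<Longrightarrow> cmp (\<lambda>b. \<tau> b y) j = \<theta> j c y"
    unfolding good_def by blast
  have gR: "free_gen R b y \<in> carrier R" for b y :: 'n by (simp add: free_gen_def)
  have \<theta>c: "\<theta> j (\<Sum>b\<in>I. frag_of (col b, b)) y = (\<Oplus>\<^bsub>R\<^esub>b\<in>I. z j b \<otimes>\<^bsub>R\<^esub> free_gen R b y)" if j: "j < m" and "I \<subseteq> S" for I j y
    using finite_subset[OF that(2) S(1)] that(2)
  proof (induction I)
    case empty
    then show ?case using \<theta>_zero[OF j] by (simp add: F_def free_mod_simps)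
  next
    case (insert i I)
    have i: "col i \<in> W" "i \<in> carrier N" "col i ! j = z j i" using colW S(2) insert.prems j by (auto simp: col_def)
    have k: "Poly_Mapping.keys (\<Sum>b\<in>I. frag_of (col b, b)) \<subseteq> TW.base"
      using sum_closed_free_Abelian_group[of I "\<lambda>b. frag_of (col b, b)" TW.base] colW S(2) insert.prems by (auto simp: W)
    have cl: "(\<lambda>b. z j b \<otimes>\<^bsub>R\<^esub> free_gen R b y) \<in> I \<rightarrow> carrier R" "z j i \<otimes>\<^bsub>R\<^esub> free_gen R i y \<in> carrier R"
      using z[OF j] gR insert.prems by auto
    have "\<theta> j (\<Sum>b\<in>insert i I. frag_of (col b, b)) = z j i \<odot>\<^bsub>F\<^esub> free_gen R i \<oplus>\<^bsub>F\<^esub> \<theta> j (\<Sum>b\<in>I. frag_of (col b, b))"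
      using insert.hyps i k by (simp add: \<theta>_add[OF j] \<theta>_gen[OF j] W)
    then show ?case using insert cl by (simp add: F_def free_mod_simps N.R.finsum_insert)
  qed
  show ?thesis
  proof (rule that[of "\<lambda>b. free_gen R b \<ominus>\<^bsub>F\<^esub> \<tau> b", folded F_def fe_def])
    fix b assume "b \<in> S"
    then have b: "b \<in> carrier N" "free_gen R b \<in> carrier F" using S(2) gF by auto
    then show "free_gen R b \<ominus>\<^bsub>F\<^esub> \<tau> b \<in> carrier F" using \<tau>(1) by simp
    show "fe (free_gen R b \<ominus>\<^bsub>F\<^esub> \<tau> b) = b"
      using b \<tau> by (simp add: linear_on_diff[OF F.left_module_axioms N fe] fe_gen) (simp add: a_minus_def)
  next
    fix j y assume j: "j < m"
    have "(\<Oplus>\<^bsub>R\<^esub>b\<in>S. z j b \<otimes>\<^bsub>R\<^esub> (free_gen R b \<ominus>\<^bsub>F\<^esub> \<tau> b) y) = cmp (\<lambda>b. free_gen R b y \<ominus>\<^bsub>R\<^esub> \<tau> b y) j"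
      unfolding cmp_def
    proof (rule N.R.finsum_cong')
      fix b assume "b \<in> S"
      then have "(free_gen R b \<ominus>\<^bsub>F\<^esub> \<tau> b) y = free_gen R b y \<ominus>\<^bsub>R\<^esub> \<tau> b y"
        using \<tau>(1) gF S(2) unfolding F_def by (intro free_mod_minus[OF N.R.ring_axioms]) auto
      then show "z j b \<otimes>\<^bsub>R\<^esub> (free_gen R b \<ominus>\<^bsub>F\<^esub> \<tau> b) y = z j b \<otimes>\<^bsub>R\<^esub> (free_gen R b y \<ominus>\<^bsub>R\<^esub> \<tau> b y)" by simp
    qed (use z[OF j] gR Fy[OF \<tau>(1)] in auto)
    also have "\<dots> = cmp (\<lambda>b. free_gen R b y) j \<ominus>\<^bsub>R\<^esub> cmp (\<lambda>b. \<tau> b y) j"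
      by (rule cmp_minus[OF j]) (use gR Fy[OF \<tau>(1)] in auto)
    also have "cmp (\<lambda>b. free_gen R b y) j = \<theta> j c y" using \<theta>c[OF j subset_refl] by (simp add: cmp_def c_def)
    finally show "(\<Oplus>\<^bsub>R\<^esub>b\<in>S. z j b \<otimes>\<^bsub>R\<^esub> (free_gen R b \<ominus>\<^bsub>F\<^esub> \<tau> b) y) = \<zero>\<^bsub>R\<^esub>"
      using \<tau>(3)[OF j] Fy[OF \<theta>_closed[OF j keys_c]] by (simp add: a_minus_def N.R.r_neg)
  qed
qed

section \<open>Ring epimorphisms\<close>

lemma right_of_simps:
  "carrier (right_of E) = carrier E" "\<zero>\<^bsub>right_of E\<^esub> = \<zero>\<^bsub>E\<^esub>"
  "x \<oplus>\<^bsub>right_of E\<^esub> y = x \<oplus>\<^bsub>E\<^esub> y" "rsmult (right_of E) x r = ract E x r"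
  by (simp_all add: right_of_def)

lemma restr_bimod_simps:
  "carrier (restr_bimod U u) = carrier U" "\<zero>\<^bsub>restr_bimod U u\<^esub> = \<zero>\<^bsub>U\<^esub>"
  "x \<oplus>\<^bsub>restr_bimod U u\<^esub> y = x \<oplus>\<^bsub>U\<^esub> y" "r \<odot>\<^bsub>restr_bimod U u\<^esub> x = u r \<otimes>\<^bsub>U\<^esub> x"
  "ract (restr_bimod U u) x r = x \<otimes>\<^bsub>U\<^esub> u r"
  by (simp_all add: restr_bimod_def)

locale ring_map = ring_hom_ring R U u for R :: "'r ring" and U :: "'u ring" (structure) and u
begin

abbreviation "UU \<equiv> restr_bimod U u"
abbreviation "UR \<equiv> right_of UU"

lemma restr_left_module: "left_module R UU"
proof -
  have "abelian_group UU"
    by (rule abelian_groupI)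
      (auto simp: restr_bimod_simps S.a_ac intro!: bexI[of _ "\<ominus> _"] S.l_neg)
  then show ?thesis
    by (intro left_module.intro R.ring_axioms left_module_axioms.intro)
      (auto simp: restr_bimod_simps S.l_distr S.r_distr S.m_assoc)
qed

lemma restr_right_module: "right_module R UR"
proof -
  have "abelian_group UR"
    by (rule abelian_groupI)
      (auto simp: restr_bimod_simps right_of_simps S.a_ac intro!: bexI[of _ "\<ominus> _"] S.l_neg)
  then show ?thesis
    by (intro right_module.intro R.ring_axioms right_module_axioms.intro)
      (auto simp: restr_bimod_simps right_of_simps S.l_distr S.r_distr S.m_assoc)
qed

lemma restr_tensor_pair: "left_module R N \<Longrightarrow> tensor_pair R UR N"
  using restr_right_module by (intro tensor_pair.intro)

lemma lmult_rlinear: "x \<in> carrier U \<Longrightarrow> rlinear_on R UR UR (\<lambda>a. x \<otimes> a)"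
  by (simp add: rlinear_on_def restr_bimod_simps right_of_simps S.r_distr S.m_assoc)

lemma rmult_linear: "x \<in> carrier U \<Longrightarrow> linear_on R UU UU (\<lambda>a. a \<otimes> x)"
  by (simp add: linear_on_def restr_bimod_simps S.l_distr S.m_assoc)

lemma restr_tensor_left_module:
  assumes "left_module R N"
  shows "left_module U (tensor_act_mod R UR N (\<lambda>x a. x \<otimes> a))"
  by (rule tensor_pair.tensor_act_mod_left_module[OF restr_tensor_pair[OF assms] S.ring_axioms lmult_rlinear])
    (auto simp: restr_bimod_simps right_of_simps S.l_distr S.m_assoc)

text \<open>
  The derivation \<open>x \<mapsto> x \<otimes> 1 - 1 \<otimes> x\<close> vanishes on the image of an epimorphism \<open>u\<close>. It therefore
  vanishes, because \<open>x \<mapsto> (x, 0)\<close> and \<open>x \<mapsto> (x, d x)\<close> are homomorphisms into the trivial extension of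
  \<open>U\<close> by \<open>U \<otimes>\<^sub>R U\<close> that agree on the image of \<open>u\<close>. The elements of the trivial extension are encoded
  as lists because epimorphisms are tested against rings carried by lists.
\<close>

lemma epimorphism_tens_commute:
  assumes epi: "ring_epimorphism R U u" and x: "x \<in> carrier U"
  shows "tens R UR UU x \<one> = tens R UR UU \<one> x"
proof -
  interpret T: tensor_pair R UR UU by (rule restr_tensor_pair[OF restr_left_module])
  define T where "T = tensor_act_mod R UR UU (\<lambda>x a. x \<otimes> a)"
  interpret L: left_module U T unfolding T_def by (rule restr_tensor_left_module[OF restr_left_module])
  note smult_T = L.smult_closed
  define ra where "ra y = tensor_map R UR UU (\<lambda>a. a) (\<lambda>b. b \<otimes> y)" for y
  let ?t = "tens R UR UU"
  note ax = T.tensor_pair_axioms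
  have UUc: "x \<in> carrier UU" "x \<in> carrier UR" if "x \<in> carrier U" for x
    using that by (simp_all add: restr_bimod_simps right_of_simps)
  have tcl: "?t a b \<in> carrier T" if "a \<in> carrier U" "b \<in> carrier U" for a b
    unfolding T_def using UUc that by (intro T.tens_closed)
  have taddl: "?t (a \<oplus> a') b = ?t a b \<oplus>\<^bsub>T\<^esub> ?t a' b" if "a \<in> carrier U" "a' \<in> carrier U" "b \<in> carrier U" for a a' b
    using T.tens_addl[of a a' b, where act = "\<lambda>x a. x \<otimes> a"] UUc that
    by (simp add: T_def restr_bimod_simps right_of_simps)
  have taddr: "?t a (b \<oplus> b') = ?t a b \<oplus>\<^bsub>T\<^esub> ?t a b'" if "a \<in> carrier U" "b \<in> carrier U" "b' \<in> carrier U" for a b b'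
    using T.tens_addr[of a b b', where act = "\<lambda>x a. x \<otimes> a"] UUc that
    by (simp add: T_def restr_bimod_simps right_of_simps)
  have tbal: "?t (a \<otimes> u r) b = ?t a (u r \<otimes> b)" if "a \<in> carrier U" "r \<in> carrier R" "b \<in> carrier U" for a r b
    using T.tens_bal[of a r b] UUc that by (simp add: restr_bimod_simps right_of_simps)
  have la_t: "x \<odot>\<^bsub>T\<^esub> ?t a b = ?t (x \<otimes> a) b" if "x \<in> carrier U" "a \<in> carrier U" "b \<in> carrier U" for x a b
    unfolding T_def tensor_act_mod_def
    using tensor_map_tens[OF ax ax lmult_rlinear[OF that(1)] linear_on_id UUc(2)[OF that(2)] UUc(1)[OF that(3)]] by simp
  have ra_t: "ra y (?t a b) = ?t a (b \<otimes> y)" if "y \<in> carrier U" "a \<in> carrier U" "b \<in> carrier U" for y a b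
    unfolding ra_def
    using tensor_map_tens[OF ax ax rlinear_on_id rmult_linear[OF that(1)] UUc(2)[OF that(2)] UUc(1)[OF that(3)]] by simp
  have ra_cl: "ra y t \<in> carrier T" if "y \<in> carrier U" "t \<in> carrier T" for y t
    unfolding ra_def T_def
    by (rule tensor_map_closed[OF ax ax rlinear_on_id rmult_linear[OF that(1)] that(2)[unfolded T_def]])
  have ra_add: "ra y (s \<oplus>\<^bsub>T\<^esub> t) = ra y s \<oplus>\<^bsub>T\<^esub> ra y t" if "y \<in> carrier U" "s \<in> carrier T" "t \<in> carrier T" for y s t
    unfolding ra_def T_def
    by (rule tensor_map_add[OF ax ax rlinear_on_id rmult_linear[OF that(1)] that(2,3)[unfolded T_def]])
  note T_eqI = T.tensor_hom_eq[where act = "\<lambda>x a. x \<otimes> a" and G = T, folded T_def, unfolded restr_bimod_simps right_of_simps]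
  have ra_addl: "ra (y \<oplus> y') t = ra y t \<oplus>\<^bsub>T\<^esub> ra y' t" if "y \<in> carrier U" "y' \<in> carrier U" "t \<in> carrier T" for y y' t
    by (rule T_eqI[OF that(3)])
      (use that in \<open>simp_all add: ra_add ra_cl ra_t taddr tcl S.r_distr L.M.add_add_swap\<close>)
  have ra_mult: "ra (y \<otimes> y') t = ra y' (ra y t)" if "y \<in> carrier U" "y' \<in> carrier U" "t \<in> carrier T" for y y' t
    by (rule T_eqI[OF that(3)]) (use that in \<open>simp_all add: ra_add ra_cl ra_t S.m_assoc\<close>)
  have ra_one: "ra \<one> t = t" if "t \<in> carrier T" for t
    by (rule T_eqI[OF that]) (simp_all add: ra_add ra_t)
  have la_ra: "ra y (x \<odot>\<^bsub>T\<^esub> t) = x \<odot>\<^bsub>T\<^esub> ra y t" if "x \<in> carrier U" "y \<in> carrier U" "t \<in> carrier T" for x y t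
    by (rule T_eqI[OF that(3)]) (use that in \<open>simp_all add: ra_add ra_cl ra_t la_t smult_T L.smult_r_distr\<close>)
  have ra_zero: "ra y \<zero>\<^bsub>T\<^esub> = \<zero>\<^bsub>T\<^esub>" if "y \<in> carrier U" for y
    using ra_add[OF that, of "\<zero>\<^bsub>T\<^esub>" "\<zero>\<^bsub>T\<^esub>"] ra_cl[OF that, of "\<zero>\<^bsub>T\<^esub>"] by (simp add: L.M.add.l_cancel_one')
  have ra_minus: "ra y (\<ominus>\<^bsub>T\<^esub> t) = \<ominus>\<^bsub>T\<^esub> ra y t" if "y \<in> carrier U" "t \<in> carrier T" for y t
    using ra_add[OF that(1), of "\<ominus>\<^bsub>T\<^esub> t" t] ra_cl[OF that(1)] that
    by (intro L.M.minus_equality[symmetric]) (simp_all add: L.M.l_neg ra_zero)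

  \<comment> \<open>The trivial extension of \<open>U\<close> by \<open>U \<otimes>\<^sub>R U\<close>.\<close>
  define E :: "('u \<times> ('u \<times> 'u \<Rightarrow>\<^sub>0 int) set) ring" where
    "E = \<lparr>carrier = carrier U \<times> carrier T,
        monoid.mult = (\<lambda>(x, t) (x', t'). (x \<otimes> x', x \<odot>\<^bsub>T\<^esub> t' \<oplus>\<^bsub>T\<^esub> ra x' t)), monoid.one = (\<one>, \<zero>\<^bsub>T\<^esub>),
        ring.zero = (\<zero>, \<zero>\<^bsub>T\<^esub>), ring.add = (\<lambda>(x, t) (x', t'). (x \<oplus> x', t \<oplus>\<^bsub>T\<^esub> t'))\<rparr>"
  have E: "ring E"
  proof (rule ringI)
    show "abelian_group E"
    proof (rule abelian_groupI)
      fix p assume "p \<in> carrier E"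
      then obtain x t where p: "p = (x, t)" "x \<in> carrier U" "t \<in> carrier T" by (auto simp: E_def)
      show "\<exists>q\<in>carrier E. q \<oplus>\<^bsub>E\<^esub> p = \<zero>\<^bsub>E\<^esub>"
        by (rule bexI[of _ "(\<ominus> x, \<ominus>\<^bsub>T\<^esub> t)"]) (use p in \<open>auto simp: E_def S.l_neg L.M.l_neg\<close>)
    qed (auto simp: E_def S.a_ac L.M.a_ac)
    show "monoid E"
    proof (rule monoidI)
      fix p q s assume "p \<in> carrier E" "q \<in> carrier E" "s \<in> carrier E"
      then show "p \<otimes>\<^bsub>E\<^esub> q \<otimes>\<^bsub>E\<^esub> s = p \<otimes>\<^bsub>E\<^esub> (q \<otimes>\<^bsub>E\<^esub> s)"
        by (auto simp: E_def S.m_assoc smult_T ra_cl ra_add L.smult_r_distr L.smult_assoc1 ra_mult la_ra L.M.a_assoc)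
    qed (auto simp: E_def smult_T ra_cl ra_one ra_zero L.smult_one L.smult_zero_right)
  qed (auto simp: E_def S.l_distr S.r_distr smult_T ra_cl ra_add ra_addl L.smult_l_distr L.smult_r_distr L.M.add_add_swap)

  define ev where "ev = (\<lambda>ps. foldr (\<lambda>(a, b) s. ?t a b \<oplus>\<^bsub>T\<^esub> s) ps \<zero>\<^bsub>T\<^esub>)"
  have ev_cl: "ev ps \<in> carrier T" if "set ps \<subseteq> carrier U \<times> carrier U" for ps
    using that by (induction ps) (auto simp: ev_def tcl)
  have ev_app: "ev (ps @ qs) = ev ps \<oplus>\<^bsub>T\<^esub> ev qs"
    if "set ps \<subseteq> carrier U \<times> carrier U" "set qs \<subseteq> carrier U \<times> carrier U" for ps qs
    using that(1)
  proof (induction ps)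
    case Nil
    then show ?case using ev_cl[OF that(2)] by (simp add: ev_def)
  next
    case (Cons p ps)
    then show ?case
      using ev_cl[of ps] ev_cl[OF that(2)] by (cases p) (auto simp: ev_def L.M.a_assoc tcl)
  qed
  have ev_surj: "\<exists>ps. set ps \<subseteq> carrier U \<times> carrier U \<and> ev ps = t" if "t \<in> carrier T" for t
    using that unfolding T_def
  proof (induction t rule: T.tensor_induct)
    case (tens a b)
    then show ?case
      by (intro exI[of _ "[(a, b)]"]) (simp add: ev_def tcl restr_bimod_simps right_of_simps)
  next
    case (add s t)
    then show ?case using ev_app unfolding T_def by (metis le_sup_iff set_append)
  qed
  define enc1 where "enc1 t = (SOME ps. set ps \<subseteq> carrier U \<times> carrier U \<and> ev ps = t)" for t
  have enc1: "ev (enc1 t) = t" if "t \<in> carrier T" for t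
    using someI_ex[OF ev_surj[OF that]] unfolding enc1_def by blast
  define fl :: "('u \<times> 'u) list \<Rightarrow> 'u list" where "fl ps = concat (map (\<lambda>(a, b). [a, b]) ps)" for ps
  have fl_inj: "fl ps = fl qs \<Longrightarrow> ps = qs" for ps qs
  proof (induction ps arbitrary: qs)
    case Nil
    then show ?case by (cases qs) (auto simp: fl_def)
  next
    case (Cons p ps)
    then show ?case by (cases p; cases qs) (auto simp: fl_def)
  qed
  define enc where "enc = (\<lambda>(x, t). x # fl (enc1 t))"
  have enc: "inj_on enc (carrier E)"
  proof (rule inj_onI)
    fix p q assume pq: "p \<in> carrier E" "q \<in> carrier E" "enc p = enc q"
    obtain x t y s where *: "p = (x, t)" "q = (y, s)" by (cases p, cases q)
    with pq have "t \<in> carrier T" "s \<in> carrier T" "x = y" "fl (enc1 t) = fl (enc1 s)" by (auto simp: E_def enc_def)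
    then show "p = q" using fl_inj[of "enc1 t" "enc1 s"] enc1 * by metis
  qed
  define d where "d x = ?t x \<one> \<ominus>\<^bsub>T\<^esub> ?t \<one> x" for x
  have d_cl: "d x \<in> carrier T" if "x \<in> carrier U" for x using that by (simp add: d_def tcl)
  have d_add: "d (x \<oplus> y) = d x \<oplus>\<^bsub>T\<^esub> d y" if "x \<in> carrier U" "y \<in> carrier U" for x y
    using that by (simp add: d_def a_minus_def taddl taddr tcl L.M.minus_add L.M.add_add_swap)
  have d_mult: "d (x \<otimes> y) = x \<odot>\<^bsub>T\<^esub> d y \<oplus>\<^bsub>T\<^esub> ra y (d x)" if "x \<in> carrier U" "y \<in> carrier U" for x y
  proof -
    have "x \<odot>\<^bsub>T\<^esub> d y = ?t (x \<otimes> y) \<one> \<oplus>\<^bsub>T\<^esub> \<ominus>\<^bsub>T\<^esub> ?t x y"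
      using that by (simp add: d_def a_minus_def L.smult_r_distr tcl L.smult_minus_right la_t)
    moreover have "ra y (d x) = ?t x y \<oplus>\<^bsub>T\<^esub> \<ominus>\<^bsub>T\<^esub> ?t \<one> (x \<otimes> y)"
      using that by (simp add: d_def a_minus_def ra_add tcl ra_minus ra_t)
    ultimately show ?thesis
      using that tcl[of x y] tcl[of "x \<otimes> y" "\<one>"] tcl[of "\<one>" "x \<otimes> y"]
      by (simp add: d_def a_minus_def L.M.a_assoc L.M.r_neg1)
  qed
  have d_u: "d (u r) = \<zero>\<^bsub>T\<^esub>" if "r \<in> carrier R" for r
    using tbal[of "\<one>" r "\<one>"] that by (simp add: d_def a_minus_def L.M.r_neg tcl)
  have v: "(\<lambda>x. (x, \<zero>\<^bsub>T\<^esub>)) \<in> ring_hom U E"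
    by (rule ring_hom_memI) (auto simp: E_def L.smult_zero_right ra_zero)
  have w: "(\<lambda>x. (x, d x)) \<in> ring_hom U E"
    using d_u[of "\<one>\<^bsub>R\<^esub>"] by (intro ring_hom_memI) (auto simp: E_def d_cl d_add d_mult)
  have iso: "enc \<in> ring_hom E (image_ring enc E)"
    using inj_imp_image_ring_iso[OF enc] by (simp add: ring_iso_def)
  have "ring (image_ring enc E)" by (rule ring.inj_imp_image_ring_is_ring[OF E enc])
  moreover have "enc \<circ> (\<lambda>x. (x, \<zero>\<^bsub>T\<^esub>)) \<in> ring_hom U (image_ring enc E)" "enc \<circ> (\<lambda>x. (x, d x)) \<in> ring_hom U (image_ring enc E)"
    using ring_hom_trans[OF v iso] ring_hom_trans[OF w iso] .
  moreover have "\<forall>r\<in>carrier R. (enc \<circ> (\<lambda>x. (x, \<zero>\<^bsub>T\<^esub>))) (u r) = (enc \<circ> (\<lambda>x. (x, d x))) (u r)"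
    by (simp add: d_u)
  ultimately have "(enc \<circ> (\<lambda>x. (x, \<zero>\<^bsub>T\<^esub>))) x = (enc \<circ> (\<lambda>x. (x, d x))) x"
    using epi x unfolding ring_epimorphism_def by blast
  then have "(x, \<zero>\<^bsub>T\<^esub>) = (x, d x)" using x d_cl by (intro inj_onD[OF enc]) (auto simp: E_def)
  then have "?t x \<one> \<ominus>\<^bsub>T\<^esub> ?t \<one> x = \<zero>\<^bsub>T\<^esub>" by (simp add: d_def)
  then show ?thesis using tcl[of x "\<one>"] tcl[of "\<one>" x] x by (simp add: L.M.minus_eq_zero_iff)
qed

end

section \<open>The Gabriel topology of a flat epimorphism\<close>

context ring_map
begin

abbreviation "FU \<equiv> free_mod R (carrier U)"
abbreviation "augU \<equiv> aug R UU"

lemma FU_left_module: "left_module R FU"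
  by (rule free_mod_left_module[OF R.ring_axioms])

lemma FU_F0: "F0 R UU = FU"
  by (simp add: F0_def restr_bimod_simps)

lemma augU_linear: "linear_on R FU UU augU"
  using aug_linear[OF restr_left_module] by (simp add: FU_F0)

lemma augU_closed: "\<alpha> \<in> carrier FU \<Longrightarrow> augU \<alpha> \<in> carrier U"
  using linear_on_closed[OF augU_linear] by (simp add: restr_bimod_simps)

lemma augU_gen: "x \<in> carrier U \<Longrightarrow> augU (free_gen R x) = x"
  using aug_gen[OF restr_left_module] by (simp add: restr_bimod_simps)

lemma FU_gen: "x \<in> carrier U \<Longrightarrow> free_gen R x \<in> carrier FU"
  by (rule free_gen_closed[OF R.ring_axioms])

lemma FU_apply: "\<alpha> \<in> carrier FU \<Longrightarrow> \<alpha> y \<in> carrier R"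
  by (simp add: free_mod_carrier_iff)

lemma finsum_restr:
  assumes "f \<in> S \<rightarrow> carrier U"
  shows "finsum UU f S = finsum U f S"
proof -
  interpret L: left_module R UU by (rule restr_left_module)
  show ?thesis
    using assms
  proof (induction S rule: infinite_finite_induct)
    case (insert i S)
    then have "f i \<in> carrier U" "f \<in> S \<rightarrow> carrier U" by auto
    moreover then have "f i \<in> carrier UU" "f \<in> S \<rightarrow> carrier UU" by (simp_all add: restr_bimod_simps)
    ultimately show ?case using insert by (simp add: L.M.finsum_insert S.finsum_insert restr_bimod_simps)
  qed (simp_all add: L.M.finsum_infinite S.finsum_infinite restr_bimod_simps)
qed

lemma augU_sum:
  assumes "\<alpha> \<in> carrier FU" "finite S" "{y. \<alpha> y \<noteq> \<zero>\<^bsub>R\<^esub>} \<subseteq> S" "S \<subseteq> carrier U"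
  shows "augU \<alpha> = (\<Oplus>y\<in>S. u (\<alpha> y) \<otimes> y)"
proof -
  have "augU \<alpha> = (\<Oplus>\<^bsub>UU\<^esub>y\<in>S. \<alpha> y \<odot>\<^bsub>UU\<^esub> y)"
    unfolding aug_def
    by (rule free_ext_superset[OF restr_left_module assms(1) _ assms(2-4)]) (auto simp: restr_bimod_simps)
  also have "\<dots> = (\<Oplus>y\<in>S. u (\<alpha> y) \<otimes> y)"
    using assms(4) FU_apply[OF assms(1)] by (subst finsum_restr) (auto simp: restr_bimod_simps)
  finally show ?thesis .
qed

text \<open>
  \<open>I U = U\<close>, expressed by a combination with coefficients in \<open>I\<close>.
\<close>

definition spanning :: "'r set \<Rightarrow> bool" where
  "spanning I \<longleftrightarrow> (\<exists>\<alpha>\<in>carrier FU. (\<forall>y. \<alpha> y \<in> I) \<and> augU \<alpha> = \<one>)"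

text \<open>The right ideal \<open>I U\<close> of \<open>U\<close>.\<close>

definition ext_ideal :: "'r set \<Rightarrow> 'u set" where
  "ext_ideal I = {x. \<exists>\<alpha>\<in>carrier FU. (\<forall>y. \<alpha> y \<in> I) \<and> augU \<alpha> = x}"

lemma spanning_iff: "spanning I \<longleftrightarrow> \<one> \<in> ext_ideal I"
  by (auto simp: spanning_def ext_ideal_def)

lemma ext_ideal_closed: "x \<in> ext_ideal I \<Longrightarrow> x \<in> carrier U"
  using augU_closed by (auto simp: ext_ideal_def)

context
  fixes I
  assumes I: "right_ideal R I"
begin

interpretation additive_subgroup I R
  using I by (simp add: right_ideal_def)

interpretation F: left_module R FU
  by (rule FU_left_module)

lemma ext_ideal_zero: "\<zero> \<in> ext_ideal I"
  unfolding ext_ideal_def using linear_on_zero[OF FU_left_module restr_left_module augU_linear]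
  by (auto intro!: bexI[of _ "\<zero>\<^bsub>FU\<^esub>"] simp: restr_bimod_simps) (simp add: free_mod_simps)

lemma ext_ideal_add:
  assumes xx: "x \<in> ext_ideal I" "x' \<in> ext_ideal I"
  shows "x \<oplus> x' \<in> ext_ideal I"
proof -
  obtain \<alpha> \<beta> where *: "\<alpha> \<in> carrier FU" "\<forall>y. \<alpha> y \<in> I" "augU \<alpha> = x" "\<beta> \<in> carrier FU" "\<forall>y. \<beta> y \<in> I" "augU \<beta> = x'"
    using xx unfolding ext_ideal_def by blast
  then show ?thesis
    unfolding ext_ideal_def
    by (auto intro!: bexI[of _ "\<alpha> \<oplus>\<^bsub>FU\<^esub> \<beta>"] simp: linear_on_add[OF augU_linear] restr_bimod_simps)
      (simp add: free_mod_simps)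
qed

lemma ext_ideal_uminus:
  assumes xx: "x \<in> ext_ideal I"
  shows "\<ominus> x \<in> ext_ideal I"
proof -
  obtain \<alpha> where *: "\<alpha> \<in> carrier FU" "\<forall>y. \<alpha> y \<in> I" "augU \<alpha> = x" using xx unfolding ext_ideal_def by blast
  have "augU (\<ominus>\<^bsub>FU\<^esub> \<alpha>) = \<ominus> x"
  proof -
    have "augU (\<ominus>\<^bsub>FU\<^esub> \<alpha>) \<oplus> augU \<alpha> = augU (\<ominus>\<^bsub>FU\<^esub> \<alpha> \<oplus>\<^bsub>FU\<^esub> \<alpha>)"
      using *(1) by (simp add: linear_on_add[OF augU_linear] restr_bimod_simps)
    also have "\<dots> = \<zero>"
      using *(1) linear_on_zero[OF FU_left_module restr_left_module augU_linear]
      by (simp add: F.M.l_neg restr_bimod_simps)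
    finally show ?thesis
      using S.minus_equality[of "augU (\<ominus>\<^bsub>FU\<^esub> \<alpha>)" "augU \<alpha>"] *(3) augU_closed[OF *(1)]
        augU_closed[OF F.M.a_inv_closed[OF *(1)]] by simp
  qed
  then show ?thesis
    unfolding ext_ideal_def using *
    by (auto intro!: bexI[of _ "\<ominus>\<^bsub>FU\<^esub> \<alpha>"] simp: free_mod_uminus[OF R.ring_axioms])
qed

lemma ext_ideal_gen:
  assumes "i \<in> I" "x \<in> carrier U"
  shows "u i \<otimes> x \<in> ext_ideal I"
proof -
  have "i \<odot>\<^bsub>FU\<^esub> free_gen R x \<in> carrier FU" "augU (i \<odot>\<^bsub>FU\<^esub> free_gen R x) = u i \<otimes> x"
    using assms FU_gen[OF assms(2)]
    by (auto intro!: F.smult_closed simp: linear_on_smult[OF augU_linear] augU_gen restr_bimod_simps)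
  moreover have "(i \<odot>\<^bsub>FU\<^esub> free_gen R x) y \<in> I" for y
    using I assms(1) by (auto simp: free_mod_simps free_gen_def right_ideal_def)
  ultimately show ?thesis unfolding ext_ideal_def by blast
qed

end

lemma rquot_right_module:
  assumes "right_ideal R I"
  shows "right_module R (ring_rquot R I)"
proof -
  have I: "additive_subgroup I R" and Ir: "\<And>i r. \<lbrakk>i \<in> I; r \<in> carrier R\<rbrakk> \<Longrightarrow> i \<otimes>\<^bsub>R\<^esub> r \<in> I"
    using assms by (auto simp: right_ideal_def)
  note ag = R.abelian_group_axioms
  interpret I: additive_subgroup I R by fact
  let ?q = "\<lambda>x. I +>\<^bsub>R\<^esub> x"
  have c: "carrier (ring_rquot R I) = ?q ` carrier R" by (auto simp: ring_rquot_def rcosets_iff)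
  have add: "?q x \<oplus>\<^bsub>ring_rquot R I\<^esub> ?q y = ?q (x \<oplus>\<^bsub>R\<^esub> y)" if "x \<in> carrier R" "y \<in> carrier R" for x y
    using coset_add[OF ag I that] by (simp add: ring_rquot_def)
  have zero: "\<zero>\<^bsub>ring_rquot R I\<^esub> = ?q \<zero>\<^bsub>R\<^esub>" using coset_zero[OF ag I] by (simp add: ring_rquot_def)
  have sm: "rsmult (ring_rquot R I) (?q x) r = ?q (x \<otimes>\<^bsub>R\<^esub> r)" if "x \<in> carrier R" "r \<in> carrier R" for x r
    unfolding ring_rquot_def rmodule.simps
    by (rule coset_map_coset[OF ag I ag I]) (use that Ir in \<open>auto simp: R.l_distr\<close>)
  have "abelian_group (ring_rquot R I)"
  proof (rule abelian_groupI)
    fix C assume "C \<in> carrier (ring_rquot R I)"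
    then obtain x where x: "C = ?q x" "x \<in> carrier R" by (auto simp: c)
    show "\<exists>D\<in>carrier (ring_rquot R I). D \<oplus>\<^bsub>ring_rquot R I\<^esub> C = \<zero>\<^bsub>ring_rquot R I\<^esub>"
      by (rule bexI[of _ "?q (\<ominus>\<^bsub>R\<^esub> x)"]) (use x in \<open>auto simp: c add zero R.l_neg\<close>)
  qed (auto simp: c add zero R.a_ac)
  then show ?thesis
    by (intro right_module.intro R.ring_axioms right_module_axioms.intro)
      (auto simp: c add sm R.l_distr R.r_distr R.m_assoc)
qed

text \<open>
  This is the isomorphism of \<open>R/I \<otimes>\<^sub>R U\<close> with \<open>U/IU\<close>. Only the vanishing of the two sides is
  compared: if \<open>1 \<otimes> 1\<close> is zero, then so is its image \<open>1\<close> in \<open>U/IU\<close>. Conversely, if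
  \<open>1 = \<Sum> u (\<alpha> y) y\<close> with coefficients in \<open>I\<close>, then \<open>1 \<otimes> x\<close> is the sum of the \<open>\<alpha> y \<otimes> y x = 0\<close>.
\<close>

lemma gabriel_iff: "I \<in> gabriel R U u \<longleftrightarrow> right_ideal R I \<and> spanning I"
proof (cases "right_ideal R I")
  case True
  have I: "additive_subgroup I R" and Ir: "\<And>i r. \<lbrakk>i \<in> I; r \<in> carrier R\<rbrakk> \<Longrightarrow> i \<otimes>\<^bsub>R\<^esub> r \<in> I"
    using True by (auto simp: right_ideal_def)
  note ag = R.abelian_group_axioms
  interpret I: additive_subgroup I R by fact
  interpret Q: right_module R "ring_rquot R I" by (rule rquot_right_module[OF True])
  interpret T: tensor_pair R "ring_rquot R I" UU
    by (intro tensor_pair.intro restr_left_module Q.right_module_axioms)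
  interpret F: left_module R FU by (rule FU_left_module)
  let ?q = "\<lambda>x. I +>\<^bsub>R\<^esub> x"
  have c: "carrier (ring_rquot R I) = ?q ` carrier R" by (auto simp: ring_rquot_def rcosets_iff)
  have zero: "\<zero>\<^bsub>ring_rquot R I\<^esub> = I" by (simp add: ring_rquot_def)
  have addq: "?q x \<oplus>\<^bsub>ring_rquot R I\<^esub> ?q y = ?q (x \<oplus>\<^bsub>R\<^esub> y)" if "x \<in> carrier R" "y \<in> carrier R" for x y
    using coset_add[OF ag I that] by (simp add: ring_rquot_def)
  have sm: "rsmult (ring_rquot R I) (?q x) r = ?q (x \<otimes>\<^bsub>R\<^esub> r)" if "x \<in> carrier R" "r \<in> carrier R" for x r
    unfolding ring_rquot_def rmodule.simps
    by (rule coset_map_coset[OF ag I ag I]) (use that Ir in \<open>auto simp: R.l_distr\<close>)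
  define act where "act = (\<lambda>(_::unit) (x::'r set). x)"
  have one_mem: "?q \<one>\<^bsub>R\<^esub> \<in> carrier (ring_rquot R I)" by (simp add: c)
  show ?thesis
  proof
    assume "I \<in> gabriel R U u"
    then have triv: "carrier (tensor_group R (ring_rquot R I) UU) = {\<one>\<^bsub>tensor_group R (ring_rquot R I) UU\<^esub>}"
      by (simp add: gabriel_def)
    have "tens R (ring_rquot R I) UU (?q \<one>\<^bsub>R\<^esub>) \<one> \<in> carrier (tensor_group R (ring_rquot R I) UU)"
      using T.tens_closed[of "?q \<one>\<^bsub>R\<^esub>" "\<one>" act] one_mem by (simp add: tensor_act_mod_def restr_bimod_simps)
    then have rel: "frag_of (?q \<one>\<^bsub>R\<^esub>, \<one>) \<in> T.rel"
      using triv by (simp add: T.one_tensor_group T.tens_eq_cls T.cls_eq_iff)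
    note H0 = ext_ideal_zero[OF True] and Hadd = ext_ideal_add[OF True] and Hneg = ext_ideal_uminus[OF True]
      and Hgen = ext_ideal_gen[OF True]
    define rep where "rep C = (SOME x. x \<in> carrier R \<and> C = ?q x)" for C
    have rep: "rep C \<in> carrier R" "?q (rep C) = C" if "C \<in> carrier (ring_rquot R I)" for C
    proof -
      have "\<exists>x. x \<in> carrier R \<and> C = ?q x" using that by (auto simp: c)
      from someI_ex[OF this] show "rep C \<in> carrier R" "?q (rep C) = C" unfolding rep_def by auto
    qed
    have cl: "(\<lambda>(C, x). u (rep C) \<otimes> x) \<in> T.base \<rightarrow> carrier U"
      using rep by (auto simp: restr_bimod_simps)
    define h where "h = frag_lift U T.base (\<lambda>(C, x). u (rep C) \<otimes> x)"
    note h_add = frag_lift_add[OF S.abelian_group_axioms cl, folded h_def]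
      and h_neg = frag_lift_neg[OF S.abelian_group_axioms cl, folded h_def]
      and h_diff = frag_lift_diff[OF S.abelian_group_axioms cl, folded h_def]
      and h_zero = frag_lift_zero[OF S.abelian_group_axioms cl, folded h_def]
    have h_gen: "h (frag_of (C, x)) = u (rep C) \<otimes> x" if "C \<in> carrier (ring_rquot R I)" "x \<in> carrier U" for C x
      using frag_lift_gen[OF S.abelian_group_axioms cl, of "(C, x)"] that by (simp add: h_def restr_bimod_simps)
    have "h c \<in> ext_ideal I" if "c \<in> T.rel" for c
      using that
    proof (induction c rule: T.rel_induct)
      case (addl C D x)
      let ?s = "C \<oplus>\<^bsub>ring_rquot R I\<^esub> D"
      have s: "?s \<in> carrier (ring_rquot R I)" "x \<in> carrier U" using addl by (auto simp: restr_bimod_simps)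
      have r: "rep C \<in> carrier R" "rep D \<in> carrier R" "rep ?s \<in> carrier R" using rep addl s by auto
      have "?q (rep ?s) = ?q (rep C \<oplus>\<^bsub>R\<^esub> rep D)"
        using rep[OF s(1)] rep[OF addl(1)] rep[OF addl(2)] addq[OF r(1,2)] by simp
      then have i: "rep ?s \<ominus>\<^bsub>R\<^esub> (rep C \<oplus>\<^bsub>R\<^esub> rep D) \<in> I" using r by (simp add: coset_eq_iff[OF ag I])
      have "h (frag_of (?s, x) - frag_of (C, x) - frag_of (D, x)) = u (rep ?s \<ominus>\<^bsub>R\<^esub> (rep C \<oplus>\<^bsub>R\<^esub> rep D)) \<otimes> x"
        using addl s r
        by (simp add: h_diff h_gen keys_diff_subset restr_bimod_simps a_minus_def S.l_distr S.minus_add S.l_minus S.a_assoc)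
      then show ?case using Hgen[OF i s(2)] by simp
    next
      case (addr C x x')
      then have x: "x \<in> carrier U" "x' \<in> carrier U" and r: "rep C \<in> carrier R" using rep by (auto simp: restr_bimod_simps)
      have "h (frag_of (C, x \<oplus>\<^bsub>UU\<^esub> x') - frag_of (C, x) - frag_of (C, x')) = \<zero>"
        using addr x r
        by (simp add: h_diff h_gen keys_diff_subset restr_bimod_simps a_minus_def S.r_distr S.a_ac S.r_neg S.r_neg1 S.r_neg2)
      then show ?case using H0 by simp
    next
      case (bal C r x)
      let ?s = "rsmult (ring_rquot R I) C r"
      have s: "?s \<in> carrier (ring_rquot R I)" "x \<in> carrier U" using bal Q.rsmult_closed by (auto simp: restr_bimod_simps)
      have r: "rep C \<in> carrier R" "rep ?s \<in> carrier R" using rep bal s by auto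
      have "?q (rep ?s) = ?q (rep C \<otimes>\<^bsub>R\<^esub> r)"
        using rep[OF s(1)] rep[OF bal(1)] sm[OF r(1) bal(2)] by simp
      then have i: "rep ?s \<ominus>\<^bsub>R\<^esub> rep C \<otimes>\<^bsub>R\<^esub> r \<in> I" using r bal(2) by (simp add: coset_eq_iff[OF ag I])
      have "h (frag_of (?s, x) - frag_of (C, r \<odot>\<^bsub>UU\<^esub> x)) = u (rep ?s \<ominus>\<^bsub>R\<^esub> rep C \<otimes>\<^bsub>R\<^esub> r) \<otimes> x"
        using bal s r
        by (simp add: h_diff h_gen restr_bimod_simps a_minus_def S.l_distr S.l_minus S.m_assoc)
      then show ?case using Hgen[OF i s(2)] by simp
    qed (auto simp: h_zero h_add h_neg H0 Hadd Hneg)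
    from this[OF rel] have h1: "u (rep (?q \<one>\<^bsub>R\<^esub>)) \<in> ext_ideal I"
      using rep(1)[OF one_mem] one_mem by (simp add: h_gen)
    have "\<one>\<^bsub>R\<^esub> \<ominus>\<^bsub>R\<^esub> rep (?q \<one>\<^bsub>R\<^esub>) \<in> I"
      using rep[OF one_mem] by (simp add: coset_eq_iff[OF ag I, symmetric])
    then have "u (\<one>\<^bsub>R\<^esub> \<ominus>\<^bsub>R\<^esub> rep (?q \<one>\<^bsub>R\<^esub>)) \<otimes> \<one> \<in> ext_ideal I" by (rule Hgen) simp
    then have "u (\<one>\<^bsub>R\<^esub> \<ominus>\<^bsub>R\<^esub> rep (?q \<one>\<^bsub>R\<^esub>)) \<in> ext_ideal I" using rep(1)[OF one_mem] by simp
    from Hadd[OF this h1] have "\<one> \<in> ext_ideal I"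
      using rep(1)[OF one_mem] by (simp add: a_minus_def S.a_assoc S.l_neg)
    then show "right_ideal R I \<and> spanning I" using True by (simp add: spanning_iff)
  next
    assume "right_ideal R I \<and> spanning I"
    then obtain \<alpha> where \<alpha>: "\<alpha> \<in> carrier FU" "\<forall>y. \<alpha> y \<in> I" "augU \<alpha> = \<one>" by (auto simp: spanning_def)
    let ?S = "{y. \<alpha> y \<noteq> \<zero>\<^bsub>R\<^esub>}"
    have S: "finite ?S" "?S \<subseteq> carrier U" using \<alpha>(1) by (auto simp: free_mod_carrier_iff)
    let ?t = "tens R (ring_rquot R I) UU"
    interpret TA: abelian_group "T.TA act" by (rule T.tensor_act_mod_abelian_group)
    have one: "?t (?q \<one>\<^bsub>R\<^esub>) x = \<zero>\<^bsub>T.TA act\<^esub>" if x: "x \<in> carrier U" for x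
    proof -
      have y: "y \<otimes> x \<in> carrier UU" if "y \<in> ?S" for y using S(2) x that by (auto simp: restr_bimod_simps)
      have *: "?t (?q \<one>\<^bsub>R\<^esub>) (\<alpha> y \<odot>\<^bsub>UU\<^esub> (y \<otimes> x)) = \<zero>\<^bsub>T.TA act\<^esub>" if "y \<in> ?S" for y
      proof -
        have \<alpha>y: "\<alpha> y \<in> carrier R" "\<alpha> y \<in> I" using FU_apply[OF \<alpha>(1)] \<alpha>(2) by auto
        have "?t (?q \<one>\<^bsub>R\<^esub>) (\<alpha> y \<odot>\<^bsub>UU\<^esub> (y \<otimes> x)) = ?t (rsmult (ring_rquot R I) (?q \<one>\<^bsub>R\<^esub>) (\<alpha> y)) (y \<otimes> x)"
          by (rule T.tens_bal[symmetric, OF one_mem \<alpha>y(1) y[OF that]])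
        also have "rsmult (ring_rquot R I) (?q \<one>\<^bsub>R\<^esub>) (\<alpha> y) = \<zero>\<^bsub>ring_rquot R I\<^esub>"
          using \<alpha>y coset_eq_iff[OF ag I, of "\<alpha> y" "\<zero>\<^bsub>R\<^esub>"] coset_zero[OF ag I] by (simp add: sm zero a_minus_def)
        finally show ?thesis using y[OF that] by (simp add: T.tens_zerol)
      qed
      have x': "x = (\<Oplus>\<^bsub>UU\<^esub>y\<in>?S. \<alpha> y \<odot>\<^bsub>UU\<^esub> (y \<otimes> x))"
      proof -
        have "x = (\<Oplus>y\<in>?S. u (\<alpha> y) \<otimes> y) \<otimes> x"
          using x \<alpha>(3) augU_sum[OF \<alpha>(1) S(1) subset_refl S(2)] by simp
        also have "\<dots> = (\<Oplus>y\<in>?S. u (\<alpha> y) \<otimes> y \<otimes> x)"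
          using S x FU_apply[OF \<alpha>(1)] by (intro S.finsum_ldistr) auto
        also have "\<dots> = (\<Oplus>y\<in>?S. u (\<alpha> y) \<otimes> (y \<otimes> x))"
          using S x FU_apply[OF \<alpha>(1)] by (intro S.finsum_cong') (auto simp: S.m_assoc)
        finally show ?thesis
          using S x FU_apply[OF \<alpha>(1)] by (subst finsum_restr) (auto simp: restr_bimod_simps)
      qed
      have "?t (?q \<one>\<^bsub>R\<^esub>) (\<Oplus>\<^bsub>UU\<^esub>y\<in>I'. \<alpha> y \<odot>\<^bsub>UU\<^esub> (y \<otimes> x)) = \<zero>\<^bsub>T.TA act\<^esub>" if "finite I'" "I' \<subseteq> ?S" for I'
        using that
      proof (induction I')
        case empty
        then show ?case using T.tens_zeror[OF one_mem] by simp
      next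
        case (insert i I')
        have cl: "\<alpha> y \<odot>\<^bsub>UU\<^esub> (y \<otimes> x) \<in> carrier UU" if "y \<in> ?S" for y
          using y[OF that] T.B.smult_closed[OF FU_apply[OF \<alpha>(1)]] by blast
        have "?t (?q \<one>\<^bsub>R\<^esub>) (\<Oplus>\<^bsub>UU\<^esub>y\<in>insert i I'. \<alpha> y \<odot>\<^bsub>UU\<^esub> (y \<otimes> x))
            = ?t (?q \<one>\<^bsub>R\<^esub>) (\<alpha> i \<odot>\<^bsub>UU\<^esub> (i \<otimes> x) \<oplus>\<^bsub>UU\<^esub> (\<Oplus>\<^bsub>UU\<^esub>y\<in>I'. \<alpha> y \<odot>\<^bsub>UU\<^esub> (y \<otimes> x)))"
          using insert cl by (subst T.B.M.finsum_insert) auto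
        also have "\<dots> = ?t (?q \<one>\<^bsub>R\<^esub>) (\<alpha> i \<odot>\<^bsub>UU\<^esub> (i \<otimes> x)) \<oplus>\<^bsub>T.TA act\<^esub> ?t (?q \<one>\<^bsub>R\<^esub>) (\<Oplus>\<^bsub>UU\<^esub>y\<in>I'. \<alpha> y \<odot>\<^bsub>UU\<^esub> (y \<otimes> x))"
          using insert cl one_mem by (intro T.tens_addr T.B.M.finsum_closed) auto
        also have "\<dots> = \<zero>\<^bsub>T.TA act\<^esub>" using insert * by auto
        finally show ?case .
      qed
      from this[OF S(1) subset_refl] show ?thesis using x' by simp
    qed
    have "t = \<zero>\<^bsub>T.TA act\<^esub>" if "t \<in> carrier (T.TA act)" for t
      using that
    proof (induction t rule: T.tensor_induct)
      case (tens C x)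
      then obtain r where r: "C = ?q r" "r \<in> carrier R" and x: "x \<in> carrier U" by (auto simp: c restr_bimod_simps)
      have "?t C x = ?t (rsmult (ring_rquot R I) (?q \<one>\<^bsub>R\<^esub>) r) x" using r by (simp add: sm)
      also have "\<dots> = ?t (?q \<one>\<^bsub>R\<^esub>) (r \<odot>\<^bsub>UU\<^esub> x)" by (rule T.tens_bal[OF one_mem r(2) tens(2)])
      also have "\<dots> = \<zero>\<^bsub>T.TA act\<^esub>" using one[of "r \<odot>\<^bsub>UU\<^esub> x"] r x by (simp add: restr_bimod_simps)
      finally show ?case .
    qed simp
    then have "carrier (T.TA act) = {\<zero>\<^bsub>T.TA act\<^esub>}" using TA.zero_closed by blast
    then show "I \<in> gabriel R U u" using True by (simp add: gabriel_def tensor_act_mod_def)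
  qed
qed (simp add: gabriel_def)

end

lemma right_idealI:
  assumes "ring R" "I \<subseteq> carrier R" "\<zero>\<^bsub>R\<^esub> \<in> I"
    and "\<And>a b. \<lbrakk>a \<in> I; b \<in> I\<rbrakk> \<Longrightarrow> a \<oplus>\<^bsub>R\<^esub> b \<in> I"
    and mult: "\<And>a r. \<lbrakk>a \<in> I; r \<in> carrier R\<rbrakk> \<Longrightarrow> a \<otimes>\<^bsub>R\<^esub> r \<in> I"
  shows "right_ideal R I"
proof -
  interpret R: ring R by fact
  have neg: "\<ominus>\<^bsub>R\<^esub> a \<in> I" if "a \<in> I" for a
    using mult[OF that, of "\<ominus>\<^bsub>R\<^esub> \<one>\<^bsub>R\<^esub>"] subsetD[OF assms(2) that] by (simp add: R.r_minus)
  have "subgroup I (add_monoid R)"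
  proof (rule R.add.subgroupI)
    show "I \<noteq> {}" using assms(3) by blast
  qed (use assms neg in auto)
  then show ?thesis using mult by (simp add: right_ideal_def additive_subgroupI)
qed

lemma right_idealD:
  assumes "right_ideal R I"
  shows "I \<subseteq> carrier R" "\<zero>\<^bsub>R\<^esub> \<in> I" "\<And>a b. \<lbrakk>a \<in> I; b \<in> I\<rbrakk> \<Longrightarrow> a \<oplus>\<^bsub>R\<^esub> b \<in> I"
    "\<And>a r. \<lbrakk>a \<in> I; r \<in> carrier R\<rbrakk> \<Longrightarrow> a \<otimes>\<^bsub>R\<^esub> r \<in> I"
proof -
  interpret additive_subgroup I R using assms by (simp add: right_ideal_def)
  show "I \<subseteq> carrier R" "\<zero>\<^bsub>R\<^esub> \<in> I" "\<And>a b. \<lbrakk>a \<in> I; b \<in> I\<rbrakk> \<Longrightarrow> a \<oplus>\<^bsub>R\<^esub> b \<in> I"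
    using a_subset by auto
  show "\<And>a r. \<lbrakk>a \<in> I; r \<in> carrier R\<rbrakk> \<Longrightarrow> a \<otimes>\<^bsub>R\<^esub> r \<in> I"
    using assms by (simp add: right_ideal_def)
qed

lemma sub_left_module:
  assumes "left_module R M" "C \<subseteq> carrier M" "\<zero>\<^bsub>M\<^esub> \<in> C"
    and add: "\<And>x y. \<lbrakk>x \<in> C; y \<in> C\<rbrakk> \<Longrightarrow> x \<oplus>\<^bsub>M\<^esub> y \<in> C"
    and smult: "\<And>r x. \<lbrakk>r \<in> carrier R; x \<in> C\<rbrakk> \<Longrightarrow> r \<odot>\<^bsub>M\<^esub> x \<in> C"
  shows "left_module R (M\<lparr>carrier := C\<rparr>)"
proof -
  interpret M: left_module R M by fact
  note C = subsetD[OF assms(2)]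
  have "abelian_group (M\<lparr>carrier := C\<rparr>)"
  proof (rule abelian_groupI)
    fix x assume x: "x \<in> carrier (M\<lparr>carrier := C\<rparr>)"
    have "\<ominus>\<^bsub>M\<^esub> x \<in> C" using smult[of "\<ominus>\<^bsub>R\<^esub> \<one>\<^bsub>R\<^esub>" x] x C by (simp add: M.smult_minus_left M.smult_one)
    with x show "\<exists>y\<in>carrier (M\<lparr>carrier := C\<rparr>). y \<oplus>\<^bsub>M\<lparr>carrier := C\<rparr>\<^esub> x = \<zero>\<^bsub>M\<lparr>carrier := C\<rparr>\<^esub>"
      by (intro bexI[of _ "\<ominus>\<^bsub>M\<^esub> x"]) (simp_all add: M.M.l_neg C)
  qed (use assms C in \<open>auto simp: M.M.a_ac\<close>)
  then show ?thesis
    by (intro left_module.intro M.R.ring_axioms left_module_axioms.intro)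
      (use smult C in \<open>auto simp: M.smult_l_distr M.smult_r_distr M.smult_assoc1 M.smult_one\<close>)
qed

context ring_map
begin

abbreviation supp :: "('u \<Rightarrow> 'r) \<Rightarrow> 'u set" where "supp \<alpha> \<equiv> {y. \<alpha> y \<noteq> \<zero>\<^bsub>R\<^esub>}"

lemma supp_finite: "\<alpha> \<in> carrier FU \<Longrightarrow> finite (supp \<alpha>)"
  and supp_carrier: "\<alpha> \<in> carrier FU \<Longrightarrow> supp \<alpha> \<subseteq> carrier U"
  by (auto simp: free_mod_carrier_iff)

lemma FU_I: "\<lbrakk>\<And>y. \<alpha> y \<in> carrier R; finite S; S \<subseteq> carrier U; supp \<alpha> \<subseteq> S\<rbrakk> \<Longrightarrow> \<alpha> \<in> carrier FU"
  by (auto simp: free_mod_carrier_iff intro: finite_subset)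

lemma u_finsum: "f \<in> I \<rightarrow> carrier R \<Longrightarrow> u (\<Oplus>\<^bsub>R\<^esub>i\<in>I. f i) = (\<Oplus>i\<in>I. u (f i))"
proof (induction I rule: infinite_finite_induct)
  case (insert i I)
  then have *: "f \<in> I \<rightarrow> carrier R" "f i \<in> carrier R" by auto
  then have "(\<lambda>i. u (f i)) \<in> I \<rightarrow> carrier U" by (auto simp: Pi_iff)
  with insert * show ?case by simp
qed simp_all

text \<open>
  If \<open>\<tau>\<close> represents \<open>x \<alpha>\<close> coefficientwise in \<open>U\<close>, then \<open>\<tau>\<close> evaluates to \<open>x\<close> times the value of \<open>\<alpha>\<close>. In
  particular \<open>\<tau>\<close> evaluates to \<open>x\<close> when \<open>\<alpha>\<close> is a combination for \<open>1\<close>, which turns \<open>\<tau>\<close> into a numerator of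
  \<open>x\<close> for the denominator \<open>\<alpha>\<close>.
\<close>

lemma augU_twist:
  assumes "\<alpha> \<in> carrier FU" "\<tau> \<in> carrier FU" "x \<in> carrier U" "\<And>y. x \<otimes> u (\<alpha> y) = u (\<tau> y)"
  shows "augU \<tau> = x \<otimes> augU \<alpha>"
proof -
  let ?S = "supp \<alpha> \<union> supp \<tau>"
  have S: "finite ?S" "?S \<subseteq> carrier U" using supp_finite supp_carrier assms(1,2) by auto
  have cl: "u (\<alpha> y) \<in> carrier U" for y using FU_apply[OF assms(1)] by simp
  have "augU \<tau> = (\<Oplus>y\<in>?S. u (\<tau> y) \<otimes> y)" by (rule augU_sum[OF assms(2) S(1) _ S(2)]) auto
  also have "\<dots> = (\<Oplus>y\<in>?S. x \<otimes> (u (\<alpha> y) \<otimes> y))"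
  proof (rule S.finsum_cong')
    fix y assume "y \<in> ?S"
    then have "y \<in> carrier U" using S by blast
    then show "u (\<tau> y) \<otimes> y = x \<otimes> (u (\<alpha> y) \<otimes> y)"
      using cl[of y] assms(3) by (simp add: assms(4)[symmetric] S.m_assoc)
  qed (use S cl assms(3) in \<open>auto simp: subset_iff\<close>)
  also have "\<dots> = x \<otimes> (\<Oplus>y\<in>?S. u (\<alpha> y) \<otimes> y)"
    using S assms(3) cl by (intro S.finsum_rdistr[symmetric]) (auto simp: subset_iff)
  also have "(\<Oplus>y\<in>?S. u (\<alpha> y) \<otimes> y) = augU \<alpha>" by (rule augU_sum[symmetric, OF assms(1) S(1) _ S(2)]) auto
  finally show ?thesis .
qed

lemma ext_ideal_mult_left:
  assumes "t \<in> carrier R" "\<And>j. j \<in> J \<Longrightarrow> t \<otimes>\<^bsub>R\<^esub> j \<in> I" "x \<in> ext_ideal J"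
  shows "u t \<otimes> x \<in> ext_ideal I"
proof -
  interpret F: left_module R FU by (rule FU_left_module)
  obtain \<alpha> where "\<alpha> \<in> carrier FU" "\<forall>y. \<alpha> y \<in> J" "augU \<alpha> = x" using assms(3) by (auto simp: ext_ideal_def)
  then have "t \<odot>\<^bsub>FU\<^esub> \<alpha> \<in> carrier FU" "\<forall>y. (t \<odot>\<^bsub>FU\<^esub> \<alpha>) y \<in> I" "augU (t \<odot>\<^bsub>FU\<^esub> \<alpha>) = u t \<otimes> x"
    using assms(1,2) by (auto intro!: F.smult_closed simp: linear_on_smult[OF augU_linear] restr_bimod_simps)
      (simp add: free_mod_simps)
  then show ?thesis unfolding ext_ideal_def by blast
qed

lemma ext_ideal_finsum:
  assumes "right_ideal R I" "\<And>y. y \<in> S \<Longrightarrow> f y \<in> ext_ideal I"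
  shows "(\<Oplus>y\<in>S. f y) \<in> ext_ideal I"
  using assms(2)
proof (induction S rule: infinite_finite_induct)
  case (insert y S)
  then have "f \<in> S \<rightarrow> carrier U" "f y \<in> carrier U" using ext_ideal_closed by auto
  with insert show ?case by (simp add: ext_ideal_add[OF assms(1)])
qed (simp_all add: ext_ideal_zero[OF assms(1)])

lemma ext_ideal_mult_right:
  assumes "right_ideal R I" "x \<in> ext_ideal I" "y \<in> carrier U"
  shows "x \<otimes> y \<in> ext_ideal I"
proof -
  obtain \<alpha> where \<alpha>: "\<alpha> \<in> carrier FU" "\<forall>y. \<alpha> y \<in> I" "augU \<alpha> = x" using assms(2) by (auto simp: ext_ideal_def)
  have S: "finite (supp \<alpha>)" "supp \<alpha> \<subseteq> carrier U" using supp_finite supp_carrier \<alpha>(1) by auto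
  have cl: "u (\<alpha> z) \<in> carrier U" for z using FU_apply[OF \<alpha>(1)] by simp
  have "x \<otimes> y = (\<Oplus>z\<in>supp \<alpha>. u (\<alpha> z) \<otimes> z) \<otimes> y"
    using augU_sum[OF \<alpha>(1) S(1) subset_refl S(2)] \<alpha>(3) by simp
  also have "\<dots> = (\<Oplus>z\<in>supp \<alpha>. u (\<alpha> z) \<otimes> z \<otimes> y)"
    using S cl assms(3) by (intro S.finsum_ldistr) (auto simp: subset_iff)
  also have "\<dots> \<in> ext_ideal I"
  proof (rule ext_ideal_finsum[OF assms(1)])
    fix z assume "z \<in> supp \<alpha>"
    then have "z \<in> carrier U" using S by blast
    then show "u (\<alpha> z) \<otimes> z \<otimes> y \<in> ext_ideal I"
      using cl assms(3) ext_ideal_gen[OF assms(1), of "\<alpha> z" "z \<otimes> y"] \<alpha>(2) by (simp add: S.m_assoc)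
  qed
  finally show ?thesis .
qed

text \<open>
  Each \<open>u (\<beta> y)\<close> lies in \<open>(\<beta> y) J U\<close>, hence in \<open>I U\<close>, and therefore \<open>1 = \<Sum> u (\<beta> y) y\<close> lies in \<open>I U\<close>.
\<close>

lemma spanning_refine:
  assumes I: "right_ideal R I" and \<beta>: "\<beta> \<in> carrier FU" "augU \<beta> = \<one>"
    and J: "\<And>y. \<exists>J. spanning J \<and> (\<forall>j\<in>J. \<beta> y \<otimes>\<^bsub>R\<^esub> j \<in> I)"
  shows "spanning I"
proof -
  have S: "finite (supp \<beta>)" "supp \<beta> \<subseteq> carrier U" using supp_finite supp_carrier \<beta>(1) by auto
  have mem: "u (\<beta> y) \<in> ext_ideal I" for y
  proof -
    obtain J where "spanning J" "\<forall>j\<in>J. \<beta> y \<otimes>\<^bsub>R\<^esub> j \<in> I" using J by blast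
    then have "u (\<beta> y) \<otimes> \<one> \<in> ext_ideal I"
      by (intro ext_ideal_mult_left[OF FU_apply[OF \<beta>(1)], of J]) (auto simp: spanning_iff)
    then show ?thesis using FU_apply[OF \<beta>(1)] by simp
  qed
  have "(\<Oplus>y\<in>supp \<beta>. u (\<beta> y) \<otimes> y) \<in> ext_ideal I"
    using S mem by (intro ext_ideal_finsum[OF I] ext_ideal_mult_right[OF I]) auto
  then show ?thesis
    using augU_sum[OF \<beta>(1) S(1) subset_refl S(2)] \<beta>(2) by (simp add: spanning_iff)
qed

definition denom :: "'u set \<Rightarrow> 'r set" where
  "denom D = {r \<in> carrier R. \<forall>x\<in>D. \<exists>s\<in>carrier R. x \<otimes> u r = u s}"

lemma denom_right_ideal:
  assumes "D \<subseteq> carrier U"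
  shows "right_ideal R (denom D)"
proof (rule right_idealI[OF R.ring_axioms])
  show "\<zero>\<^bsub>R\<^esub> \<in> denom D" using assms by (auto simp: denom_def subset_iff intro!: bexI[of _ "\<zero>\<^bsub>R\<^esub>"])
  fix a assume a: "a \<in> denom D"
  { fix b assume b: "b \<in> denom D"
    have "\<exists>s\<in>carrier R. x \<otimes> u (a \<oplus>\<^bsub>R\<^esub> b) = u s" if x: "x \<in> D" for x
    proof -
      obtain s s' where "s \<in> carrier R" "x \<otimes> u a = u s" "s' \<in> carrier R" "x \<otimes> u b = u s'"
        using a b x unfolding denom_def by blast
      then show ?thesis
        using a b x assms by (intro bexI[of _ "s \<oplus>\<^bsub>R\<^esub> s'"]) (auto simp: denom_def S.r_distr subset_iff)
    qed
    with a b show "a \<oplus>\<^bsub>R\<^esub> b \<in> denom D" by (simp add: denom_def) }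
  { fix r assume r: "r \<in> carrier R"
    have "\<exists>s\<in>carrier R. x \<otimes> u (a \<otimes>\<^bsub>R\<^esub> r) = u s" if x: "x \<in> D" for x
    proof -
      obtain s where s: "s \<in> carrier R" "x \<otimes> u a = u s" using a x unfolding denom_def by blast
      have "x \<otimes> u (a \<otimes>\<^bsub>R\<^esub> r) = x \<otimes> u a \<otimes> u r"
        using a r x assms by (auto simp: denom_def S.m_assoc subset_iff)
      with s r show ?thesis by (intro bexI[of _ "s \<otimes>\<^bsub>R\<^esub> r"]) auto
    qed
    with a r show "a \<otimes>\<^bsub>R\<^esub> r \<in> denom D" by (simp add: denom_def) }
qed (auto simp: denom_def)

end

locale flat_epi = ring_map R U u for R :: "'r ring" and U :: "'u ring" (structure) and u +
  assumes epi: "ring_epimorphism R U u" and flat: "flat_left_module R (restr_bimod U u)"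
begin

text \<open>
  The equation \<open>x \<otimes> 1 = 1 \<otimes> x\<close> is a consequence of finitely many bilinearity relations in \<open>U \<otimes>\<^sub>R U\<close>. Up
  to left multiplication by elements of \<open>U\<close>, each of them is an \<open>R\<close>-linear relation \<open>z\<close> between elements
  of the second factor. Suppose that elements \<open>t b\<close> of \<open>R\<close> are substituted for the elements \<open>b\<close> of the second
  factor and satisfy these relations. Then the equation becomes \<open>x u (t 1) = u (t x)\<close>. By the equational
  criterion there are such \<open>t\<close>, namely the coefficients of the \<open>\<tau> b\<close>, and they can be made to satisfy the
  relations \<open>K\<close> as well.
\<close>

lemma trivialize_relations:
  assumes D: "finite D" "D \<subseteq> carrier U" and K: "finite K" "K \<subseteq> carrier FU"
    and supp: "\<And>\<kappa>. \<kappa> \<in> K \<Longrightarrow> supp \<kappa> \<subseteq> D" and aug: "\<And>\<kappa>. \<kappa> \<in> K \<Longrightarrow> augU \<kappa> = \<zero>"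
  obtains \<tau> where "\<And>w. w \<in> insert \<one> D \<Longrightarrow> \<tau> w \<in> carrier FU" "\<And>w. w \<in> insert \<one> D \<Longrightarrow> augU (\<tau> w) = w"
    "\<And>w y. w \<in> D \<Longrightarrow> w \<otimes> u (\<tau> \<one> y) = u (\<tau> w y)"
    "\<And>\<kappa> y. \<kappa> \<in> K \<Longrightarrow> (\<Oplus>\<^bsub>R\<^esub>w\<in>D. \<kappa> w \<otimes>\<^bsub>R\<^esub> \<tau> w y) = \<zero>\<^bsub>R\<^esub>"
proof -
  interpret T: tensor_pair R UR UU by (rule restr_tensor_pair[OF restr_left_module])
  interpret F: left_module R FU by (rule FU_left_module)
  interpret B: left_module R "self_bimod R" by (rule self_bimod_left_module[OF R.ring_axioms])
  let ?g = "free_gen R"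
  define ev where "ev t = free_ext R (self_bimod R) t" for t :: "'u \<Rightarrow> 'r"
  define E where "E t = frag_lift U T.base (\<lambda>(a, b). a \<otimes> u (t b))" for t
  have base: "T.base = carrier U \<times> carrier U" by (simp add: right_of_simps restr_bimod_simps)
  have ev: "linear_on R FU (self_bimod R) (ev t)" "\<And>b. b \<in> carrier U \<Longrightarrow> ev t (?g b) = t b" if "\<forall>b. t b \<in> carrier R" for t
  proof -
    have t: "t \<in> carrier U \<rightarrow> carrier (self_bimod R)" using that by (simp add: self_bimod_simps)
    show "linear_on R FU (self_bimod R) (ev t)" unfolding ev_def by (rule free_ext_linear[OF B.left_module_axioms t])
    show "ev t (?g b) = t b" if "b \<in> carrier U" for b
      unfolding ev_def by (rule free_ext_gen[OF B.left_module_axioms t that])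
  qed
  have cl: "(\<lambda>(a, b). a \<otimes> u (t b)) \<in> T.base \<rightarrow> carrier U" if "\<forall>b. t b \<in> carrier R" for t
    using that by (auto simp: base)
  note E_add = frag_lift_add[OF S.abelian_group_axioms cl, folded E_def]
    and E_neg = frag_lift_neg[OF S.abelian_group_axioms cl, folded E_def]
    and E_diff = frag_lift_diff[OF S.abelian_group_axioms cl, folded E_def]
    and E_zero = frag_lift_zero[OF S.abelian_group_axioms cl, folded E_def]
  have E_gen: "E t (frag_of (a, b)) = a \<otimes> u (t b)" if "\<forall>b. t b \<in> carrier R" "a \<in> carrier U" "b \<in> carrier U" for t a b
    using frag_lift_gen[OF S.abelian_group_axioms cl[OF that(1)], of "(a, b)"] that by (simp add: E_def base)
  \<comment> \<open>Substituting \<open>t\<close> into the second factor annihilates \<open>c\<close> as soon as \<open>t\<close> satisfies the relations \<open>Y\<close>,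
    which hold in \<open>U\<close>.\<close>
  define kills where "kills Y c \<longleftrightarrow> finite Y \<and> Y \<subseteq> {z \<in> carrier FU. augU z = \<zero>} \<and>
      (\<forall>t. (\<forall>b. t b \<in> carrier R) \<longrightarrow> (\<forall>z\<in>Y. ev t z = \<zero>\<^bsub>R\<^esub>) \<longrightarrow> E t c = \<zero>)" for Y c
  define P where "P c \<longleftrightarrow> (\<exists>Y. kills Y c)" for c
  have P1: "P c" if "z \<in> carrier FU" "augU z = \<zero>\<^bsub>UU\<^esub>"
      "\<And>t. \<lbrakk>\<forall>b. t b \<in> carrier R\<rbrakk> \<Longrightarrow> E t c = a \<otimes> u (ev t z)" "a \<in> carrier U" for c z a
    unfolding P_def kills_def by (rule exI[of _ "{z}"]) (use that in \<open>simp add: restr_bimod_simps\<close>)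
  have P_rel: "P c" if "c \<in> T.rel" for c
    using that
  proof (induction c rule: T.rel_induct)
    case zero
    show ?case unfolding P_def kills_def by (rule exI[of _ "{}"]) (simp add: E_zero)
  next
    case (add c d)
    then obtain Y Y' where "kills Y c" "kills Y' d" unfolding P_def by blast
    then show ?case
      unfolding P_def kills_def using add(1,2) by (intro exI[of _ "Y \<union> Y'"]) (simp add: E_add)
  next
    case (minus c)
    then show ?case unfolding P_def kills_def by (elim exE) (rule exI, auto simp: E_neg)
  next
    case (addl a a' b)
    then have ab: "a \<in> carrier U" "a' \<in> carrier U" "b \<in> carrier U" by (simp_all add: right_of_simps restr_bimod_simps)
    have "E t (frag_of (a \<oplus> a', b) - frag_of (a, b) - frag_of (a', b)) = \<zero>" if t: "\<forall>b. t b \<in> carrier R" for t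
      using ab t by (simp add: E_diff[OF t] E_gen[OF t] keys_diff_subset right_of_simps restr_bimod_simps)
        (simp add: S.l_distr a_minus_def S.a_ac S.r_neg S.r_neg1 S.r_neg2)
    then show ?case
      unfolding P_def kills_def by (intro exI[of _ "{}"]) (simp add: right_of_simps restr_bimod_simps)
  next
    case (addr a b b')
    then have ab: "a \<in> carrier U" "b \<in> carrier U" "b' \<in> carrier U" by (simp_all add: right_of_simps restr_bimod_simps)
    let ?z = "?g (b \<oplus> b') \<ominus>\<^bsub>FU\<^esub> ?g b \<ominus>\<^bsub>FU\<^esub> ?g b'"
    have g: "?g (b \<oplus> b') \<in> carrier FU" "?g b \<in> carrier FU" "?g b' \<in> carrier FU" using ab by (auto intro!: FU_gen)
    show ?case
    proof (rule P1[of ?z _ a])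
      have "b \<in> carrier UU" "b' \<in> carrier UU" using ab by (simp_all add: restr_bimod_simps)
      then have "(b \<oplus>\<^bsub>UU\<^esub> b') \<ominus>\<^bsub>UU\<^esub> b \<ominus>\<^bsub>UU\<^esub> b' = \<zero>\<^bsub>UU\<^esub>"
        by (simp add: a_minus_def T.B.M.a_ac T.B.M.r_neg T.B.M.r_neg1 T.B.M.r_neg2)
      then show "augU ?z = \<zero>\<^bsub>UU\<^esub>"
        using g ab by (simp add: linear_on_diff[OF FU_left_module restr_left_module augU_linear] augU_gen restr_bimod_simps(3))
      fix t :: "'u \<Rightarrow> 'r" assume t: "\<forall>b. t b \<in> carrier R"
      have "ev t ?z = t (b \<oplus> b') \<ominus>\<^bsub>self_bimod R\<^esub> t b \<ominus>\<^bsub>self_bimod R\<^esub> t b'"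
        using g ab by (simp add: linear_on_diff[OF FU_left_module B.left_module_axioms ev(1)[OF t]] ev(2)[OF t])
      also have "\<dots> = t (b \<oplus> b') \<ominus>\<^bsub>R\<^esub> t b \<ominus>\<^bsub>R\<^esub> t b'" using t by (simp add: self_bimod_minus[OF R.ring_axioms])
      finally show "E t (frag_of (a, b \<oplus>\<^bsub>UU\<^esub> b') - frag_of (a, b) - frag_of (a, b')) = a \<otimes> u (ev t ?z)"
        using ab t by (simp add: E_diff[OF t] E_gen[OF t] keys_diff_subset right_of_simps restr_bimod_simps)
          (simp add: S.r_distr a_minus_def S.r_minus)
    qed (use g ab in simp_all)
  next
    case (bal a r b)
    then have ab: "a \<in> carrier U" "b \<in> carrier U" "r \<in> carrier R" by (simp_all add: right_of_simps restr_bimod_simps)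
    let ?z = "r \<odot>\<^bsub>FU\<^esub> ?g b \<ominus>\<^bsub>FU\<^esub> ?g (u r \<otimes> b)"
    have g: "r \<odot>\<^bsub>FU\<^esub> ?g b \<in> carrier FU" "?g b \<in> carrier FU" "?g (u r \<otimes> b) \<in> carrier FU"
      using ab by (auto intro!: FU_gen F.smult_closed)
    show ?case
    proof (rule P1[of ?z _ a])
      have "u r \<otimes> b \<in> carrier UU" using ab by (simp add: restr_bimod_simps)
      then show "augU ?z = \<zero>\<^bsub>UU\<^esub>"
        using g ab by (simp add: linear_on_diff[OF FU_left_module restr_left_module augU_linear] augU_gen
            linear_on_smult[OF augU_linear] restr_bimod_simps(4) T.B.M.minus_eq_zero_iff)
      fix t :: "'u \<Rightarrow> 'r" assume t: "\<forall>b. t b \<in> carrier R"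
      have "ev t ?z = r \<otimes>\<^bsub>R\<^esub> t b \<ominus>\<^bsub>self_bimod R\<^esub> t (u r \<otimes> b)"
        using g ab by (simp add: linear_on_diff[OF FU_left_module B.left_module_axioms ev(1)[OF t]]
            linear_on_smult[OF ev(1)[OF t]] ev(2)[OF t] self_bimod_simps(4))
      also have "\<dots> = r \<otimes>\<^bsub>R\<^esub> t b \<ominus>\<^bsub>R\<^esub> t (u r \<otimes> b)" using t by (simp add: self_bimod_minus[OF R.ring_axioms])
      finally show "E t (frag_of (rsmult UR a r, b) - frag_of (a, r \<odot>\<^bsub>UU\<^esub> b)) = a \<otimes> u (ev t ?z)"
        using ab t by (simp add: E_diff[OF t] E_gen[OF t] right_of_simps restr_bimod_simps)
          (simp add: S.r_distr a_minus_def S.r_minus S.m_assoc)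
    qed (use g ab in simp_all)
  qed
  have "P (frag_of (x, \<one>) - frag_of (\<one>, x))" if "x \<in> D" for x
    using epimorphism_tens_commute[OF epi, of x] that D(2) by (intro P_rel) (auto simp: T.tens_eq_cls T.cls_eq_iff)
  then have "\<forall>x\<in>D. \<exists>Y. kills Y (frag_of (x, \<one>) - frag_of (\<one>, x))" by (simp add: P_def)
  from bchoice[OF this] obtain Y where Y: "\<forall>x\<in>D. kills (Y x) (frag_of (x, \<one>) - frag_of (\<one>, x))" by blast
  define Z where "Z = K \<union> (\<Union>x\<in>D. Y x)"
  have Z: "finite Z" "Z \<subseteq> {z \<in> carrier FU. augU z = \<zero>}" using D(1) K aug Y by (auto simp: Z_def kills_def)
  define S where "S = insert \<one> D \<union> (\<Union>z\<in>Z. supp z)"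
  have S: "finite S" "S \<subseteq> carrier U" "insert \<one> D \<subseteq> S"
    using Z D by (auto simp: S_def free_mod_carrier_iff)
  have SUU: "S \<subseteq> carrier UU" using S(2) by (simp add: restr_bimod_simps)
  obtain zs where zs: "set zs = Z" using finite_list[OF Z(1)] by blast
  have z: "zs ! j \<in> carrier FU" "augU (zs ! j) = \<zero>\<^bsub>UU\<^esub>" "supp (zs ! j) \<subseteq> S" if "j < length zs" for j
    using nth_mem[OF that] Z(2) by (auto simp: zs S_def restr_bimod_simps)
  have rel: "(\<Oplus>\<^bsub>UU\<^esub>b\<in>S. (zs ! j) b \<odot>\<^bsub>UU\<^esub> b) = \<zero>\<^bsub>UU\<^esub>" if "j < length zs" for j
    using free_ext_superset[OF restr_left_module z(1)[OF that], of "\<lambda>x. x" S] z[OF that] S(1,2)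
    by (simp add: aug_def restr_bimod_simps)
  obtain \<tau> where \<tau>: "\<And>b. b \<in> S \<Longrightarrow> \<tau> b \<in> carrier (free_mod R (carrier UU))"
    and aug\<tau>: "\<And>b. b \<in> S \<Longrightarrow> free_ext R UU (\<lambda>x. x) (\<tau> b) = b"
    and rel\<tau>: "\<And>j y. j < length zs \<Longrightarrow> (\<Oplus>\<^bsub>R\<^esub>b\<in>S. (zs ! j) b \<otimes>\<^bsub>R\<^esub> \<tau> b y) = \<zero>\<^bsub>R\<^esub>"
    by (rule flat_relations[OF flat S(1) SUU, of "length zs" "\<lambda>j. zs ! j"]) (use FU_apply[OF z(1)] rel in auto)
  have \<tau>': "\<tau> b \<in> carrier FU" if "b \<in> S" for b using \<tau>[OF that] by (simp add: restr_bimod_simps)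
  have relZ: "(\<Oplus>\<^bsub>R\<^esub>b\<in>S. z b \<otimes>\<^bsub>R\<^esub> \<tau> b y) = \<zero>\<^bsub>R\<^esub>" if "z \<in> Z" for z y
    using that rel\<tau>[of _ y] unfolding zs[symmetric] by (metis in_set_conv_nth)
  show ?thesis
  proof (rule that[of \<tau>])
    show "\<tau> w \<in> carrier FU" "augU (\<tau> w) = w" if "w \<in> insert \<one> D" for w
      using \<tau>' aug\<tau> S(3) that by (auto simp: aug_def)
    show "w \<otimes> u (\<tau> \<one> y) = u (\<tau> w y)" if w: "w \<in> D" for w y
    proof -
      have wS: "w \<in> S" "\<one> \<in> S" "w \<in> carrier U" using w S(3) D(2) by auto
      define t where "t b = (if b \<in> S then \<tau> b y else \<zero>\<^bsub>R\<^esub>)" for b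
      have t: "\<forall>b. t b \<in> carrier R" using FU_apply[OF \<tau>'] by (simp add: t_def)
      have "ev t z = \<zero>\<^bsub>R\<^esub>" if z: "z \<in> Z" for z
      proof -
        have zF: "z \<in> carrier FU" "supp z \<subseteq> S" using z Z(2) by (auto simp: S_def)
        have "ev t z = (\<Oplus>\<^bsub>self_bimod R\<^esub>b\<in>S. z b \<otimes>\<^bsub>R\<^esub> t b)"
          unfolding ev_def using free_ext_superset[OF B.left_module_axioms zF(1), of t S] zF(2) S t by (simp add: self_bimod_simps)
        also have "\<dots> = (\<Oplus>\<^bsub>R\<^esub>b\<in>S. z b \<otimes>\<^bsub>R\<^esub> t b)" by (simp add: finsum_def finprod_def self_bimod_def)
        also have "\<dots> = (\<Oplus>\<^bsub>R\<^esub>b\<in>S. z b \<otimes>\<^bsub>R\<^esub> \<tau> b y)"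
          using FU_apply[OF \<tau>'] FU_apply[OF zF(1)] by (intro R.finsum_cong') (auto simp: t_def)
        finally show ?thesis using relZ[OF z] by simp
      qed
      then have "\<forall>z\<in>Y w. ev t z = \<zero>\<^bsub>R\<^esub>" using w by (auto simp: Z_def)
      with Y w t have "E t (frag_of (w, \<one>) - frag_of (\<one>, w)) = \<zero>" unfolding kills_def by blast
      then have "w \<otimes> u (t \<one>) \<ominus> u (t w) = \<zero>"
        using wS t by (simp add: E_diff[OF t] E_gen[OF t] base)
      then show ?thesis
        using S.minus_eq_zero_iff[of "w \<otimes> u (t \<one>)" "u (t w)"] wS FU_apply[OF \<tau>'[OF wS(1)]] FU_apply[OF \<tau>'[OF wS(2)]]
        by (simp add: t_def)
    qed
    show "(\<Oplus>\<^bsub>R\<^esub>w\<in>D. \<kappa> w \<otimes>\<^bsub>R\<^esub> \<tau> w y) = \<zero>\<^bsub>R\<^esub>" if k: "\<kappa> \<in> K" for \<kappa> y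
    proof -
      have k0: "\<kappa> w = \<zero>\<^bsub>R\<^esub>" if "w \<notin> D" for w using supp[OF k] that by blast
      have "(\<Oplus>\<^bsub>R\<^esub>w\<in>D. \<kappa> w \<otimes>\<^bsub>R\<^esub> \<tau> w y) = (\<Oplus>\<^bsub>R\<^esub>w\<in>S. \<kappa> w \<otimes>\<^bsub>R\<^esub> \<tau> w y)"
        using S K(2) k FU_apply FU_apply[OF \<tau>'] k0 by (intro R.add.finprod_mono_neutral_cong_left) auto
      then show ?thesis using relZ k by (simp add: Z_def)
    qed
  qed
qed

lemma denominators:
  assumes "finite D" "D \<subseteq> carrier U"
  obtains \<alpha> \<tau> where "\<alpha> \<in> carrier FU" "augU \<alpha> = \<one>" "\<And>x. x \<in> D \<Longrightarrow> \<tau> x \<in> carrier FU"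
    "\<And>x y. x \<in> D \<Longrightarrow> x \<otimes> u (\<alpha> y) = u (\<tau> x y)"
proof (rule trivialize_relations[OF assms, of "{}"])
  fix \<tau> assume "\<And>w. w \<in> insert \<one> D \<Longrightarrow> \<tau> w \<in> carrier FU" "\<And>w. w \<in> insert \<one> D \<Longrightarrow> augU (\<tau> w) = w"
    "\<And>w y. w \<in> D \<Longrightarrow> w \<otimes> u (\<tau> \<one> y) = u (\<tau> w y)"
  then show thesis using that[of "\<tau> \<one>" \<tau>] by simp
qed auto

lemma denom_gabriel:
  assumes "finite D" "D \<subseteq> carrier U"
  shows "denom D \<in> gabriel R U u"
proof (rule denominators[OF assms])
  fix \<alpha> \<tau> assume a: "\<alpha> \<in> carrier FU" "augU \<alpha> = \<one>" "\<And>x. x \<in> D \<Longrightarrow> \<tau> x \<in> carrier FU"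
    "\<And>x y. x \<in> D \<Longrightarrow> x \<otimes> u (\<alpha> y) = u (\<tau> x y)"
  then have "\<alpha> y \<in> denom D" for y
    using FU_apply[OF a(1)] FU_apply[OF a(3)] by (auto simp: denom_def)
  with a show ?thesis using denom_right_ideal[OF assms(2)] by (auto simp: gabriel_iff spanning_def)
qed

text \<open>
  This is \<open>trivialize_relations\<close> for the single relation \<open>e 1 = 0\<close> in \<open>U\<close>.
\<close>

lemma kernel_annihilator_spanning:
  assumes e: "e \<in> carrier R" "u e = \<zero>"
  shows "spanning {r \<in> carrier R. e \<otimes>\<^bsub>R\<^esub> r = \<zero>\<^bsub>R\<^esub>}"
proof -
  interpret F: left_module R FU by (rule FU_left_module)
  let ?k = "e \<odot>\<^bsub>FU\<^esub> free_gen R \<one>"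
  have k: "?k \<in> carrier FU" "augU ?k = \<zero>" "supp ?k \<subseteq> {\<one>}" "?k \<one> = e"
    using e by (auto simp: F.smult_closed FU_gen augU_gen linear_on_smult[OF augU_linear] restr_bimod_simps(4))
      (auto simp: free_mod_simps free_gen_def split: if_splits)
  show ?thesis
  proof (rule trivialize_relations[of "{\<one>}" "{?k}"])
    fix \<tau> assume t: "\<And>w. w \<in> insert \<one> {\<one>} \<Longrightarrow> \<tau> w \<in> carrier FU" "\<And>w. w \<in> insert \<one> {\<one>} \<Longrightarrow> augU (\<tau> w) = w"
      and rel: "\<And>\<kappa> y. \<kappa> \<in> {?k} \<Longrightarrow> (\<Oplus>\<^bsub>R\<^esub>w\<in>{\<one>}. \<kappa> w \<otimes>\<^bsub>R\<^esub> \<tau> w y) = \<zero>\<^bsub>R\<^esub>"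
    have t1: "\<tau> \<one> \<in> carrier FU" "augU (\<tau> \<one>) = \<one>" using t by auto
    have "e \<otimes>\<^bsub>R\<^esub> \<tau> \<one> y = \<zero>\<^bsub>R\<^esub>" for y
      using rel[of ?k y] k(4) e FU_apply[OF t1(1), of y] by (simp add: R.finsum_insert)
    then show ?thesis unfolding spanning_def using t1 FU_apply[OF t1(1)] by blast
  qed (use k in auto)
qed

text \<open>
  Let \<open>\<beta>\<close> be a combination for \<open>1\<close> with coefficients in \<open>I\<close>, and let \<open>\<gamma>\<close> be a common denominator of the
  elements \<open>w t\<close> for \<open>w\<close> in the support of \<open>\<beta>\<close>. Then \<open>t (\<gamma> y) = \<Sum> u (\<beta> w) w t (\<gamma> y)\<close> has the same image in
  \<open>U\<close> as an element \<open>m\<close> of \<open>I\<close>. The difference of the two is annihilated by a right ideal that spans \<open>U\<close>.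
\<close>

lemma colon_gabriel:
  assumes "I \<in> gabriel R U u" "t \<in> carrier R"
  shows "ideal_colon R I t \<in> gabriel R U u"
proof -
  have I: "right_ideal R I" "spanning I" using assms(1) by (auto simp: gabriel_iff)
  obtain \<beta> where \<beta>: "\<beta> \<in> carrier FU" "\<forall>y. \<beta> y \<in> I" "augU \<beta> = \<one>" using I(2) unfolding spanning_def by blast
  note ID = right_idealD[OF I(1)]
  have colon: "right_ideal R (ideal_colon R I t)"
  proof (rule right_idealI[OF R.ring_axioms])
    fix a r assume "a \<in> ideal_colon R I t" "r \<in> carrier R"
    then show "a \<otimes>\<^bsub>R\<^esub> r \<in> ideal_colon R I t"
      using assms(2) ID(4)[of "t \<otimes>\<^bsub>R\<^esub> a" r] by (simp add: ideal_colon_def R.m_assoc)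
  qed (use assms(2) ID in \<open>auto simp: ideal_colon_def R.r_distr\<close>)
  let ?B = "supp \<beta>"
  have B: "finite ?B" "?B \<subseteq> carrier U" using supp_finite supp_carrier \<beta>(1) by auto
  have \<beta>R: "\<beta> w \<in> carrier R" for w using FU_apply[OF \<beta>(1)] .
  let ?D = "(\<lambda>w. w \<otimes> u t) ` ?B"
  obtain \<gamma> \<tau> where \<gamma>: "\<gamma> \<in> carrier FU" "augU \<gamma> = \<one>" "\<And>x. x \<in> ?D \<Longrightarrow> \<tau> x \<in> carrier FU"
    "\<And>x y. x \<in> ?D \<Longrightarrow> x \<otimes> u (\<gamma> y) = u (\<tau> x y)"
    by (rule denominators[of ?D]) (use B assms(2) in auto)
  have "spanning (ideal_colon R I t)"
  proof (rule spanning_refine[OF colon \<gamma>(1,2)])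
    fix y
    have \<gamma>y: "\<gamma> y \<in> carrier R" using FU_apply[OF \<gamma>(1)] .
    define s where "s w = \<tau> (w \<otimes> u t) y" for w
    have s: "s w \<in> carrier R" "w \<otimes> u t \<otimes> u (\<gamma> y) = u (s w)" if "w \<in> ?B" for w
      using FU_apply[OF \<gamma>(3)[of "w \<otimes> u t"]] \<gamma>(4)[of "w \<otimes> u t" y] that unfolding s_def by blast+
    define m where "m = (\<Oplus>\<^bsub>R\<^esub>w\<in>?B. \<beta> w \<otimes>\<^bsub>R\<^esub> s w)"
    have mR: "m \<in> carrier R" unfolding m_def using \<beta>R s(1) by (intro R.finsum_closed) auto
    have mI: "m \<otimes>\<^bsub>R\<^esub> j \<in> I" if j: "j \<in> carrier R" for j
    proof -
      have "(\<Oplus>\<^bsub>R\<^esub>w\<in>B'. \<beta> w \<otimes>\<^bsub>R\<^esub> s w) \<in> I" if "finite B'" "B' \<subseteq> ?B" for B'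
        using that
      proof (induction B')
        case (insert w B')
        have w: "\<beta> w \<otimes>\<^bsub>R\<^esub> s w \<in> I" using ID(4) \<beta>(2) s(1)[of w] insert.prems by blast
        have cl: "(\<lambda>w. \<beta> w \<otimes>\<^bsub>R\<^esub> s w) \<in> B' \<rightarrow> carrier R" "\<beta> w \<otimes>\<^bsub>R\<^esub> s w \<in> carrier R"
          using \<beta>R s(1) insert.prems by auto
        show ?case using insert cl w by (simp add: ID(3) R.finsum_insert)
      qed (simp add: ID)
      then show ?thesis using B(1) j by (simp add: m_def ID(4))
    qed
    have um: "u (t \<otimes>\<^bsub>R\<^esub> \<gamma> y) = u m"
    proof -
      have "u m = (\<Oplus>w\<in>?B. u (\<beta> w \<otimes>\<^bsub>R\<^esub> s w))" unfolding m_def using \<beta>R s(1) by (intro u_finsum) auto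
      also have "\<dots> = (\<Oplus>w\<in>?B. u (\<beta> w) \<otimes> w \<otimes> u (t \<otimes>\<^bsub>R\<^esub> \<gamma> y))"
      proof (rule S.finsum_cong')
        fix w assume w: "w \<in> ?B"
        then have "w \<in> carrier U" using B(2) by blast
        then show "u (\<beta> w \<otimes>\<^bsub>R\<^esub> s w) = u (\<beta> w) \<otimes> w \<otimes> u (t \<otimes>\<^bsub>R\<^esub> \<gamma> y)"
          using \<beta>R s(1)[OF w] \<gamma>y assms(2) by (simp add: s(2)[OF w, symmetric] S.m_assoc)
      qed (use \<beta>R \<gamma>y assms(2) B(2) in auto)
      also have "\<dots> = (\<Oplus>w\<in>?B. u (\<beta> w) \<otimes> w) \<otimes> u (t \<otimes>\<^bsub>R\<^esub> \<gamma> y)"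
        using \<beta>R \<gamma>y assms(2) B by (intro S.finsum_ldistr[symmetric]) (auto simp: subset_iff)
      also have "(\<Oplus>w\<in>?B. u (\<beta> w) \<otimes> w) = \<one>"
        using augU_sum[OF \<beta>(1) B(1) subset_refl B(2)] \<beta>(3) by simp
      finally show ?thesis using \<gamma>y assms(2) by simp
    qed
    let ?e = "t \<otimes>\<^bsub>R\<^esub> \<gamma> y \<ominus>\<^bsub>R\<^esub> m"
    have eR: "?e \<in> carrier R" using assms(2) \<gamma>y mR by simp
    have "u ?e = \<zero>" using um assms(2) \<gamma>y mR by (simp add: a_minus_def S.r_neg del: hom_mult)
    with eR have "spanning {r \<in> carrier R. ?e \<otimes>\<^bsub>R\<^esub> r = \<zero>\<^bsub>R\<^esub>}" by (rule kernel_annihilator_spanning)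
    moreover have "\<gamma> y \<otimes>\<^bsub>R\<^esub> j \<in> ideal_colon R I t" if j: "j \<in> {r \<in> carrier R. ?e \<otimes>\<^bsub>R\<^esub> r = \<zero>\<^bsub>R\<^esub>}" for j
    proof -
      have jR: "j \<in> carrier R" "?e \<otimes>\<^bsub>R\<^esub> j = \<zero>\<^bsub>R\<^esub>" using j by auto
      have "t \<otimes>\<^bsub>R\<^esub> \<gamma> y \<otimes>\<^bsub>R\<^esub> j \<ominus>\<^bsub>R\<^esub> m \<otimes>\<^bsub>R\<^esub> j = \<zero>\<^bsub>R\<^esub>"
        using jR assms(2) \<gamma>y mR by (simp add: a_minus_def R.l_distr R.l_minus)
      then have "t \<otimes>\<^bsub>R\<^esub> \<gamma> y \<otimes>\<^bsub>R\<^esub> j = m \<otimes>\<^bsub>R\<^esub> j" using jR assms(2) \<gamma>y mR by (simp add: R.minus_eq_zero_iff)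
      then show ?thesis using mI[OF jR(1)] jR assms(2) \<gamma>y by (simp add: ideal_colon_def R.m_assoc)
    qed
    ultimately show "\<exists>J. spanning J \<and> (\<forall>j\<in>J. \<gamma> y \<otimes>\<^bsub>R\<^esub> j \<in> ideal_colon R I t)" by blast
  qed
  with colon show ?thesis by (simp add: gabriel_iff)
qed

lemma inter_gabriel:
  assumes I: "I \<in> gabriel R U u" and J: "J \<in> gabriel R U u"
  shows "I \<inter> J \<in> gabriel R U u"
proof -
  have ID: "right_ideal R I" "spanning I" and JD: "right_ideal R J" using I J by (auto simp: gabriel_iff)
  obtain \<beta> where \<beta>: "\<beta> \<in> carrier FU" "\<forall>y. \<beta> y \<in> I" "augU \<beta> = \<one>" using ID(2) unfolding spanning_def by blast
  have IJ: "right_ideal R (I \<inter> J)"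
    by (rule right_idealI[OF R.ring_axioms]) (use right_idealD[OF ID(1)] right_idealD[OF JD] in auto)
  have "spanning (I \<inter> J)"
  proof (rule spanning_refine[OF IJ \<beta>(1,3)])
    fix y
    have "spanning (ideal_colon R J (\<beta> y))" using colon_gabriel[OF J FU_apply[OF \<beta>(1)]] by (simp add: gabriel_iff)
    moreover have "\<beta> y \<otimes>\<^bsub>R\<^esub> j \<in> I \<inter> J" if "j \<in> ideal_colon R J (\<beta> y)" for j
      using that right_idealD(4)[OF ID(1), of "\<beta> y" j] \<beta>(2) by (auto simp: ideal_colon_def)
    ultimately show "\<exists>K. spanning K \<and> (\<forall>j\<in>K. \<beta> y \<otimes>\<^bsub>R\<^esub> j \<in> I \<inter> J)" by blast
  qed
  with IJ show ?thesis by (simp add: gabriel_iff)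
qed

end

section \<open>Extending homomorphisms into modules over the localization\<close>

definition restr_mod :: "('r \<Rightarrow> 'u) \<Rightarrow> ('u, 'n) module \<Rightarrow> ('r, 'n) module" where
  "restr_mod u N = \<lparr>carrier = carrier N, monoid.mult = undefined, monoid.one = undefined,
     ring.zero = \<zero>\<^bsub>N\<^esub>, ring.add = ring.add N, smult = (\<lambda>r n. u r \<odot>\<^bsub>N\<^esub> n)\<rparr>"

lemma restr_mod_simps:
  "carrier (restr_mod u N) = carrier N" "\<zero>\<^bsub>restr_mod u N\<^esub> = \<zero>\<^bsub>N\<^esub>"
  "x \<oplus>\<^bsub>restr_mod u N\<^esub> y = x \<oplus>\<^bsub>N\<^esub> y" "r \<odot>\<^bsub>restr_mod u N\<^esub> x = u r \<odot>\<^bsub>N\<^esub> x"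
  by (simp_all add: restr_mod_def)

locale flat_epi_module = flat_epi R U u + N: left_module U N
  for R :: "'r ring" and U :: "'u ring" (structure) and u and N :: "('u, 'n) module"
begin

abbreviation "NR \<equiv> restr_mod u N"

lemma NR_left_module: "left_module R NR"
proof -
  have "abelian_group NR"
    by (rule abelian_groupI)
      (auto simp: restr_mod_simps N.M.a_ac intro!: bexI[of _ "\<ominus>\<^bsub>N\<^esub> _"] N.M.l_neg)
  then show ?thesis
    by (intro left_module.intro R.ring_axioms left_module_axioms.intro)
      (auto simp: restr_mod_simps N.smult_closed N.smult_l_distr N.smult_r_distr N.smult_assoc1 N.smult_one)
qed

lemma NR_uminus: "x \<in> carrier N \<Longrightarrow> \<ominus>\<^bsub>NR\<^esub> x = \<ominus>\<^bsub>N\<^esub> x"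
proof -
  assume x: "x \<in> carrier N"
  interpret L: left_module R NR by (rule NR_left_module)
  show ?thesis
    using x L.M.minus_equality[of "\<ominus>\<^bsub>N\<^esub> x" x] by (simp add: restr_mod_simps N.M.l_neg)
qed

lemma NR_minus: "y \<in> carrier N \<Longrightarrow> x \<ominus>\<^bsub>NR\<^esub> y = x \<ominus>\<^bsub>N\<^esub> y"
  by (simp add: a_minus_def NR_uminus restr_mod_simps)

lemma NR_finsum: "f \<in> I \<rightarrow> carrier N \<Longrightarrow> finsum NR f I = finsum N f I"
proof -
  assume f: "f \<in> I \<rightarrow> carrier N"
  interpret L: left_module R NR by (rule NR_left_module)
  show ?thesis
    using f
  proof (induction I rule: infinite_finite_induct)
    case (insert i I)
    then have "f i \<in> carrier N" "f \<in> I \<rightarrow> carrier N" by auto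
    moreover then have "f i \<in> carrier NR" "f \<in> I \<rightarrow> carrier NR" by (simp_all add: restr_mod_simps)
    ultimately show ?case using insert by (simp add: L.M.finsum_insert N.M.finsum_insert restr_mod_simps)
  qed (simp_all add: L.M.finsum_infinite N.M.finsum_infinite restr_mod_simps)
qed

lemma FU_linear_sum:
  assumes K: "linear_on R FU NR K" and \<alpha>: "\<alpha> \<in> carrier FU" and D: "finite D" "supp \<alpha> \<subseteq> D" "D \<subseteq> carrier U"
  shows "K \<alpha> = (\<Oplus>\<^bsub>N\<^esub>w\<in>D. u (\<alpha> w) \<odot>\<^bsub>N\<^esub> K (free_gen R w))"
proof -
  have g: "(\<lambda>w. K (free_gen R w)) \<in> carrier U \<rightarrow> carrier NR"
    using linear_on_closed[OF K] FU_gen by blast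
  have "K \<alpha> = finsum NR (\<lambda>w. \<alpha> w \<odot>\<^bsub>NR\<^esub> K (free_gen R w)) D"
    using linear_on_eq_free_ext[OF NR_left_module K \<alpha>] free_ext_superset[OF NR_left_module \<alpha> g D] by simp
  also have "\<dots> = (\<Oplus>\<^bsub>N\<^esub>w\<in>D. u (\<alpha> w) \<odot>\<^bsub>N\<^esub> K (free_gen R w))"
    using g D(3) FU_apply[OF \<alpha>] by (subst NR_finsum) (auto simp: restr_mod_simps intro!: N.smult_closed)
  finally show ?thesis .
qed

text \<open>
  Linear maps into a \<open>U\<close>-module commute with fractions: the coefficients of \<open>\<tau>\<close> and \<open>x \<alpha>\<close> agree in \<open>U\<close>,
  and a linear map into \<open>N\<close> depends only on the images of the coefficients in \<open>U\<close>.
\<close>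

lemma linear_twist:
  assumes K: "linear_on R FU NR K" and \<alpha>: "\<alpha> \<in> carrier FU" and \<tau>: "\<tau> \<in> carrier FU" and x: "x \<in> carrier U"
    and eq: "\<And>y. x \<otimes> u (\<alpha> y) = u (\<tau> y)"
  shows "K \<tau> = x \<odot>\<^bsub>N\<^esub> K \<alpha>"
proof -
  let ?D = "supp \<alpha> \<union> supp \<tau>"
  have D: "finite ?D" "?D \<subseteq> carrier U" using supp_finite supp_carrier \<alpha> \<tau> by auto
  have cl: "K (free_gen R w) \<in> carrier N" if "w \<in> ?D" for w
    using linear_on_closed[OF K FU_gen] D(2) that by (auto simp: restr_mod_simps)
  have u\<alpha>: "u (\<alpha> w) \<in> carrier U" for w using FU_apply[OF \<alpha>] by simp
  have "K \<tau> = (\<Oplus>\<^bsub>N\<^esub>w\<in>?D. u (\<tau> w) \<odot>\<^bsub>N\<^esub> K (free_gen R w))" by (rule FU_linear_sum[OF K \<tau> D(1) _ D(2)]) auto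
  also have "\<dots> = (\<Oplus>\<^bsub>N\<^esub>w\<in>?D. x \<odot>\<^bsub>N\<^esub> (u (\<alpha> w) \<odot>\<^bsub>N\<^esub> K (free_gen R w)))"
  proof (rule N.M.finsum_cong')
    fix w assume "w \<in> ?D"
    from cl[OF this] show "u (\<tau> w) \<odot>\<^bsub>N\<^esub> K (free_gen R w) = x \<odot>\<^bsub>N\<^esub> (u (\<alpha> w) \<odot>\<^bsub>N\<^esub> K (free_gen R w))"
      using x u\<alpha> by (simp add: eq[symmetric] N.smult_assoc1)
  qed (use x u\<alpha> cl in \<open>auto intro!: N.smult_closed\<close>)
  also have "\<dots> = x \<odot>\<^bsub>N\<^esub> (\<Oplus>\<^bsub>N\<^esub>w\<in>?D. u (\<alpha> w) \<odot>\<^bsub>N\<^esub> K (free_gen R w))"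
    using x u\<alpha> cl by (intro N.smult_finsum[symmetric]) (auto intro!: N.smult_closed)
  also have "(\<Oplus>\<^bsub>N\<^esub>w\<in>?D. u (\<alpha> w) \<odot>\<^bsub>N\<^esub> K (free_gen R w)) = K \<alpha>"
    by (rule FU_linear_sum[symmetric, OF K \<alpha> D(1) _ D(2)]) auto
  finally show ?thesis .
qed

text \<open>The kernel of the augmentation \<open>F\<^sub>0 U \<rightarrow> U\<close>.\<close>

definition ZU :: "('r, 'u \<Rightarrow> 'r) module" where
  "ZU = FU\<lparr>carrier := {z \<in> carrier FU. augU z = \<zero>}\<rparr>"

lemma ZU_simps: "z \<in> carrier ZU \<longleftrightarrow> z \<in> carrier FU \<and> augU z = \<zero>"
  "\<zero>\<^bsub>ZU\<^esub> = \<zero>\<^bsub>FU\<^esub>" "x \<oplus>\<^bsub>ZU\<^esub> y = x \<oplus>\<^bsub>FU\<^esub> y" "r \<odot>\<^bsub>ZU\<^esub> x = r \<odot>\<^bsub>FU\<^esub> x"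
  by (simp_all add: ZU_def)

lemma ZU_left_module: "left_module R ZU"
proof -
  interpret F: left_module R FU by (rule FU_left_module)
  show ?thesis
    unfolding ZU_def
    by (rule sub_left_module[OF FU_left_module])
      (auto simp: linear_on_zero[OF FU_left_module restr_left_module augU_linear] linear_on_add[OF augU_linear]
        linear_on_smult[OF augU_linear] restr_bimod_simps F.smult_closed)
qed

lemma ZU_uminus: "x \<in> carrier ZU \<Longrightarrow> \<ominus>\<^bsub>ZU\<^esub> x = \<ominus>\<^bsub>FU\<^esub> x"
proof -
  assume x: "x \<in> carrier ZU"
  interpret L: left_module R ZU by (rule ZU_left_module)
  interpret F: left_module R FU by (rule FU_left_module)
  have "\<ominus>\<^bsub>ZU\<^esub> x \<oplus>\<^bsub>FU\<^esub> x = \<zero>\<^bsub>FU\<^esub>" using L.M.l_neg[OF x] by (simp add: ZU_simps(2,3))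
  then show ?thesis
    using F.M.minus_equality[of "\<ominus>\<^bsub>ZU\<^esub> x" x] x L.M.a_inv_closed[OF x] by (simp add: ZU_simps(1))
qed

lemma ZU_minus: "y \<in> carrier ZU \<Longrightarrow> x \<ominus>\<^bsub>ZU\<^esub> y = x \<ominus>\<^bsub>FU\<^esub> y"
  by (simp add: a_minus_def ZU_uminus ZU_simps(3))

lemma ZU_diffI:
  assumes "x \<in> carrier FU" "y \<in> carrier FU" "augU x = augU y"
  shows "x \<ominus>\<^bsub>FU\<^esub> y \<in> carrier ZU"
proof -
  interpret F: left_module R FU by (rule FU_left_module)
  interpret L: left_module R UU by (rule restr_left_module)
  have "augU (x \<ominus>\<^bsub>FU\<^esub> y) = \<zero>\<^bsub>UU\<^esub>"
    using assms linear_on_closed[OF augU_linear assms(2)]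
    by (simp add: linear_on_diff[OF FU_left_module restr_left_module augU_linear] L.M.minus_eq_zero_iff)
  then show ?thesis using assms by (simp add: ZU_simps restr_bimod_simps)
qed

lemma ZU_finsum_apply:
  "f \<in> I \<rightarrow> carrier ZU \<Longrightarrow> finsum ZU f I s = (\<Oplus>\<^bsub>R\<^esub>i\<in>I. f i s)"
proof -
  assume f: "f \<in> I \<rightarrow> carrier ZU"
  interpret L: left_module R ZU by (rule ZU_left_module)
  show ?thesis
    using f
  proof (induction I rule: infinite_finite_induct)
    case (insert i I)
    then have *: "f i \<in> carrier ZU" "f \<in> I \<rightarrow> carrier ZU" by auto
    then have "f i s \<in> carrier R" "(\<lambda>i. f i s) \<in> I \<rightarrow> carrier R" using FU_apply by (auto simp: ZU_simps Pi_iff)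
    with * insert show ?case by (simp add: L.M.finsum_insert R.finsum_insert ZU_simps free_mod_simps)
  qed (simp_all add: L.M.finsum_infinite R.finsum_infinite ZU_simps free_mod_simps)
qed

text \<open>
  If \<open>\<tau> w\<close> is another combination with value \<open>w\<close>, then replacing the generators by the \<open>\<tau> w\<close> changes
  \<open>\<kappa>\<close> by a combination of the elements \<open>[w] - \<tau> w\<close> of the kernel.
\<close>

lemma ZU_expand:
  assumes D: "finite D" "D \<subseteq> carrier U" and \<kappa>: "\<kappa> \<in> carrier FU" "supp \<kappa> \<subseteq> D"
    and \<tau>: "\<And>w. w \<in> D \<Longrightarrow> \<tau> w \<in> carrier FU" "\<And>w. w \<in> D \<Longrightarrow> augU (\<tau> w) = w"
  shows "finsum ZU (\<lambda>w. \<kappa> w \<odot>\<^bsub>ZU\<^esub> (free_gen R w \<ominus>\<^bsub>FU\<^esub> \<tau> w)) D y = \<kappa> y \<ominus>\<^bsub>R\<^esub> (\<Oplus>\<^bsub>R\<^esub>w\<in>D. \<kappa> w \<otimes>\<^bsub>R\<^esub> \<tau> w y)"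
proof -
  interpret L: left_module R ZU by (rule ZU_left_module)
  let ?g = "free_gen R"
  have \<kappa>R: "\<kappa> w \<in> carrier R" for w using FU_apply[OF \<kappa>(1)] .
  have \<tau>R: "\<tau> w y \<in> carrier R" if "w \<in> D" for w using FU_apply[OF \<tau>(1)[OF that]] .
  have g: "?g w \<in> carrier FU" "w \<in> carrier U" "?g w y \<in> carrier R" if "w \<in> D" for w
    using D(2) that FU_gen by (auto simp: free_gen_def)
  have e: "?g w \<ominus>\<^bsub>FU\<^esub> \<tau> w \<in> carrier ZU" if "w \<in> D" for w
    using that by (intro ZU_diffI g \<tau>) (simp_all add: augU_gen g \<tau>)
  have cl: "(\<lambda>w. \<kappa> w \<odot>\<^bsub>ZU\<^esub> (?g w \<ominus>\<^bsub>FU\<^esub> \<tau> w)) \<in> D \<rightarrow> carrier ZU" using \<kappa>R e by (intro Pi_I L.smult_closed) auto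
  have "finsum ZU (\<lambda>w. \<kappa> w \<odot>\<^bsub>ZU\<^esub> (?g w \<ominus>\<^bsub>FU\<^esub> \<tau> w)) D y = (\<Oplus>\<^bsub>R\<^esub>w\<in>D. (\<kappa> w \<odot>\<^bsub>ZU\<^esub> (?g w \<ominus>\<^bsub>FU\<^esub> \<tau> w)) y)"
    by (rule ZU_finsum_apply[OF cl])
  also have "\<dots> = (\<Oplus>\<^bsub>R\<^esub>w\<in>D. \<kappa> w \<otimes>\<^bsub>R\<^esub> ?g w y \<ominus>\<^bsub>R\<^esub> \<kappa> w \<otimes>\<^bsub>R\<^esub> \<tau> w y)"
  proof (rule R.finsum_cong')
    fix w assume w: "w \<in> D"
    have "(?g w \<ominus>\<^bsub>FU\<^esub> \<tau> w) y = ?g w y \<ominus>\<^bsub>R\<^esub> \<tau> w y" by (rule free_mod_minus[OF R.ring_axioms g(1)[OF w] \<tau>(1)[OF w]])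
    then show "(\<kappa> w \<odot>\<^bsub>ZU\<^esub> (?g w \<ominus>\<^bsub>FU\<^esub> \<tau> w)) y = \<kappa> w \<otimes>\<^bsub>R\<^esub> ?g w y \<ominus>\<^bsub>R\<^esub> \<kappa> w \<otimes>\<^bsub>R\<^esub> \<tau> w y"
      using \<kappa>R \<tau>R[OF w] g(3)[OF w] by (simp add: ZU_simps free_mod_simps a_minus_def R.r_distr R.r_minus)
  qed (use \<kappa>R \<tau>R g(3) in auto)
  also have "\<dots> = (\<Oplus>\<^bsub>R\<^esub>w\<in>D. \<kappa> w \<otimes>\<^bsub>R\<^esub> ?g w y) \<ominus>\<^bsub>R\<^esub> (\<Oplus>\<^bsub>R\<^esub>w\<in>D. \<kappa> w \<otimes>\<^bsub>R\<^esub> \<tau> w y)"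
    using \<kappa>R \<tau>R g(3) by (intro R.finsum_minus) auto
  also have "(\<Oplus>\<^bsub>R\<^esub>w\<in>D. \<kappa> w \<otimes>\<^bsub>R\<^esub> ?g w y) = \<kappa> y"
  proof (cases "y \<in> D")
    case True
    have "(\<Oplus>\<^bsub>R\<^esub>w\<in>D. \<kappa> w \<otimes>\<^bsub>R\<^esub> ?g w y) = (\<Oplus>\<^bsub>R\<^esub>w\<in>D. if y = w then \<kappa> w else \<zero>\<^bsub>R\<^esub>)"
      using \<kappa>R by (intro R.finsum_cong') (auto simp: free_gen_def)
    also have "\<dots> = \<kappa> y" using True D(1) \<kappa>R by (intro R.add.finprod_singleton) auto
    finally show ?thesis .
  next
    case False
    then have "\<kappa> y = \<zero>\<^bsub>R\<^esub>" using \<kappa>(2) by blast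
    moreover have "(\<Oplus>\<^bsub>R\<^esub>w\<in>D. \<kappa> w \<otimes>\<^bsub>R\<^esub> ?g w y) = \<zero>\<^bsub>R\<^esub>"
      by (rule R.add.finprod_one_eqI) (use False \<kappa>R in \<open>auto simp: free_gen_def\<close>)
    ultimately show ?thesis by simp
  qed
  finally show ?thesis .
qed

text \<open>
  The analogue of \<open>linear_twist\<close> for maps that are defined only on the kernel of the augmentation. The
  generators of the free module are not available there. But \<open>\<alpha>\<close> and \<open>\<tau>\<close> are relations between elements
  \<open>w\<close> of \<open>U\<close>, so that, for suitable numerators \<open>\<theta> w\<close> satisfying the same relations, both are combinations
  of the elements \<open>[w] - \<theta> w\<close> of the kernel.
\<close>

lemma kernel_twist:
  assumes b: "linear_on R ZU NR b" and \<alpha>: "\<alpha> \<in> carrier ZU" and \<tau>: "\<tau> \<in> carrier FU" and x: "x \<in> carrier U"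
    and eq: "\<And>y. x \<otimes> u (\<alpha> y) = u (\<tau> y)"
  shows "\<tau> \<in> carrier ZU" "b \<tau> = x \<odot>\<^bsub>N\<^esub> b \<alpha>"
proof -
  interpret F: left_module R FU by (rule FU_left_module)
  interpret L: left_module R ZU by (rule ZU_left_module)
  have \<alpha>F: "\<alpha> \<in> carrier FU" using \<alpha> by (simp add: ZU_simps)
  show \<tau>Z: "\<tau> \<in> carrier ZU" using augU_twist[OF \<alpha>F \<tau> x eq] \<alpha> \<tau> x by (simp add: ZU_simps)
  let ?D = "supp \<alpha> \<union> supp \<tau>"
  have D: "finite ?D" "?D \<subseteq> carrier U" using supp_finite supp_carrier \<alpha>F \<tau> by auto
  obtain \<theta> where "\<And>w. w \<in> insert \<one> ?D \<Longrightarrow> \<theta> w \<in> carrier FU" "\<And>w. w \<in> insert \<one> ?D \<Longrightarrow> augU (\<theta> w) = w"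
    and rel: "\<And>\<kappa> y. \<kappa> \<in> {\<alpha>, \<tau>} \<Longrightarrow> (\<Oplus>\<^bsub>R\<^esub>w\<in>?D. \<kappa> w \<otimes>\<^bsub>R\<^esub> \<theta> w y) = \<zero>\<^bsub>R\<^esub>"
    by (rule trivialize_relations[OF D, of "{\<alpha>, \<tau>}"]) (use \<alpha> \<tau>Z in \<open>auto simp: ZU_simps\<close>)
  then have \<theta>: "\<theta> w \<in> carrier FU" "augU (\<theta> w) = w" if "w \<in> ?D" for w using that by auto
  define \<zeta> where "\<zeta> w = free_gen R w \<ominus>\<^bsub>FU\<^esub> \<theta> w" for w
  have gen: "free_gen R w \<in> carrier FU" "w \<in> carrier U" if "w \<in> ?D" for w using D(2) that FU_gen by auto
  have \<zeta>: "\<zeta> w \<in> carrier ZU" if "w \<in> ?D" for w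
    unfolding \<zeta>_def by (rule ZU_diffI[OF gen(1)[OF that] \<theta>(1)[OF that]]) (simp add: augU_gen gen(2)[OF that] \<theta>(2)[OF that])
  have sum: "b \<kappa> = (\<Oplus>\<^bsub>N\<^esub>w\<in>?D. u (\<kappa> w) \<odot>\<^bsub>N\<^esub> b (\<zeta> w))" if \<kappa>: "\<kappa> \<in> {\<alpha>, \<tau>}" for \<kappa>
  proof -
    have \<kappa>F: "\<kappa> \<in> carrier FU" "supp \<kappa> \<subseteq> ?D" using \<kappa> \<alpha>F \<tau> by auto
    have \<kappa>R: "\<kappa> w \<in> carrier R" for w using FU_apply[OF \<kappa>F(1)] .
    have cl: "(\<lambda>w. \<kappa> w \<odot>\<^bsub>ZU\<^esub> \<zeta> w) \<in> ?D \<rightarrow> carrier ZU" using \<kappa>R \<zeta> by (intro Pi_I L.smult_closed) auto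
    have "finsum ZU (\<lambda>w. \<kappa> w \<odot>\<^bsub>ZU\<^esub> \<zeta> w) ?D y = \<kappa> y" for y
      using ZU_expand[OF D \<kappa>F \<theta>] rel[OF \<kappa>] \<kappa>R by (simp add: \<zeta>_def a_minus_def)
    then have "\<kappa> = finsum ZU (\<lambda>w. \<kappa> w \<odot>\<^bsub>ZU\<^esub> \<zeta> w) ?D" by (simp add: fun_eq_iff)
    then have "b \<kappa> = b (finsum ZU (\<lambda>w. \<kappa> w \<odot>\<^bsub>ZU\<^esub> \<zeta> w) ?D)" by simp
    also have "\<dots> = finsum NR (\<lambda>w. b (\<kappa> w \<odot>\<^bsub>ZU\<^esub> \<zeta> w)) ?D"
      by (rule linear_on_finsum[OF ZU_left_module NR_left_module b cl])
    also have "\<dots> = finsum N (\<lambda>w. b (\<kappa> w \<odot>\<^bsub>ZU\<^esub> \<zeta> w)) ?D"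
      using linear_on_closed[OF b] cl by (intro NR_finsum) (auto simp: restr_mod_simps)
    also have "\<dots> = (\<Oplus>\<^bsub>N\<^esub>w\<in>?D. u (\<kappa> w) \<odot>\<^bsub>N\<^esub> b (\<zeta> w))"
      using linear_on_closed[OF b \<zeta>] \<kappa>R \<zeta> 
      by (intro N.M.finsum_cong') (auto simp: linear_on_smult[OF b] restr_mod_simps intro!: N.smult_closed)
    finally show ?thesis .
  qed
  have b\<zeta>: "b (\<zeta> w) \<in> carrier N" if "w \<in> ?D" for w using linear_on_closed[OF b \<zeta>[OF that]] by (simp add: restr_mod_simps)
  have u\<alpha>: "u (\<alpha> w) \<in> carrier U" for w using FU_apply[OF \<alpha>F] by simp
  have "b \<tau> = (\<Oplus>\<^bsub>N\<^esub>w\<in>?D. u (\<tau> w) \<odot>\<^bsub>N\<^esub> b (\<zeta> w))" by (rule sum) simp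
  also have "\<dots> = (\<Oplus>\<^bsub>N\<^esub>w\<in>?D. x \<odot>\<^bsub>N\<^esub> (u (\<alpha> w) \<odot>\<^bsub>N\<^esub> b (\<zeta> w)))"
  proof (rule N.M.finsum_cong')
    fix w assume w: "w \<in> ?D"
    show "u (\<tau> w) \<odot>\<^bsub>N\<^esub> b (\<zeta> w) = x \<odot>\<^bsub>N\<^esub> (u (\<alpha> w) \<odot>\<^bsub>N\<^esub> b (\<zeta> w))"
      using x u\<alpha> b\<zeta>[OF w] by (simp add: eq[symmetric] N.smult_assoc1)
  qed (use x u\<alpha> b\<zeta> in \<open>auto intro!: N.smult_closed\<close>)
  also have "\<dots> = x \<odot>\<^bsub>N\<^esub> (\<Oplus>\<^bsub>N\<^esub>w\<in>?D. u (\<alpha> w) \<odot>\<^bsub>N\<^esub> b (\<zeta> w))"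
    using x u\<alpha> b\<zeta> by (intro N.smult_finsum[symmetric]) (auto intro!: N.smult_closed)
  also have "(\<Oplus>\<^bsub>N\<^esub>w\<in>?D. u (\<alpha> w) \<odot>\<^bsub>N\<^esub> b (\<zeta> w)) = b \<alpha>" by (rule sum[symmetric]) simp
  finally show "b \<tau> = x \<odot>\<^bsub>N\<^esub> b \<alpha>" .
qed

text \<open>
  This is the vanishing of \<open>Ext\<^sup>1(K, N)\<close>. The extension \<open>c\<close> is forced: write \<open>x u (\<alpha> y) = u (\<tau> y)\<close>
  where \<open>\<alpha>\<close> has the value \<open>1\<close>. Then \<open>c \<alpha> = n + b (\<alpha> - [1])\<close>, and since \<open>c \<tau> = x (c \<alpha>)\<close>, it follows that
  \<open>c [x] = x (c \<alpha>) + b ([x] - \<tau>)\<close>. By \<open>kernel_twist\<close> the right-hand side does not depend on the choice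
  of \<open>\<alpha>\<close> and \<open>\<tau>\<close>, and it does extend \<open>b\<close>.
\<close>

lemma extend_from_kernel:
  assumes b: "linear_on R ZU NR b" and n: "n \<in> carrier N"
  obtains c where "linear_on R FU NR c" "\<And>z. z \<in> carrier ZU \<Longrightarrow> c z = b z" "c (free_gen R \<one>) = n"
proof -
  interpret F: left_module R FU by (rule FU_left_module)
  interpret Z: left_module R ZU by (rule ZU_left_module)
  interpret NN: left_module R NR by (rule NR_left_module)
  let ?g = "free_gen R"
  have bcl: "b z \<in> carrier N" if "z \<in> carrier ZU" for z using linear_on_closed[OF b that] by (simp add: restr_mod_simps)
  have g1: "?g \<one> \<in> carrier FU" "augU (?g \<one>) = \<one>" by (simp_all add: FU_gen augU_gen)
  define ok where "ok x \<alpha> \<tau> \<longleftrightarrow> \<alpha> \<in> carrier FU \<and> \<tau> \<in> carrier FU \<and> augU \<alpha> = \<one> \<and> (\<forall>y. x \<otimes> u (\<alpha> y) = u (\<tau> y))" for x \<alpha> \<tau>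
  define k where "k \<alpha> = n \<oplus>\<^bsub>N\<^esub> b (\<alpha> \<ominus>\<^bsub>FU\<^esub> ?g \<one>)" for \<alpha>
  define v where "v x \<alpha> \<tau> = x \<odot>\<^bsub>N\<^esub> k \<alpha> \<oplus>\<^bsub>N\<^esub> b (?g x \<ominus>\<^bsub>FU\<^esub> \<tau>)" for x \<alpha> \<tau>
  have okD: "\<alpha> \<in> carrier FU" "\<tau> \<in> carrier FU" "\<alpha> \<ominus>\<^bsub>FU\<^esub> ?g \<one> \<in> carrier ZU" "?g x \<ominus>\<^bsub>FU\<^esub> \<tau> \<in> carrier ZU" "augU \<tau> = x"
    "k \<alpha> \<in> carrier N" "v x \<alpha> \<tau> \<in> carrier N"
    if ok: "ok x \<alpha> \<tau>" and x: "x \<in> carrier U" for x \<alpha> \<tau>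
  proof -
    show *: "\<alpha> \<in> carrier FU" "\<tau> \<in> carrier FU" using ok by (auto simp: ok_def)
    show "augU \<tau> = x" using ok x augU_twist[of \<alpha> \<tau> x] by (simp add: ok_def)
    then show 2: "?g x \<ominus>\<^bsub>FU\<^esub> \<tau> \<in> carrier ZU" using * x by (intro ZU_diffI) (auto simp: FU_gen augU_gen)
    show 1: "\<alpha> \<ominus>\<^bsub>FU\<^esub> ?g \<one> \<in> carrier ZU" using * ok g1 by (intro ZU_diffI) (auto simp: ok_def)
    show "k \<alpha> \<in> carrier N" unfolding k_def using n bcl[OF 1] by simp
    then show "v x \<alpha> \<tau> \<in> carrier N" unfolding v_def using x bcl[OF 2] by (simp add: N.smult_closed)
  qed
  have b_minus: "b (y \<ominus>\<^bsub>FU\<^esub> z) = b y \<ominus>\<^bsub>N\<^esub> b z" if "y \<in> carrier ZU" "z \<in> carrier ZU" for y z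
    using linear_on_diff[OF ZU_left_module NR_left_module b that] bcl that by (simp add: ZU_minus NR_minus)
  have v_unique: "v x \<alpha> \<tau> = v x \<alpha>' \<tau>'" if ok: "ok x \<alpha> \<tau>" "ok x \<alpha>' \<tau>'" and x: "x \<in> carrier U" for x \<alpha> \<tau> \<alpha>' \<tau>'
  proof -
    note o1 = okD[OF ok(1) x] and o2 = okD[OF ok(2) x]
    have d: "\<alpha> \<ominus>\<^bsub>FU\<^esub> \<alpha>' \<in> carrier ZU" using o1 o2 ok by (intro ZU_diffI) (auto simp: ok_def)
    have dt: "\<tau> \<ominus>\<^bsub>FU\<^esub> \<tau>' \<in> carrier ZU" using o1 o2 by (intro ZU_diffI) auto
    have "x \<otimes> u ((\<alpha> \<ominus>\<^bsub>FU\<^esub> \<alpha>') y) = u ((\<tau> \<ominus>\<^bsub>FU\<^esub> \<tau>') y)" for y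
    proof -
      have "\<alpha> y \<in> carrier R" "\<alpha>' y \<in> carrier R" "\<tau> y \<in> carrier R" "\<tau>' y \<in> carrier R" using o1 o2 FU_apply by auto
      moreover have "x \<otimes> u (\<alpha> y) = u (\<tau> y)" "x \<otimes> u (\<alpha>' y) = u (\<tau>' y)" using ok by (auto simp: ok_def)
      ultimately show ?thesis
        using x o1 o2 by (simp add: free_mod_minus[OF R.ring_axioms]) (simp add: a_minus_def S.r_distr S.r_minus)
    qed
    then have tw: "b (\<tau> \<ominus>\<^bsub>FU\<^esub> \<tau>') = x \<odot>\<^bsub>N\<^esub> b (\<alpha> \<ominus>\<^bsub>FU\<^esub> \<alpha>')"
      using kernel_twist(2)[OF b d _ x] dt by (simp add: ZU_simps)
    have e1: "\<alpha> \<ominus>\<^bsub>FU\<^esub> ?g \<one> = (\<alpha> \<ominus>\<^bsub>FU\<^esub> \<alpha>') \<oplus>\<^bsub>ZU\<^esub> (\<alpha>' \<ominus>\<^bsub>FU\<^esub> ?g \<one>)"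
      using o1 o2 g1 by (simp add: ZU_simps a_minus_def F.M.a_assoc F.M.r_neg1)
    have gx: "?g x \<in> carrier FU" using x by (rule FU_gen)
    have e2: "?g x \<ominus>\<^bsub>FU\<^esub> \<tau>' = (\<tau> \<ominus>\<^bsub>FU\<^esub> \<tau>') \<oplus>\<^bsub>ZU\<^esub> (?g x \<ominus>\<^bsub>FU\<^esub> \<tau>)"
      using o1 o2 gx F.M.a_comm[of "\<tau> \<ominus>\<^bsub>FU\<^esub> \<tau>'" "?g x \<ominus>\<^bsub>FU\<^esub> \<tau>"]
      by (simp add: ZU_simps a_minus_def F.M.a_assoc F.M.r_neg1)
    have k: "k \<alpha> = b (\<alpha> \<ominus>\<^bsub>FU\<^esub> \<alpha>') \<oplus>\<^bsub>N\<^esub> k \<alpha>'"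
      unfolding k_def e1 using n bcl[OF d] bcl[OF o2(3)]
      by (simp add: linear_on_add[OF b d o2(3)] restr_mod_simps N.M.a_lcomm)
    have "v x \<alpha> \<tau> = x \<odot>\<^bsub>N\<^esub> k \<alpha>' \<oplus>\<^bsub>N\<^esub> (x \<odot>\<^bsub>N\<^esub> b (\<alpha> \<ominus>\<^bsub>FU\<^esub> \<alpha>') \<oplus>\<^bsub>N\<^esub> b (?g x \<ominus>\<^bsub>FU\<^esub> \<tau>))"
      unfolding v_def k using x bcl[OF d] o2(6) bcl[OF o1(4)] N.smult_closed[OF x o2(6)] N.smult_closed[OF x bcl[OF d]]
      by (simp add: N.smult_r_distr N.M.a_assoc N.M.a_lcomm)
    also have "x \<odot>\<^bsub>N\<^esub> b (\<alpha> \<ominus>\<^bsub>FU\<^esub> \<alpha>') \<oplus>\<^bsub>N\<^esub> b (?g x \<ominus>\<^bsub>FU\<^esub> \<tau>) = b (?g x \<ominus>\<^bsub>FU\<^esub> \<tau>')"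
      unfolding e2 tw[symmetric] by (simp add: linear_on_add[OF b dt o1(4)] restr_mod_simps)
    finally show ?thesis by (simp add: v_def)
  qed
  define s where "s x = (SOME n. \<exists>\<alpha> \<tau>. ok x \<alpha> \<tau> \<and> n = v x \<alpha> \<tau>)" for x
  have s_eq: "s x = v x \<alpha> \<tau>" if "ok x \<alpha> \<tau>" "x \<in> carrier U" for x \<alpha> \<tau>
    unfolding s_def
  proof (rule some_equality)
    show "\<exists>\<alpha>' \<tau>'. ok x \<alpha>' \<tau>' \<and> v x \<alpha> \<tau> = v x \<alpha>' \<tau>'" using that by blast
  qed (use v_unique that in blast)
  have ok_ex: "\<exists>\<alpha> \<tau>. \<forall>x\<in>D. ok x \<alpha> (\<tau> x)" if D: "finite D" "D \<subseteq> carrier U" for D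
  proof -
    obtain \<alpha> \<tau> where *: "\<alpha> \<in> carrier FU" "augU \<alpha> = \<one>" "\<And>x. x \<in> D \<Longrightarrow> \<tau> x \<in> carrier FU"
      "\<And>x y. x \<in> D \<Longrightarrow> x \<otimes> u (\<alpha> y) = u (\<tau> x y)"
      by (rule denominators[OF D]) blast
    then show ?thesis by (intro exI[of _ \<alpha>] exI[of _ \<tau>]) (simp add: ok_def)
  qed
  have s_cl: "s x \<in> carrier N" if x: "x \<in> carrier U" for x
  proof -
    obtain \<alpha> \<tau> where "ok x \<alpha> \<tau>" using ok_ex[of "{x}"] x by auto
    then show ?thesis using s_eq okD(7) x by simp
  qed
  define c where "c = free_ext R NR s"
  have sPi: "s \<in> carrier U \<rightarrow> carrier NR" using s_cl by (simp add: restr_mod_simps)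
  have c: "linear_on R FU NR c" unfolding c_def by (rule free_ext_linear[OF NR_left_module sPi])
  have cg: "c (?g x) = s x" if "x \<in> carrier U" for x unfolding c_def by (rule free_ext_gen[OF NR_left_module sPi that])
  show ?thesis
  proof (rule that[OF c])
    have ok1: "ok \<one> (?g \<one>) (?g \<one>)" using g1 FU_apply[OF g1(1)] by (simp add: ok_def)
    have "?g \<one> \<ominus>\<^bsub>FU\<^esub> ?g \<one> = \<zero>\<^bsub>ZU\<^esub>" using g1 by (simp add: F.M.minus_eq_zero_iff ZU_simps)
    then have "v \<one> (?g \<one>) (?g \<one>) = n"
      using n linear_on_zero[OF ZU_left_module NR_left_module b] by (simp add: v_def k_def restr_mod_simps N.smult_one)
    then show "c (?g \<one>) = n" using s_eq[OF ok1] cg by simp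
  next
    fix z assume z: "z \<in> carrier ZU"
    then have zF: "z \<in> carrier FU" and augz: "augU z = \<zero>" by (auto simp: ZU_simps)
    let ?D = "supp z"
    have D: "finite ?D" "?D \<subseteq> carrier U" using supp_finite supp_carrier zF by auto
    have zR: "z w \<in> carrier R" for w using FU_apply[OF zF] .
    obtain \<alpha> \<tau> where ok: "\<And>x. x \<in> ?D \<Longrightarrow> ok x \<alpha> (\<tau> x)" using ok_ex[OF D] by blast
    show "c z = b z"
    proof (cases "?D = {}")
      case True
      then have "z = \<zero>\<^bsub>ZU\<^esub>" by (auto simp: ZU_simps free_mod_simps fun_eq_iff)
      then show ?thesis
        using linear_on_zero[OF ZU_left_module NR_left_module b] linear_on_zero[OF FU_left_module NR_left_module c]
        by (simp add: ZU_simps)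
    next
      case False
      then obtain x0 where x0: "x0 \<in> ?D" by blast
      then have x0U: "x0 \<in> carrier U" using D(2) by blast
      have kN: "k \<alpha> \<in> carrier N" and \<alpha>F: "\<alpha> \<in> carrier FU" using okD[OF ok[OF x0] x0U] by auto
      have wU: "w \<in> carrier U" if "w \<in> ?D" for w using D(2) that by blast
      note o = okD[OF ok wU]
      let ?e = "\<lambda>w. ?g w \<ominus>\<^bsub>FU\<^esub> \<tau> w"
      have e: "?e w \<in> carrier ZU" if "w \<in> ?D" for w using o(4)[OF that that] .
      have cl: "(\<lambda>w. z w \<odot>\<^bsub>ZU\<^esub> ?e w) \<in> ?D \<rightarrow> carrier ZU" using zR e by (intro Pi_I Z.smult_closed) auto
      have uz: "u (z w) \<in> carrier U" for w using zR by simp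
      have "c z = (\<Oplus>\<^bsub>N\<^esub>w\<in>?D. u (z w) \<odot>\<^bsub>N\<^esub> c (?g w))" by (rule FU_linear_sum[OF c zF D(1) subset_refl D(2)])
      also have "\<dots> = (\<Oplus>\<^bsub>N\<^esub>w\<in>?D. (u (z w) \<otimes> w) \<odot>\<^bsub>N\<^esub> k \<alpha> \<oplus>\<^bsub>N\<^esub> b (z w \<odot>\<^bsub>ZU\<^esub> ?e w))"
      proof (rule N.M.finsum_cong')
        fix w assume w: "w \<in> ?D"
        have "c (?g w) = w \<odot>\<^bsub>N\<^esub> k \<alpha> \<oplus>\<^bsub>N\<^esub> b (?e w)" using cg[OF wU[OF w]] s_eq[OF ok[OF w] wU[OF w]] by (simp add: v_def)
        then show "u (z w) \<odot>\<^bsub>N\<^esub> c (?g w) = (u (z w) \<otimes> w) \<odot>\<^bsub>N\<^esub> k \<alpha> \<oplus>\<^bsub>N\<^esub> b (z w \<odot>\<^bsub>ZU\<^esub> ?e w)"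
          using uz kN wU[OF w] bcl[OF e[OF w]] zR e[OF w]
          by (simp add: N.smult_r_distr N.smult_closed N.smult_assoc1 linear_on_smult[OF b] restr_mod_simps)
      next
        show "(\<lambda>w. (u (z w) \<otimes> w) \<odot>\<^bsub>N\<^esub> k \<alpha> \<oplus>\<^bsub>N\<^esub> b (z w \<odot>\<^bsub>ZU\<^esub> ?e w)) \<in> ?D \<rightarrow> carrier N"
          using uz kN wU bcl cl by (intro Pi_I N.M.a_closed N.smult_closed S.m_closed) auto
      qed rule
      also have "\<dots> = (\<Oplus>\<^bsub>N\<^esub>w\<in>?D. (u (z w) \<otimes> w) \<odot>\<^bsub>N\<^esub> k \<alpha>) \<oplus>\<^bsub>N\<^esub> (\<Oplus>\<^bsub>N\<^esub>w\<in>?D. b (z w \<odot>\<^bsub>ZU\<^esub> ?e w))"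
        using uz kN wU bcl cl by (intro N.M.finsum_addf Pi_I N.smult_closed S.m_closed) auto
      also have "(\<Oplus>\<^bsub>N\<^esub>w\<in>?D. (u (z w) \<otimes> w) \<odot>\<^bsub>N\<^esub> k \<alpha>) = (\<Oplus>w\<in>?D. u (z w) \<otimes> w) \<odot>\<^bsub>N\<^esub> k \<alpha>"
        using uz kN wU by (intro N.finsum_smult[symmetric]) auto
      also have "(\<Oplus>w\<in>?D. u (z w) \<otimes> w) = \<zero>" using augU_sum[OF zF D(1) subset_refl D(2)] augz by simp
      also have "(\<Oplus>\<^bsub>N\<^esub>w\<in>?D. b (z w \<odot>\<^bsub>ZU\<^esub> ?e w)) = b (finsum ZU (\<lambda>w. z w \<odot>\<^bsub>ZU\<^esub> ?e w) ?D)"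
        using linear_on_finsum[OF ZU_left_module NR_left_module b cl] bcl cl by (subst (asm) NR_finsum) auto
      finally have cz: "c z = b (finsum ZU (\<lambda>w. z w \<odot>\<^bsub>ZU\<^esub> ?e w) ?D)"
        using kN bcl[OF Z.M.finsum_closed[OF cl]] by (simp add: N.smult_zero_left)
      let ?f = "finsum ZU (\<lambda>w. z w \<odot>\<^bsub>ZU\<^esub> ?e w) ?D"
      have f: "?f \<in> carrier ZU" by (rule Z.M.finsum_closed[OF cl])
      let ?t = "z \<ominus>\<^bsub>FU\<^esub> ?f"
      have t: "?t \<in> carrier ZU" using Z.M.minus_closed[OF z f] ZU_minus[OF f, of z] by simp
      \<comment> \<open>The coefficients of \<open>?t\<close> are in the kernel of \<open>u\<close>.\<close>
      have ut: "u (?t y) = \<zero>" for y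
      proof -
        have \<tau>R: "\<tau> w y \<in> carrier R" if "w \<in> ?D" for w using FU_apply[OF o(2)[OF that that]] .
        have fy: "?f y = z y \<ominus>\<^bsub>R\<^esub> (\<Oplus>\<^bsub>R\<^esub>w\<in>?D. z w \<otimes>\<^bsub>R\<^esub> \<tau> w y)"
          by (rule ZU_expand[OF D zF subset_refl]) (use o in auto)
        have sR: "(\<Oplus>\<^bsub>R\<^esub>w\<in>?D. z w \<otimes>\<^bsub>R\<^esub> \<tau> w y) \<in> carrier R" using zR \<tau>R by (intro R.finsum_closed) auto
        have "?t y = z y \<ominus>\<^bsub>R\<^esub> ?f y" using f by (intro free_mod_minus[OF R.ring_axioms zF]) (simp add: ZU_simps)
        also have "\<dots> = (\<Oplus>\<^bsub>R\<^esub>w\<in>?D. z w \<otimes>\<^bsub>R\<^esub> \<tau> w y)"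
          unfolding fy using sR zR by (simp add: a_minus_def R.minus_add R.r_neg1 R.r_neg2)
        finally have "u (?t y) = (\<Oplus>w\<in>?D. u (z w \<otimes>\<^bsub>R\<^esub> \<tau> w y))"
          using zR \<tau>R u_finsum[of "\<lambda>w. z w \<otimes>\<^bsub>R\<^esub> \<tau> w y" ?D] by simp
        also have "\<dots> = (\<Oplus>w\<in>?D. u (z w) \<otimes> w \<otimes> u (\<alpha> y))"
        proof (rule S.finsum_cong')
          fix w assume w: "w \<in> ?D"
          have "w \<otimes> u (\<alpha> y) = u (\<tau> w y)" using ok[OF w] by (simp add: ok_def)
          then show "u (z w \<otimes>\<^bsub>R\<^esub> \<tau> w y) = u (z w) \<otimes> w \<otimes> u (\<alpha> y)"
            using zR \<tau>R[OF w] wU[OF w] FU_apply[OF \<alpha>F] by (simp add: S.m_assoc)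
        qed (use uz wU FU_apply[OF \<alpha>F] in auto)
        also have "\<dots> = (\<Oplus>w\<in>?D. u (z w) \<otimes> w) \<otimes> u (\<alpha> y)"
          using uz wU FU_apply[OF \<alpha>F] D(1) by (intro S.finsum_ldistr[symmetric]) auto
        also have "(\<Oplus>w\<in>?D. u (z w) \<otimes> w) = \<zero>" using augU_sum[OF zF D(1) subset_refl D(2)] augz by simp
        finally show ?thesis using FU_apply[OF \<alpha>F] by simp
      qed
      have "b ?t = \<one> \<odot>\<^bsub>N\<^esub> b \<zero>\<^bsub>ZU\<^esub>"
        by (rule kernel_twist(2)[OF b Z.M.zero_closed]) (use t ut in \<open>auto simp: ZU_simps free_mod_simps\<close>)
      then have "b z \<ominus>\<^bsub>N\<^esub> b ?f = \<zero>\<^bsub>N\<^esub>"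
        using b_minus[OF z f] linear_on_zero[OF ZU_left_module NR_left_module b]
        by (simp add: restr_mod_simps N.smult_zero_right)
      then show ?thesis using cz bcl[OF z] bcl[OF f] by (simp add: N.M.minus_eq_zero_iff)
    qed
  qed
qed

end

section \<open>The completion\<close>

subsection \<open>The bimodule \<open>U/R\<close> and modules of homomorphisms\<close>

definition is_bimodule :: "'r ring \<Rightarrow> ('r, 'b) bimodule \<Rightarrow> bool" where
  "is_bimodule R E \<longleftrightarrow> left_module R E \<and> right_module R (right_of E) \<and>
     (\<forall>r\<in>carrier R. \<forall>s\<in>carrier R. \<forall>x\<in>carrier E. ract E (r \<odot>\<^bsub>E\<^esub> x) s = r \<odot>\<^bsub>E\<^esub> ract E x s)"

lemma is_bimodule_ract_linear:
  assumes "is_bimodule R E" "s \<in> carrier R"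
  shows "linear_on R E E (\<lambda>x. ract E x s)"
proof -
  interpret E: right_module R "right_of E" using assms(1) by (simp add: is_bimodule_def)
  show ?thesis
    using assms E.rsmult_closed[OF assms(2)] E.rsmult_l_distr[OF assms(2)]
    by (auto simp: linear_on_def is_bimodule_def right_of_simps)
qed

lemma hom_mod_simps:
  "carrier (hom_mod R E V) = mod_hom R E V"
  "\<zero>\<^bsub>hom_mod R E V\<^esub> = (\<lambda>x\<in>carrier E. \<zero>\<^bsub>V\<^esub>)"
  "f \<oplus>\<^bsub>hom_mod R E V\<^esub> g = (\<lambda>x\<in>carrier E. f x \<oplus>\<^bsub>V\<^esub> g x)"
  "r \<odot>\<^bsub>hom_mod R E V\<^esub> f = (\<lambda>x\<in>carrier E. f (ract E x r))"
  by (simp_all add: hom_mod_def)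

lemma mod_hom_ext:
  assumes "f \<in> mod_hom R E V" "g \<in> mod_hom R E V" "\<And>x. x \<in> carrier E \<Longrightarrow> f x = g x"
  shows "f = g"
  using assms by (auto simp: mod_hom_iff intro: extensionalityI)

lemma hom_mod_left_module:
  assumes E: "is_bimodule R E" and V: "left_module R V"
  shows "left_module R (hom_mod R E V)"
proof -
  have El: "left_module R E" using E by (simp add: is_bimodule_def)
  interpret E: left_module R E by (rule El)
  interpret Er: right_module R "right_of E" using E by (simp add: is_bimodule_def)
  interpret V: left_module R V by fact
  let ?W = "hom_mod R E V"
  note rl = is_bimodule_ract_linear[OF E]
  have cl: "f x \<in> carrier V" if "f \<in> mod_hom R E V" "x \<in> carrier E" for f x
    using that linear_on_closed by (auto simp: mod_hom_iff)
  have rcl: "ract E x r \<in> carrier E" if "x \<in> carrier E" "r \<in> carrier R" for x r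
    using linear_on_closed[OF rl[OF that(2)] that(1)] .
  have eqI: "f = g" if "f \<in> extensional (carrier E)" "g \<in> extensional (carrier E)" "\<And>x. x \<in> carrier E \<Longrightarrow> f x = g x" for f g :: "'b \<Rightarrow> 'c"
    using that by (rule extensionalityI)
  have zero: "\<zero>\<^bsub>?W\<^esub> \<in> carrier ?W"
    unfolding hom_mod_simps by (rule linear_on_restrict[OF El linear_on_const_zero[OF V]])
  have add: "f \<oplus>\<^bsub>?W\<^esub> g \<in> carrier ?W" if "f \<in> carrier ?W" "g \<in> carrier ?W" for f g
    unfolding hom_mod_simps by (rule linear_on_restrict[OF El linear_on_sum[OF V]]) (use that in \<open>auto simp: hom_mod_simps mod_hom_iff\<close>)
  have smult: "r \<odot>\<^bsub>?W\<^esub> f \<in> carrier ?W" if "r \<in> carrier R" "f \<in> carrier ?W" for r f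
    unfolding hom_mod_simps
    by (rule linear_on_restrict[OF El linear_on_comp[OF rl[OF that(1)]]]) (use that in \<open>auto simp: hom_mod_simps mod_hom_iff\<close>)
  have ag: "abelian_group ?W"
  proof (rule abelian_groupI[OF add zero])
    fix f assume f: "f \<in> carrier ?W"
    then have f': "linear_on R E V f" "f \<in> extensional (carrier E)" by (auto simp: hom_mod_simps mod_hom_iff)
    show "\<zero>\<^bsub>?W\<^esub> \<oplus>\<^bsub>?W\<^esub> f = f" by (rule eqI) (use f' f cl in \<open>auto simp: hom_mod_simps\<close>)
    show "\<exists>g\<in>carrier ?W. g \<oplus>\<^bsub>?W\<^esub> f = \<zero>\<^bsub>?W\<^esub>"
    proof
      show "(\<lambda>x\<in>carrier E. \<ominus>\<^bsub>V\<^esub> f x) \<in> carrier ?W"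
        unfolding hom_mod_simps by (rule linear_on_restrict[OF El linear_on_uminus[OF V f'(1)]])
      show "(\<lambda>x\<in>carrier E. \<ominus>\<^bsub>V\<^esub> f x) \<oplus>\<^bsub>?W\<^esub> f = \<zero>\<^bsub>?W\<^esub>"
        by (rule eqI) (use f cl in \<open>auto simp: hom_mod_simps V.M.l_neg\<close>)
    qed
    fix g assume g: "g \<in> carrier ?W"
    show "f \<oplus>\<^bsub>?W\<^esub> g = g \<oplus>\<^bsub>?W\<^esub> f" by (rule eqI) (use f g cl in \<open>auto simp: hom_mod_simps V.M.a_comm\<close>)
    fix h assume h: "h \<in> carrier ?W"
    show "f \<oplus>\<^bsub>?W\<^esub> g \<oplus>\<^bsub>?W\<^esub> h = f \<oplus>\<^bsub>?W\<^esub> (g \<oplus>\<^bsub>?W\<^esub> h)"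
      by (rule eqI) (use f g h cl in \<open>auto simp: hom_mod_simps V.M.a_assoc\<close>)
  qed
  show ?thesis
  proof (intro left_module.intro left_module_axioms.intro E.R.ring_axioms ag smult)
    fix r s f assume rs: "r \<in> carrier R" "s \<in> carrier R" and f: "f \<in> carrier ?W"
    then have f': "linear_on R E V f" by (auto simp: hom_mod_simps mod_hom_iff)
    show "(r \<oplus>\<^bsub>R\<^esub> s) \<odot>\<^bsub>?W\<^esub> f = r \<odot>\<^bsub>?W\<^esub> f \<oplus>\<^bsub>?W\<^esub> s \<odot>\<^bsub>?W\<^esub> f"
    proof (rule eqI)
      fix x assume x: "x \<in> carrier E"
      then have "ract E x (r \<oplus>\<^bsub>R\<^esub> s) = ract E x r \<oplus>\<^bsub>E\<^esub> ract E x s"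
        using Er.rsmult_r_distr[OF rs, of x] by (simp add: right_of_simps)
      then show "((r \<oplus>\<^bsub>R\<^esub> s) \<odot>\<^bsub>?W\<^esub> f) x = (r \<odot>\<^bsub>?W\<^esub> f \<oplus>\<^bsub>?W\<^esub> s \<odot>\<^bsub>?W\<^esub> f) x"
        using x rs by (simp add: hom_mod_simps linear_on_add[OF f'] rcl)
    qed (auto simp: hom_mod_simps)
    show "(r \<otimes>\<^bsub>R\<^esub> s) \<odot>\<^bsub>?W\<^esub> f = r \<odot>\<^bsub>?W\<^esub> (s \<odot>\<^bsub>?W\<^esub> f)"
    proof (rule eqI)
      fix x assume x: "x \<in> carrier E"
      then have "ract E x (r \<otimes>\<^bsub>R\<^esub> s) = ract E (ract E x r) s"
        using Er.rsmult_assoc[OF rs, of x] by (simp add: right_of_simps)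
      then show "((r \<otimes>\<^bsub>R\<^esub> s) \<odot>\<^bsub>?W\<^esub> f) x = (r \<odot>\<^bsub>?W\<^esub> (s \<odot>\<^bsub>?W\<^esub> f)) x"
        using x rs by (simp add: hom_mod_simps rcl)
    qed (auto simp: hom_mod_simps)
  next
    fix r f g assume r: "r \<in> carrier R"
    show "r \<odot>\<^bsub>?W\<^esub> (f \<oplus>\<^bsub>?W\<^esub> g) = r \<odot>\<^bsub>?W\<^esub> f \<oplus>\<^bsub>?W\<^esub> r \<odot>\<^bsub>?W\<^esub> g"
      by (rule eqI) (use r in \<open>auto simp: hom_mod_simps rcl\<close>)
  next
    fix f assume f: "f \<in> carrier ?W"
    show "\<one>\<^bsub>R\<^esub> \<odot>\<^bsub>?W\<^esub> f = f"
      by (rule eqI) (use f Er.rsmult_one in \<open>auto simp: hom_mod_simps mod_hom_iff right_of_simps\<close>)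
  qed
qed

lemma hom_mod_finsum_apply:
  assumes E: "is_bimodule R E" and V: "left_module R V" and f: "f \<in> I \<rightarrow> mod_hom R E V" and x: "x \<in> carrier E"
  shows "finsum (hom_mod R E V) f I x = finsum V (\<lambda>i. f i x) I"
proof -
  interpret W: left_module R "hom_mod R E V" by (rule hom_mod_left_module[OF E V])
  interpret V: left_module R V by fact
  show ?thesis
    using f
  proof (induction I rule: infinite_finite_induct)
    case (insert i I)
    then have *: "f i \<in> mod_hom R E V" "f \<in> I \<rightarrow> mod_hom R E V" by auto
    then have "f i x \<in> carrier V" "(\<lambda>i. f i x) \<in> I \<rightarrow> carrier V"
      using x by (auto simp: mod_hom_iff linear_on_def Pi_iff)
    with * insert x show ?case by (simp add: W.M.finsum_insert V.M.finsum_insert hom_mod_simps)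
  qed (use x in \<open>simp_all add: W.M.finsum_infinite V.M.finsum_infinite hom_mod_simps\<close>)
qed

context ring_map
begin

abbreviation "cok \<equiv> coker_bimod R U u"
abbreviation "\<pi> \<equiv> coker_proj R U u"

lemma image_subgroup: "additive_subgroup (u ` carrier R) U" "additive_subgroup (u ` carrier R) UU"
proof -
  have "subgroup (u ` carrier R) (add_monoid U)"
  proof (rule S.add.subgroupI)
    fix a assume "a \<in> u ` carrier R"
    then obtain r where "a = u r" "r \<in> carrier R" by blast
    then show "\<ominus> a \<in> u ` carrier R" by (auto intro!: image_eqI[of _ _ "\<ominus>\<^bsub>R\<^esub> r"])
  next
    fix a b assume "a \<in> u ` carrier R" "b \<in> u ` carrier R"
    then obtain r s where "a = u r" "r \<in> carrier R" "b = u s" "s \<in> carrier R" by blast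
    then show "a \<oplus> b \<in> u ` carrier R" by (auto intro!: image_eqI[of _ _ "r \<oplus>\<^bsub>R\<^esub> s"])
  qed auto
  then show "additive_subgroup (u ` carrier R) U" by (rule additive_subgroupI)
  interpret L: left_module R UU by (rule restr_left_module)
  have "subgroup (u ` carrier R) (add_monoid UU)"
  proof (rule L.M.add.subgroupI)
    fix a assume "a \<in> u ` carrier R"
    then obtain r where r: "a = u r" "r \<in> carrier R" by blast
    then have "\<ominus>\<^bsub>UU\<^esub> a = u (\<ominus>\<^bsub>R\<^esub> r)"
      using L.M.minus_equality[of "u (\<ominus>\<^bsub>R\<^esub> r)" a] by (simp add: restr_bimod_simps S.l_neg)
    then show "\<ominus>\<^bsub>UU\<^esub> a \<in> u ` carrier R" by (rule image_eqI) (use r in simp)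
  next
    fix a b assume "a \<in> u ` carrier R" "b \<in> u ` carrier R"
    then obtain r s where "a = u r" "r \<in> carrier R" "b = u s" "s \<in> carrier R" by blast
    then show "a \<oplus>\<^bsub>UU\<^esub> b \<in> u ` carrier R" by (auto simp: restr_bimod_simps intro!: image_eqI[of _ _ "r \<oplus>\<^bsub>R\<^esub> s"])
  qed (auto simp: restr_bimod_simps)
  then show "additive_subgroup (u ` carrier R) UU" by (rule additive_subgroupI)
qed

lemma proj_eq_coset: "\<pi> x = (u ` carrier R) +>\<^bsub>UU\<^esub> x"
  by (simp add: coker_proj_def a_r_coset_def' restr_bimod_simps)

lemma UU_abelian_group: "abelian_group UU"
  using restr_left_module by (rule left_module.axioms(2))

lemma cok_carrier: "carrier cok = \<pi> ` carrier U"
  by (auto simp: coker_bimod_def quot_bimod_def rcosets_iff proj_eq_coset restr_bimod_simps)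

lemma proj_closed: "x \<in> carrier U \<Longrightarrow> \<pi> x \<in> carrier cok"
  by (simp add: cok_carrier)

lemma proj_eq_iff:
  assumes "x \<in> carrier U" "y \<in> carrier U"
  shows "\<pi> x = \<pi> y \<longleftrightarrow> x \<ominus> y \<in> u ` carrier R"
  unfolding coker_proj_def using assms by (rule coset_eq_iff[OF S.abelian_group_axioms image_subgroup(1)])

lemma cok_zero: "\<zero>\<^bsub>cok\<^esub> = \<pi> \<zero>"
  using coset_zero[OF S.abelian_group_axioms image_subgroup(1)]
  by (simp add: coker_proj_def coker_bimod_def quot_bimod_def)

lemma proj_eq_zero_iff: "x \<in> carrier U \<Longrightarrow> \<pi> x = \<zero>\<^bsub>cok\<^esub> \<longleftrightarrow> x \<in> u ` carrier R"
  using proj_eq_iff[of x "\<zero>"] by (simp add: cok_zero a_minus_def)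

lemma proj_add: "\<lbrakk>x \<in> carrier U; y \<in> carrier U\<rbrakk> \<Longrightarrow> \<pi> x \<oplus>\<^bsub>cok\<^esub> \<pi> y = \<pi> (x \<oplus> y)"
  using coset_add[OF UU_abelian_group image_subgroup(2), of x y]
  by (simp add: proj_eq_coset coker_bimod_def quot_bimod_def restr_bimod_simps)

lemma proj_smult:
  assumes "r \<in> carrier R" "x \<in> carrier U"
  shows "r \<odot>\<^bsub>cok\<^esub> \<pi> x = \<pi> (u r \<otimes> x)"
proof -
  have "coset_map UU (u ` carrier R) (\<lambda>x. r \<odot>\<^bsub>UU\<^esub> x) (\<pi> x) = u ` carrier R +>\<^bsub>UU\<^esub> (r \<odot>\<^bsub>UU\<^esub> x)"
    unfolding proj_eq_coset
    by (rule coset_map_coset[OF UU_abelian_group image_subgroup(2) UU_abelian_group image_subgroup(2)])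
      (use assms in \<open>auto simp: restr_bimod_simps S.r_distr simp flip: hom_mult\<close>)
  then show ?thesis by (simp add: coker_bimod_def quot_bimod_def restr_bimod_simps proj_eq_coset)
qed

lemma proj_ract:
  assumes "r \<in> carrier R" "x \<in> carrier U"
  shows "ract cok (\<pi> x) r = \<pi> (x \<otimes> u r)"
proof -
  have "coset_map UU (u ` carrier R) (\<lambda>x. ract UU x r) (\<pi> x) = u ` carrier R +>\<^bsub>UU\<^esub> (ract UU x r)"
    unfolding proj_eq_coset
    by (rule coset_map_coset[OF UU_abelian_group image_subgroup(2) UU_abelian_group image_subgroup(2)])
      (use assms in \<open>auto simp: restr_bimod_simps S.l_distr simp flip: hom_mult\<close>)
  then show ?thesis by (simp add: coker_bimod_def quot_bimod_def restr_bimod_simps proj_eq_coset)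
qed

lemma cok_bimodule: "is_bimodule R cok"
proof -
  have neg: "\<exists>y\<in>carrier cok. y \<oplus>\<^bsub>cok\<^esub> x = \<zero>\<^bsub>cok\<^esub>" if "x \<in> carrier cok" for x
  proof -
    have "x \<in> \<pi> ` carrier U" using that by (simp add: cok_carrier)
    then obtain a where a: "x = \<pi> a" "a \<in> carrier U" by blast
    then show ?thesis by (intro bexI[of _ "\<pi> (\<ominus> a)"]) (simp_all add: proj_add cok_zero S.l_neg proj_closed)
  qed
  have ag: "abelian_group cok"
    by (rule abelian_groupI) (use neg in \<open>auto simp: cok_carrier proj_add cok_zero S.a_ac\<close>)
  have ag': "abelian_group (right_of cok)"
    by (rule abelian_groupI) (use neg in \<open>auto simp: right_of_simps cok_carrier proj_add cok_zero S.a_ac\<close>)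
  have "left_module R cok"
    by (intro left_module.intro R.ring_axioms left_module_axioms.intro ag)
      (auto simp: cok_carrier proj_add proj_smult S.l_distr S.r_distr S.m_assoc)
  moreover have "right_module R (right_of cok)"
    by (intro right_module.intro R.ring_axioms right_module_axioms.intro ag')
      (auto simp: right_of_simps cok_carrier proj_add proj_ract S.l_distr S.r_distr S.m_assoc)
  ultimately show ?thesis
    by (auto simp: is_bimodule_def cok_carrier proj_smult proj_ract S.m_assoc)
qed

lemma cok_left_module: "left_module R cok" and cok_right_module: "right_module R (right_of cok)"
  using cok_bimodule by (simp_all add: is_bimodule_def)

lemma proj_linear: "linear_on R UU cok \<pi>"
  by (simp add: linear_on_def restr_bimod_simps proj_closed proj_add proj_smult)

lemma proj_rlinear: "rlinear_on R UR (right_of cok) \<pi>"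
  by (simp add: rlinear_on_def right_of_simps restr_bimod_simps proj_closed proj_add proj_ract)

lemma descend_to_cok:
  assumes V: "left_module R V" and g: "linear_on R UU V g" and one: "g \<one> = \<zero>\<^bsub>V\<^esub>"
  obtains h where "h \<in> mod_hom R cok V" "\<And>x. x \<in> carrier U \<Longrightarrow> h (\<pi> x) = g x"
proof -
  interpret V: left_module R V by fact
  interpret L: left_module R UU by (rule restr_left_module)
  have gu: "g (u r) = \<zero>\<^bsub>V\<^esub>" if "r \<in> carrier R" for r
    using linear_on_smult[OF g that, of "\<one>"] one that by (simp add: restr_bimod_simps V.smult_zero_right)
  have eq: "g x = g y" if "\<pi> x = \<pi> y" "x \<in> carrier U" "y \<in> carrier U" for x y
  proof -
    have "x \<ominus> y \<in> u ` carrier R" using that by (simp add: proj_eq_iff)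
    then obtain r where r: "r \<in> carrier R" "x \<ominus> y = u r" by blast
    have "x = u r \<oplus>\<^bsub>UU\<^esub> y" using r(2)[symmetric] that by (simp add: restr_bimod_simps a_minus_def S.a_assoc S.l_neg)
    then show ?thesis
      using linear_on_add[OF g, of "u r" y] gu[OF r(1)] r(1) that linear_on_closed[OF g, of y]
      by (simp add: restr_bimod_simps)
  qed
  define h where "h = (\<lambda>C\<in>carrier cok. g (SOME x. x \<in> carrier U \<and> \<pi> x = C))"
  have h: "h (\<pi> x) = g x" if x: "x \<in> carrier U" for x
  proof -
    have "\<exists>y. y \<in> carrier U \<and> \<pi> y = \<pi> x" using x by blast
    then have "(SOME y. y \<in> carrier U \<and> \<pi> y = \<pi> x) \<in> carrier U \<and> \<pi> (SOME y. y \<in> carrier U \<and> \<pi> y = \<pi> x) = \<pi> x"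
      by (rule someI_ex)
    then have "g (SOME y. y \<in> carrier U \<and> \<pi> y = \<pi> x) = g x" using x by (intro eq) auto
    then show ?thesis using proj_closed[OF x] by (simp add: h_def)
  qed
  have "h \<in> mod_hom R cok V"
    unfolding mod_hom_iff
    using linear_on_closed[OF g] linear_on_add[OF g] linear_on_smult[OF g]
    by (auto simp: linear_on_def cok_carrier h proj_add proj_smult restr_bimod_simps) (simp add: h_def cok_carrier)
  with h show ?thesis by (rule that[rotated])
qed

end

subsection \<open>The module of compatible families of cosets\<close>

lemma ideal_smult_subgroup:
  assumes "left_module R M" "I \<subseteq> carrier R"
  shows "additive_subgroup (ideal_smult I M) M"
proof -
  interpret left_module R M by fact
  have "subgroup (ideal_smult I M) (add_monoid M)"
    unfolding ideal_smult_def using assms(2)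
    by (intro group.generate_is_subgroup M.add.is_group) (auto intro!: smult_closed)
  then show ?thesis by (rule additive_subgroupI)
qed

lemma ideal_smultI: "\<lbrakk>r \<in> I; m \<in> carrier M\<rbrakk> \<Longrightarrow> r \<odot>\<^bsub>M\<^esub> m \<in> ideal_smult I M"
  unfolding ideal_smult_def by (rule generate.incl) blast

lemma ideal_smult_least:
  assumes "left_module R M" "additive_subgroup H M" "\<And>r m. \<lbrakk>r \<in> I; m \<in> carrier M\<rbrakk> \<Longrightarrow> r \<odot>\<^bsub>M\<^esub> m \<in> H"
  shows "ideal_smult I M \<subseteq> H"
proof -
  interpret left_module R M by fact
  interpret H: additive_subgroup H M by fact
  show ?thesis
    unfolding ideal_smult_def by (rule M.add.generate_subgroup_incl[OF _ H.a_subgroup]) (use assms(3) in auto)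
qed

lemma ideal_smult_mono:
  assumes "left_module R M" "I \<subseteq> J" "J \<subseteq> carrier R"
  shows "ideal_smult I M \<subseteq> ideal_smult J M"
proof (rule ideal_smult_least[OF assms(1) ideal_smult_subgroup[OF assms(1,3)]])
  fix r m assume "r \<in> I" "m \<in> carrier M"
  then show "r \<odot>\<^bsub>M\<^esub> m \<in> ideal_smult J M" using assms(2) by (intro ideal_smultI) auto
qed

lemma linear_ker_subgroup:
  assumes "left_module R M" "abelian_group V" "\<And>x. x \<in> carrier M \<Longrightarrow> f x \<in> carrier V"
    and "\<And>x y. \<lbrakk>x \<in> carrier M; y \<in> carrier M\<rbrakk> \<Longrightarrow> f (x \<oplus>\<^bsub>M\<^esub> y) = f x \<oplus>\<^bsub>V\<^esub> f y"
    and N: "additive_subgroup N V"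
  shows "additive_subgroup {x \<in> carrier M. f x \<in> N} M"
proof -
  interpret M: left_module R M by fact
  interpret V: abelian_group V by fact
  interpret N: additive_subgroup N V by fact
  have z: "f \<zero>\<^bsub>M\<^esub> = \<zero>\<^bsub>V\<^esub>" using assms(4)[of "\<zero>\<^bsub>M\<^esub>" "\<zero>\<^bsub>M\<^esub>"] assms(3)[of "\<zero>\<^bsub>M\<^esub>"] by (simp add: V.add.l_cancel_one')
  have neg: "f (\<ominus>\<^bsub>M\<^esub> x) = \<ominus>\<^bsub>V\<^esub> f x" if "x \<in> carrier M" for x
    using assms(4)[of "\<ominus>\<^bsub>M\<^esub> x" x] that z assms(3)
    by (intro V.minus_equality[symmetric]) (simp_all add: M.M.l_neg)
  show ?thesis
  proof (rule additive_subgroupI, rule M.M.add.subgroupI)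
    show "{x \<in> carrier M. f x \<in> N} \<noteq> {}" using z N.zero_closed by auto
  qed (auto simp: assms(4) neg)
qed

lemma Lambda_simps:
  "\<zero>\<^bsub>Lambda R G M\<^esub> = (\<lambda>I\<in>G. ideal_smult I M)"
  "x \<oplus>\<^bsub>Lambda R G M\<^esub> y = (\<lambda>I\<in>G. x I <+>\<^bsub>M\<^esub> y I)"
  "r \<odot>\<^bsub>Lambda R G M\<^esub> x = (\<lambda>I\<in>G. coset_map M (ideal_smult I M) (\<lambda>m. r \<odot>\<^bsub>M\<^esub> m) (x (ideal_colon R I r)))"
  by (simp_all add: Lambda_def)

locale completion = M: left_module R M for R :: "'r ring" and M :: "('r, 'm) module" +
  fixes G :: "'r set set"
  assumes G_subset: "I \<in> G \<Longrightarrow> I \<subseteq> carrier R"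
    and G_colon: "\<lbrakk>I \<in> G; r \<in> carrier R\<rbrakk> \<Longrightarrow> ideal_colon R I r \<in> G"
begin

abbreviation "cs I m \<equiv> ideal_smult I M +>\<^bsub>M\<^esub> m"
abbreviation "LM \<equiv> Lambda R G M"

lemma sg: "I \<in> G \<Longrightarrow> additive_subgroup (ideal_smult I M) M"
  by (rule ideal_smult_subgroup[OF M.left_module_axioms G_subset])

lemma cs_eq_iff: "\<lbrakk>I \<in> G; m \<in> carrier M; m' \<in> carrier M\<rbrakk> \<Longrightarrow> cs I m = cs I m' \<longleftrightarrow> m \<ominus>\<^bsub>M\<^esub> m' \<in> ideal_smult I M"
  by (rule coset_eq_iff[OF M.M.abelian_group_axioms sg])

lemma cs_mem_iff: "\<lbrakk>I \<in> G; m \<in> carrier M\<rbrakk> \<Longrightarrow> m' \<in> cs I m \<longleftrightarrow> m' \<in> carrier M \<and> m' \<ominus>\<^bsub>M\<^esub> m \<in> ideal_smult I M"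
  by (rule mem_coset_iff[OF M.M.abelian_group_axioms sg])

lemma cs_self: "\<lbrakk>I \<in> G; m \<in> carrier M\<rbrakk> \<Longrightarrow> m \<in> cs I m"
  by (rule coset_self[OF M.M.abelian_group_axioms sg])

lemma cs_mono: "\<lbrakk>I \<in> G; J \<in> G; I \<subseteq> J; m \<in> carrier M\<rbrakk> \<Longrightarrow> cs I m \<subseteq> cs J m"
  using ideal_smult_mono[OF M.left_module_axioms _ G_subset, of I J] by (auto simp: cs_mem_iff)

lemma coset_map_id:
  assumes "I \<in> G" "J \<in> G" "I \<subseteq> J" "m \<in> carrier M"
  shows "coset_map M (ideal_smult J M) (\<lambda>m. m) (cs I m) = cs J m"
  by (rule coset_map_coset[OF M.M.abelian_group_axioms sg M.M.abelian_group_axioms sg])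
    (use assms ideal_smult_mono[OF M.left_module_axioms assms(3) G_subset] in auto)

lemma coset_map_smult:
  assumes "I \<in> G" "r \<in> carrier R" "m \<in> carrier M"
  shows "coset_map M (ideal_smult I M) (\<lambda>m. r \<odot>\<^bsub>M\<^esub> m) (cs (ideal_colon R I r) m) = cs I (r \<odot>\<^bsub>M\<^esub> m)"
proof (rule coset_map_coset[OF M.M.abelian_group_axioms sg M.M.abelian_group_axioms sg])
  have "ideal_smult (ideal_colon R I r) M \<subseteq> {m \<in> carrier M. r \<odot>\<^bsub>M\<^esub> m \<in> ideal_smult I M}"
  proof (rule ideal_smult_least[OF M.left_module_axioms])
    show "additive_subgroup {m \<in> carrier M. r \<odot>\<^bsub>M\<^esub> m \<in> ideal_smult I M} M"
      by (rule linear_ker_subgroup[OF M.left_module_axioms M.M.abelian_group_axioms _ _ sg])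
        (use assms in \<open>auto simp: M.smult_closed M.smult_r_distr\<close>)
    fix t m assume tm: "t \<in> ideal_colon R I r" "m \<in> carrier M"
    then have "t \<in> carrier R" "r \<otimes>\<^bsub>R\<^esub> t \<in> I" by (auto simp: ideal_colon_def)
    then show "t \<odot>\<^bsub>M\<^esub> m \<in> {m \<in> carrier M. r \<odot>\<^bsub>M\<^esub> m \<in> ideal_smult I M}"
      using tm assms(2) ideal_smultI[of "r \<otimes>\<^bsub>R\<^esub> t" I m] by (simp add: M.smult_closed M.smult_assoc1[symmetric])
  qed
  then show "\<And>x. x \<in> ideal_smult (ideal_colon R I r) M \<Longrightarrow> r \<odot>\<^bsub>M\<^esub> x \<in> ideal_smult I M" by blast
qed (use assms in \<open>auto simp: M.smult_closed M.smult_r_distr G_colon\<close>)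

text \<open>
  The compatibility of the family of cosets amounts to inclusions, since \<open>I M \<subseteq> J M\<close> for \<open>I \<subseteq> J\<close>.
\<close>

lemma Lambda_iff:
  "y \<in> carrier LM \<longleftrightarrow> y \<in> extensional G \<and> (\<forall>I\<in>G. \<exists>m\<in>carrier M. y I = cs I m) \<and>
     (\<forall>I\<in>G. \<forall>J\<in>G. I \<subseteq> J \<longrightarrow> y I \<subseteq> y J)"
proof -
  have *: "coset_map M (ideal_smult J M) (\<lambda>m. m) (y I) = y J \<longleftrightarrow> y I \<subseteq> y J"
    if y: "\<forall>I\<in>G. \<exists>m\<in>carrier M. y I = cs I m" and IJ: "I \<in> G" "J \<in> G" "I \<subseteq> J" for I J
  proof -
    obtain m m' where m: "m \<in> carrier M" "y I = cs I m" "m' \<in> carrier M" "y J = cs J m'" using bspec[OF y IJ(1)] bspec[OF y IJ(2)] by blast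
    have 1: "coset_map M (ideal_smult J M) (\<lambda>m. m) (y I) = cs J m" using coset_map_id[OF IJ m(1)] m(2) by simp
    show ?thesis
    proof
      assume "coset_map M (ideal_smult J M) (\<lambda>m. m) (y I) = y J"
      then have "y J = cs J m" using 1 by (rule trans[OF sym])
      then show "y I \<subseteq> y J" using cs_mono[OF IJ m(1)] m(2) by (simp only:)
    next
      assume "y I \<subseteq> y J"
      then have "m \<in> cs J m'" using cs_self[OF IJ(1) m(1)] unfolding m(2,4) by (rule subsetD)
      then have "cs J m = cs J m'" using m(1,3) IJ(2) by (simp add: cs_eq_iff cs_mem_iff)
      with 1 m(4) show "coset_map M (ideal_smult J M) (\<lambda>m. m) (y I) = y J" by (simp only:)
    qed
  qed
  have "y \<in> carrier LM \<longleftrightarrow> y \<in> extensional G \<and> (\<forall>I\<in>G. \<exists>m\<in>carrier M. y I = cs I m) \<and>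
     (\<forall>I\<in>G. \<forall>J\<in>G. I \<subseteq> J \<longrightarrow> coset_map M (ideal_smult J M) (\<lambda>m. m) (y I) = y J)"
    by (auto simp: Lambda_def PiE_def rcosets_iff Pi_iff)
  with * show ?thesis by (metis (no_types, lifting))
qed

lemma Lambda_obtain:
  assumes "y \<in> carrier LM" "I \<in> G"
  obtains m where "m \<in> carrier M" "m \<in> y I" "y I = cs I m"
  using assms cs_self by (auto simp: Lambda_iff)

lemma Lambda_coset:
  assumes "y \<in> carrier LM" "I \<in> G" "m \<in> y I"
  shows "m \<in> carrier M" "y I = cs I m"
proof -
  obtain m' where m': "m' \<in> carrier M" "y I = cs I m'" using assms(1,2) by (rule Lambda_obtain)
  then show "m \<in> carrier M" using assms(2,3) by (simp add: cs_mem_iff)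
  with m' show "y I = cs I m" using assms(2,3) cs_eq_iff[OF assms(2), of m m'] by (simp add: cs_mem_iff)
qed

lemma Lambda_mono: "\<lbrakk>y \<in> carrier LM; I \<in> G; J \<in> G; I \<subseteq> J\<rbrakk> \<Longrightarrow> y I \<subseteq> y J"
  by (simp add: Lambda_iff)

lemma Lambda_eqI: "\<lbrakk>y \<in> carrier LM; y' \<in> carrier LM; \<And>I. I \<in> G \<Longrightarrow> y I = y' I\<rbrakk> \<Longrightarrow> y = y'"
  by (auto simp: Lambda_iff intro: extensionalityI)

lemma Lambda_zero_closed: "\<zero>\<^bsub>LM\<^esub> \<in> carrier LM"
  using ideal_smult_mono[OF M.left_module_axioms] G_subset coset_zero[OF M.M.abelian_group_axioms sg]
  by (auto simp: Lambda_iff Lambda_simps intro!: bexI[of _ "\<zero>\<^bsub>M\<^esub>"])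

lemma Lambda_add_apply:
  assumes "y \<in> carrier LM" "y' \<in> carrier LM" "I \<in> G" "m \<in> y I" "m' \<in> y' I"
  shows "(y \<oplus>\<^bsub>LM\<^esub> y') I = cs I (m \<oplus>\<^bsub>M\<^esub> m')"
  using Lambda_coset[OF assms(1,3,4)] Lambda_coset[OF assms(2,3,5)] assms(3)
    coset_add[OF M.M.abelian_group_axioms sg, of I m m']
  by (simp add: Lambda_simps)

lemma Lambda_smult_apply:
  assumes "y \<in> carrier LM" "r \<in> carrier R" "I \<in> G" "m \<in> y (ideal_colon R I r)"
  shows "(r \<odot>\<^bsub>LM\<^esub> y) I = cs I (r \<odot>\<^bsub>M\<^esub> m)"
  using Lambda_coset[OF assms(1) G_colon[OF assms(3,2)] assms(4)] coset_map_smult[OF assms(3,2)] assms(3)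
  by (simp add: Lambda_simps)

lemma Lambda_add_closed:
  assumes y: "y \<in> carrier LM" and y': "y' \<in> carrier LM"
  shows "y \<oplus>\<^bsub>LM\<^esub> y' \<in> carrier LM"
  unfolding Lambda_iff
proof (intro conjI ballI impI)
  show "y \<oplus>\<^bsub>LM\<^esub> y' \<in> extensional G" by (simp add: Lambda_simps)
  fix I assume I: "I \<in> G"
  obtain m m' where m: "m \<in> carrier M" "m \<in> y I" "m' \<in> carrier M" "m' \<in> y' I"
    using Lambda_obtain[OF y I] Lambda_obtain[OF y' I] by metis
  then show "\<exists>m\<in>carrier M. (y \<oplus>\<^bsub>LM\<^esub> y') I = cs I m"
    using Lambda_add_apply[OF y y' I] by blast
  fix J assume J: "J \<in> G" "I \<subseteq> J"
  then have "m \<in> y J" "m' \<in> y' J" using Lambda_mono y y' I m by blast+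
  then show "(y \<oplus>\<^bsub>LM\<^esub> y') I \<subseteq> (y \<oplus>\<^bsub>LM\<^esub> y') J"
    using Lambda_add_apply[OF y y'] m I J cs_mono by simp
qed

lemma Lambda_smult_closed:
  assumes y: "y \<in> carrier LM" and r: "r \<in> carrier R"
  shows "r \<odot>\<^bsub>LM\<^esub> y \<in> carrier LM"
  unfolding Lambda_iff
proof (intro conjI ballI impI)
  show "r \<odot>\<^bsub>LM\<^esub> y \<in> extensional G" by (simp add: Lambda_simps)
  fix I assume I: "I \<in> G"
  obtain m where m: "m \<in> carrier M" "m \<in> y (ideal_colon R I r)" using Lambda_obtain[OF y G_colon[OF I r]] by metis
  then show "\<exists>m\<in>carrier M. (r \<odot>\<^bsub>LM\<^esub> y) I = cs I m"
    using Lambda_smult_apply[OF y r I m(2)] M.smult_closed[OF r m(1)] by blast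
  fix J assume J: "J \<in> G" "I \<subseteq> J"
  then have "ideal_colon R I r \<subseteq> ideal_colon R J r" by (auto simp: ideal_colon_def)
  then have "m \<in> y (ideal_colon R J r)" using Lambda_mono[OF y G_colon[OF I r] G_colon[OF J(1) r]] m by blast
  then show "(r \<odot>\<^bsub>LM\<^esub> y) I \<subseteq> (r \<odot>\<^bsub>LM\<^esub> y) J"
    using Lambda_smult_apply[OF y r] m I J cs_mono M.smult_closed[OF r m(1)] by simp
qed

lemma completion_map_closed: "m \<in> carrier M \<Longrightarrow> completion_map G M m \<in> carrier LM"
  using cs_mono by (auto simp: Lambda_iff completion_map_def)

end

subsection \<open>The completion of a torsion-free module\<close>

text \<open>
  The sequence \<open>0 \<rightarrow> M \<rightarrow> U \<otimes> M \<rightarrow> U/R \<otimes> M \<rightarrow> 0\<close>. What is used of it is its exactness and the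
  \<open>U\<close>-module structure of the middle term.
\<close>

locale torsion_free_sequence = flat_epi_module R U u N + M: left_module R M + V: left_module R V
  for R :: "'r ring" and U :: "'u ring" (structure) and u and N :: "('u, 'n) module"
    and M :: "('r, 'm) module" and V :: "('r, 'v) module" +
  fixes i :: "'m \<Rightarrow> 'n" and p :: "'n \<Rightarrow> 'v"
  assumes i_linear: "linear_on R M (restr_mod u N) i" and i_inj: "inj_on i (carrier M)"
    and p_linear: "linear_on R (restr_mod u N) V p"
    and p_surj: "v \<in> carrier V \<Longrightarrow> \<exists>n\<in>carrier N. p n = v"
    and p_ker: "n \<in> carrier N \<Longrightarrow> p n = \<zero>\<^bsub>V\<^esub> \<longleftrightarrow> n \<in> i ` carrier M"
begin

abbreviation "GT \<equiv> gabriel R U u"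
abbreviation "HV \<equiv> hom_mod R cok V"

sublocale C: completion R M GT
proof unfold_locales
  show "I \<subseteq> carrier R" if "I \<in> GT" for I
    using that right_idealD(1)[of R I] by (simp add: gabriel_iff)
qed (rule colon_gabriel)

lemma HV_left_module: "left_module R HV"
  by (rule hom_mod_left_module[OF cok_bimodule V.left_module_axioms])

lemma i_closed: "m \<in> carrier M \<Longrightarrow> i m \<in> carrier N"
  using linear_on_closed[OF i_linear] by (simp add: restr_mod_simps)

lemma i_add: "\<lbrakk>m \<in> carrier M; m' \<in> carrier M\<rbrakk> \<Longrightarrow> i (m \<oplus>\<^bsub>M\<^esub> m') = i m \<oplus>\<^bsub>N\<^esub> i m'"
  using linear_on_add[OF i_linear] by (simp add: restr_mod_simps)

lemma i_smult: "\<lbrakk>r \<in> carrier R; m \<in> carrier M\<rbrakk> \<Longrightarrow> i (r \<odot>\<^bsub>M\<^esub> m) = u r \<odot>\<^bsub>N\<^esub> i m"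
  using linear_on_smult[OF i_linear] by (simp add: restr_mod_simps)

lemma i_minus: "\<lbrakk>m \<in> carrier M; m' \<in> carrier M\<rbrakk> \<Longrightarrow> i (m \<ominus>\<^bsub>M\<^esub> m') = i m \<ominus>\<^bsub>N\<^esub> i m'"
  using linear_on_diff[OF M.left_module_axioms NR_left_module i_linear] by (simp add: NR_minus i_closed)

lemma p_closed: "n \<in> carrier N \<Longrightarrow> p n \<in> carrier V"
  using linear_on_closed[OF p_linear] by (simp add: restr_mod_simps)

lemma p_add: "\<lbrakk>n \<in> carrier N; n' \<in> carrier N\<rbrakk> \<Longrightarrow> p (n \<oplus>\<^bsub>N\<^esub> n') = p n \<oplus>\<^bsub>V\<^esub> p n'"
  using linear_on_add[OF p_linear] by (simp add: restr_mod_simps)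

lemma p_smult: "\<lbrakk>r \<in> carrier R; n \<in> carrier N\<rbrakk> \<Longrightarrow> p (u r \<odot>\<^bsub>N\<^esub> n) = r \<odot>\<^bsub>V\<^esub> p n"
  using linear_on_smult[OF p_linear] by (simp add: restr_mod_simps)

lemma p_minus: "\<lbrakk>n \<in> carrier N; n' \<in> carrier N\<rbrakk> \<Longrightarrow> p (n \<ominus>\<^bsub>N\<^esub> n') = p n \<ominus>\<^bsub>V\<^esub> p n'"
  using linear_on_diff[OF NR_left_module V.left_module_axioms p_linear] by (simp add: NR_minus restr_mod_simps)

lemma p_i: "m \<in> carrier M \<Longrightarrow> p (i m) = \<zero>\<^bsub>V\<^esub>"
  using p_ker i_closed by blast

lemma p_eq_iff: "\<lbrakk>n \<in> carrier N; n' \<in> carrier N\<rbrakk> \<Longrightarrow> p n = p n' \<longleftrightarrow> n \<ominus>\<^bsub>N\<^esub> n' \<in> i ` carrier M"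
  using p_ker[of "n \<ominus>\<^bsub>N\<^esub> n'"] V.M.minus_eq_zero_iff[of "p n" "p n'"] by (simp add: p_minus p_closed)

text \<open>The class of \<open>x \<otimes> m\<close> in \<open>V\<close>.\<close>

definition pr :: "'u \<Rightarrow> 'm \<Rightarrow> 'v" where
  "pr x m = p (x \<odot>\<^bsub>N\<^esub> i m)"

lemma pr_closed: "\<lbrakk>x \<in> carrier U; m \<in> carrier M\<rbrakk> \<Longrightarrow> pr x m \<in> carrier V"
  by (simp add: pr_def p_closed N.smult_closed i_closed)

lemma pr_add_right: "\<lbrakk>x \<in> carrier U; m \<in> carrier M; m' \<in> carrier M\<rbrakk> \<Longrightarrow> pr x (m \<oplus>\<^bsub>M\<^esub> m') = pr x m \<oplus>\<^bsub>V\<^esub> pr x m'"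
  by (simp add: pr_def p_add N.smult_closed i_closed i_add N.smult_r_distr)

lemma pr_minus_right: "\<lbrakk>x \<in> carrier U; m \<in> carrier M; m' \<in> carrier M\<rbrakk> \<Longrightarrow> pr x (m \<ominus>\<^bsub>M\<^esub> m') = pr x m \<ominus>\<^bsub>V\<^esub> pr x m'"
  by (simp add: pr_def p_minus N.smult_closed i_closed i_minus) (simp add: a_minus_def N.smult_closed i_closed
      N.smult_r_distr N.smult_minus_right p_minus[unfolded a_minus_def])

lemma pr_ract: "\<lbrakk>x \<in> carrier U; r \<in> carrier R; m \<in> carrier M\<rbrakk> \<Longrightarrow> pr (x \<otimes> u r) m = pr x (r \<odot>\<^bsub>M\<^esub> m)"
  by (simp add: pr_def N.smult_assoc1 i_closed i_smult)

lemma pr_linear: "m \<in> carrier M \<Longrightarrow> linear_on R UU V (\<lambda>x. pr x m)"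
  by (simp add: linear_on_def restr_bimod_simps pr_closed)
    (simp add: pr_def p_add N.smult_closed i_closed N.smult_l_distr N.smult_assoc1 p_smult)

lemma pr_one: "m \<in> carrier M \<Longrightarrow> pr \<one> m = \<zero>\<^bsub>V\<^esub>"
  by (simp add: pr_def N.smult_one i_closed p_i)

lemma pr_image: "\<lbrakk>r \<in> carrier R; m \<in> carrier M\<rbrakk> \<Longrightarrow> pr (u r) m = \<zero>\<^bsub>V\<^esub>"
  using pr_ract[of "\<one>" r m] by (simp add: pr_one M.smult_closed)

lemma pr_denom:
  assumes "I \<subseteq> denom {x}" "x \<in> carrier U" "d \<in> ideal_smult I M"
  shows "pr x d = \<zero>\<^bsub>V\<^esub>"
proof -
  have z: "additive_subgroup {\<zero>\<^bsub>V\<^esub>} V"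
    by (rule additive_subgroupI) (rule V.M.add.triv_subgroup[simplified])
  have "ideal_smult I M \<subseteq> {m \<in> carrier M. pr x m \<in> {\<zero>\<^bsub>V\<^esub>}}"
  proof (rule ideal_smult_least[OF M.left_module_axioms])
    show "additive_subgroup {m \<in> carrier M. pr x m \<in> {\<zero>\<^bsub>V\<^esub>}} M"
      by (rule linear_ker_subgroup[OF M.left_module_axioms V.M.abelian_group_axioms _ _ z])
        (use assms(2) in \<open>auto simp: pr_closed pr_add_right\<close>)
    fix r m assume r: "r \<in> I" and m: "m \<in> carrier M"
    then obtain s where s: "r \<in> carrier R" "s \<in> carrier R" "x \<otimes> u r = u s"
      using assms(1) by (auto simp: denom_def)
    then have "pr x (r \<odot>\<^bsub>M\<^esub> m) = \<zero>\<^bsub>V\<^esub>" using pr_ract[OF assms(2) s(1) m] pr_image[OF s(2) m] by simp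
    then show "r \<odot>\<^bsub>M\<^esub> m \<in> {m \<in> carrier M. pr x m \<in> {\<zero>\<^bsub>V\<^esub>}}" using s(1) m by (simp add: M.smult_closed)
  qed
  then show ?thesis using assms(3) by blast
qed

text \<open>
  Elements of \<open>I M\<close> become zero after multiplication by \<open>x\<close>, because \<open>x I\<close> is contained in the image of
  \<open>R\<close>. The same holds for \<open>J\<close>, and both cosets contain a member of the coset at \<open>I \<inter> J\<close>.
\<close>

lemma pr_coset:
  assumes y: "y \<in> carrier C.LM" and I: "I \<in> GT" "I \<subseteq> denom {x}" "m \<in> y I" and J: "J \<in> GT" "J \<subseteq> denom {x}" "m' \<in> y J"
    and x: "x \<in> carrier U"
  shows "pr x m = pr x m'"
proof -
  have same: "pr x a = pr x b" if K: "K \<in> GT" "K \<subseteq> denom {x}" "a \<in> y K" "b \<in> y K" for a b K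
  proof -
    note a = C.Lambda_coset[OF y K(1,3)]
    note b = C.Lambda_coset[OF y K(1,4)]
    have "C.cs K a = C.cs K b" by (rule trans[OF a(2)[symmetric] b(2)])
    then have "a \<ominus>\<^bsub>M\<^esub> b \<in> ideal_smult K M" using C.cs_eq_iff[OF K(1) a(1) b(1)] by simp
    from pr_denom[OF K(2) x this] show ?thesis
      using a(1) b(1) x by (simp add: pr_minus_right V.M.minus_eq_zero_iff pr_closed)
  qed
  have IJ: "I \<inter> J \<in> GT" by (rule inter_gabriel[OF I(1) J(1)])
  obtain a where a: "a \<in> y (I \<inter> J)" using C.Lambda_obtain[OF y IJ] by metis
  then have "a \<in> y I" "a \<in> y J" using C.Lambda_mono[OF y IJ] I(1) J(1) by blast+
  then show ?thesis using same[OF I] same[OF J] by metis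
qed

text \<open>\<open>represents g y\<close> says that \<open>g\<close> is the homomorphism \<open>U/R \<rightarrow> V\<close> glued from the family \<open>y\<close>.\<close>

definition represents :: "('u set \<Rightarrow> 'v) \<Rightarrow> ('r set \<Rightarrow> 'm set) \<Rightarrow> bool" where
  "represents g y \<longleftrightarrow> (\<forall>I\<in>GT. \<forall>m\<in>y I. \<forall>x\<in>carrier U. I \<subseteq> denom {x} \<longrightarrow> g (\<pi> x) = pr x m)"

lemma denom_single_gabriel: "x \<in> carrier U \<Longrightarrow> denom {x} \<in> GT"
  by (rule denom_gabriel) auto

lemma mod_hom_cok_ext:
  assumes "g \<in> mod_hom R cok V" "h \<in> mod_hom R cok V" "\<And>x. x \<in> carrier U \<Longrightarrow> g (\<pi> x) = h (\<pi> x)"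
  shows "g = h"
  by (rule mod_hom_ext[OF assms(1,2)]) (use assms(3) in \<open>auto simp: cok_carrier\<close>)

lemma mod_hom_proj_linear:
  "g \<in> mod_hom R cok V \<Longrightarrow> linear_on R UU V (\<lambda>x. g (\<pi> x))"
  by (rule linear_on_comp[OF proj_linear]) (simp add: mod_hom_iff)

lemma mod_hom_proj_one:
  assumes "g \<in> mod_hom R cok V" "r \<in> carrier R"
  shows "g (\<pi> (u r)) = \<zero>\<^bsub>V\<^esub>"
proof -
  have "\<pi> (u r) = \<zero>\<^bsub>cok\<^esub>" using assms(2) by (simp add: proj_eq_zero_iff)
  then show ?thesis
    using linear_on_zero[OF cok_left_module V.left_module_axioms] assms(1) by (simp add: mod_hom_iff)
qed

lemma represents_unique:
  assumes y: "y \<in> carrier C.LM" and "g \<in> mod_hom R cok V" "h \<in> mod_hom R cok V" "represents g y" "represents h y"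
  shows "g = h"
proof (rule mod_hom_cok_ext[OF assms(2,3)])
  fix x assume x: "x \<in> carrier U"
  obtain m where "m \<in> y (denom {x})" using C.Lambda_obtain[OF y denom_single_gabriel[OF x]] by metis
  then show "g (\<pi> x) = h (\<pi> x)" using assms(4,5) x denom_single_gabriel[OF x] by (simp add: represents_def)
qed

lemma represents_ex:
  assumes y: "y \<in> carrier C.LM"
  shows "\<exists>g\<in>mod_hom R cok V. represents g y"
proof -
  have "\<forall>x\<in>carrier U. \<exists>m. m \<in> y (denom {x})" using C.Lambda_obtain[OF y denom_single_gabriel] by metis
  from bchoice[OF this] obtain \<mu> where \<mu>: "\<And>x. x \<in> carrier U \<Longrightarrow> \<mu> x \<in> y (denom {x})" by blast
  define g where "g x = pr x (\<mu> x)" for x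
  have val: "g x = pr x m" if "x \<in> carrier U" "I \<in> GT" "I \<subseteq> denom {x}" "m \<in> y I" for x I m
    unfolding g_def using pr_coset[OF y denom_single_gabriel subset_refl \<mu>] that by blast
  have g_closed: "g x \<in> carrier V" if "x \<in> carrier U" for x
    unfolding g_def using C.Lambda_coset(1)[OF y denom_single_gabriel \<mu>] that by (intro pr_closed) auto
  have "linear_on R UU V g"
  proof (rule linear_onI)
    fix x assume "x \<in> carrier UU"
    then have x: "x \<in> carrier U" by (simp add: restr_bimod_simps)
    then show "g x \<in> carrier V" by (rule g_closed)
    { fix x' assume "x' \<in> carrier UU"
      then have x': "x' \<in> carrier U" by (simp add: restr_bimod_simps)
      let ?I = "denom {x} \<inter> denom {x'} \<inter> denom {x \<oplus> x'}"
      have I: "?I \<in> GT" using x x' by (intro inter_gabriel denom_single_gabriel) auto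
      obtain m where m: "m \<in> carrier M" "m \<in> y ?I" using C.Lambda_obtain[OF y I] by metis
      have "g x = pr x m" "g x' = pr x' m" "g (x \<oplus> x') = pr (x \<oplus> x') m"
        by (rule val[OF _ I _ m(2)]; use x x' in auto)+
      then show "g (x \<oplus>\<^bsub>UU\<^esub> x') = g x \<oplus>\<^bsub>V\<^esub> g x'"
        using linear_on_add[OF pr_linear[OF m(1)], of x x'] x x' by (simp add: restr_bimod_simps) }
    { fix r assume r: "r \<in> carrier R"
      let ?I = "denom {x} \<inter> denom {u r \<otimes> x}"
      have I: "?I \<in> GT" using x r by (intro inter_gabriel denom_single_gabriel) auto
      obtain m where m: "m \<in> carrier M" "m \<in> y ?I" using C.Lambda_obtain[OF y I] by metis
      have "g x = pr x m" "g (u r \<otimes> x) = pr (u r \<otimes> x) m"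
        by (rule val[OF _ I _ m(2)]; use x r in auto)+
      then show "g (r \<odot>\<^bsub>UU\<^esub> x) = r \<odot>\<^bsub>V\<^esub> g x"
        using linear_on_smult[OF pr_linear[OF m(1)] r, of x] x by (simp add: restr_bimod_simps) }
  qed
  moreover have "g \<one> = \<zero>\<^bsub>V\<^esub>"
    unfolding g_def using C.Lambda_coset(1)[OF y denom_single_gabriel \<mu>] by (intro pr_one) auto
  ultimately obtain h where h: "h \<in> mod_hom R cok V" "\<And>x. x \<in> carrier U \<Longrightarrow> h (\<pi> x) = g x"
    by (rule descend_to_cok[OF V.left_module_axioms]) blast
  then show ?thesis using val by (auto simp: represents_def intro!: bexI[of _ h])
qed

text \<open>
  On combinations whose value lies in the image of \<open>R\<close> a lift of \<open>g\<close> takes its values in \<open>M\<close>. This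
  gives the components of the family of \<open>g\<close> in the completion as well as the cocycle of \<open>g\<close>.
\<close>

definition is_lift :: "('u set \<Rightarrow> 'v) \<Rightarrow> (('u \<Rightarrow> 'r) \<Rightarrow> 'n) \<Rightarrow> bool" where
  "is_lift g H \<longleftrightarrow> linear_on R FU NR H \<and> (\<forall>c\<in>carrier FU. p (H c) = g (\<pi> (augU c)))"

lemma lift_closed: "\<lbrakk>is_lift g H; c \<in> carrier FU\<rbrakk> \<Longrightarrow> H c \<in> carrier N"
  using linear_on_closed[of R FU NR H c] by (simp add: is_lift_def restr_mod_simps)

lemma is_liftI:
  assumes g: "g \<in> mod_hom R cok V" and H: "linear_on R FU NR H"
    and gen: "\<And>x. x \<in> carrier U \<Longrightarrow> p (H (free_gen R x)) = g (\<pi> x)"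
  shows "is_lift g H"
  unfolding is_lift_def
proof (intro conjI ballI H)
  fix c assume "c \<in> carrier FU"
  then show "p (H c) = g (\<pi> (augU c))"
    by (rule linear_on_free_eq[OF R.ring_axioms V.left_module_axioms linear_on_comp[OF H p_linear]
          linear_on_comp[OF augU_linear mod_hom_proj_linear[OF g]], rotated])
      (simp add: gen augU_gen)
qed

lemma lift_ex:
  assumes g: "g \<in> mod_hom R cok V"
  shows "\<exists>H. is_lift g H"
proof -
  have "\<forall>x\<in>carrier U. \<exists>n. n \<in> carrier N \<and> p n = g (\<pi> x)"
    using p_surj linear_on_closed[OF mod_hom_proj_linear[OF g]] by (auto simp: restr_bimod_simps)
  from bchoice[OF this] obtain s where s: "\<And>x. x \<in> carrier U \<Longrightarrow> s x \<in> carrier N \<and> p (s x) = g (\<pi> x)" by blast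
  then have sPi: "s \<in> carrier U \<rightarrow> carrier NR" by (simp add: restr_mod_simps)
  have "is_lift g (free_ext R NR s)"
    by (rule is_liftI[OF g free_ext_linear[OF NR_left_module sPi]])
      (simp add: free_ext_gen[OF NR_left_module sPi] s)
  then show ?thesis by blast
qed

lemma lift_image:
  assumes "g \<in> mod_hom R cok V" "is_lift g H" "c \<in> carrier FU" "augU c \<in> u ` carrier R"
  shows "H c \<in> i ` carrier M"
proof -
  have "p (H c) = \<zero>\<^bsub>V\<^esub>" using assms mod_hom_proj_one[OF assms(1)] by (auto simp: is_lift_def)
  then show ?thesis using p_ker lift_closed assms(2,3) by blast
qed

definition inv_i :: "'n \<Rightarrow> 'm" where "inv_i = inv_into (carrier M) i"

lemma inv_i: "n \<in> i ` carrier M \<Longrightarrow> inv_i n \<in> carrier M \<and> i (inv_i n) = n"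
  unfolding inv_i_def using inv_into_into f_inv_into_f by metis

lemma inv_i_i: "m \<in> carrier M \<Longrightarrow> inv_i (i m) = m"
  unfolding inv_i_def using i_inj by (rule inv_into_f_f)

lemma i_eq_iff: "\<lbrakk>m \<in> carrier M; m' \<in> carrier M\<rbrakk> \<Longrightarrow> i m = i m' \<longleftrightarrow> m = m'"
  using i_inj by (auto dest: inj_onD)

text \<open>
  By \<open>linear_twist\<close> the element \<open>x (H \<gamma>)\<close> is the value of \<open>H\<close> at a numerator of \<open>x\<close>.
\<close>

lemma lift_twist:
  assumes g: "g \<in> mod_hom R cok V" and H: "is_lift g H" and \<gamma>: "\<gamma> \<in> carrier FU" "augU \<gamma> = \<one>"
    and x: "x \<in> carrier U" and den: "\<And>y. \<gamma> y \<in> denom {x}"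
  shows "g (\<pi> x) = p (x \<odot>\<^bsub>N\<^esub> H \<gamma>)"
proof -
  have "\<forall>y. \<exists>s. s \<in> carrier R \<and> x \<otimes> u (\<gamma> y) = u s" using den by (auto simp: denom_def)
  then obtain s where s: "\<And>y. s y \<in> carrier R" "\<And>y. x \<otimes> u (\<gamma> y) = u (s y)" by metis
  define \<tau> where "\<tau> y = (if \<gamma> y = \<zero>\<^bsub>R\<^esub> then \<zero>\<^bsub>R\<^esub> else s y)" for y
  have \<tau>: "\<tau> \<in> carrier FU"
    by (rule FU_I[OF _ supp_finite[OF \<gamma>(1)] supp_carrier[OF \<gamma>(1)]]) (use s in \<open>auto simp: \<tau>_def\<close>)
  have eq: "x \<otimes> u (\<gamma> y) = u (\<tau> y)" for y
  proof (cases "\<gamma> y = \<zero>\<^bsub>R\<^esub>")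
    case True
    then show ?thesis using x by (simp add: \<tau>_def)
  qed (use s(2)[of y] in \<open>simp add: \<tau>_def\<close>)
  have "H \<tau> = x \<odot>\<^bsub>N\<^esub> H \<gamma>" using H by (intro linear_twist[OF _ \<gamma>(1) \<tau> x eq]) (simp add: is_lift_def)
  moreover have "augU \<tau> = x" using augU_twist[OF \<gamma>(1) \<tau> x eq] \<gamma>(2) x by simp
  ultimately show ?thesis using H \<tau> by (auto simp: is_lift_def)
qed

text \<open>
  By assumption \<open>w n\<close> and \<open>H [w]\<close> agree modulo \<open>M\<close>. Hence \<open>n = \<Sum> u (\<beta> w) w n\<close> agrees with
  \<open>H \<beta> = \<Sum> u (\<beta> w) (H [w])\<close> modulo \<open>I M\<close>.
\<close>

lemma lift_approximation:
  assumes g: "g \<in> mod_hom R cok V" and H: "is_lift g H" and \<beta>: "\<beta> \<in> carrier FU" "augU \<beta> = \<one>"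
    and I: "\<And>y. \<beta> y \<in> I" "I \<subseteq> carrier R" and n: "n \<in> carrier N"
    and approx: "\<And>w. w \<in> supp \<beta> \<Longrightarrow> p (w \<odot>\<^bsub>N\<^esub> n) = g (\<pi> w)"
  obtains d where "d \<in> ideal_smult I M" "d \<in> carrier M" "H \<beta> = n \<oplus>\<^bsub>N\<^esub> i d"
proof -
  let ?D = "supp \<beta>"
  have D: "finite ?D" "?D \<subseteq> carrier U" using supp_finite supp_carrier \<beta>(1) by auto
  have Hlin: "linear_on R FU NR H" using H by (simp add: is_lift_def)
  have Hw: "H (free_gen R w) \<in> carrier N" if "w \<in> ?D" for w using lift_closed[OF H FU_gen] D(2) that by blast
  have wn: "w \<odot>\<^bsub>N\<^esub> n \<in> carrier N" if "w \<in> ?D" for w using D(2) that n by (intro N.smult_closed) auto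
  have "\<forall>w\<in>?D. \<exists>k. k \<in> carrier M \<and> H (free_gen R w) = w \<odot>\<^bsub>N\<^esub> n \<oplus>\<^bsub>N\<^esub> i k"
  proof
    fix w assume w: "w \<in> ?D"
    then have wU: "w \<in> carrier U" using D(2) by blast
    have "p (H (free_gen R w)) = g (\<pi> w)" using H FU_gen[OF wU] by (simp add: is_lift_def augU_gen[OF wU])
    then have "H (free_gen R w) \<ominus>\<^bsub>N\<^esub> w \<odot>\<^bsub>N\<^esub> n \<in> i ` carrier M"
      using approx[OF w] p_eq_iff[OF Hw[OF w] wn[OF w]] by simp
    then obtain k where "k \<in> carrier M" "H (free_gen R w) \<ominus>\<^bsub>N\<^esub> w \<odot>\<^bsub>N\<^esub> n = i k" by blast
    moreover then have "H (free_gen R w) = w \<odot>\<^bsub>N\<^esub> n \<oplus>\<^bsub>N\<^esub> i k"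
      using Hw[OF w] wn[OF w] by (simp add: a_minus_def N.M.a_lcomm N.M.r_neg flip: \<open>_ = i k\<close>)
    ultimately show "\<exists>k. k \<in> carrier M \<and> H (free_gen R w) = w \<odot>\<^bsub>N\<^esub> n \<oplus>\<^bsub>N\<^esub> i k" by blast
  qed
  from bchoice[OF this] obtain k where k: "\<And>w. w \<in> ?D \<Longrightarrow> k w \<in> carrier M \<and> H (free_gen R w) = w \<odot>\<^bsub>N\<^esub> n \<oplus>\<^bsub>N\<^esub> i (k w)"
    by blast
  have \<beta>R: "\<beta> w \<in> carrier R" for w using FU_apply[OF \<beta>(1)] .
  then have u\<beta>: "u (\<beta> w) \<in> carrier U" for w by simp
  define d where "d = (\<Oplus>\<^bsub>M\<^esub>w\<in>?D. \<beta> w \<odot>\<^bsub>M\<^esub> k w)"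
  have dcl: "(\<lambda>w. \<beta> w \<odot>\<^bsub>M\<^esub> k w) \<in> ?D \<rightarrow> carrier M" using \<beta>R k by (intro Pi_I M.smult_closed) auto
  have dI: "d \<in> ideal_smult I M"
  proof -
    interpret IM: additive_subgroup "ideal_smult I M" M by (rule ideal_smult_subgroup[OF M.left_module_axioms I(2)])
    have "(\<Oplus>\<^bsub>M\<^esub>w\<in>D'. \<beta> w \<odot>\<^bsub>M\<^esub> k w) \<in> ideal_smult I M" if "finite D'" "D' \<subseteq> ?D" for D'
      using that
    proof (induction D')
      case (insert w D')
      then have *: "(\<lambda>w. \<beta> w \<odot>\<^bsub>M\<^esub> k w) \<in> D' \<rightarrow> carrier M" "\<beta> w \<odot>\<^bsub>M\<^esub> k w \<in> carrier M" using dcl by auto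
      have "\<beta> w \<odot>\<^bsub>M\<^esub> k w \<in> ideal_smult I M" using I(1) k insert.prems by (intro ideal_smultI) auto
      with insert * show ?case by (simp add: M.M.finsum_insert)
    qed simp
    then show ?thesis using D(1) by (simp add: d_def)
  qed
  have dM: "d \<in> carrier M" unfolding d_def using dcl by (rule M.M.finsum_closed)
  have cl1: "(\<lambda>w. (u (\<beta> w) \<otimes> w) \<odot>\<^bsub>N\<^esub> n) \<in> ?D \<rightarrow> carrier N"
    using u\<beta> D(2) n by (intro Pi_I N.smult_closed S.m_closed) auto
  have cl2: "(\<lambda>w. i (\<beta> w \<odot>\<^bsub>M\<^esub> k w)) \<in> ?D \<rightarrow> carrier N" using dcl i_closed by auto
  have "H \<beta> = (\<Oplus>\<^bsub>N\<^esub>w\<in>?D. u (\<beta> w) \<odot>\<^bsub>N\<^esub> H (free_gen R w))" by (rule FU_linear_sum[OF Hlin \<beta>(1) D(1) subset_refl D(2)])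
  also have "\<dots> = (\<Oplus>\<^bsub>N\<^esub>w\<in>?D. (u (\<beta> w) \<otimes> w) \<odot>\<^bsub>N\<^esub> n \<oplus>\<^bsub>N\<^esub> i (\<beta> w \<odot>\<^bsub>M\<^esub> k w))"
  proof (rule N.M.finsum_cong')
    fix w assume w: "w \<in> ?D"
    have "k w \<in> carrier M" "H (free_gen R w) = w \<odot>\<^bsub>N\<^esub> n \<oplus>\<^bsub>N\<^esub> i (k w)" "w \<in> carrier U" using k[OF w] D(2) w by auto
    then show "u (\<beta> w) \<odot>\<^bsub>N\<^esub> H (free_gen R w) = (u (\<beta> w) \<otimes> w) \<odot>\<^bsub>N\<^esub> n \<oplus>\<^bsub>N\<^esub> i (\<beta> w \<odot>\<^bsub>M\<^esub> k w)"
      using u\<beta> n wn[OF w] \<beta>R by (simp add: N.smult_r_distr i_closed N.smult_assoc1 i_smult)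
  qed (use cl1 cl2 in auto)
  also have "\<dots> = (\<Oplus>\<^bsub>N\<^esub>w\<in>?D. (u (\<beta> w) \<otimes> w) \<odot>\<^bsub>N\<^esub> n) \<oplus>\<^bsub>N\<^esub> (\<Oplus>\<^bsub>N\<^esub>w\<in>?D. i (\<beta> w \<odot>\<^bsub>M\<^esub> k w))"
    by (rule N.M.finsum_addf[OF cl1 cl2])
  also have "(\<Oplus>\<^bsub>N\<^esub>w\<in>?D. (u (\<beta> w) \<otimes> w) \<odot>\<^bsub>N\<^esub> n) = (\<Oplus>w\<in>?D. u (\<beta> w) \<otimes> w) \<odot>\<^bsub>N\<^esub> n"
    using u\<beta> D(2) n by (intro N.finsum_smult[symmetric]) auto
  also have "\<dots> = n"
    unfolding augU_sum[OF \<beta>(1) D(1) subset_refl D(2), symmetric] \<beta>(2) using n by (rule N.smult_one)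
  also have "(\<Oplus>\<^bsub>N\<^esub>w\<in>?D. i (\<beta> w \<odot>\<^bsub>M\<^esub> k w)) = i d"
    unfolding d_def using linear_on_finsum[OF M.left_module_axioms NR_left_module i_linear dcl] NR_finsum[OF cl2] by simp
  finally show ?thesis using that dI dM by blast
qed

lemma gabriel_combination:
  assumes "I \<in> GT"
  obtains \<beta> where "\<beta> \<in> carrier FU" "augU \<beta> = \<one>" "\<And>y. \<beta> y \<in> I" "I \<subseteq> carrier R"
  using assms right_idealD(1) by (auto simp: gabriel_iff spanning_def)

lemma represents_component:
  assumes y: "y \<in> carrier C.LM" and g: "g \<in> mod_hom R cok V" and gy: "represents g y" and H: "is_lift g H"
    and I: "I \<in> GT" and \<beta>: "\<beta> \<in> carrier FU" "augU \<beta> = \<one>" "\<And>y. \<beta> y \<in> I"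
  shows "y I = C.cs I (inv_i (H \<beta>))"
proof -
  let ?D = "supp \<beta>"
  have D: "finite ?D" "?D \<subseteq> carrier U" using supp_finite supp_carrier \<beta>(1) by auto
  let ?J = "I \<inter> denom ?D"
  have J: "?J \<in> GT" by (rule inter_gabriel[OF I denom_gabriel[OF D]])
  obtain m where m: "m \<in> carrier M" "m \<in> y ?J" using C.Lambda_obtain[OF y J] by metis
  then have mI: "m \<in> y I" using C.Lambda_mono[OF y J I] by blast
  have "pr w m = g (\<pi> w)" if "w \<in> ?D" for w
  proof -
    have "?J \<subseteq> denom {w}" "w \<in> carrier U" using that D(2) by (auto simp: denom_def)
    then show ?thesis using gy J m(2) by (simp add: represents_def)
  qed
  then obtain d where d: "d \<in> ideal_smult I M" "d \<in> carrier M" "H \<beta> = i m \<oplus>\<^bsub>N\<^esub> i d"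
    using lift_approximation[OF g H \<beta>(1,2,3) C.G_subset[OF I] i_closed[OF m(1)]] unfolding pr_def by blast
  then have "H \<beta> = i (m \<oplus>\<^bsub>M\<^esub> d)" using m(1) by (simp add: i_add)
  then have e: "inv_i (H \<beta>) = m \<oplus>\<^bsub>M\<^esub> d" using m(1) d(2) by (simp add: inv_i_i)
  have "(m \<oplus>\<^bsub>M\<^esub> d) \<ominus>\<^bsub>M\<^esub> m = d" using m(1) d(2) M.M.a_comm[of m d] by (simp add: a_minus_def M.M.a_assoc M.M.r_neg)
  then have "C.cs I (m \<oplus>\<^bsub>M\<^esub> d) = C.cs I m" using m(1) d I by (simp add: C.cs_eq_iff)
  then show ?thesis using C.Lambda_coset(2)[OF y I mI] e by simp
qed

lemma represents_inj:
  assumes y: "y \<in> carrier C.LM" "y' \<in> carrier C.LM" and g: "g \<in> mod_hom R cok V" "represents g y" "represents g y'"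
  shows "y = y'"
proof (rule C.Lambda_eqI[OF y])
  fix I assume I: "I \<in> GT"
  obtain H where H: "is_lift g H" using lift_ex[OF g(1)] ..
  obtain \<beta> where \<beta>: "\<beta> \<in> carrier FU" "augU \<beta> = \<one>" "\<And>y. \<beta> y \<in> I" using I by (rule gabriel_combination) blast
  show "y I = y' I"
    using represents_component[OF y(1) g(1,2) H I \<beta>] represents_component[OF y(2) g(1,3) H I \<beta>] by simp
qed

lemma represents_surj:
  assumes g: "g \<in> mod_hom R cok V"
  shows "\<exists>y\<in>carrier C.LM. represents g y"
proof -
  obtain H where H: "is_lift g H" using lift_ex[OF g] ..
  have "\<forall>I\<in>GT. \<exists>\<beta>. \<beta> \<in> carrier FU \<and> augU \<beta> = \<one> \<and> (\<forall>y. \<beta> y \<in> I)" using gabriel_combination by metis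
  from bchoice[OF this] obtain \<beta> where \<beta>': "\<forall>I\<in>GT. \<beta> I \<in> carrier FU \<and> augU (\<beta> I) = \<one> \<and> (\<forall>y. \<beta> I y \<in> I)" by blast
  then have \<beta>: "\<beta> I \<in> carrier FU" "augU (\<beta> I) = \<one>" "\<beta> I y \<in> I" if "I \<in> GT" for I y using that by auto
  define m where "m I = inv_i (H (\<beta> I))" for I
  have im: "m I \<in> carrier M" "i (m I) = H (\<beta> I)" if "I \<in> GT" for I
  proof -
    have "augU (\<beta> I) \<in> u ` carrier R" using \<beta>(2)[OF that] by (auto intro!: image_eqI[of _ _ "\<one>\<^bsub>R\<^esub>"])
    from inv_i[OF lift_image[OF g H \<beta>(1)[OF that] this]] show "m I \<in> carrier M" "i (m I) = H (\<beta> I)"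
      by (auto simp: m_def)
  qed
  define y where "y = (\<lambda>I\<in>GT. C.cs I (m I))"
  \<comment> \<open>\<open>m I\<close> and \<open>m K\<close> agree modulo \<open>I M\<close> as soon as \<open>K\<close> is small compared to the combination \<open>\<beta> I\<close>.\<close>
  have close: "C.cs I (m I) = C.cs I (m K)" if I: "I \<in> GT" and K: "K \<in> GT" "K \<subseteq> denom (supp (\<beta> I))" for I K
  proof -
    have approx: "p (w \<odot>\<^bsub>N\<^esub> H (\<beta> K)) = g (\<pi> w)" if "w \<in> supp (\<beta> I)" for w
    proof -
      have "w \<in> carrier U" using supp_carrier[OF \<beta>(1)[OF I]] that by blast
      moreover have "\<beta> K z \<in> denom {w}" for z using \<beta>(3)[OF K(1), of z] K(2) that by (auto simp: denom_def)
      ultimately show ?thesis using lift_twist[OF g H \<beta>(1,2)[OF K(1)]] by simp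
    qed
    obtain d where d: "d \<in> ideal_smult I M" "d \<in> carrier M" "H (\<beta> I) = H (\<beta> K) \<oplus>\<^bsub>N\<^esub> i d"
      using lift_approximation[OF g H \<beta>(1,2)[OF I] \<beta>(3)[OF I] C.G_subset[OF I] lift_closed[OF H \<beta>(1)[OF K(1)]] approx]
      by blast
    then have "i (m I) = i (m K \<oplus>\<^bsub>M\<^esub> d)" using im[OF I] im[OF K(1)] by (simp add: i_add)
    then have "m I = m K \<oplus>\<^bsub>M\<^esub> d" using im[OF I] im[OF K(1)] d(2) by (simp add: i_eq_iff)
    moreover have "(m K \<oplus>\<^bsub>M\<^esub> d) \<ominus>\<^bsub>M\<^esub> m K = d"
      using im[OF K(1)] d(2) M.M.a_comm[of "m K" d] by (simp add: a_minus_def M.M.a_assoc M.M.r_neg)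
    ultimately show ?thesis using I im(1)[OF I] im(1)[OF K(1)] d by (simp add: C.cs_eq_iff)
  qed
  have y: "y \<in> carrier C.LM"
    unfolding C.Lambda_iff
  proof (intro conjI ballI impI)
    show "y \<in> extensional GT" by (simp add: y_def)
    fix I assume I: "I \<in> GT"
    show "\<exists>m\<in>carrier M. y I = C.cs I m" using im(1)[OF I] I by (auto simp: y_def)
    fix J assume J: "J \<in> GT" "I \<subseteq> J"
    let ?K = "denom (supp (\<beta> I)) \<inter> denom (supp (\<beta> J))"
    have K: "?K \<in> GT"
      using \<beta>(1) I J(1) by (intro inter_gabriel denom_gabriel supp_finite supp_carrier) auto
    have "C.cs I (m I) = C.cs I (m ?K)" "C.cs J (m J) = C.cs J (m ?K)" using close[OF I K] close[OF J(1) K] by auto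
    then show "y I \<subseteq> y J" using C.cs_mono[OF I J im(1)[OF K]] I J(1) by (simp add: y_def)
  qed
  moreover have "represents g y"
    unfolding represents_def
  proof (intro ballI impI)
    fix I k x assume I: "I \<in> GT" and k: "k \<in> y I" and x: "x \<in> carrier U" and den: "I \<subseteq> denom {x}"
    have "m I \<in> y I" using C.cs_self[OF I im(1)[OF I]] I by (simp add: y_def)
    then have "pr x k = pr x (m I)" by (rule pr_coset[OF y I den k I den _ x])
    also have "\<dots> = g (\<pi> x)"
      using lift_twist[OF g H \<beta>(1,2)[OF I] x subsetD[OF den \<beta>(3)[OF I]]] im(2)[OF I] by (simp add: pr_def)
    finally show "g (\<pi> x) = pr x k" by simp
  qed
  ultimately show ?thesis by blast
qed

definition glued :: "('r set \<Rightarrow> 'm set) \<Rightarrow> 'u set \<Rightarrow> 'v" where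
  "glued y = (THE g. g \<in> mod_hom R cok V \<and> represents g y)"

lemma glued:
  assumes "y \<in> carrier C.LM"
  shows "glued y \<in> mod_hom R cok V" "represents (glued y) y"
proof -
  have "\<exists>!g. g \<in> mod_hom R cok V \<and> represents g y"
    using represents_ex[OF assms] represents_unique[OF assms] by blast
  from theI'[OF this] show "glued y \<in> mod_hom R cok V" "represents (glued y) y" by (auto simp: glued_def)
qed

lemma glued_eqI: "\<lbrakk>y \<in> carrier C.LM; g \<in> mod_hom R cok V; represents g y\<rbrakk> \<Longrightarrow> glued y = g"
  using glued represents_unique by blast

lemma glued_bij: "bij_betw glued (carrier C.LM) (mod_hom R cok V)"
proof (rule bij_betwI')
  fix y y' assume "y \<in> carrier C.LM" "y' \<in> carrier C.LM"
  then show "glued y = glued y' \<longleftrightarrow> y = y'" using represents_inj glued by metis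
next
  fix g assume "g \<in> mod_hom R cok V"
  then show "\<exists>y\<in>carrier C.LM. g = glued y" using represents_surj glued_eqI by metis
qed (rule glued)

lemma glued_add:
  assumes y: "y \<in> carrier C.LM" "y' \<in> carrier C.LM"
  shows "glued (y \<oplus>\<^bsub>C.LM\<^esub> y') = glued y \<oplus>\<^bsub>HV\<^esub> glued y'"
proof (rule glued_eqI[OF C.Lambda_add_closed[OF y]])
  interpret W: left_module R HV by (rule HV_left_module)
  show "glued y \<oplus>\<^bsub>HV\<^esub> glued y' \<in> mod_hom R cok V"
    using W.M.a_closed[of "glued y" "glued y'"] glued[OF y(1)] glued[OF y(2)] by (simp add: hom_mod_simps(1))
  show "represents (glued y \<oplus>\<^bsub>HV\<^esub> glued y') (y \<oplus>\<^bsub>C.LM\<^esub> y')"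
    unfolding represents_def
  proof (intro ballI impI)
    fix I k x assume I: "I \<in> GT" and k: "k \<in> (y \<oplus>\<^bsub>C.LM\<^esub> y') I" and x: "x \<in> carrier U" and den: "I \<subseteq> denom {x}"
    obtain m m' where m: "m \<in> carrier M" "m \<in> y I" "m' \<in> carrier M" "m' \<in> y' I"
      using C.Lambda_obtain[OF y(1) I] C.Lambda_obtain[OF y(2) I] by metis
    have "m \<oplus>\<^bsub>M\<^esub> m' \<in> (y \<oplus>\<^bsub>C.LM\<^esub> y') I" using C.Lambda_add_apply[OF y I m(2,4)] C.cs_self[OF I] m by simp
    then have "pr x k = pr x (m \<oplus>\<^bsub>M\<^esub> m')" by (rule pr_coset[OF C.Lambda_add_closed[OF y] I den k I den _ x])
    also have "\<dots> = glued y (\<pi> x) \<oplus>\<^bsub>V\<^esub> glued y' (\<pi> x)"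
      using glued(2)[OF y(1)] glued(2)[OF y(2)] I den m x by (simp add: represents_def pr_add_right)
    finally show "(glued y \<oplus>\<^bsub>HV\<^esub> glued y') (\<pi> x) = pr x k" using x by (simp add: hom_mod_simps proj_closed)
  qed
qed

lemma glued_smult:
  assumes y: "y \<in> carrier C.LM" and r: "r \<in> carrier R"
  shows "glued (r \<odot>\<^bsub>C.LM\<^esub> y) = r \<odot>\<^bsub>HV\<^esub> glued y"
proof (rule glued_eqI[OF C.Lambda_smult_closed[OF y r]])
  interpret W: left_module R HV by (rule HV_left_module)
  show "r \<odot>\<^bsub>HV\<^esub> glued y \<in> mod_hom R cok V"
    using W.smult_closed[OF r, of "glued y"] glued[OF y] by (simp add: hom_mod_simps(1))
  show "represents (r \<odot>\<^bsub>HV\<^esub> glued y) (r \<odot>\<^bsub>C.LM\<^esub> y)"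
    unfolding represents_def
  proof (intro ballI impI)
    fix I k x assume I: "I \<in> GT" and k: "k \<in> (r \<odot>\<^bsub>C.LM\<^esub> y) I" and x: "x \<in> carrier U" and den: "I \<subseteq> denom {x}"
    note Ir = C.G_colon[OF I r]
    obtain m where m: "m \<in> carrier M" "m \<in> y (ideal_colon R I r)" using C.Lambda_obtain[OF y Ir] by metis
    have "r \<odot>\<^bsub>M\<^esub> m \<in> (r \<odot>\<^bsub>C.LM\<^esub> y) I"
      using C.Lambda_smult_apply[OF y r I m(2)] C.cs_self[OF I M.smult_closed[OF r m(1)]] by simp
    then have "pr x k = pr x (r \<odot>\<^bsub>M\<^esub> m)" by (rule pr_coset[OF C.Lambda_smult_closed[OF y r] I den k I den _ x])
    also have "\<dots> = pr (x \<otimes> u r) m" by (rule pr_ract[symmetric, OF x r m(1)])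
    also have "\<dots> = glued y (\<pi> (x \<otimes> u r))"
    proof -
      have "ideal_colon R I r \<subseteq> denom {x \<otimes> u r}"
      proof
        fix t assume t: "t \<in> ideal_colon R I r"
        then have tR: "t \<in> carrier R" "r \<otimes>\<^bsub>R\<^esub> t \<in> denom {x}" using den by (auto simp: ideal_colon_def)
        then show "t \<in> denom {x \<otimes> u r}" using x r by (simp add: denom_def S.m_assoc)
      qed
      then show ?thesis using glued(2)[OF y] Ir m(2) x r by (simp add: represents_def)
    qed
    finally show "(r \<odot>\<^bsub>HV\<^esub> glued y) (\<pi> x) = pr x k"
      using x r by (simp add: hom_mod_simps proj_closed proj_ract)
  qed
qed

lemma glued_completion_map:
  assumes m: "m \<in> carrier M" and x: "x \<in> carrier U"
  shows "glued (completion_map GT M m) (\<pi> x) = pr x m"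
proof -
  note y = C.completion_map_closed[OF m] and D = denom_single_gabriel[OF x]
  have "m \<in> completion_map GT M m (denom {x})" using C.cs_self[OF D m] D by (simp add: completion_map_def)
  then show ?thesis using glued(2)[OF y] D x by (simp add: represents_def)
qed

end

section \<open>Classes in the first extension module\<close>

lemma aug_bd1:
  assumes K: "linear_complex R K" and z: "z \<in> carrier (P1 R K)"
  shows "aug R (rterm K) (bd1 R K z) = tdiff K (aug R (lterm K) (fst z))"
proof -
  note Kd = linear_complexD[OF K]
  interpret B: left_module R "rterm K" by (rule Kd(3))
  obtain x y where xy: "z = (x, y)" "x \<in> carrier (F0 R (lterm K))" "y \<in> carrier (F1 R (rterm K))"
    using z by (auto simp: P1_def prod_mod_simps)
  note t = F0_map_linear[OF Kd(1) linear_on_Pi[OF Kd(4)]]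
  have "tdiff K (aug R (lterm K) x) \<in> carrier (rterm K)"
    by (rule linear_on_closed[OF Kd(4) linear_on_closed[OF aug_linear[OF Kd(2)] xy(2)]])
  then show ?thesis
    using linear_on_closed[OF t xy(2)] linear_on_closed[OF d1_linear[OF Kd(1)] xy(3)]
    by (simp add: xy(1) bd1_def linear_on_add[OF aug_linear[OF Kd(3)]] aug_d1[OF Kd(3) xy(3)] aug_F0_map[OF Kd(2-4) xy(2)])
qed

context ring_map
begin

abbreviation "KC \<equiv> K_complex R U u"

lemma KC_simps: "lterm KC = self_bimod R" "rterm KC = UU" "tdiff KC = u"
  by (simp_all add: K_complex_def)

lemmas self_left_module = self_bimod_left_module[OF R.ring_axioms]

lemma u_linear: "linear_on R (self_bimod R) UU u"
  by (simp add: linear_on_def self_bimod_simps restr_bimod_simps)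

lemma K_complex_linear: "linear_complex R KC"
  by (simp add: linear_complex_def KC_simps self_left_module restr_left_module u_linear)

lemma stalk_complex_linear: "linear_complex R (stalk cok)"
proof -
  have "left_module R (zero_bimod :: ('r, unit) bimodule)"
    by (intro left_module.intro R.ring_axioms left_module_axioms.intro abelian_groupI)
      (auto simp: zero_bimod_def)
  then show ?thesis
    using linear_on_const_zero[OF cok_left_module] by (simp add: linear_complex_def stalk_def cok_left_module)
qed

lemma P0_K: "P0 R KC = FU"
  by (simp add: P0_def KC_simps FU_F0)

lemma K_bd1_closed: "z \<in> carrier (P1 R KC) \<Longrightarrow> bd1 R KC z \<in> carrier FU"
  using linear_on_closed[OF bd1_linear[OF K_complex_linear]] by (simp add: P0_K)

lemma augU_bd1:
  assumes "z \<in> carrier (P1 R KC)"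
  shows "augU (bd1 R KC z) = u (aug R (self_bimod R) (fst z))" "aug R (self_bimod R) (fst z) \<in> carrier R"
proof -
  show "augU (bd1 R KC z) = u (aug R (self_bimod R) (fst z))"
    using aug_bd1[OF K_complex_linear assms] by (simp add: KC_simps)
  have "fst z \<in> carrier (F0 R (self_bimod R))"
    using assms by (auto simp: P1_def KC_simps prod_mod_simps)
  from linear_on_closed[OF aug_linear[OF self_left_module] this]
  show "aug R (self_bimod R) (fst z) \<in> carrier R" by (simp add: self_bimod_simps)
qed

end

context torsion_free_sequence
begin

abbreviation "ext_class \<phi> \<equiv> ext1_coboundaries R KC M +>\<^bsub>ext1_cocycles R KC M\<^esub> \<phi>"

text \<open>Linearity can be checked after applying the injective map \<open>i\<close>.\<close>

lemma linear_on_pullback: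
  assumes P: "left_module R P" and k: "linear_on R P NR k"
    and \<phi>: "\<And>z. z \<in> carrier P \<Longrightarrow> \<phi> z \<in> carrier M" "\<And>z. z \<in> carrier P \<Longrightarrow> i (\<phi> z) = k z"
  shows "linear_on R P M \<phi>"
proof (rule linear_onI)
  interpret P: left_module R P by (rule P)
  fix x assume x: "x \<in> carrier P"
  show "\<phi> x \<in> carrier M" by (rule \<phi>(1)[OF x])
  { fix y assume y: "y \<in> carrier P"
    have "i (\<phi> (x \<oplus>\<^bsub>P\<^esub> y)) = i (\<phi> x \<oplus>\<^bsub>M\<^esub> \<phi> y)"
      using x y linear_on_add[OF k x y] by (simp add: \<phi> i_add restr_mod_simps)
    then show "\<phi> (x \<oplus>\<^bsub>P\<^esub> y) = \<phi> x \<oplus>\<^bsub>M\<^esub> \<phi> y" using x y by (simp add: i_eq_iff \<phi>(1)) }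
  { fix r assume r: "r \<in> carrier R"
    have "i (\<phi> (r \<odot>\<^bsub>P\<^esub> x)) = i (r \<odot>\<^bsub>M\<^esub> \<phi> x)"
      using x r linear_on_smult[OF k r x] by (simp add: \<phi> i_smult restr_mod_simps P.smult_closed)
    then show "\<phi> (r \<odot>\<^bsub>P\<^esub> x) = r \<odot>\<^bsub>M\<^esub> \<phi> x" using x r by (simp add: i_eq_iff \<phi>(1) P.smult_closed M.smult_closed) }
qed

lemma cocycle_pullback:
  assumes K: "linear_complex R K" and h: "linear_on R (P0 R K) NR h"
    and \<phi>: "\<And>z. z \<in> carrier (P1 R K) \<Longrightarrow> \<phi> z \<in> carrier M" "\<And>z. z \<in> carrier (P1 R K) \<Longrightarrow> i (\<phi> z) = h (bd1 R K z)"
    and ext: "\<phi> \<in> extensional (carrier (P1 R K))"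
  shows "\<phi> \<in> carrier (ext1_cocycles R K M)"
  unfolding ext1_cocycles_iff
proof (intro conjI ballI ext)
  note R = linear_complexD(1)[OF K]
  show "linear_on R (P1 R K) M \<phi>"
    by (rule linear_on_pullback[OF P1_left_module[OF R] linear_on_comp[OF bd1_linear[OF K] h] \<phi>])
  fix z assume z: "z \<in> carrier (P2 R K)"
  have "i (\<phi> (bd2 R K z)) = \<zero>\<^bsub>N\<^esub>"
    using \<phi>(2)[OF bd2_closed[OF K z]] bd1_bd2[OF K z] linear_on_zero[OF P0_left_module[OF R] NR_left_module h]
    by (simp add: restr_mod_simps)
  also have "\<dots> = i \<zero>\<^bsub>M\<^esub>" using linear_on_zero[OF M.left_module_axioms NR_left_module i_linear] by (simp add: restr_mod_simps)
  finally show "\<phi> (bd2 R K z) = \<zero>\<^bsub>M\<^esub>" using \<phi>(1)[OF bd2_closed[OF K z]] by (simp add: i_eq_iff)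
qed

definition lift_cocycle :: "(('u \<Rightarrow> 'r) \<Rightarrow> 'n) \<Rightarrow> ('r \<Rightarrow> 'r) \<times> (('u \<Rightarrow> 'r) \<Rightarrow> 'r) \<Rightarrow> 'm" where
  "lift_cocycle H = (\<lambda>z\<in>carrier (P1 R KC). inv_i (H (bd1 R KC z)))"

lemma lift_cocycle:
  assumes g: "g \<in> mod_hom R cok V" and H: "is_lift g H" and z: "z \<in> carrier (P1 R KC)"
  shows "lift_cocycle H z \<in> carrier M" "i (lift_cocycle H z) = H (bd1 R KC z)"
proof -
  have "H (bd1 R KC z) \<in> i ` carrier M"
    by (rule lift_image[OF g H K_bd1_closed[OF z]]) (simp add: augU_bd1[OF z])
  from inv_i[OF this] show "lift_cocycle H z \<in> carrier M" "i (lift_cocycle H z) = H (bd1 R KC z)"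
    using z by (simp_all add: lift_cocycle_def)
qed

lemma lift_cocycle_closed:
  assumes g: "g \<in> mod_hom R cok V" and H: "is_lift g H"
  shows "lift_cocycle H \<in> carrier (ext1_cocycles R KC M)"
  by (rule cocycle_pullback[OF K_complex_linear, where h = H])
    (use H lift_cocycle[OF g H] in \<open>simp_all add: P0_K is_lift_def\<close>, simp add: lift_cocycle_def)

lemma lift_cocycle_eqI:
  assumes g: "g \<in> mod_hom R cok V" and H: "is_lift g H" and "\<phi> \<in> extensional (carrier (P1 R KC))"
    and \<phi>: "\<And>z. z \<in> carrier (P1 R KC) \<Longrightarrow> \<phi> z \<in> carrier M" "\<And>z. z \<in> carrier (P1 R KC) \<Longrightarrow> i (\<phi> z) = H (bd1 R KC z)"
  shows "\<phi> = lift_cocycle H"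
proof (rule extensionalityI)
  fix z assume z: "z \<in> carrier (P1 R KC)"
  show "\<phi> z = lift_cocycle H z"
    using i_eq_iff[OF \<phi>(1)[OF z] lift_cocycle(1)[OF g H z]] \<phi>(2)[OF z] lift_cocycle(2)[OF g H z] by simp
qed (use assms in \<open>simp_all add: lift_cocycle_def\<close>)

text \<open>
  The difference of two lifts takes its values in \<open>M\<close> and thus defines a coboundary.
\<close>

lemma lift_class_unique:
  assumes g: "g \<in> mod_hom R cok V" and H: "is_lift g H" and H': "is_lift g H'"
  shows "ext_class (lift_cocycle H) = ext_class (lift_cocycle H')"
proof -
  have Hlin: "linear_on R FU NR H" "linear_on R FU NR H'" using H H' by (auto simp: is_lift_def)
  have im: "H c \<ominus>\<^bsub>N\<^esub> H' c \<in> i ` carrier M" if "c \<in> carrier FU" for c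
    using that H H' p_eq_iff[OF lift_closed[OF H that] lift_closed[OF H' that]] by (simp add: is_lift_def)
  define c where "c x = inv_i (H x \<ominus>\<^bsub>N\<^esub> H' x)" for x
  have c: "c x \<in> carrier M" "i (c x) = H x \<ominus>\<^bsub>N\<^esub> H' x" if "x \<in> carrier FU" for x
    using inv_i[OF im[OF that]] by (simp_all add: c_def)
  have "linear_on R FU M c"
    by (rule linear_on_pullback[OF FU_left_module linear_on_minus_fun[OF NR_left_module Hlin]])
      (simp_all add: c NR_minus lift_closed[OF H'])
  then have "linear_on R (P0 R KC) M c" by (simp add: P0_K)
  then show ?thesis
  proof (rule ext1_class_eqI[OF K_complex_linear M.left_module_axioms lift_cocycle_closed[OF g H] lift_cocycle_closed[OF g H']])
    fix z assume z: "z \<in> carrier (P1 R KC)"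
    note b = K_bd1_closed[OF z]
    note h = lift_closed[OF H b] lift_closed[OF H' b]
    have eq: "i (lift_cocycle H z) = i (c (bd1 R KC z) \<oplus>\<^bsub>M\<^esub> lift_cocycle H' z)"
      using h by (simp add: i_add c[OF b] lift_cocycle[OF g H z] lift_cocycle[OF g H' z] a_minus_def N.M.a_assoc N.M.l_neg)
    show "lift_cocycle H z = c (bd1 R KC z) \<oplus>\<^bsub>M\<^esub> lift_cocycle H' z"
      by (rule i_eq_iff[THEN iffD1, OF _ _ eq]) (simp_all add: c(1)[OF b] lift_cocycle(1)[OF g H z] lift_cocycle(1)[OF g H' z])
  qed
qed

text \<open>
  The connecting map \<open>Hom(K, V) \<rightarrow> Hom(K, M[1])\<close>, where \<open>Hom(K, V) = Hom(U/R, V)\<close>.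
\<close>

definition hom_class :: "('u set \<Rightarrow> 'v) \<Rightarrow> (('r \<Rightarrow> 'r) \<times> (('u \<Rightarrow> 'r) \<Rightarrow> 'r) \<Rightarrow> 'm) set" where
  "hom_class g = ext_class (lift_cocycle (SOME H. is_lift g H))"

lemma hom_class_eqI:
  assumes g: "g \<in> mod_hom R cok V" and H: "is_lift g H" and "\<phi> \<in> extensional (carrier (P1 R KC))"
    and "\<And>z. z \<in> carrier (P1 R KC) \<Longrightarrow> \<phi> z \<in> carrier M" "\<And>z. z \<in> carrier (P1 R KC) \<Longrightarrow> i (\<phi> z) = H (bd1 R KC z)"
  shows "hom_class g = ext_class \<phi>"
proof -
  have "\<phi> = lift_cocycle H" by (rule lift_cocycle_eqI[OF assms])
  then show ?thesis unfolding hom_class_def using lift_class_unique[OF g someI[of "is_lift g", OF H] H] by simp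
qed

lemma hom_class_lift: "\<lbrakk>g \<in> mod_hom R cok V; is_lift g H\<rbrakk> \<Longrightarrow> hom_class g = ext_class (lift_cocycle H)"
  by (rule hom_class_eqI) (simp_all add: lift_cocycle, simp add: lift_cocycle_def)

text \<open>
  The restriction of a cocycle to the second summand of \<open>P1\<close> is a homomorphism \<open>b\<close> on the kernel of the
  augmentation of \<open>U\<close>, its restriction to the first summand is determined by the value \<open>m\<close> at the generator
  \<open>[1]\<close>. The extension of these data to a homomorphism \<open>c\<close> into \<open>N\<close> is a lift, because modulo \<open>M\<close> it
  vanishes on the kernel and on \<open>[1]\<close>.
\<close>

lemma cocycle_from_lift:
  assumes \<phi>: "\<phi> \<in> carrier (ext1_cocycles R KC M)"
  obtains g H where "g \<in> mod_hom R cok V" "is_lift g H" "\<And>z. z \<in> carrier (P1 R KC) \<Longrightarrow> i (\<phi> z) = H (bd1 R KC z)"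
proof -
  note R = R.ring_axioms
  interpret FS: left_module R "F0 R (self_bimod R)" by (rule F0_left_module[OF R])
  interpret FS1: left_module R "F1 R (self_bimod R)" by (rule F1_left_module[OF R])
  interpret F: left_module R FU by (rule FU_left_module)
  interpret F1: left_module R "F1 R UU" by (rule F1_left_module[OF R])
  interpret F2: left_module R "F2 R UU" by (rule F2_left_module[OF R])
  interpret Z: left_module R ZU by (rule ZU_left_module)
  let ?g = "free_gen R"
  let ?o = "\<zero>\<^bsub>F0 R (self_bimod R)\<^esub>" and ?l = "\<zero>\<^bsub>F1 R UU\<^esub>"
  have \<phi>lin: "linear_on R (prod_mod (F0 R (self_bimod R)) (F1 R UU)) M \<phi>"
    and \<phi>0: "\<And>z. z \<in> carrier (P2 R KC) \<Longrightarrow> \<phi> (bd2 R KC z) = \<zero>\<^bsub>M\<^esub>"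
    using \<phi> by (auto simp: ext1_cocycles_iff P1_def KC_simps)
  have d1: "linear_on R (F1 R UU) FU (d1 R UU)" using d1_linear[OF R, of UU] by (simp add: FU_F0)
  note F0u = F0_map_linear[OF R linear_on_Pi[OF u_linear], unfolded FU_F0]
  note F1u = F1_map_linear[OF self_left_module restr_left_module u_linear]
  have \<psi>lin: "linear_on R (F1 R UU) M (\<lambda>y. \<phi> (?o, y))"
    by (rule linear_on_comp[OF _ \<phi>lin]) (simp add: linear_on_def prod_mod_simps FS.smult_zero_right)
  have \<chi>lin: "linear_on R (F0 R (self_bimod R)) M (\<lambda>x. \<phi> (x, ?l))"
    by (rule linear_on_comp[OF _ \<phi>lin]) (simp add: linear_on_def prod_mod_simps F1.smult_zero_right)
  have \<psi>cl: "\<phi> (?o, y) \<in> carrier M" if "y \<in> carrier (F1 R UU)" for y using linear_on_closed[OF \<psi>lin that] .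
  have \<psi>0: "\<phi> (?o, y) = \<zero>\<^bsub>M\<^esub>" if y: "y \<in> carrier (F1 R UU)" "d1 R UU y = \<zero>\<^bsub>FU\<^esub>" for y
  proof -
    have gy: "?g y \<in> carrier (F2 R UU)" using y by (simp add: F2_def free_gen_closed[OF R] FU_F0)
    have "bd2 R KC (\<zero>\<^bsub>F1 R (self_bimod R)\<^esub>, ?g y) = (?o, y)"
      using y linear_on_zero[OF F1_left_module[OF R] F0_left_module[OF R] d1_linear[OF R, of "self_bimod R"]]
        linear_on_zero[OF F1_left_module[OF R] F1_left_module[OF R] F1u]
      by (simp add: bd2_def KC_simps d2_gen[OF R] FU_F0)
    moreover have "(\<zero>\<^bsub>F1 R (self_bimod R)\<^esub>, ?g y) \<in> carrier (P2 R KC)" using gy by (simp add: P2_def KC_simps prod_mod_simps)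
    ultimately show ?thesis using \<phi>0 by metis
  qed
  have \<psi>eq: "\<phi> (?o, y) = \<phi> (?o, y')"
    if y: "y \<in> carrier (F1 R UU)" "y' \<in> carrier (F1 R UU)" "d1 R UU y = d1 R UU y'" for y y'
  proof -
    have "d1 R UU (y \<ominus>\<^bsub>F1 R UU\<^esub> y') = \<zero>\<^bsub>FU\<^esub>"
      using linear_on_diff[OF F1_left_module[OF R] FU_left_module d1 y(1,2)] y linear_on_closed[OF d1 y(2)]
      by (simp add: F.M.minus_eq_zero_iff)
    then have "\<phi> (?o, y \<ominus>\<^bsub>F1 R UU\<^esub> y') = \<zero>\<^bsub>M\<^esub>" using y by (intro \<psi>0) auto
    then show ?thesis
      using linear_on_diff[OF F1_left_module[OF R] M.left_module_axioms \<psi>lin y(1,2)] y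
      by (simp add: M.M.minus_eq_zero_iff \<psi>cl)
  qed
  have gen1: "?g z \<in> carrier (F1 R UU)" "d1 R UU (?g z) = z" if "z \<in> carrier ZU" for z
    using that by (auto simp: ZU_simps F1_gen_closed[OF R] d1_gen[OF R] FU_F0 restr_bimod_simps)
  define b where "b z = i (\<phi> (?o, ?g z))" for z
  have b: "linear_on R ZU NR b"
  proof (rule linear_onI)
    fix z assume z: "z \<in> carrier ZU"
    show "b z \<in> carrier NR" unfolding b_def by (simp add: restr_mod_simps i_closed \<psi>cl gen1(1)[OF z])
    { fix z' assume z': "z' \<in> carrier ZU"
      have "\<phi> (?o, ?g (z \<oplus>\<^bsub>ZU\<^esub> z')) = \<phi> (?o, ?g z \<oplus>\<^bsub>F1 R UU\<^esub> ?g z')"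
        using z z' gen1[OF Z.M.a_closed[OF z z']] by (intro \<psi>eq) (simp_all add: gen1 linear_on_add[OF d1] ZU_simps(3))
      then show "b (z \<oplus>\<^bsub>ZU\<^esub> z') = b z \<oplus>\<^bsub>NR\<^esub> b z'"
        using z z' by (simp add: b_def linear_on_add[OF \<psi>lin] gen1 i_add \<psi>cl restr_mod_simps) }
    { fix r assume r: "r \<in> carrier R"
      have "\<phi> (?o, ?g (r \<odot>\<^bsub>ZU\<^esub> z)) = \<phi> (?o, r \<odot>\<^bsub>F1 R UU\<^esub> ?g z)"
        using z r gen1[OF Z.smult_closed[OF r z]]
        by (intro \<psi>eq) (simp_all add: gen1 linear_on_smult[OF d1] ZU_simps(4) F1.smult_closed)
      then show "b (r \<odot>\<^bsub>ZU\<^esub> z) = r \<odot>\<^bsub>NR\<^esub> b z"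
        using z r by (simp add: b_def linear_on_smult[OF \<psi>lin] gen1 i_smult \<psi>cl restr_mod_simps) }
  qed
  have g1: "?g \<one>\<^bsub>R\<^esub> \<in> carrier (F0 R (self_bimod R))" by (simp add: F0_gen_closed[OF R] self_bimod_simps)
  define m where "m = \<phi> (?g \<one>\<^bsub>R\<^esub>, ?l)"
  have m: "m \<in> carrier M" unfolding m_def by (rule linear_on_closed[OF \<chi>lin g1])
  obtain c where c: "linear_on R FU NR c" and cZ: "\<And>z. z \<in> carrier ZU \<Longrightarrow> c z = b z" and c1: "c (?g \<one>) = i m"
    using extend_from_kernel[OF b i_closed[OF m]] by metis
  have c\<psi>: "c (d1 R UU y) = i (\<phi> (?o, y))" if y: "y \<in> carrier (F1 R UU)" for y
  proof -
    have z: "d1 R UU y \<in> carrier ZU"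
      using linear_on_closed[OF d1 y] aug_d1[OF restr_left_module y] by (simp add: ZU_simps restr_bimod_simps)
    have "\<phi> (?o, ?g (d1 R UU y)) = \<phi> (?o, y)" by (rule \<psi>eq[OF gen1(1)[OF z] y gen1(2)[OF z]])
    then show ?thesis using cZ[OF z] by (simp add: b_def)
  qed
  have c\<chi>: "c (F0_map R UU u x) = i (\<phi> (x, ?l))" if x: "x \<in> carrier (F0 R (self_bimod R))" for x
  proof (rule linear_on_free_eq[OF R NR_left_module _ _ _ x[unfolded F0_def self_bimod_simps]])
    show "linear_on R (free_mod R (carrier R)) NR (\<lambda>x. c (F0_map R UU u x))"
      using linear_on_comp[OF F0u c] by (simp add: F0_def self_bimod_simps)
    show "linear_on R (free_mod R (carrier R)) NR (\<lambda>x. i (\<phi> (x, ?l)))"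
      using linear_on_comp[OF \<chi>lin i_linear] by (simp add: F0_def[of R "self_bimod R"] self_bimod_simps)
    fix r assume r: "r \<in> carrier R"
    have gr: "?g r \<in> carrier (F0 R (self_bimod R))" using r by (simp add: F0_gen_closed[OF R] self_bimod_simps)
    have r1: "r \<odot>\<^bsub>F0 R (self_bimod R)\<^esub> ?g \<one>\<^bsub>R\<^esub> \<in> carrier (F0 R (self_bimod R))" by (rule FS.smult_closed[OF r g1])
    let ?e = "?g r \<ominus>\<^bsub>F0 R (self_bimod R)\<^esub> r \<odot>\<^bsub>F0 R (self_bimod R)\<^esub> ?g \<one>\<^bsub>R\<^esub>"
    have e: "?e \<in> carrier (F0 R (self_bimod R))" using gr r1 by simp
    interpret S: left_module R "self_bimod R" by (rule self_left_module)
    have auge: "aug R (self_bimod R) ?e = \<zero>\<^bsub>self_bimod R\<^esub>"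
      using linear_on_diff[OF FS.left_module_axioms self_left_module aug_linear[OF self_left_module] gr r1] r g1
      by (simp add: linear_on_smult[OF aug_linear[OF self_left_module]] aug_gen[OF self_left_module] self_bimod_simps(1,4)
          S.M.minus_eq_zero_iff)
    have ge: "?g ?e \<in> carrier (F1 R (self_bimod R))" by (rule F1_gen_closed[OF R e auge])
    let ?w = "F0_map R UU u ?e"
    have F1e: "F1_map R UU u (?g ?e) = ?g ?w" by (rule F1_map_gen[OF self_left_module restr_left_module u_linear e auge])
    have w: "?w \<in> carrier ZU"
      using linear_on_closed[OF F0u e] aug_F0_map[OF self_left_module restr_left_module u_linear e]
      by (simp add: auge ZU_simps self_bimod_simps)
    have bd: "bd2 R KC (?g ?e, \<zero>\<^bsub>F2 R UU\<^esub>) = (\<ominus>\<^bsub>F0 R (self_bimod R)\<^esub> ?e, ?g ?w)"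
      using gen1(1)[OF w] linear_on_zero[OF F2_left_module[OF R] F1_left_module[OF R] d2_linear[OF R, of UU]]
      by (simp add: bd2_def KC_simps d1_gen[OF R e auge] F1e)
    have "(?g ?e, \<zero>\<^bsub>F2 R UU\<^esub>) \<in> carrier (P2 R KC)" using ge by (simp add: P2_def KC_simps prod_mod_simps)
    from \<phi>0[OF this, unfolded bd] have z: "\<phi> (\<ominus>\<^bsub>F0 R (self_bimod R)\<^esub> ?e, ?g ?w) = \<zero>\<^bsub>M\<^esub>" .
    have me: "\<ominus>\<^bsub>F0 R (self_bimod R)\<^esub> ?e \<in> carrier (F0 R (self_bimod R))" using e by simp
    have "\<phi> (\<ominus>\<^bsub>F0 R (self_bimod R)\<^esub> ?e, ?g ?w) = \<phi> (\<ominus>\<^bsub>F0 R (self_bimod R)\<^esub> ?e, ?l) \<oplus>\<^bsub>M\<^esub> \<phi> (?o, ?g ?w)"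
      using linear_on_add[OF \<phi>lin, of "(\<ominus>\<^bsub>F0 R (self_bimod R)\<^esub> ?e, ?l)" "(?o, ?g ?w)"] gen1(1)[OF w] me
      by (simp add: prod_mod_simps)
    with z have "\<ominus>\<^bsub>M\<^esub> \<phi> (?e, ?l) \<oplus>\<^bsub>M\<^esub> \<phi> (?o, ?g ?w) = \<zero>\<^bsub>M\<^esub>"
      using linear_on_minus[OF FS.left_module_axioms M.left_module_axioms \<chi>lin e] by simp
    then have eq: "\<phi> (?o, ?g ?w) = \<phi> (?e, ?l)"
      using linear_on_closed[OF \<chi>lin e] \<psi>cl[OF gen1(1)[OF w]] by (metis M.M.a_inv_closed M.M.minus_equality M.M.minus_minus M.M.a_comm)
    have cw: "c ?w = i (\<phi> (?e, ?l))" using cZ[OF w] eq by (simp add: b_def)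
    have F0r: "F0_map R UU u (?g r) = ?g (u r)" "F0_map R UU u (?g \<one>\<^bsub>R\<^esub>) = ?g \<one>"
      using F0_map_gen[OF R linear_on_Pi[OF u_linear]] r by (simp_all add: self_bimod_simps)
    have gu: "?g (u r) \<in> carrier FU" "?g \<one> \<in> carrier FU" using r by (auto intro: FU_gen)
    have "?w = ?g (u r) \<ominus>\<^bsub>FU\<^esub> r \<odot>\<^bsub>FU\<^esub> ?g \<one>"
      using linear_on_diff[OF FS.left_module_axioms FU_left_module F0u gr r1] linear_on_smult[OF F0u r g1] F0r by simp
    then have "c ?w = c (?g (u r)) \<ominus>\<^bsub>N\<^esub> u r \<odot>\<^bsub>N\<^esub> i m"
      using linear_on_diff[OF FU_left_module NR_left_module c gu(1) F.smult_closed[OF r gu(2)]] linear_on_smult[OF c r gu(2)]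
        m r by (simp add: c1 restr_mod_simps NR_minus N.smult_closed i_closed)
    moreover have "\<phi> (?e, ?l) = \<phi> (?g r, ?l) \<ominus>\<^bsub>M\<^esub> r \<odot>\<^bsub>M\<^esub> m"
      using linear_on_diff[OF FS.left_module_axioms M.left_module_axioms \<chi>lin gr r1] linear_on_smult[OF \<chi>lin r g1]
      by (simp add: m_def)
    ultimately have "c (?g (u r)) \<ominus>\<^bsub>N\<^esub> u r \<odot>\<^bsub>N\<^esub> i m = i (\<phi> (?g r, ?l)) \<ominus>\<^bsub>N\<^esub> u r \<odot>\<^bsub>N\<^esub> i m"
      using cw linear_on_closed[OF \<chi>lin gr] m r by (simp add: i_minus i_smult M.smult_closed)
    moreover have "c (?g (u r)) \<in> carrier N" using linear_on_closed[OF c gu(1)] by (simp add: restr_mod_simps)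
    ultimately have "c (?g (u r)) = i (\<phi> (?g r, ?l))"
      using linear_on_closed[OF \<chi>lin gr] m r by (simp add: a_minus_def N.smult_closed i_closed)
    then show "c (F0_map R UU u (?g r)) = i (\<phi> (?g r, ?l))" by (simp add: F0r)
  qed
  have main: "i (\<phi> z) = c (bd1 R KC z)" if z: "z \<in> carrier (P1 R KC)" for z
  proof -
    obtain x y where xy: "z = (x, y)" "x \<in> carrier (F0 R (self_bimod R))" "y \<in> carrier (F1 R UU)"
      using z by (auto simp: P1_def KC_simps prod_mod_simps)
    have "\<phi> z = \<phi> (x, ?l) \<oplus>\<^bsub>M\<^esub> \<phi> (?o, y)"
      using linear_on_add[OF \<phi>lin, of "(x, ?l)" "(?o, y)"] xy by (simp add: prod_mod_simps)
    then show ?thesis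
      using xy linear_on_closed[OF F0u xy(2)] linear_on_closed[OF d1 xy(3)] linear_on_closed[OF \<chi>lin xy(2)]
      by (simp add: bd1_def KC_simps FU_F0 linear_on_add[OF c] c\<psi> c\<chi> i_add \<psi>cl restr_mod_simps)
  qed
  have dep: "p (c w) = p (c w')" if w: "w \<in> carrier FU" "w' \<in> carrier FU" "augU w = augU w'" for w w'
  proof -
    have z: "w \<ominus>\<^bsub>FU\<^esub> w' \<in> carrier ZU" by (rule ZU_diffI[OF w])
    then have "c (w \<ominus>\<^bsub>FU\<^esub> w') \<in> i ` carrier M" using cZ \<psi>cl gen1 by (simp add: b_def)
    moreover have "c w \<in> carrier N" "c w' \<in> carrier N"
      using linear_on_closed[OF c] w by (auto simp: restr_mod_simps)
    ultimately show ?thesis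
      using linear_on_diff[OF FU_left_module NR_left_module c w(1,2)] by (simp add: p_eq_iff NR_minus)
  qed
  have pc: "linear_on R FU V (\<lambda>w. p (c w))" by (rule linear_on_comp[OF c p_linear])
  have "linear_on R UU V (\<lambda>x. p (c (?g x)))"
  proof (rule linear_onI)
    fix x assume "x \<in> carrier UU"
    then have x: "x \<in> carrier U" "?g x \<in> carrier FU" by (auto simp: restr_bimod_simps FU_gen)
    show "p (c (?g x)) \<in> carrier V" by (rule linear_on_closed[OF pc x(2)])
    { fix y assume "y \<in> carrier UU"
      then have y: "y \<in> carrier U" "?g y \<in> carrier FU" by (auto simp: restr_bimod_simps FU_gen)
      have "p (c (?g (x \<oplus> y))) = p (c (?g x \<oplus>\<^bsub>FU\<^esub> ?g y))"
        using x y by (intro dep) (simp_all add: FU_gen augU_gen linear_on_add[OF augU_linear] restr_bimod_simps)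
      then show "p (c (?g (x \<oplus>\<^bsub>UU\<^esub> y))) = p (c (?g x)) \<oplus>\<^bsub>V\<^esub> p (c (?g y))"
        using x y by (simp add: restr_bimod_simps linear_on_add[OF pc]) }
    { fix r assume r: "r \<in> carrier R"
      have "p (c (?g (u r \<otimes> x))) = p (c (r \<odot>\<^bsub>FU\<^esub> ?g x))"
        using x r by (intro dep) (simp_all add: FU_gen augU_gen linear_on_smult[OF augU_linear] restr_bimod_simps F.smult_closed)
      then show "p (c (?g (r \<odot>\<^bsub>UU\<^esub> x))) = r \<odot>\<^bsub>V\<^esub> p (c (?g x))"
        using x r by (simp add: restr_bimod_simps linear_on_smult[OF pc]) }
  qed
  moreover have "p (c (?g \<one>)) = \<zero>\<^bsub>V\<^esub>" by (simp add: c1 p_i[OF m])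
  ultimately obtain g where g: "g \<in> mod_hom R cok V" "\<And>x. x \<in> carrier U \<Longrightarrow> g (\<pi> x) = p (c (?g x))"
    by (rule descend_to_cok[OF V.left_module_axioms]) blast
  show ?thesis
    by (rule that[OF g(1) is_liftI[OF g(1) c] main]) (simp_all add: g(2))
qed

text \<open>
  When the classes agree, then two lifts \<open>H\<close> and \<open>H'\<close> differ, up to a homomorphism \<open>e\<close> into \<open>M\<close>, by a
  homomorphism \<open>D\<close> that vanishes on the image of \<open>bd1\<close>, that is, on the kernel of the augmentation and on
  \<open>[1]\<close>. As its values are in a \<open>U\<close>-module, \<open>D\<close> is zero: with a denominator \<open>\<alpha>\<close> and a numerator \<open>\<tau>\<close> of \<open>x\<close>
  one has \<open>D [x] = D \<tau> = x (D \<alpha>) = x (D [1]) = 0\<close>.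
\<close>

lemma hom_class_inj:
  assumes g: "g \<in> mod_hom R cok V" "g' \<in> mod_hom R cok V" and eq: "hom_class g = hom_class g'"
  shows "g = g'"
proof -
  interpret F: left_module R FU by (rule FU_left_module)
  interpret NR: left_module R NR by (rule NR_left_module)
  obtain H where H: "is_lift g H" using lift_ex[OF g(1)] ..
  obtain H' where H': "is_lift g' H'" using lift_ex[OF g(2)] ..
  have Hlin: "linear_on R FU NR H" "linear_on R FU NR H'" using H H' by (auto simp: is_lift_def)
  have "ext_class (lift_cocycle H) = ext_class (lift_cocycle H')" using eq hom_class_lift g H H' by simp
  then obtain e where e: "linear_on R FU M e"
    "\<And>z. z \<in> carrier (P1 R KC) \<Longrightarrow> lift_cocycle H z = e (bd1 R KC z) \<oplus>\<^bsub>M\<^esub> lift_cocycle H' z"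
    by (rule ext1_class_eqD[OF K_complex_linear M.left_module_axioms lift_cocycle_closed[OF g(1) H]
          lift_cocycle_closed[OF g(2) H'], unfolded P0_K]) blast
  define E where "E c = i (e c) \<oplus>\<^bsub>N\<^esub> H' c" for c
  have Elin: "linear_on R FU NR E"
    using linear_on_sum[OF NR_left_module linear_on_comp[OF e(1) i_linear] Hlin(2)] by (simp add: E_def[abs_def] restr_mod_simps)
  define D where "D c = H c \<ominus>\<^bsub>NR\<^esub> E c" for c
  have Dlin: "linear_on R FU NR D" unfolding D_def by (rule linear_on_minus_fun[OF NR_left_module Hlin(1) Elin])
  have Dcl: "D c \<in> carrier N" if "c \<in> carrier FU" for c using linear_on_closed[OF Dlin that] by (simp add: restr_mod_simps)
  have D0: "D (bd1 R KC z) = \<zero>\<^bsub>N\<^esub>" if z: "z \<in> carrier (P1 R KC)" for z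
  proof -
    note b = K_bd1_closed[OF z]
    have "H (bd1 R KC z) = E (bd1 R KC z)"
      using lift_cocycle[OF g(1) H z] lift_cocycle[OF g(2) H' z] e(2)[OF z] linear_on_closed[OF e(1) b]
      by (simp add: E_def i_add)
    then show ?thesis
      using linear_on_closed[OF Elin b] NR.M.minus_eq_zero_iff[of "E (bd1 R KC z)" "E (bd1 R KC z)"]
      by (simp add: D_def restr_mod_simps(2))
  qed
  have DZ: "D z = \<zero>\<^bsub>N\<^esub>" if z: "z \<in> carrier ZU" for z
  proof -
    have zF: "z \<in> carrier (F0 R UU)" "aug R UU z = \<zero>\<^bsub>UU\<^esub>" using z by (auto simp: ZU_simps FU_F0 restr_bimod_simps)
    let ?z = "(\<zero>\<^bsub>F0 R (self_bimod R)\<^esub>, free_gen R z)"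
    interpret FS: left_module R "F0 R (self_bimod R)" by (rule F0_left_module[OF R.ring_axioms])
    have "?z \<in> carrier (P1 R KC)"
      using F1_gen_closed[OF R.ring_axioms zF] by (simp add: P1_def KC_simps prod_mod_simps)
    moreover have "bd1 R KC ?z = z"
      using linear_on_zero[OF F0_left_module[OF R.ring_axioms] F0_left_module[OF R.ring_axioms]
          F0_map_linear[OF R.ring_axioms linear_on_Pi[OF u_linear]]] zF(1)
      by (simp add: bd1_def KC_simps d1_gen[OF R.ring_axioms zF] FU_F0)
    ultimately show ?thesis using D0 by metis
  qed
  have D1: "D (free_gen R \<one>) = \<zero>\<^bsub>N\<^esub>"
  proof -
    let ?z = "(free_gen R \<one>\<^bsub>R\<^esub>, \<zero>\<^bsub>F1 R UU\<^esub>)"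
    interpret F1: left_module R "F1 R UU" by (rule F1_left_module[OF R.ring_axioms])
    have "?z \<in> carrier (P1 R KC)"
      using F0_gen_closed[OF R.ring_axioms, of "\<one>\<^bsub>R\<^esub>" "self_bimod R"] by (simp add: P1_def KC_simps prod_mod_simps self_bimod_simps)
    moreover have "bd1 R KC ?z = free_gen R \<one>"
      using linear_on_zero[OF F1_left_module[OF R.ring_axioms] F0_left_module[OF R.ring_axioms] d1_linear[OF R.ring_axioms, of UU]]
        F0_map_gen[OF R.ring_axioms linear_on_Pi[OF u_linear], of "\<one>\<^bsub>R\<^esub>"] FU_gen[of "\<one>"]
      by (simp add: bd1_def KC_simps FU_F0 self_bimod_simps)
    ultimately show ?thesis using D0 by metis
  qed
  have Deq: "D c = D c'" if c: "c \<in> carrier FU" "c' \<in> carrier FU" "augU c = augU c'" for c c'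
  proof -
    have "D c \<ominus>\<^bsub>NR\<^esub> D c' = \<zero>\<^bsub>N\<^esub>"
      using DZ[OF ZU_diffI[OF c]] linear_on_diff[OF FU_left_module NR_left_module Dlin c(1,2)] by simp
    then show ?thesis using Dcl c by (simp add: NR_minus N.M.minus_eq_zero_iff)
  qed
  show ?thesis
  proof (rule mod_hom_cok_ext[OF g])
    fix x assume x: "x \<in> carrier U"
    note gx = FU_gen[OF x]
    obtain \<alpha> \<tau> where a: "\<alpha> \<in> carrier FU" "augU \<alpha> = \<one>" "\<tau> \<in> carrier FU" "\<And>y. x \<otimes> u (\<alpha> y) = u (\<tau> y)"
    proof (rule denominators[of "{x}"])
      fix \<alpha> \<tau> assume "\<alpha> \<in> carrier FU" "augU \<alpha> = \<one>" "\<And>w. w \<in> {x} \<Longrightarrow> \<tau> w \<in> carrier FU"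
        "\<And>w y. w \<in> {x} \<Longrightarrow> w \<otimes> u (\<alpha> y) = u (\<tau> w y)"
      then show thesis using that[of \<alpha> "\<tau> x"] by simp
    qed (use x in auto)
    have "D (free_gen R x) = D \<tau>"
      using augU_twist[OF a(1,3) x a(4)] x a by (intro Deq gx) (simp_all add: augU_gen)
    also have "\<dots> = x \<odot>\<^bsub>N\<^esub> D \<alpha>" by (rule linear_twist[OF Dlin a(1,3) x a(4)])
    also have "D \<alpha> = D (free_gen R \<one>)" using a(1,2) by (intro Deq FU_gen) (simp_all add: augU_gen)
    also have "x \<odot>\<^bsub>N\<^esub> \<dots> = \<zero>\<^bsub>N\<^esub>" using x by (simp add: D1 N.smult_zero_right)
    finally have "H (free_gen R x) = E (free_gen R x)"
      using linear_on_closed[OF Hlin(1) gx] linear_on_closed[OF Elin gx] by (simp add: D_def NR.M.minus_eq_zero_iff flip: restr_mod_simps(2)[of u])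
    then have "p (H (free_gen R x)) = p (H' (free_gen R x))"
      using linear_on_closed[OF e(1) gx] lift_closed[OF H' gx] p_closed[OF lift_closed[OF H' gx]]
      by (simp add: E_def p_add i_closed p_i)
    then show "g (\<pi> x) = g' (\<pi> x)" using H H' gx x by (simp add: is_lift_def augU_gen)
  qed
qed

end

section \<open>The isomorphism between the completion and the extension module\<close>

lemma left_module_transport:
  assumes A: "left_module R A" and f: "bij_betw f (carrier A) (carrier B)"
    and add: "\<And>x y. \<lbrakk>x \<in> carrier A; y \<in> carrier A\<rbrakk> \<Longrightarrow> f x \<oplus>\<^bsub>B\<^esub> f y = f (x \<oplus>\<^bsub>A\<^esub> y)"
    and smult: "\<And>r x. \<lbrakk>r \<in> carrier R; x \<in> carrier A\<rbrakk> \<Longrightarrow> r \<odot>\<^bsub>B\<^esub> f x = f (r \<odot>\<^bsub>A\<^esub> x)"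
    and zero: "\<zero>\<^bsub>B\<^esub> = f \<zero>\<^bsub>A\<^esub>"
  shows "left_module R B"
proof -
  interpret A: left_module R A by fact
  have B: "carrier B = f ` carrier A" using f by (simp add: bij_betw_def)
  have "abelian_group B"
  proof (rule abelian_groupI)
    fix x assume "x \<in> carrier B"
    then obtain a where "x = f a" "a \<in> carrier A" by (auto simp: B)
    then have "f (\<ominus>\<^bsub>A\<^esub> a) \<in> carrier B" "f (\<ominus>\<^bsub>A\<^esub> a) \<oplus>\<^bsub>B\<^esub> x = \<zero>\<^bsub>B\<^esub>" by (auto simp: B add zero A.M.l_neg)
    then show "\<exists>y\<in>carrier B. y \<oplus>\<^bsub>B\<^esub> x = \<zero>\<^bsub>B\<^esub>" by blast
  qed (auto simp: B add zero A.M.a_ac)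
  then show ?thesis
    by (intro left_module.intro A.R.ring_axioms left_module_axioms.intro)
      (auto simp: B add smult A.smult_closed A.smult_l_distr A.smult_r_distr A.smult_assoc1 A.smult_one)
qed

context torsion_free_sequence
begin

abbreviation "DM \<equiv> Delta R U u M"

lemma Delta_carrier: "carrier DM = a_rcosets\<^bsub>ext1_cocycles R KC M\<^esub> ext1_coboundaries R KC M"
  and Delta_zero: "\<zero>\<^bsub>DM\<^esub> = ext1_coboundaries R KC M"
  and Delta_add: "x \<oplus>\<^bsub>DM\<^esub> y = x <+>\<^bsub>ext1_cocycles R KC M\<^esub> y"
  and Delta_smult: "r \<odot>\<^bsub>DM\<^esub> x =
    coset_map (ext1_cocycles R KC M) (ext1_coboundaries R KC M) (\<lambda>\<phi>. r \<odot>\<^bsub>ext1_cocycles R KC M\<^esub> \<phi>) x"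
  by (simp_all add: Delta_def Ext1_def quot_mod_def)

lemmas cocycle_cosets =
  ext1_cocycles_group[OF K_complex_linear M.left_module_axioms] ext1_coboundaries_subgroup[OF K_complex_linear M.left_module_axioms]

lemma hom_class_bij: "bij_betw hom_class (mod_hom R cok V) (carrier DM)"
proof (rule bij_betw_imageI)
  show "inj_on hom_class (mod_hom R cok V)" using hom_class_inj by (auto intro: inj_onI)
  show "hom_class ` mod_hom R cok V = carrier DM"
  proof (intro equalityI subsetI)
    fix C assume "C \<in> hom_class ` mod_hom R cok V"
    then obtain g H where "g \<in> mod_hom R cok V" "is_lift g H" "C = hom_class g" using lift_ex by blast
    then show "C \<in> carrier DM"
      using lift_cocycle_closed hom_class_lift unfolding Delta_carrier rcosets_iff by blast
  next
    fix C assume "C \<in> carrier DM"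
    then obtain \<phi> where \<phi>: "\<phi> \<in> carrier (ext1_cocycles R KC M)" "C = ext_class \<phi>" unfolding Delta_carrier rcosets_iff by blast
    obtain g H where g: "g \<in> mod_hom R cok V" "is_lift g H" "\<And>z. z \<in> carrier (P1 R KC) \<Longrightarrow> i (\<phi> z) = H (bd1 R KC z)"
      using cocycle_from_lift[OF \<phi>(1)] by metis
    have "hom_class g = C"
      unfolding \<phi>(2) using \<phi>(1) linear_on_closed[of R "P1 R KC" M \<phi>]
      by (intro hom_class_eqI[OF g(1,2) _ _ g(3)]) (auto simp: ext1_cocycles_iff)
    then show "C \<in> hom_class ` mod_hom R cok V" using g(1) by blast
  qed
qed

lemma hom_class_add:
  assumes g: "g \<in> mod_hom R cok V" "g' \<in> mod_hom R cok V"
  shows "hom_class g \<oplus>\<^bsub>DM\<^esub> hom_class g' = hom_class (g \<oplus>\<^bsub>HV\<^esub> g')"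
proof -
  interpret W: left_module R HV by (rule HV_left_module)
  interpret Z: abelian_group "ext1_cocycles R KC M" by (rule cocycle_cosets)
  obtain H where H: "is_lift g H" using lift_ex[OF g(1)] ..
  obtain H' where H': "is_lift g' H'" using lift_ex[OF g(2)] ..
  have gg: "g \<oplus>\<^bsub>HV\<^esub> g' \<in> mod_hom R cok V" using W.M.a_closed[of g g'] g by (simp add: hom_mod_simps(1))
  have Hlin: "linear_on R FU NR H" "linear_on R FU NR H'" using H H' by (auto simp: is_lift_def)
  have L: "is_lift (g \<oplus>\<^bsub>HV\<^esub> g') (\<lambda>c. H c \<oplus>\<^bsub>NR\<^esub> H' c)"
  proof (rule is_liftI[OF gg linear_on_sum[OF NR_left_module Hlin]])
    fix x assume "x \<in> carrier U"
    then show "p (H (free_gen R x) \<oplus>\<^bsub>NR\<^esub> H' (free_gen R x)) = (g \<oplus>\<^bsub>HV\<^esub> g') (\<pi> x)"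
      using H H' FU_gen[of x] lift_closed[OF H] lift_closed[OF H']
      by (simp add: restr_mod_simps p_add is_lift_def augU_gen hom_mod_simps proj_closed)
  qed
  have c: "lift_cocycle H \<in> carrier (ext1_cocycles R KC M)" "lift_cocycle H' \<in> carrier (ext1_cocycles R KC M)"
    using lift_cocycle_closed g H H' by auto
  have "hom_class (g \<oplus>\<^bsub>HV\<^esub> g') = ext_class (lift_cocycle H \<oplus>\<^bsub>ext1_cocycles R KC M\<^esub> lift_cocycle H')"
    by (rule hom_class_eqI[OF gg L])
      (simp_all add: ext1_cocycles_simps lift_cocycle[OF g(1) H] lift_cocycle[OF g(2) H'] i_add restr_mod_simps)
  then show ?thesis
    using coset_add[OF cocycle_cosets c] hom_class_lift g H H' by (simp add: Delta_add)
qed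

text \<open>
  Right multiplication by \<open>r\<close> on \<open>K\<close> carries a lift of \<open>g\<close> to one of \<open>r g\<close>. The module structure of
  \<^const>\<open>Ext1\<close> involves all members of a class. Each of them comes from some lift of \<open>g\<close>, because
  it comes from a lift of some homomorphism with the same class.
\<close>

lemma hom_class_smult:
  assumes r: "r \<in> carrier R" and g: "g \<in> mod_hom R cok V"
  shows "r \<odot>\<^bsub>DM\<^esub> hom_class g = hom_class (r \<odot>\<^bsub>HV\<^esub> g)"
proof -
  interpret W: left_module R HV by (rule HV_left_module)
  obtain H0 where H0: "is_lift g H0" using lift_ex[OF g] ..
  note c0 = lift_cocycle_closed[OF g H0]
  have rg: "r \<odot>\<^bsub>HV\<^esub> g \<in> mod_hom R cok V" using W.smult_closed[OF r, of g] g by (simp add: hom_mod_simps(1))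
  show ?thesis
    unfolding Delta_smult
  proof (rule coset_map_eq)
    have eq: "hom_class g = ext_class (lift_cocycle H0)" by (rule hom_class_lift[OF g H0])
    then show "hom_class g \<noteq> {}" using coset_self[OF cocycle_cosets c0] by auto
    fix \<phi> assume "\<phi> \<in> hom_class g"
    then have \<phi>: "\<phi> \<in> carrier (ext1_cocycles R KC M)"
      "\<phi> \<ominus>\<^bsub>ext1_cocycles R KC M\<^esub> lift_cocycle H0 \<in> ext1_coboundaries R KC M"
      using mem_coset_iff[OF cocycle_cosets c0] eq by auto
    then have same: "ext_class \<phi> = hom_class g" using coset_eq_iff[OF cocycle_cosets \<phi>(1) c0] eq by simp
    have \<phi>lin: "linear_on R (P1 R KC) M \<phi>" "\<phi> \<in> extensional (carrier (P1 R KC))"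
      using \<phi>(1) by (auto simp: ext1_cocycles_iff)
    obtain g' H where g': "g' \<in> mod_hom R cok V" and H: "is_lift g' H"
      and \<phi>H: "\<And>z. z \<in> carrier (P1 R KC) \<Longrightarrow> i (\<phi> z) = H (bd1 R KC z)"
      using cocycle_from_lift[OF \<phi>(1)] by metis
    have "hom_class g' = ext_class \<phi>"
      by (rule hom_class_eqI[OF g' H \<phi>lin(2) linear_on_closed[OF \<phi>lin(1)] \<phi>H])
    then have "g' = g" using hom_class_inj[OF g' g] same by simp
    note H = H[unfolded this]
    let ?ru = "\<lambda>x. x \<otimes> u r" and ?rr = "\<lambda>x. x \<otimes>\<^bsub>R\<^esub> r"
    have lin: "linear_on R (self_bimod R) (self_bimod R) ?rr" "linear_on R UU UU ?ru"
      using r by (simp_all add: linear_on_def self_bimod_simps R.l_distr R.m_assoc rmult_linear[unfolded linear_on_def])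
    let ?P = "P1_map R KC (\<lambda>x. ract (lterm KC) x r) (\<lambda>x. ract (rterm KC) x r)"
    have P: "?P = P1_map R KC ?rr ?ru" by (simp add: KC_simps self_bimod_simps restr_bimod_simps)
    have Pcl: "P1_map R KC ?rr ?ru z \<in> carrier (P1 R KC)" if "z \<in> carrier (P1 R KC)" for z
      using linear_on_closed[OF P1_map_linear[OF K_complex_linear K_complex_linear] that] lin by (simp add: KC_simps)
    have bP: "bd1 R KC (P1_map R KC ?rr ?ru z) = F0_map R UU ?ru (bd1 R KC z)" if "z \<in> carrier (P1 R KC)" for z
      using bd1_P1_map[OF K_complex_linear K_complex_linear _ _ _ that, of ?rr ?ru] lin r
      by (simp add: KC_simps self_bimod_simps)
    have L: "is_lift (r \<odot>\<^bsub>HV\<^esub> g) (\<lambda>c. H (F0_map R UU ?ru c))"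
    proof (rule is_liftI[OF rg])
      have "linear_on R FU NR H" using H by (simp add: is_lift_def)
      then show "linear_on R FU NR (\<lambda>c. H (F0_map R UU ?ru c))"
        by (rule linear_on_comp[OF F0_map_linear[OF R.ring_axioms linear_on_Pi[OF lin(2)], unfolded FU_F0]])
      fix x assume x: "x \<in> carrier U"
      have xr: "x \<otimes> u r \<in> carrier U" using x r by simp
      have "F0_map R UU ?ru (free_gen R x) = free_gen R (x \<otimes> u r)"
        using F0_map_gen[OF R.ring_axioms linear_on_Pi[OF lin(2)]] x by (simp add: restr_bimod_simps)
      then show "p (H (F0_map R UU ?ru (free_gen R x))) = (r \<odot>\<^bsub>HV\<^esub> g) (\<pi> x)"
        using H FU_gen[OF xr] x r by (simp add: is_lift_def augU_gen xr hom_mod_simps proj_closed proj_ract)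
    qed
    have "hom_class (r \<odot>\<^bsub>HV\<^esub> g) = ext_class (\<lambda>z\<in>carrier (P1 R KC). \<phi> (?P z))"
      unfolding P by (rule hom_class_eqI[OF rg L]) (simp_all add: linear_on_closed[OF \<phi>lin(1)] Pcl \<phi>H bP)
    then show "ext_class (r \<odot>\<^bsub>ext1_cocycles R KC M\<^esub> \<phi>) = hom_class (r \<odot>\<^bsub>HV\<^esub> g)" by (simp add: ext1_cocycles_def)
  qed
qed

lemma hom_class_zero: "hom_class \<zero>\<^bsub>HV\<^esub> = \<zero>\<^bsub>DM\<^esub>"
proof -
  interpret W: left_module R HV by (rule HV_left_module)
  interpret Z: abelian_group "ext1_cocycles R KC M" by (rule cocycle_cosets)
  have z: "\<zero>\<^bsub>HV\<^esub> \<in> mod_hom R cok V" using W.M.zero_closed by (simp add: hom_mod_simps(1))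
  have z': "p \<zero>\<^bsub>N\<^esub> = \<zero>\<^bsub>V\<^esub>" "i \<zero>\<^bsub>M\<^esub> = \<zero>\<^bsub>N\<^esub>"
    using linear_on_zero[OF NR_left_module V.left_module_axioms p_linear]
      linear_on_zero[OF M.left_module_axioms NR_left_module i_linear] by (simp_all add: restr_mod_simps)
  have L: "is_lift \<zero>\<^bsub>HV\<^esub> (\<lambda>_. \<zero>\<^bsub>NR\<^esub>)"
    by (rule is_liftI[OF z linear_on_const_zero[OF NR_left_module]])
      (simp add: restr_mod_simps z' hom_mod_simps proj_closed)
  have "hom_class \<zero>\<^bsub>HV\<^esub> = ext_class \<zero>\<^bsub>ext1_cocycles R KC M\<^esub>"
    by (rule hom_class_eqI[OF z L]) (simp_all add: ext1_cocycles_simps z' restr_mod_simps)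
  then show ?thesis using coset_zero[OF cocycle_cosets] by (simp add: Delta_zero)
qed

lemma Delta_left_module: "left_module R DM"
  by (rule left_module_transport[OF HV_left_module, of hom_class])
    (simp_all add: hom_mod_simps(1) hom_class_bij hom_class_add hom_class_smult hom_class_zero)

lemma hom_class_linear: "linear_on R HV DM hom_class"
  using hom_class_bij by (auto simp: linear_on_def hom_mod_simps(1) hom_class_add hom_class_smult bij_betw_def)

lemma glued_zero: "glued \<zero>\<^bsub>C.LM\<^esub> = \<zero>\<^bsub>HV\<^esub>"
proof (rule glued_eqI[OF C.Lambda_zero_closed])
  interpret W: left_module R HV by (rule HV_left_module)
  show "\<zero>\<^bsub>HV\<^esub> \<in> mod_hom R cok V" using W.M.zero_closed by (simp add: hom_mod_simps(1))
  show "represents \<zero>\<^bsub>HV\<^esub> \<zero>\<^bsub>C.LM\<^esub>"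
    by (auto simp: represents_def hom_mod_simps proj_closed Lambda_simps pr_denom)
qed

lemma Lambda_left_module: "left_module R C.LM"
proof (rule left_module_transport[OF HV_left_module, of "inv_into (carrier C.LM) glued"])
  let ?f = "inv_into (carrier C.LM) glued"
  interpret W: left_module R HV by (rule HV_left_module)
  have inj: "inj_on glued (carrier C.LM)" and im: "glued ` carrier C.LM = carrier HV"
    using glued_bij by (auto simp: bij_betw_def hom_mod_simps(1))
  have f: "?f g \<in> carrier C.LM" "glued (?f g) = g" if "g \<in> carrier HV" for g
    using that inv_into_into[of g glued] f_inv_into_f[of g glued] by (simp_all add: im)
  show "bij_betw ?f (carrier HV) (carrier C.LM)"
    using bij_betw_inv_into[OF glued_bij] by (simp add: hom_mod_simps(1))
  show "?f x \<oplus>\<^bsub>C.LM\<^esub> ?f y = ?f (x \<oplus>\<^bsub>HV\<^esub> y)" if "x \<in> carrier HV" "y \<in> carrier HV" for x y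
    using that by (intro inj_onD[OF inj]) (simp_all add: glued_add f C.Lambda_add_closed)
  show "r \<odot>\<^bsub>C.LM\<^esub> ?f x = ?f (r \<odot>\<^bsub>HV\<^esub> x)" if "r \<in> carrier R" "x \<in> carrier HV" for r x
    using that by (intro inj_onD[OF inj]) (simp_all add: glued_smult f C.Lambda_smult_closed W.smult_closed)
  show "\<zero>\<^bsub>C.LM\<^esub> = ?f \<zero>\<^bsub>HV\<^esub>"
    by (intro inj_onD[OF inj]) (simp_all add: glued_zero f C.Lambda_zero_closed)
qed

lemma glued_linear: "linear_on R C.LM HV glued"
  by (simp add: linear_on_def glued_add glued_smult glued hom_mod_simps(1))

text \<open>The homomorphism \<open>x \<mapsto> x \<otimes> m\<close>.\<close>

definition pr_hom :: "'m \<Rightarrow> 'u set \<Rightarrow> 'v" where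
  "pr_hom m = glued (completion_map GT M m)"

lemma pr_hom: "m \<in> carrier M \<Longrightarrow> pr_hom m \<in> mod_hom R cok V"
  "\<lbrakk>m \<in> carrier M; x \<in> carrier U\<rbrakk> \<Longrightarrow> pr_hom m (\<pi> x) = pr x m"
  by (simp_all add: pr_hom_def glued glued_completion_map C.completion_map_closed)

lemma hom_class_pr_hom:
  assumes m: "m \<in> carrier M"
  shows "hom_class (pr_hom m) = delta R U u M m"
  unfolding delta_def
proof (rule hom_class_eqI[OF pr_hom(1)[OF m]])
  show "is_lift (pr_hom m) (\<lambda>c. augU c \<odot>\<^bsub>N\<^esub> i m)"
  proof (rule is_liftI[OF pr_hom(1)[OF m]])
    have "linear_on R UU NR (\<lambda>x. x \<odot>\<^bsub>N\<^esub> i m)"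
      using m by (auto simp: linear_on_def restr_bimod_simps restr_mod_simps N.smult_closed N.smult_l_distr N.smult_assoc1 i_closed)
    then show "linear_on R FU NR (\<lambda>c. augU c \<odot>\<^bsub>N\<^esub> i m)" by (rule linear_on_comp[OF augU_linear])
    fix x assume "x \<in> carrier U"
    then show "p (augU (free_gen R x) \<odot>\<^bsub>N\<^esub> i m) = pr_hom m (\<pi> x)" using m by (simp add: augU_gen pr_hom pr_def)
  qed
qed (use m in \<open>simp_all add: augU_bd1 M.smult_closed i_smult\<close>)

text \<open>
  For a lift \<open>H\<close> of \<open>g\<close> and a combination \<open>\<Sum> u (\<beta> w) w = 1\<close> with coefficients in \<open>I\<close>, the homomorphism
  \<open>g\<close> differs from the one given by \<open>m = H \<beta>\<close> by \<open>\<Sum> (\<beta> w) (k w)\<close> with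
  \<open>k w x = g (x w) - p (x (H [w]))\<close>. The latter vanishes at \<open>x = 1\<close>, and so it is defined on \<open>U/R\<close>.
\<close>

lemma hom_decomposition:
  assumes g: "g \<in> mod_hom R cok V" and I: "I \<in> GT"
  obtains m and D :: "'u set" and k \<beta> where "m \<in> carrier M" "finite D" "k \<in> D \<rightarrow> carrier HV" "range \<beta> \<subseteq> I"
    "g = pr_hom m \<oplus>\<^bsub>HV\<^esub> (\<Oplus>\<^bsub>HV\<^esub>w\<in>D. \<beta> w \<odot>\<^bsub>HV\<^esub> k w)"
proof -
  interpret W: left_module R HV by (rule HV_left_module)
  obtain H where H: "is_lift g H" using lift_ex[OF g] ..
  then have Hlin: "linear_on R FU NR H" by (simp add: is_lift_def)
  obtain \<beta> where \<beta>: "\<beta> \<in> carrier FU" "augU \<beta> = \<one>" "\<And>y. \<beta> y \<in> I" using I by (rule gabriel_combination) blast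
  let ?D = "supp \<beta>"
  have D: "finite ?D" "?D \<subseteq> carrier U" using supp_finite supp_carrier \<beta>(1) by auto
  have \<beta>R: "\<beta> w \<in> carrier R" for w using FU_apply[OF \<beta>(1)] .
  define m where "m = inv_i (H \<beta>)"
  have m: "m \<in> carrier M" "i m = H \<beta>"
    using inv_i[OF lift_image[OF g H \<beta>(1)]] \<beta>(2) imageI[OF R.one_closed, of u] by (simp_all add: m_def)
  have HN: "H (free_gen R w) \<in> carrier N" if "w \<in> carrier U" for w using lift_closed[OF H FU_gen[OF that]] .
  note gl = mod_hom_proj_linear[OF g]
  have gcl: "g (\<pi> x) \<in> carrier V" if "x \<in> carrier U" for x using linear_on_closed[OF gl] that by (simp add: restr_bimod_simps)
  let ?k = "\<lambda>w x. g (\<pi> (x \<otimes> w)) \<ominus>\<^bsub>V\<^esub> p (x \<odot>\<^bsub>N\<^esub> H (free_gen R w))"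
  have "\<exists>k. k \<in> mod_hom R cok V \<and> (\<forall>x\<in>carrier U. k (\<pi> x) = ?k w x)" if w: "w \<in> carrier U" for w
  proof -
    have "linear_on R UU NR (\<lambda>x. x \<odot>\<^bsub>N\<^esub> H (free_gen R w))"
      using HN[OF w] by (auto simp: linear_on_def restr_bimod_simps restr_mod_simps N.smult_closed N.smult_l_distr N.smult_assoc1)
    from linear_on_minus_fun[OF V.left_module_axioms linear_on_comp[OF rmult_linear[OF w] gl] linear_on_comp[OF this p_linear]]
    have lin: "linear_on R UU V (?k w)" .
    have one: "?k w \<one> = \<zero>\<^bsub>V\<^esub>"
      using H FU_gen[OF w] w gcl[OF w] by (simp add: is_lift_def augU_gen N.smult_one HN V.M.minus_eq_zero_iff)
    obtain k where "k \<in> mod_hom R cok V" "\<And>x. x \<in> carrier U \<Longrightarrow> k (\<pi> x) = ?k w x"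
      by (rule descend_to_cok[OF V.left_module_axioms lin one]) blast
    then show ?thesis by blast
  qed
  then obtain k where k: "\<And>w. w \<in> carrier U \<Longrightarrow> k w \<in> mod_hom R cok V"
    "\<And>w x. \<lbrakk>w \<in> carrier U; x \<in> carrier U\<rbrakk> \<Longrightarrow> k w (\<pi> x) = ?k w x" by metis
  have kcl: "k \<in> ?D \<rightarrow> carrier HV" using k(1) D(2) by (auto simp: hom_mod_simps(1))
  then have bkcl: "(\<lambda>w. \<beta> w \<odot>\<^bsub>HV\<^esub> k w) \<in> ?D \<rightarrow> mod_hom R cok V"
    using \<beta>R W.smult_closed by (auto simp: hom_mod_simps(1) Pi_iff)
  let ?s = "\<Oplus>\<^bsub>HV\<^esub>w\<in>?D. \<beta> w \<odot>\<^bsub>HV\<^esub> k w"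
  have scl: "?s \<in> carrier HV" using bkcl by (intro W.M.finsum_closed) (simp add: hom_mod_simps(1))
  have sum: "pr_hom m \<oplus>\<^bsub>HV\<^esub> ?s \<in> mod_hom R cok V"
    using W.M.a_closed[OF _ scl, of "pr_hom m"] pr_hom(1)[OF m(1)] by (simp add: hom_mod_simps(1))
  have "g = pr_hom m \<oplus>\<^bsub>HV\<^esub> ?s"
  proof (rule mod_hom_cok_ext[OF g sum])
    fix x assume x: "x \<in> carrier U"
    have wU: "w \<in> carrier U" if "w \<in> ?D" for w using D(2) that by blast
    have uw: "u (\<beta> w) \<in> carrier U" for w using \<beta>R by simp
    let ?y = "\<lambda>w. x \<otimes> (u (\<beta> w) \<otimes> w)" and ?n = "\<lambda>w. x \<odot>\<^bsub>N\<^esub> (u (\<beta> w) \<odot>\<^bsub>N\<^esub> H (free_gen R w))"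
    have ycl: "?y \<in> ?D \<rightarrow> carrier U" using x uw wU by auto
    have ncl: "?n \<in> ?D \<rightarrow> carrier N" using x uw wU HN by (auto intro!: N.smult_closed)
    have "?s (\<pi> x) = (\<Oplus>\<^bsub>V\<^esub>w\<in>?D. (\<beta> w \<odot>\<^bsub>HV\<^esub> k w) (\<pi> x))"
      by (rule hom_mod_finsum_apply[OF cok_bimodule V.left_module_axioms bkcl proj_closed[OF x]])
    also have "\<dots> = (\<Oplus>\<^bsub>V\<^esub>w\<in>?D. g (\<pi> (?y w)) \<ominus>\<^bsub>V\<^esub> p (?n w))"
      using x \<beta>R wU uw HN gcl k(2) funcset_mem[OF ncl, THEN p_closed]
      by (intro V.M.finsum_cong')
        (auto simp: hom_mod_simps proj_closed proj_ract S.m_assoc N.smult_assoc1 intro!: V.M.minus_closed N.smult_closed)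
    also have "\<dots> = (\<Oplus>\<^bsub>V\<^esub>w\<in>?D. g (\<pi> (?y w))) \<ominus>\<^bsub>V\<^esub> (\<Oplus>\<^bsub>V\<^esub>w\<in>?D. p (?n w))"
    proof -
      interpret RV: left_module R V by (rule V.left_module_axioms)
      have a: "(\<lambda>w. g (\<pi> (?y w))) \<in> ?D \<rightarrow> carrier V" "(\<lambda>w. \<ominus>\<^bsub>V\<^esub> p (?n w)) \<in> ?D \<rightarrow> carrier V" "(\<lambda>w. p (?n w)) \<in> ?D \<rightarrow> carrier V"
        using ycl ncl gcl p_closed by (auto simp: Pi_iff)
      have neg: "(\<Oplus>\<^bsub>V\<^esub>w\<in>?D. \<ominus>\<^bsub>V\<^esub> p (?n w)) = \<ominus>\<^bsub>V\<^esub> (\<Oplus>\<^bsub>V\<^esub>w\<in>?D. p (?n w))"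
        by (rule linear_on_finsum[symmetric, OF V.left_module_axioms V.left_module_axioms linear_on_uminus[OF V.left_module_axioms linear_on_id] a(3)])
      show ?thesis using V.M.finsum_addf[OF a(1,2)] by (simp add: a_minus_def neg)
    qed
    also have "(\<Oplus>\<^bsub>V\<^esub>w\<in>?D. g (\<pi> (?y w))) = g (\<pi> x)"
    proof -
      have "(\<Oplus>\<^bsub>V\<^esub>w\<in>?D. g (\<pi> (?y w))) = g (\<pi> (finsum UU ?y ?D))"
        using ycl by (intro linear_on_finsum[symmetric, OF restr_left_module V.left_module_axioms gl]) (simp add: restr_bimod_simps)
      also have "finsum UU ?y ?D = finsum U ?y ?D" using ycl by (rule finsum_restr)
      also have "\<dots> = x \<otimes> (\<Oplus>w\<in>?D. u (\<beta> w) \<otimes> w)" using x uw wU D(1) by (intro S.finsum_rdistr[symmetric]) auto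
      also have "(\<Oplus>w\<in>?D. u (\<beta> w) \<otimes> w) = \<one>" using augU_sum[OF \<beta>(1) D(1) subset_refl D(2)] \<beta>(2) by simp
      finally show ?thesis using x by simp
    qed
    also have "(\<Oplus>\<^bsub>V\<^esub>w\<in>?D. p (?n w)) = pr x m"
    proof -
      have "(\<Oplus>\<^bsub>V\<^esub>w\<in>?D. p (?n w)) = p (finsum NR ?n ?D)"
        using ncl by (intro linear_on_finsum[symmetric, OF NR_left_module V.left_module_axioms p_linear]) (simp add: restr_mod_simps)
      also have "finsum NR ?n ?D = finsum N ?n ?D" using ncl by (rule NR_finsum)
      also have "\<dots> = x \<odot>\<^bsub>N\<^esub> (\<Oplus>\<^bsub>N\<^esub>w\<in>?D. u (\<beta> w) \<odot>\<^bsub>N\<^esub> H (free_gen R w))"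
        using x uw wU HN by (intro N.smult_finsum[symmetric]) (auto intro!: N.smult_closed)
      also have "(\<Oplus>\<^bsub>N\<^esub>w\<in>?D. u (\<beta> w) \<odot>\<^bsub>N\<^esub> H (free_gen R w)) = H \<beta>"
        by (rule FU_linear_sum[symmetric, OF Hlin \<beta>(1) D(1) subset_refl D(2)])
      finally show ?thesis by (simp add: pr_def m(2))
    qed
    finally have "?s (\<pi> x) = g (\<pi> x) \<ominus>\<^bsub>V\<^esub> pr x m" .
    then show "g (\<pi> x) = (pr_hom m \<oplus>\<^bsub>HV\<^esub> ?s) (\<pi> x)"
      using x m(1) gcl[OF x] pr_closed[OF x m(1)]
        V.M.a_lcomm[of "pr x m" "g (\<pi> x)" "\<ominus>\<^bsub>V\<^esub> pr x m"]
      by (simp add: hom_mod_simps(3) proj_closed pr_hom a_minus_def V.M.r_neg)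
  qed
  then show ?thesis using that[of m ?D k \<beta>] m(1) D(1) kcl \<beta>(3) by (simp add: image_subset_iff)
qed

text \<open>
  The component at \<open>I\<close> of a multiple by an element of \<open>I\<close> is zero, so in view of \<open>hom_decomposition\<close>
  it depends only on the values at the homomorphisms that come from \<open>M\<close>.
\<close>

lemma linear_into_completion_unique:
  assumes b: "linear_on R HV C.LM b" and b': "linear_on R HV C.LM b'"
    and eq: "\<And>m. m \<in> carrier M \<Longrightarrow> b (pr_hom m) = b' (pr_hom m)" and g: "g \<in> carrier HV"
  shows "b g = b' g"
proof (rule C.Lambda_eqI[OF linear_on_closed[OF b g] linear_on_closed[OF b' g]])
  interpret W: left_module R HV by (rule HV_left_module)
  interpret L: left_module R C.LM by (rule Lambda_left_module)
  fix I assume I: "I \<in> GT"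
  obtain m and D :: "'u set" and k \<beta> where m: "m \<in> carrier M" and D: "finite D" "k \<in> D \<rightarrow> carrier HV" "range \<beta> \<subseteq> I"
    and dec: "g = pr_hom m \<oplus>\<^bsub>HV\<^esub> (\<Oplus>\<^bsub>HV\<^esub>w\<in>D. \<beta> w \<odot>\<^bsub>HV\<^esub> k w)"
    by (rule hom_decomposition[OF g[unfolded hom_mod_simps(1)] I])
  have \<beta>I: "\<beta> w \<in> I" for w using D(3) by blast
  have \<beta>R: "\<beta> w \<in> carrier R" for w using C.G_subset[OF I] \<beta>I by blast
  let ?s = "\<lambda>D. \<Oplus>\<^bsub>HV\<^esub>w\<in>D. \<beta> w \<odot>\<^bsub>HV\<^esub> k w"
  have bkcl: "(\<lambda>w. \<beta> w \<odot>\<^bsub>HV\<^esub> k w) \<in> D' \<rightarrow> carrier HV" if "D' \<subseteq> D" for D' using \<beta>R D(2) that by (auto intro!: W.smult_closed)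
  have mHV: "pr_hom m \<in> carrier HV" using pr_hom(1)[OF m] by (simp add: hom_mod_simps(1))
  interpret IM: additive_subgroup "ideal_smult I M" M by (rule C.sg[OF I])
  have mult: "\<zero>\<^bsub>M\<^esub> \<in> (r \<odot>\<^bsub>C.LM\<^esub> y) I" if r: "r \<in> I" and y: "y \<in> carrier C.LM" for r y
  proof -
    have rR: "r \<in> carrier R" using C.G_subset[OF I] r by blast
    obtain a where a: "a \<in> carrier M" "a \<in> y (ideal_colon R I r)" using C.Lambda_obtain[OF y C.G_colon[OF I rR]] by metis
    have "\<zero>\<^bsub>M\<^esub> \<ominus>\<^bsub>M\<^esub> r \<odot>\<^bsub>M\<^esub> a \<in> ideal_smult I M"
      using IM.a_inv_closed[OF ideal_smultI[OF r a(1)]] rR a(1) by (simp add: a_minus_def M.smult_closed)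
    then show ?thesis
      using C.Lambda_smult_apply[OF y rR I a(2)] rR a(1) by (simp add: C.cs_mem_iff[OF I] M.smult_closed)
  qed
  have comp: "f g I = f (pr_hom m) I" if f: "linear_on R HV C.LM f" for f
  proof -
    have "\<zero>\<^bsub>M\<^esub> \<in> f (?s D') I" if "D' \<subseteq> D" for D'
      using finite_subset[OF that D(1)] that
    proof (induction D')
      case empty
      have "f \<zero>\<^bsub>HV\<^esub> = \<zero>\<^bsub>C.LM\<^esub>" by (rule linear_on_zero[OF W.left_module_axioms Lambda_left_module f])
      then show ?case using I by (simp add: Lambda_simps IM.zero_closed)
    next
      case (insert w D')
      then have w: "k w \<in> carrier HV" and D': "D' \<subseteq> D" using D(2) by auto
      note bw = W.smult_closed[OF \<beta>R w] and s = W.M.finsum_closed[OF bkcl[OF D']]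
      have "?s (insert w D') = \<beta> w \<odot>\<^bsub>HV\<^esub> k w \<oplus>\<^bsub>HV\<^esub> ?s D'"
        using insert.hyps bkcl[OF D'] bw by (simp add: W.M.finsum_insert)
      then have "f (?s (insert w D')) = \<beta> w \<odot>\<^bsub>C.LM\<^esub> f (k w) \<oplus>\<^bsub>C.LM\<^esub> f (?s D')"
        using linear_on_add[OF f bw s] linear_on_smult[OF f \<beta>R w] by simp
      then have "f (?s (insert w D')) I = C.cs I (\<zero>\<^bsub>M\<^esub> \<oplus>\<^bsub>M\<^esub> \<zero>\<^bsub>M\<^esub>)"
        using C.Lambda_add_apply[OF L.smult_closed[OF \<beta>R linear_on_closed[OF f w]] linear_on_closed[OF f s] I
            mult[OF \<beta>I linear_on_closed[OF f w]] insert.IH[OF D']] by simp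
      then show ?case using C.cs_self[OF I, of "\<zero>\<^bsub>M\<^esub>"] by simp
    qed
    from this[OF subset_refl] have z: "\<zero>\<^bsub>M\<^esub> \<in> f (?s D) I" .
    note s = W.M.finsum_closed[OF bkcl[OF subset_refl]]
    obtain a where a: "a \<in> carrier M" "a \<in> f (pr_hom m) I" "f (pr_hom m) I = C.cs I a"
      using C.Lambda_obtain[OF linear_on_closed[OF f mHV] I] by metis
    have "f g = f (pr_hom m) \<oplus>\<^bsub>C.LM\<^esub> f (?s D)" unfolding dec by (rule linear_on_add[OF f mHV s])
    then show ?thesis
      using C.Lambda_add_apply[OF linear_on_closed[OF f mHV] linear_on_closed[OF f s] I a(2) z] a by simp
  qed
  show "b g I = b' g I" using comp[OF b] comp[OF b'] eq[OF m] by simp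
qed

lemma beta_inverse:
  defines "t \<equiv> (\<lambda>y\<in>carrier C.LM. hom_class (glued y))"
  shows "(\<exists>!b. is_beta R U u M b) \<and> inverse_module_isos R DM C.LM (beta R U u M) t"
proof -
  interpret DL: left_module R DM by (rule Delta_left_module)
  interpret L: left_module R C.LM by (rule Lambda_left_module)
  have tbij: "bij_betw t (carrier C.LM) (carrier DM)"
    using bij_betw_trans[OF glued_bij hom_class_bij] by (rule bij_betw_cong[THEN iffD1, rotated]) (simp add: t_def)
  have tlin: "t \<in> mod_hom R C.LM DM"
    unfolding t_def by (rule linear_on_restrict[OF L.left_module_axioms linear_on_comp[OF glued_linear hom_class_linear]])
  then have tl: "linear_on R C.LM DM t" by (simp add: mod_hom_iff)
  have tinj: "inj_on t (carrier C.LM)" and tim: "t ` carrier C.LM = carrier DM" using tbij by (auto simp: bij_betw_def)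
  define b where "b = (\<lambda>c\<in>carrier DM. inv_into (carrier C.LM) t c)"
  have bt: "b (t y) = y" if "y \<in> carrier C.LM" for y
    using that tim by (auto simp: b_def inv_into_f_f[OF tinj])
  have tb: "t (b c) = c" "b c \<in> carrier C.LM" if "c \<in> carrier DM" for c
    using that tim f_inv_into_f[of c t] inv_into_into[of c t] by (simp_all add: b_def)
  have bhom: "b \<in> mod_hom R DM C.LM"
    unfolding mod_hom_iff
  proof (intro conjI linear_onI)
    show "b \<in> extensional (carrier DM)" by (simp add: b_def)
    show "b (x \<oplus>\<^bsub>DM\<^esub> y) = b x \<oplus>\<^bsub>C.LM\<^esub> b y" if "x \<in> carrier DM" "y \<in> carrier DM" for x y
      using that by (intro inj_onD[OF tinj]) (simp_all add: tb linear_on_add[OF tl])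
    show "b (r \<odot>\<^bsub>DM\<^esub> x) = r \<odot>\<^bsub>C.LM\<^esub> b x" if "r \<in> carrier R" "x \<in> carrier DM" for r x
      using that by (intro inj_onD[OF tinj]) (simp_all add: tb linear_on_smult[OF tl] DL.smult_closed L.smult_closed)
  qed (rule tb)
  have tcomp: "t (completion_map GT M m) = delta R U u M m" if m: "m \<in> carrier M" for m
    using hom_class_pr_hom[OF m] C.completion_map_closed[OF m] by (simp add: t_def pr_hom_def)
  have isb: "is_beta R U u M b"
    unfolding is_beta_def using bhom bt tcomp C.completion_map_closed by metis
  have uniq: "b' = b" if b': "is_beta R U u M b'" for b'
  proof -
    have b'l: "linear_on R DM C.LM b'" "b' \<in> extensional (carrier DM)" using b' by (auto simp: is_beta_def mod_hom_iff)
    have bl: "linear_on R DM C.LM b" using bhom by (simp add: mod_hom_iff)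
    show ?thesis
    proof (rule extensionalityI[OF b'l(2)])
      show "b \<in> extensional (carrier DM)" by (simp add: b_def)
      fix c assume "c \<in> carrier DM"
      then obtain g where g: "g \<in> carrier HV" "c = hom_class g" using hom_class_bij by (auto simp: bij_betw_def hom_mod_simps(1))
      show "b' c = b c"
        unfolding g(2)
        by (rule linear_into_completion_unique[OF linear_on_comp[OF hom_class_linear b'l(1)] linear_on_comp[OF hom_class_linear bl] _ g(1)])
          (use b' isb in \<open>simp add: hom_class_pr_hom is_beta_def\<close>)
    qed
  qed
  have ex1: "\<exists>!b. is_beta R U u M b" using isb uniq by blast
  have "beta R U u M = b" unfolding beta_def using isb uniq by (rule the_equality)
  then show ?thesis
    using ex1 bhom tlin bt tb by (simp add: inverse_module_isos_def DL.left_module_axioms L.left_module_axioms)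
qed

subsection \<open>Gluing and the connecting homomorphism\<close>

text \<open>
  The part of \<open>U/R\<close> annihilated by \<open>I\<close> consists of the classes of those \<open>x\<close> with \<open>x I\<close> contained in the
  image of \<open>R\<close>, and elements of \<open>I Hom(U/R, V)\<close> vanish on it. So the second map in the definition of
  \<open>theta\<close> glues in the same way as \<open>glued\<close>.
\<close>

lemma glue_Lambda_map:
  assumes f: "\<And>m. m \<in> carrier M \<Longrightarrow> f m \<in> mod_hom R cok V" "\<And>m x. \<lbrakk>m \<in> carrier M; x \<in> carrier U\<rbrakk> \<Longrightarrow> f m (\<pi> x) = pr x m"
    and y: "y \<in> carrier C.LM"
  shows "glue R GT cok V (Lambda_map GT HV f y) = glued y"
  unfolding glue_def
proof (rule the_equality)
  interpret W: left_module R HV by (rule HV_left_module)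
  have HVG: "abelian_group HV" by (rule W.M.abelian_group_axioms)
  have sg: "additive_subgroup (ideal_smult I HV) HV" if "I \<in> GT" for I
    by (rule ideal_smult_subgroup[OF HV_left_module C.G_subset[OF that]])
  have fHV: "f m \<in> carrier HV" if "m \<in> carrier M" for m using f(1)[OF that] by (simp add: hom_mod_simps(1))
  have ann: "\<pi> x \<in> annihilated I cok \<longleftrightarrow> I \<subseteq> denom {x}" if I: "I \<in> GT" and x: "x \<in> carrier U" for I x
    using C.G_subset[OF I] x
    by (auto simp: annihilated_def denom_def proj_closed proj_ract proj_eq_zero_iff subset_eq image_iff)
  show "glued y \<in> mod_hom R cok V \<and> (\<forall>I\<in>GT. \<forall>h\<in>Lambda_map GT HV f y I. \<forall>x\<in>annihilated I cok. glued y x = h x)"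
  proof (intro conjI ballI glued(1)[OF y])
    fix I h C0 assume I: "I \<in> GT" and h: "h \<in> Lambda_map GT HV f y I" and C0: "C0 \<in> annihilated I cok"
    then obtain x where x: "x \<in> carrier U" "C0 = \<pi> x" by (auto simp: annihilated_def cok_carrier)
    have den: "I \<subseteq> denom {x}" using ann[OF I x(1)] C0 x(2) by simp
    obtain m where m: "m \<in> y I" "h \<in> ideal_smult I HV +>\<^bsub>HV\<^esub> f m" using h I by (auto simp: Lambda_map_def coset_map_def)
    have mM: "m \<in> carrier M" using C.Lambda_coset(1)[OF y I m(1)] .
    have hm: "h \<in> carrier HV" "h \<ominus>\<^bsub>HV\<^esub> f m \<in> ideal_smult I HV" using m(2) mem_coset_iff[OF HVG sg[OF I] fHV[OF mM]] by auto
    have z: "additive_subgroup {\<zero>\<^bsub>V\<^esub>} V" by (rule additive_subgroupI) (rule V.M.add.triv_subgroup[simplified])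
    have XC: "C0 \<in> carrier cok" using C0 by (simp add: annihilated_def)
    have vcl: "w C0 \<in> carrier V" if "w \<in> carrier HV" for w
      using that XC linear_on_closed[of R cok V w C0] by (simp add: hom_mod_simps(1) mod_hom_iff)
    have "ideal_smult I HV \<subseteq> {w \<in> carrier HV. w C0 \<in> {\<zero>\<^bsub>V\<^esub>}}"
    proof (rule ideal_smult_least[OF HV_left_module])
      show "additive_subgroup {w \<in> carrier HV. w C0 \<in> {\<zero>\<^bsub>V\<^esub>}} HV"
        by (rule linear_ker_subgroup[OF HV_left_module V.M.abelian_group_axioms vcl _ z]) (unfold hom_mod_simps(3), simp_all add: XC)
      fix r w assume r: "r \<in> I" and w: "w \<in> carrier HV"
      have rR: "r \<in> carrier R" using C.G_subset[OF I] r by blast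
      have "(r \<odot>\<^bsub>HV\<^esub> w) C0 = w \<zero>\<^bsub>cok\<^esub>" using C0 r XC by (simp add: hom_mod_simps(4) annihilated_def)
      also have "\<dots> = \<zero>\<^bsub>V\<^esub>"
        using linear_on_zero[OF cok_left_module V.left_module_axioms] w by (simp add: hom_mod_simps(1) mod_hom_iff)
      finally show "r \<odot>\<^bsub>HV\<^esub> w \<in> {w \<in> carrier HV. w C0 \<in> {\<zero>\<^bsub>V\<^esub>}}" using W.smult_closed[OF rR w] by simp
    qed
    then have "(h \<ominus>\<^bsub>HV\<^esub> f m) C0 = \<zero>\<^bsub>V\<^esub>" using hm(2) by blast
    moreover have "h = (h \<ominus>\<^bsub>HV\<^esub> f m) \<oplus>\<^bsub>HV\<^esub> f m" using hm(1) fHV[OF mM] by (simp add: a_minus_def W.M.a_assoc W.M.l_neg)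
    then have "h C0 = ((h \<ominus>\<^bsub>HV\<^esub> f m) \<oplus>\<^bsub>HV\<^esub> f m) C0" by (rule arg_cong)
    then have "h C0 = (h \<ominus>\<^bsub>HV\<^esub> f m) C0 \<oplus>\<^bsub>V\<^esub> f m C0" unfolding hom_mod_simps(3) using XC by simp
    ultimately have "h C0 = f m C0" using vcl[OF fHV[OF mM]] by simp
    then show "glued y C0 = h C0" using glued(2)[OF y] I m(1) den x f(2)[OF mM x(1)] by (simp add: represents_def)
  qed
  fix h assume h: "h \<in> mod_hom R cok V \<and> (\<forall>I\<in>GT. \<forall>k\<in>Lambda_map GT HV f y I. \<forall>x\<in>annihilated I cok. h x = k x)"
  show "h = glued y"
  proof (rule mod_hom_cok_ext[OF conjunct1[OF h] glued(1)[OF y]])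
    fix x assume x: "x \<in> carrier U"
    let ?I = "denom {x}"
    have I: "?I \<in> GT" by (rule denom_single_gabriel[OF x])
    obtain m where m: "m \<in> carrier M" "m \<in> y ?I" using C.Lambda_obtain[OF y I] by metis
    have "f m \<in> Lambda_map GT HV f y ?I"
      using coset_self[OF HVG sg[OF I] fHV[OF m(1)]] m(2) I by (auto simp: Lambda_map_def coset_map_def)
    then have "h (\<pi> x) = f m (\<pi> x)" using h I ann[OF I x] by blast
    also have "\<dots> = glued y (\<pi> x)" using f(2)[OF m(1) x] glued(2)[OF y] I m(2) x by (simp add: represents_def)
    finally show "h (\<pi> x) = glued y (\<pi> x)" .
  qed
qed

text \<open>
  A lift over the free resolution of \<open>U/R\<close>, composed with the map of resolutions induced by the
  projection, is a lift over that of \<open>U\<close>.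
\<close>

lemma Ext1_map_connecting:
  assumes g: "g \<in> mod_hom R cok V"
  shows "Ext1_map R KC (stalk cok) M (\<lambda>_. ()) \<pi> (connecting R cok M NR i p g) = hom_class g"
  unfolding Ext1_map_def
proof (rule coset_map_eq)
  note R = R.ring_axioms
  let ?S = "stalk cok"
  have S: "rterm ?S = cok" "lterm ?S = zero_bimod" "\<And>x. tdiff ?S x = \<zero>\<^bsub>cok\<^esub>" by (simp_all add: stalk_def)
  have P0S: "P0 R ?S = F0 R cok" by (simp add: P0_def S)
  have glin: "linear_on R cok V g" using g by (simp add: mod_hom_iff)
  show "connecting R cok M NR i p g \<noteq> {}"
  proof -
    have "\<forall>C0\<in>carrier cok. \<exists>n. n \<in> carrier N \<and> p n = g C0" using p_surj linear_on_closed[OF glin] by metis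
    from bchoice[OF this] obtain s where s: "\<And>C0. C0 \<in> carrier cok \<Longrightarrow> s C0 \<in> carrier N \<and> p (s C0) = g C0" by blast
    then have sPi: "s \<in> carrier cok \<rightarrow> carrier NR" by (simp add: restr_mod_simps)
    define h where "h = (\<lambda>c\<in>carrier (F0 R cok). free_ext R NR s c)"
    have hh: "h \<in> mod_hom R (F0 R cok) NR"
      unfolding h_def by (rule linear_on_restrict[OF F0_left_module[OF R]]) (use free_ext_linear[OF NR_left_module sPi] in \<open>simp add: F0_def\<close>)
    then have hl: "linear_on R (F0 R cok) NR h" by (simp add: mod_hom_iff)
    have ph: "p (h c) = g (aug R cok c)" if c: "c \<in> carrier (F0 R cok)" for c
    proof (rule linear_on_free_eq[OF R V.left_module_axioms _ _ _ c[unfolded F0_def]])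
      show "linear_on R (free_mod R (carrier cok)) V (\<lambda>c. p (h c))" using linear_on_comp[OF hl p_linear] by (simp add: F0_def)
      show "linear_on R (free_mod R (carrier cok)) V (\<lambda>c. g (aug R cok c))"
        using linear_on_comp[OF aug_linear[OF cok_left_module] glin] by (simp add: F0_def)
      fix C0 assume C0: "C0 \<in> carrier cok"
      then have "free_gen R C0 \<in> carrier (F0 R cok)" by (rule F0_gen_closed[OF R])
      then show "p (h (free_gen R C0)) = g (aug R cok (free_gen R C0))"
        using C0 s by (simp add: h_def free_ext_gen[OF NR_left_module sPi] aug_gen[OF cok_left_module])
    qed
    have bcl: "bd1 R ?S z \<in> carrier (F0 R cok)" if "z \<in> carrier (P1 R ?S)" for z
      using linear_on_closed[OF bd1_linear[OF stalk_complex_linear] that] by (simp add: P0S)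
    have im: "h (bd1 R ?S z) \<in> i ` carrier M" if z: "z \<in> carrier (P1 R ?S)" for z
    proof -
      have "p (h (bd1 R ?S z)) = g \<zero>\<^bsub>cok\<^esub>"
        using ph[OF bcl[OF z]] aug_bd1[OF stalk_complex_linear z] by (simp add: S)
      then have "p (h (bd1 R ?S z)) = \<zero>\<^bsub>V\<^esub>" using linear_on_zero[OF cok_left_module V.left_module_axioms glin] by simp
      moreover have "h (bd1 R ?S z) \<in> carrier N" using linear_on_closed[OF hl bcl[OF z]] by (simp add: restr_mod_simps)
      ultimately show ?thesis using p_ker by blast
    qed
    define \<phi> where "\<phi> = (\<lambda>z\<in>carrier (P1 R ?S). inv_i (h (bd1 R ?S z)))"
    have \<phi>: "\<phi> z \<in> carrier M" "i (\<phi> z) = h (bd1 R ?S z)" if "z \<in> carrier (P1 R ?S)" for z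
      using inv_i[OF im[OF that]] that by (simp_all add: \<phi>_def)
    have "\<phi> \<in> carrier (ext1_cocycles R ?S M)"
      by (rule cocycle_pullback[OF stalk_complex_linear, where h = h]) (use \<phi> hl in \<open>simp_all add: P0S\<close>, simp add: \<phi>_def)
    then have "\<phi> \<in> connecting R cok M NR i p g"
      using hh ph \<phi>(2) by (auto simp: connecting_def P0S)
    then show ?thesis by blast
  qed
  fix \<phi> assume "\<phi> \<in> connecting R cok M NR i p g"
  then obtain h where \<phi>: "\<phi> \<in> carrier (ext1_cocycles R ?S M)" and h: "h \<in> mod_hom R (F0 R cok) NR"
    and ph: "\<And>c. c \<in> carrier (F0 R cok) \<Longrightarrow> p (h c) = g (aug R cok c)"
    and ih: "\<And>z. z \<in> carrier (P1 R ?S) \<Longrightarrow> i (\<phi> z) = h (bd1 R ?S z)"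
    by (auto simp: connecting_def P0S)
  have \<phi>l: "linear_on R (P1 R ?S) M \<phi>" using \<phi> by (simp add: ext1_cocycles_iff)
  note F0p = F0_map_linear[OF R linear_on_Pi[OF proj_linear], unfolded FU_F0]
  have zl: "linear_on R (lterm KC) (lterm ?S) (\<lambda>_. ())" by (simp add: linear_on_def S zero_bimod_def)
  have pl: "linear_on R (rterm KC) (rterm ?S) \<pi>" using proj_linear by (simp add: KC_simps S)
  have comm: "\<pi> (tdiff KC r) = tdiff ?S ()" if "r \<in> carrier (lterm KC)" for r
    using that by (simp add: KC_simps S self_bimod_simps proj_eq_zero_iff)
  note Pcl = linear_on_closed[OF P1_map_linear[OF K_complex_linear stalk_complex_linear zl pl]]
  note bP = bd1_P1_map[OF K_complex_linear stalk_complex_linear zl pl comm, unfolded S]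
  have L: "is_lift g (\<lambda>c. h (F0_map R cok \<pi> c))"
    unfolding is_lift_def
  proof (intro conjI ballI)
    show "linear_on R FU NR (\<lambda>c. h (F0_map R cok \<pi> c))" by (rule linear_on_comp[OF F0p]) (use h in \<open>simp add: mod_hom_iff\<close>)
    fix c assume c: "c \<in> carrier FU"
    show "p (h (F0_map R cok \<pi> c)) = g (\<pi> (augU c))"
      using ph[OF linear_on_closed[OF F0p c]] aug_F0_map[OF restr_left_module cok_left_module proj_linear] c
      by (simp add: FU_F0)
  qed
  show "ext_class (\<lambda>z\<in>carrier (P1 R KC). \<phi> (P1_map R ?S (\<lambda>_. ()) \<pi> z)) = hom_class g"
    by (rule hom_class_eqI[OF g L, symmetric]) (simp_all add: linear_on_closed[OF \<phi>l Pcl] ih[OF Pcl] bP)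
qed

end

section \<open>The sequence of tensor products\<close>

text \<open>
  Right exactness of the tensor product. Let \<open>P\<close> be the group of the elements that represent a tensor of the
  form \<open>1 \<otimes> m\<close>. Replacing each class in \<open>U/R\<close> by a representative \<open>s\<close> turns the relations of
  \<open>U/R \<otimes> M\<close> into elements of \<open>P\<close>, and it is inverse to the projection up to elements of \<open>P\<close>.
\<close>

lemma (in ring_map) tensor_cok_kernel:
  fixes M :: "('r, 'm) module"
  assumes M: "left_module R M" and t: "t \<in> carrier (tensor_act_mod R UR M act)"
    and 0: "tensor_map R (right_of cok) M \<pi> (\<lambda>m. m) t = \<zero>\<^bsub>tensor_act_mod R (right_of cok) M act'\<^esub>"
  shows "t \<in> unit_tens R U u M ` carrier M"
proof -
  interpret M: left_module R M by fact
  interpret T: tensor_pair R UR M by (rule restr_tensor_pair[OF M])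
  interpret T': tensor_pair R "right_of cok" M by (intro tensor_pair.intro cok_right_module M)
  have UR: "carrier UR = carrier U" by (simp add: right_of_simps restr_bimod_simps)
  define P where "P e \<longleftrightarrow> (\<exists>m\<in>carrier M. e - frag_of (\<one>, m) \<in> T.rel)" for e
  have Prel: "P e" if "e \<in> T.rel" for e
    using T.rel_diff[OF that T.rel_zeror[of "\<one>"]] by (auto simp: P_def UR intro!: bexI[of _ "\<zero>\<^bsub>M\<^esub>"])
  have Padd: "P (e + e')" if e: "P e" "P e'" for e e'
  proof -
    obtain m m' where m: "m \<in> carrier M" "e - frag_of (\<one>, m) \<in> T.rel" "m' \<in> carrier M" "e' - frag_of (\<one>, m') \<in> T.rel"
      using e by (auto simp: P_def)
    have "(e - frag_of (\<one>, m)) + (e' - frag_of (\<one>, m'))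
        - (frag_of (\<one>, m \<oplus>\<^bsub>M\<^esub> m') - frag_of (\<one>, m) - frag_of (\<one>, m')) \<in> T.rel"
      using m T.rel_diff[OF T.rel_add[OF m(2,4)] T.rel_addr[of "\<one>" m m']] by (simp add: UR)
    then show ?thesis using m(1,3) by (auto simp: P_def algebra_simps intro!: bexI[of _ "m \<oplus>\<^bsub>M\<^esub> m'"])
  qed
  have Pminus: "P (- e)" if e: "P e" for e
  proof -
    obtain m where m: "m \<in> carrier M" "e - frag_of (\<one>, m) \<in> T.rel" using e by (auto simp: P_def)
    let ?n = "\<ominus>\<^bsub>M\<^esub> m"
    have "- (frag_of (\<one>, \<zero>\<^bsub>M\<^esub>) - frag_of (\<one>, ?n) - frag_of (\<one>, m)) + frag_of (\<one>, \<zero>\<^bsub>M\<^esub>)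
        + (e - frag_of (\<one>, m)) \<in> T.rel"
      using m T.rel_addr[of "\<one>" ?n m] by (intro T.rel_add T.rel_minus T.rel_zeror m(2)) (simp_all add: UR M.M.l_neg)
    moreover have "- (- (frag_of (\<one>, \<zero>\<^bsub>M\<^esub>) - frag_of (\<one>, ?n) - frag_of (\<one>, m)) + frag_of (\<one>, \<zero>\<^bsub>M\<^esub>)
        + (e - frag_of (\<one>, m))) = - e - frag_of (\<one>, ?n)"
      by simp
    ultimately have "- e - frag_of (\<one>, ?n) \<in> T.rel" using T.rel_minus by metis
    then show ?thesis using m(1) by (auto simp: P_def)
  qed
  have Pdiff: "P (e - e')" if "P e" "P e'" for e e' using Padd[OF that(1) Pminus[OF that(2)]] by simp
  have same: "P (frag_of (x, m) - frag_of (y, m))"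
    if xy: "\<pi> x = \<pi> y" "x \<in> carrier U" "y \<in> carrier U" and m: "m \<in> carrier M" for x y m
  proof -
    obtain r where r: "r \<in> carrier R" "x \<ominus> y = u r" using xy by (auto simp: proj_eq_iff)
    have x: "x = u r \<oplus> y" using r(2)[symmetric] xy by (simp add: a_minus_def S.a_assoc S.l_neg)
    have "frag_of (u r, m) - frag_of (\<one>, r \<odot>\<^bsub>M\<^esub> m) \<in> T.rel"
      using T.rel_bal[of "\<one>" r m] r m by (simp add: right_of_simps restr_bimod_simps)
    then have "P (frag_of (u r, m))" using M.smult_closed[OF r(1) m] by (auto simp: P_def)
    moreover have "frag_of (u r \<oplus> y, m) - frag_of (u r, m) - frag_of (y, m) \<in> T.rel"
      using T.rel_addl[of "u r" y m] r xy m by (simp add: right_of_simps restr_bimod_simps)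
    ultimately have "P (frag_of (u r, m) + (frag_of (u r \<oplus> y, m) - frag_of (u r, m) - frag_of (y, m)))"
      by (rule Padd[OF _ Prel])
    then show ?thesis by (simp add: x algebra_simps)
  qed
  have "\<forall>C\<in>carrier cok. \<exists>x. x \<in> carrier U \<and> \<pi> x = C" by (auto simp: cok_carrier)
  from bchoice[OF this] obtain s where s: "\<And>C. C \<in> carrier cok \<Longrightarrow> s C \<in> carrier U" "\<And>C. C \<in> carrier cok \<Longrightarrow> \<pi> (s C) = C" by blast
  define \<psi> where "\<psi> = frag_extend (\<lambda>(C, m). frag_of (s C, m :: 'm))"
  have cokR: "carrier (right_of cok) = carrier cok" by (simp add: right_of_simps)
  interpret K: left_module R cok by (rule cok_left_module)
  have \<psi>rel: "P (\<psi> c)" if "c \<in> T'.rel" for c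
    using that
  proof (induction c rule: T'.rel_induct)
    case (addl C C' m)
    then have C: "C \<in> carrier cok" "C' \<in> carrier cok" by (simp_all add: cokR)
    have "\<pi> (s (C \<oplus>\<^bsub>cok\<^esub> C')) = \<pi> (s C \<oplus> s C')" using C by (simp add: s proj_add[symmetric])
    then have "P (frag_of (s (C \<oplus>\<^bsub>cok\<^esub> C'), m) - frag_of (s C \<oplus> s C', m))"
      by (rule same) (use C addl in \<open>simp_all add: s\<close>)
    moreover have "frag_of (s C \<oplus> s C', m) - frag_of (s C, m) - frag_of (s C', m) \<in> T.rel"
      using T.rel_addl[of "s C" "s C'" m] C addl by (simp add: right_of_simps restr_bimod_simps s)
    ultimately have "P (frag_of (s (C \<oplus>\<^bsub>cok\<^esub> C'), m) - frag_of (s C \<oplus> s C', m)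
        + (frag_of (s C \<oplus> s C', m) - frag_of (s C, m) - frag_of (s C', m)))"
      by (rule Padd[OF _ Prel])
    then show ?case by (simp add: \<psi>_def frag_extend_diff frag_extend_add right_of_simps algebra_simps)
  next
    case (addr C m m')
    then show ?case
      using Prel[OF T.rel_addr[of "s C" m m']] by (simp add: \<psi>_def frag_extend_diff right_of_simps restr_bimod_simps s)
  next
    case (bal C r m)
    then have C: "C \<in> carrier cok" by (simp add: cokR)
    have Cr: "ract cok C r \<in> carrier cok" using T'.A.rsmult_closed[OF bal(2,1)] by (simp add: right_of_simps)
    have "\<pi> (s (ract cok C r)) = \<pi> (s C \<otimes> u r)" using C Cr bal(2) by (simp add: s proj_ract[symmetric])
    then have "P (frag_of (s (ract cok C r), m) - frag_of (s C \<otimes> u r, m))"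
      using C Cr bal by (intro same) (simp_all add: s)
    moreover have "frag_of (s C \<otimes> u r, m) - frag_of (s C, r \<odot>\<^bsub>M\<^esub> m) \<in> T.rel"
      using T.rel_bal[of "s C" r m] C bal by (simp add: right_of_simps restr_bimod_simps s)
    ultimately have "P (frag_of (s (ract cok C r), m) - frag_of (s C \<otimes> u r, m)
        + (frag_of (s C \<otimes> u r, m) - frag_of (s C, r \<odot>\<^bsub>M\<^esub> m)))"
      by (rule Padd[OF _ Prel])
    then show ?case by (simp add: \<psi>_def frag_extend_diff frag_extend_add right_of_simps algebra_simps)
  qed (simp_all add: \<psi>_def frag_extend_add frag_extend_minus Prel T.rel_zero Padd Pminus)
  define \<phi> where "\<phi> = frag_extend (\<lambda>(x, m). frag_of (\<pi> x, m :: 'm))"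
  have \<psi>\<phi>: "P (\<psi> (\<phi> c) - c)" if "Poly_Mapping.keys c \<subseteq> T.base" for c
    using that
  proof (induction c rule: frag_induction)
    case zero
    show ?case by (simp add: \<psi>_def \<phi>_def Prel T.rel_zero)
  next
    case (one xm)
    then obtain x m where "xm = (x, m)" "x \<in> carrier U" "m \<in> carrier M" by (auto simp: UR)
    then show ?case using same[of "s (\<pi> x)" x m] by (simp add: \<psi>_def \<phi>_def s proj_closed)
  next
    case (diff a b)
    then show ?case using Pdiff[of "\<psi> (\<phi> a) - a" "\<psi> (\<phi> b) - b"] by (simp add: \<psi>_def \<phi>_def frag_extend_diff algebra_simps)
  qed
  obtain c where c: "t = T.cls c" "Poly_Mapping.keys c \<subseteq> T.base" using t by (auto simp: T.tensor_act_mod_simps)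
  have "T'.cls (\<phi> c) = T'.cls 0"
    using 0 tensor_map_cls(1)[OF T.tensor_pair_axioms T'.tensor_pair_axioms proj_rlinear linear_on_id c(2)]
    by (simp add: c(1) \<phi>_def T'.tensor_act_mod_simps)
  then have "P (\<psi> (\<phi> c))" by (intro \<psi>rel) (simp add: T'.cls_eq_iff)
  from Pdiff[OF this \<psi>\<phi>[OF c(2)]] obtain m where m: "m \<in> carrier M" "c - frag_of (\<one>, m) \<in> T.rel" by (auto simp: P_def)
  then have "t = unit_tens R U u M m" by (simp add: c(1) unit_tens_def T.tens_eq_cls T.cls_eq_iff)
  with m(1) show ?thesis by blast
qed

text \<open>
  The left \<open>U\<close>-module structure of \<open>U \<otimes> M\<close> comes from \<^const>\<open>tensor_act_mod\<close>. The last two facts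
  describe the homomorphisms \<open>x \<mapsto> x \<otimes> m\<close> that enter into \<open>theta\<close>.
\<close>

lemma (in flat_epi) tensor_sequence:
  assumes M: "left_module R M" and tf: "torsion_free R U u M"
  defines "N \<equiv> tensor_act_mod R UR M (\<lambda>x a. x \<otimes> a)"
    and "p \<equiv> tensor_map R (right_of cok) M \<pi> (\<lambda>m. m)"
  shows "restr_mod u N = tensor_mod R UU M"
    and "torsion_free_sequence R U u N M (V_mod R U u M) (unit_tens R U u M) p"
    and "\<And>x m. \<lbrakk>x \<in> carrier U; m \<in> carrier M\<rbrakk> \<Longrightarrow> p (x \<odot>\<^bsub>N\<^esub> unit_tens R U u M m) = tens R (right_of cok) M (\<pi> x) m"
    and "\<And>m. m \<in> carrier M \<Longrightarrow> (\<lambda>x\<in>carrier cok. tens R (right_of cok) M x m) \<in> mod_hom R cok (V_mod R U u M)"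
proof -
  interpret M: left_module R M by fact
  interpret T: tensor_pair R UR M by (rule restr_tensor_pair[OF M])
  interpret T': tensor_pair R "right_of cok" M by (intro tensor_pair.intro cok_right_module M)
  interpret N: left_module U N unfolding N_def by (rule restr_tensor_left_module[OF M])
  interpret K: left_module R cok by (rule cok_left_module)
  let ?V = "V_mod R U u M"
  have V: "?V = tensor_act_mod R (right_of cok) M (\<lambda>r a. r \<odot>\<^bsub>cok\<^esub> a)" by (simp add: V_mod_def tensor_mod_eq)
  have actr: "rlinear_on R (right_of cok) (right_of cok) (\<lambda>a. r \<odot>\<^bsub>cok\<^esub> a)" if "r \<in> carrier R" for r
    using cok_bimodule that by (auto simp: rlinear_on_def right_of_simps K.smult_closed K.smult_r_distr is_bimodule_def)
  have Vmod: "left_module R ?V"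
    unfolding V
    by (rule T'.tensor_act_mod_left_module[OF R.ring_axioms actr])
      (simp_all add: right_of_simps K.smult_l_distr K.smult_assoc1 K.smult_one)
  interpret V: left_module R ?V by (rule Vmod)
  have smV: "r \<odot>\<^bsub>?V\<^esub> tens R (right_of cok) M C m = tens R (right_of cok) M (r \<odot>\<^bsub>cok\<^esub> C) m"
    if "r \<in> carrier R" "C \<in> carrier cok" "m \<in> carrier M" for r C m
    unfolding V using tensor_map_tens[OF T'.tensor_pair_axioms T'.tensor_pair_axioms actr[OF that(1)] linear_on_id, of C m] that
    by (simp add: tensor_act_mod_def right_of_simps)
  have smN: "x \<odot>\<^bsub>N\<^esub> tens R UR M y m = tens R UR M (x \<otimes> y) m"
    if "x \<in> carrier U" "y \<in> carrier U" "m \<in> carrier M" for x y m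
    unfolding N_def using tensor_map_tens[OF T.tensor_pair_axioms T.tensor_pair_axioms lmult_rlinear[OF that(1)] linear_on_id, of y m] that
    by (simp add: tensor_act_mod_def right_of_simps restr_bimod_simps)
  have ptens: "p (tens R UR M x m) = tens R (right_of cok) M (\<pi> x) m" if "x \<in> carrier U" "m \<in> carrier M" for x m
    unfolding p_def using tensor_map_tens[OF T.tensor_pair_axioms T'.tensor_pair_axioms proj_rlinear linear_on_id, of x m] that
    by (simp add: right_of_simps restr_bimod_simps)
  have pcl: "p t \<in> carrier ?V" if "t \<in> carrier N" for t
    using tensor_map_closed[OF T.tensor_pair_axioms T'.tensor_pair_axioms proj_rlinear linear_on_id that[unfolded N_def]]
    unfolding V p_def .
  have padd: "p (s \<oplus>\<^bsub>N\<^esub> t) = p s \<oplus>\<^bsub>?V\<^esub> p t" if "s \<in> carrier N" "t \<in> carrier N" for s t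
    using tensor_map_add[OF T.tensor_pair_axioms T'.tensor_pair_axioms proj_rlinear linear_on_id that[unfolded N_def]]
    unfolding V p_def N_def .
  have tN: "tens R UR M x m \<in> carrier N" if "x \<in> carrier U" "m \<in> carrier M" for x m
    unfolding N_def using that by (intro T.tens_closed) (simp_all add: right_of_simps restr_bimod_simps)
  have tV: "tens R (right_of cok) M C m \<in> carrier ?V" if "C \<in> carrier cok" "m \<in> carrier M" for C m
    unfolding V using that by (intro T'.tens_closed) (simp_all add: right_of_simps)
  show eq: "restr_mod u N = tensor_mod R UU M"
    by (simp add: N_def restr_mod_def tensor_mod_def tensor_act_mod_def) (simp add: restr_bimod_def)
  show val: "p (x \<odot>\<^bsub>N\<^esub> unit_tens R U u M m) = tens R (right_of cok) M (\<pi> x) m" if "x \<in> carrier U" "m \<in> carrier M" for x m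
    using that by (simp add: unit_tens_def smN ptens)
  show "(\<lambda>C\<in>carrier cok. tens R (right_of cok) M C m) \<in> mod_hom R cok ?V" if m: "m \<in> carrier M" for m
  proof (rule linear_on_restrict[OF cok_left_module linear_onI])
    show "tens R (right_of cok) M (C \<oplus>\<^bsub>cok\<^esub> C') m = tens R (right_of cok) M C m \<oplus>\<^bsub>?V\<^esub> tens R (right_of cok) M C' m"
      if "C \<in> carrier cok" "C' \<in> carrier cok" for C C'
      unfolding V using T'.tens_addl[of C C' m, where act = "\<lambda>r a. r \<odot>\<^bsub>cok\<^esub> a"] that m by (simp add: right_of_simps)
  qed (use m in \<open>simp_all add: tV smV\<close>)
  have plin: "linear_on R (restr_mod u N) ?V p"
  proof (rule linear_onI)
    fix r t assume r: "r \<in> carrier R" and "t \<in> carrier (restr_mod u N)"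
    then have t: "t \<in> carrier N" by (simp add: restr_mod_simps)
    have "p (u r \<odot>\<^bsub>N\<^esub> t) = r \<odot>\<^bsub>?V\<^esub> p t"
    proof (rule T.tensor_hom_eq[OF t[unfolded N_def]])
      fix x m assume "x \<in> carrier UR" "m \<in> carrier M"
      then have x: "x \<in> carrier U" "m \<in> carrier M" by (simp_all add: right_of_simps restr_bimod_simps)
      then show "p (u r \<odot>\<^bsub>N\<^esub> tens R UR M x m) = r \<odot>\<^bsub>?V\<^esub> p (tens R UR M x m)"
        using r by (simp add: smN ptens smV proj_closed proj_smult)
    qed (use r in \<open>simp_all flip: N_def add: N.smult_r_distr N.smult_closed V.smult_r_distr padd pcl\<close>)
    then show "p (r \<odot>\<^bsub>restr_mod u N\<^esub> t) = r \<odot>\<^bsub>?V\<^esub> p t" by (simp add: restr_mod_simps)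
  qed (simp_all add: restr_mod_simps pcl padd)
  show "torsion_free_sequence R U u N M ?V (unit_tens R U u M) p"
  proof (intro torsion_free_sequence.intro flat_epi_module.intro flat_epi_axioms N.left_module_axioms M Vmod
      torsion_free_sequence_axioms.intro plin)
    show "linear_on R M (restr_mod u N) (unit_tens R U u M)"
    proof (rule linear_onI)
      fix m assume m: "m \<in> carrier M"
      then show "unit_tens R U u M m \<in> carrier (restr_mod u N)" by (simp add: restr_mod_simps unit_tens_def tN)
      { fix m' assume "m' \<in> carrier M"
        then show "unit_tens R U u M (m \<oplus>\<^bsub>M\<^esub> m') = unit_tens R U u M m \<oplus>\<^bsub>restr_mod u N\<^esub> unit_tens R U u M m'"
          using m T.tens_addr[of "\<one>" m m', where act = "\<lambda>x a. x \<otimes> a"]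
          by (simp add: restr_mod_simps unit_tens_def N_def right_of_simps restr_bimod_simps) }
      { fix r assume r: "r \<in> carrier R"
        then show "unit_tens R U u M (r \<odot>\<^bsub>M\<^esub> m) = r \<odot>\<^bsub>restr_mod u N\<^esub> unit_tens R U u M m"
          using m T.tens_bal[of "\<one>" r m] smN[of "u r" "\<one>" m]
          by (simp add: restr_mod_simps unit_tens_def right_of_simps restr_bimod_simps) }
    qed
    show "inj_on (unit_tens R U u M) (carrier M)" using tf by (simp add: torsion_free_def)
    show "\<exists>n\<in>carrier N. p n = v" if "v \<in> carrier ?V" for v
      using that unfolding V
    proof (induction v rule: T'.tensor_induct)
      case (tens C m)
      then obtain x where x: "x \<in> carrier U" "C = \<pi> x" by (auto simp: right_of_simps cok_carrier)
      then show ?case using tens tN ptens by blast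
    next
      case (add s t)
      then show ?case using padd N.M.a_closed unfolding V by metis
    qed
    show "p n = \<zero>\<^bsub>?V\<^esub> \<longleftrightarrow> n \<in> unit_tens R U u M ` carrier M" if n: "n \<in> carrier N" for n
    proof
      assume "p n = \<zero>\<^bsub>?V\<^esub>"
      then show "n \<in> unit_tens R U u M ` carrier M" using tensor_cok_kernel[OF M n[unfolded N_def]] unfolding V p_def by blast
    next
      assume "n \<in> unit_tens R U u M ` carrier M"
      then obtain m where m: "m \<in> carrier M" "n = unit_tens R U u M m" by blast
      have "\<pi> \<one> = \<zero>\<^bsub>cok\<^esub>" using imageI[OF R.one_closed, of u] by (simp add: proj_eq_zero_iff)
      then show "p n = \<zero>\<^bsub>?V\<^esub>"
        using m T'.tens_zerol[OF m(1), where act = "\<lambda>r a. r \<odot>\<^bsub>cok\<^esub> a"] by (simp add: unit_tens_def ptens V right_of_simps)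
    qed
  qed
qed

theorem corollary10p8:
  fixes R :: "'r ring" and U :: "'u ring" and u :: "'r \<Rightarrow> 'u" and M :: "('r, 'm) module"
  assumes "ring R" and "ring U"
    and "ring_epimorphism R U u"
    and "flat_left_module R (restr_bimod U u)"
    and "has_countable_base (gabriel R U u)"
    and "left_module R M"
    and "torsion_free R U u M"
  shows "(\<exists>!b. is_beta R U u M b) \<and>
    inverse_module_isos R (Delta R U u M) (Lambda R (gabriel R U u) M)
      (beta R U u M) (theta R U u M)"
proof -
  have "ring_hom_ring R U u" using assms(1-3) by (intro ring_hom_ringI2) (simp_all add: ring_epimorphism_def)
  then interpret E: flat_epi R U u using assms(3,4) by (intro flat_epi.intro ring_map.intro flat_epi_axioms.intro)
  note seq = E.tensor_sequence[OF assms(6,7)]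
  interpret Q: torsion_free_sequence R U u "tensor_act_mod R E.UR M (\<lambda>x a. x \<otimes>\<^bsub>U\<^esub> a)" M "V_mod R U u M"
    "unit_tens R U u M" "tensor_map R (right_of E.cok) M E.\<pi> (\<lambda>m. m)"
    by (rule seq(2))
  have "theta R U u M y = Q.hom_class (Q.glued y)" if y: "y \<in> carrier Q.C.LM" for y
  proof -
    have "theta2 R U u M (theta1 R U u M y) = Q.glued y"
      unfolding theta1_def theta2_def
      by (rule Q.glue_Lambda_map[OF seq(4) _ y]) (simp_all add: Q.pr_def seq(3) E.proj_closed)
    moreover have "theta4 R U u M (theta3 R U u M (Q.glued y)) = Q.hom_class (Q.glued y)"
      using Q.Ext1_map_connecting[OF Q.glued(1)[OF y]] unfolding theta3_def theta4_def seq(1) .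
    ultimately show ?thesis using y by (simp add: theta_def)
  qed
  then have "theta R U u M = (\<lambda>y\<in>carrier Q.C.LM. Q.hom_class (Q.glued y))"
    by (intro extensionalityI[of _ "carrier Q.C.LM"]) (simp_all add: theta_def)
  then show ?thesis using Q.beta_inverse by simp
qed

end
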